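(* Let $$(\mathcal{S}):\quad u^1_{x_ix_j}=0,\ i,j=1,\dots,n,\qquad u^k_x=A^ku^1_x,\ k=2,\dots,m,$$ be a nondegenerate flat system with $n$ independent variables $x$ and $m$ dependent variables $u=(u^1,\dots,u^m)$, i.e. $A^1:=Id_n,A^2,\dots,A^m$ are linearly independent constant complex $n\times n$ matrices. If $(\mathcal{S}^\varepsilon)$ is an involutive holomorphic deformation of $(\mathcal{S})$, then for every $\varepsilon$ close enough to the origin $\dim Lie(\mathcal{S}^\varepsilon)\le\dim Lie(\mathcal{S})$.
   Context: All considerations are local. Write $w=u^1$, $v^k=u^k$ ($k\ge2$), $w_x=(w_{x_1},\dots,w_{x_n})$. **Deformation.** An involutive holomorphic deformation of $(\mathcal{S})$ is a family of systems $(\mathcal{S}^\varepsilon)$: $w_{x_ix_j}=F_{ij}(\varepsilon,x,u,w_x)$ ($F_{ij}=F_{ji}$), $v^k_{x_j}=G^k_j(\varepsilon,x,u,w_x)$, $k=2,\dots,m$, with right sides holomorphic in $(x,u,w_x)$ and real analytic in a vector parameter $\varepsilon$ in a neighborhood of the origin, coinciding with $(\mathcal{S})$ for $\varepsilon=0$ (i.e. $F_{ij}(0,\cdot)=0$ and $G^k_j(0,x,u,w_x)=(A^kw_x)_j$), and involutive for every fixed $\varepsilon$. Involutive means that on the space with coordinates $(x,u,w^{(1)})$, $w^{(1)}=(w_1,\dots,w_n)$, the distribution defined by the 1-forms $\omega_i=dw_i-\sum_jF_{ij}(\varepsilon,x,u,w^{(1)})dx_j$, $\phi^1=dw-\sum_jw_jdx_j$,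 $\phi^k=dv^k-\sum_jG^k_j(\varepsilon,x,u,w^{(1)})dx_j$ ($k\ge2$) satisfies the Frobenius condition. **Symmetries.** An infinitesimal symmetry of a system is a holomorphic vector field on a domain in $\mathbb{C}^n_x\times\mathbb{C}^m_u$ whose local flow maps graphs of solutions to graphs of solutions; $Lie(\cdot)$ is the complex Lie algebra of infinitesimal symmetries. *)

theory Defs
  imports "HOL-Analysis.Analysis"
begin

section \<open>Complex normed spaces and maps of several complex variables\<close>

class complex_normed_space = real_normed_vector +
  fixes scaleC :: "complex \<Rightarrow> 'a \<Rightarrow> 'a" (infixr "*\<^sub>C" 75)
  assumes scaleC_add_right: "c *\<^sub>C (x + y) = c *\<^sub>C x + c *\<^sub>C y"
    and scaleC_add_left: "(c + d) *\<^sub>C x = c *\<^sub>C x + d *\<^sub>C x"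
    and scaleC_scaleC: "c *\<^sub>C (d *\<^sub>C x) = (c * d) *\<^sub>C x"
    and scaleC_of_real: "complex_of_real r *\<^sub>C x = r *\<^sub>R x"
    and norm_scaleC: "norm (c *\<^sub>C x) = cmod c * norm x"

instantiation complex :: complex_normed_space
begin
definition scaleC_complex :: "complex \<Rightarrow> complex \<Rightarrow> complex"
  where "scaleC_complex c x = c * x"
instance
  by standard (auto simp: scaleC_complex_def algebra_simps norm_mult scaleR_conv_of_real)
end

instantiation vec :: (complex_normed_space, finite) complex_normed_space
begin
definition scaleC_vec :: "complex \<Rightarrow> 'a ^ 'b \<Rightarrow> 'a ^ 'b"
  where "scaleC_vec c x = (\<chi> i. c *\<^sub>C (x $ i))"
instance
proof
  fix c :: complex and x :: "'a ^ 'b"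
  show "norm (c *\<^sub>C x) = cmod c * norm x"
    by (simp add: norm_vec_def scaleC_vec_def norm_scaleC L2_set_left_distrib[symmetric]
        L2_set_right_distrib)
qed (auto simp: scaleC_vec_def vec_eq_iff scaleC_add_right scaleC_add_left scaleC_scaleC
    scaleC_of_real)
end

instantiation prod :: (complex_normed_space, complex_normed_space) complex_normed_space
begin
definition scaleC_prod :: "complex \<Rightarrow> 'a \<times> 'b \<Rightarrow> 'a \<times> 'b"
  where "scaleC_prod c x = (c *\<^sub>C fst x, c *\<^sub>C snd x)"
instance
proof
  fix c :: complex and x :: "'a \<times> 'b"
  have "sqrt ((cmod c * norm (fst x))\<^sup>2 + (cmod c * norm (snd x))\<^sup>2)
      = sqrt ((cmod c)\<^sup>2 * ((norm (fst x))\<^sup>2 + (norm (snd x))\<^sup>2))"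
    by (simp add: power_mult_distrib algebra_simps)
  then show "norm (c *\<^sub>C x) = cmod c * norm x"
    by (simp add: norm_prod_def scaleC_prod_def norm_scaleC real_sqrt_mult)
qed (auto simp: scaleC_prod_def prod_eq_iff scaleC_add_right scaleC_add_left scaleC_scaleC
    scaleC_of_real)
end

text \<open>Holomorphy of a map on an open set: real differentiability with complex linear
  differential at every point.\<close>

definition holomorphic_map_on ::
  "('a::complex_normed_space \<Rightarrow> 'b::complex_normed_space) \<Rightarrow> 'a set \<Rightarrow> bool"
where
  "holomorphic_map_on f S \<longleftrightarrow>
     (\<forall>z\<in>S. \<exists>D. (f has_derivative D) (at z) \<and> (\<forall>c v. D (c *\<^sub>C v) = c *\<^sub>C D v))"

text \<open>Real analyticity on an open set: near each point the map is the sum of a convergent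
  power series in the real coordinates.  The summation range consists of the multi-indices,
  that is, of the functions from the standard basis to the naturals (extended by zero).\<close>

definition real_analytic_on ::
  "('a::euclidean_space \<Rightarrow> 'b::real_normed_vector) \<Rightarrow> 'a set \<Rightarrow> bool"
where
  "real_analytic_on f S \<longleftrightarrow>
     (\<forall>a\<in>S. \<exists>r>0. \<exists>c :: ('a \<Rightarrow> nat) \<Rightarrow> 'b. \<forall>h. norm h < r \<longrightarrow>
        ((\<lambda>\<alpha>. (\<Prod>b\<in>Basis. (h \<bullet> b) ^ \<alpha> b) *\<^sub>R c \<alpha>) has_sum f (a + h))
          {\<alpha>. \<forall>b. b \<notin> Basis \<longrightarrow> \<alpha> b = 0})"

definition partial_deriv :: "'n::finite \<Rightarrow> (complex ^ 'n \<Rightarrow> complex) \<Rightarrow> complex ^ 'n \<Rightarrow> complex"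
where
  "partial_deriv j f x = deriv (\<lambda>t. f (x + axis j t)) 0"

section \<open>The systems and their solutions\<close>

text \<open>A base point is \<open>(x, u)\<close>, a jet is \<open>(x, u, p)\<close> with \<open>p\<close> standing for the gradient of
  \<open>w\<close>.  The dependent variables are indexed by an arbitrary finite type; \<open>o1\<close> is the index of
  the distinguished variable \<open>w = u $ o1\<close>.  A system on a set \<open>\<Omega>\<close> of jets is a pair \<open>F\<close>, \<open>G\<close>
  of right sides; the values \<open>G o1 j\<close> are never used.\<close>

type_synonym ('n, 'm) base = "(complex ^ 'n) \<times> (complex ^ 'm)"
type_synonym ('n, 'm) jet = "(complex ^ 'n) \<times> (complex ^ 'm) \<times> (complex ^ 'n)"
type_synonym ('n, 'm) rhs2 = "'n \<Rightarrow> 'n \<Rightarrow> ('n, 'm) jet \<Rightarrow> complex"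
type_synonym ('n, 'm) rhs1 = "'m \<Rightarrow> 'n \<Rightarrow> ('n, 'm) jet \<Rightarrow> complex"

definition jet1 ::
  "'m::finite \<Rightarrow> (complex ^ 'n::finite \<Rightarrow> complex ^ 'm) \<Rightarrow> complex ^ 'n \<Rightarrow> ('n, 'm) jet"
where
  "jet1 o1 u x = (x, u x, \<chi> j. partial_deriv j (\<lambda>y. u y $ o1) x)"

definition is_solution ::
  "'m::finite \<Rightarrow> ('n::finite, 'm) jet set \<Rightarrow> ('n, 'm) rhs2 \<Rightarrow> ('n, 'm) rhs1 \<Rightarrow>
   (complex ^ 'n) set \<Rightarrow> (complex ^ 'n \<Rightarrow> complex ^ 'm) \<Rightarrow> bool"
where
  "is_solution o1 \<Omega> F G V u \<longleftrightarrow>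
     open V \<and> holomorphic_map_on u V \<and>
     (\<forall>x\<in>V. jet1 o1 u x \<in> \<Omega> \<and>
        (\<forall>i j. partial_deriv j (partial_deriv i (\<lambda>y. u y $ o1)) x = F i j (jet1 o1 u x)) \<and>
        (\<forall>k j. k \<noteq> o1 \<longrightarrow> partial_deriv j (\<lambda>y. u y $ k) x = G k j (jet1 o1 u x)))"

definition graph_on :: "('a \<Rightarrow> 'b) \<Rightarrow> 'a set \<Rightarrow> ('a \<times> 'b) set"
where
  "graph_on u V = (\<lambda>x. (x, u x)) ` V"

text \<open>The flat system \<open>w\<^bsub>x\<^sub>i x\<^sub>j\<^esub> = 0\<close>, \<open>u\<^sup>k\<^sub>x = A\<^sup>k w\<^sub>x\<close>.\<close>

definition flat_F :: "('n, 'm) rhs2"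
where
  "flat_F i j z = 0"

definition flat_G :: "('m \<Rightarrow> complex ^ 'n ^ 'n) \<Rightarrow> ('n::finite, 'm) rhs1"
where
  "flat_G A k j = (\<lambda>(x, u, p). (A k *v p) $ j)"

text \<open>Linear independence over the complex numbers of \<open>A\<close> as a family, hence \<open>inj\<close>.\<close>

definition nondegenerate_flat :: "'m \<Rightarrow> ('m::finite \<Rightarrow> complex ^ 'n ^ 'n::finite) \<Rightarrow> bool"
where
  "nondegenerate_flat o1 A \<longleftrightarrow>
     A o1 = mat 1 \<and> inj A \<and> \<not> module.dependent (*\<^sub>C) (range A)"

section \<open>Involutivity and deformations\<close>

text \<open>A 1-form is given by \<open>\<theta> z \<xi>\<close>, its value on the tangent vector \<open>\<xi>\<close> at \<open>z\<close>.  The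
  distribution defined by a set of 1-forms is their common kernel; the Frobenius condition says
  that the exterior derivatives of the forms vanish on it.\<close>

definition ext_deriv ::
  "('a::real_normed_vector \<Rightarrow> 'a \<Rightarrow> complex) \<Rightarrow> 'a \<Rightarrow> 'a \<Rightarrow> 'a \<Rightarrow> complex"
where
  "ext_deriv \<theta> z \<xi> \<eta> =
     frechet_derivative (\<lambda>y. \<theta> y \<eta>) (at z) \<xi> - frechet_derivative (\<lambda>y. \<theta> y \<xi>) (at z) \<eta>"

definition distribution_at :: "('a \<Rightarrow> 'a \<Rightarrow> complex) set \<Rightarrow> 'a \<Rightarrow> 'a set"
where
  "distribution_at \<Theta> z = {\<xi>. \<forall>\<theta>\<in>\<Theta>. \<theta> z \<xi> = 0}"

definition frobenius_condition ::
  "('a::real_normed_vector \<Rightarrow> 'a \<Rightarrow> complex) set \<Rightarrow> 'a set \<Rightarrow> bool"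
where
  "frobenius_condition \<Theta> S \<longleftrightarrow>
     (\<forall>z\<in>S. \<forall>\<theta>\<in>\<Theta>. \<forall>\<xi>\<in>distribution_at \<Theta> z. \<forall>\<eta>\<in>distribution_at \<Theta> z. ext_deriv \<theta> z \<xi> \<eta> = 0)"

definition form_omega ::
  "('n::finite, 'm::finite) rhs2 \<Rightarrow> 'n \<Rightarrow> ('n, 'm) jet \<Rightarrow> ('n, 'm) jet \<Rightarrow> complex"
where
  "form_omega F i z = (\<lambda>(dx, du, dp). dp $ i - (\<Sum>j\<in>UNIV. F i j z * dx $ j))"

definition form_phi ::
  "'m::finite \<Rightarrow> ('n::finite, 'm) rhs1 \<Rightarrow> 'm \<Rightarrow> ('n, 'm) jet \<Rightarrow> ('n, 'm) jet \<Rightarrow> complex"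
where
  "form_phi o1 G k = (\<lambda>(x, u, p) (dx, du, dp).
     du $ k - (\<Sum>j\<in>UNIV. (if k = o1 then p $ j else G k j (x, u, p)) * dx $ j))"

definition involutive ::
  "'m::finite \<Rightarrow> ('n::finite, 'm) jet set \<Rightarrow> ('n, 'm) rhs2 \<Rightarrow> ('n, 'm) rhs1 \<Rightarrow> bool"
where
  "involutive o1 \<Omega> F G \<longleftrightarrow>
     frobenius_condition (range (form_omega F) \<union> range (form_phi o1 G)) \<Omega>"

text \<open>\<open>E\<close> is the neighborhood of the origin in the parameter space.  Analyticity in the
  parameter is understood jointly with the jet variables.\<close>

definition involutive_deformation ::
  "'m::finite \<Rightarrow> ('m \<Rightarrow> complex ^ 'n ^ 'n::finite) \<Rightarrow> 'e::euclidean_space set \<Rightarrow> ('n, 'm) jet set \<Rightarrow>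
   ('e \<Rightarrow> ('n, 'm) rhs2) \<Rightarrow> ('e \<Rightarrow> ('n, 'm) rhs1) \<Rightarrow> bool"
where
  "involutive_deformation o1 A E \<Omega> F G \<longleftrightarrow>
     open E \<and> 0 \<in> E \<and> open \<Omega> \<and>
     (\<forall>i j. real_analytic_on (\<lambda>(\<epsilon>, z). F \<epsilon> i j z) (E \<times> \<Omega>)) \<and>
     (\<forall>k j. k \<noteq> o1 \<longrightarrow> real_analytic_on (\<lambda>(\<epsilon>, z). G \<epsilon> k j z) (E \<times> \<Omega>)) \<and>
     (\<forall>\<epsilon>\<in>E.
        (\<forall>i j. holomorphic_map_on (F \<epsilon> i j) \<Omega>) \<and>
        (\<forall>k j. k \<noteq> o1 \<longrightarrow> holomorphic_map_on (G \<epsilon> k j) \<Omega>) \<and>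
        (\<forall>i j. \<forall>z\<in>\<Omega>. F \<epsilon> i j z = F \<epsilon> j i z) \<and>
        involutive o1 \<Omega> (F \<epsilon>) (G \<epsilon>)) \<and>
     (\<forall>z\<in>\<Omega>. \<forall>i j. F 0 i j z = flat_F i j z) \<and>
     (\<forall>z\<in>\<Omega>. \<forall>k j. k \<noteq> o1 \<longrightarrow> G 0 k j z = flat_G A k j z)"

section \<open>Infinitesimal symmetries\<close>

text \<open>\<open>\<Phi>\<close> is the flow of \<open>X\<close> with initial points in \<open>N\<close>, for complex times of modulus less than
  \<open>\<delta>\<close>, staying in \<open>D\<close>.\<close>

definition is_local_flow ::
  "('a::complex_normed_space \<Rightarrow> 'a) \<Rightarrow> 'a set \<Rightarrow> real \<Rightarrow> 'a set \<Rightarrow> (complex \<Rightarrow> 'a \<Rightarrow> 'a) \<Rightarrow> bool"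
where
  "is_local_flow X D \<delta> N \<Phi> \<longleftrightarrow>
     (\<forall>q\<in>N. \<Phi> 0 q = q \<and>
        (\<forall>t\<in>ball 0 \<delta>. \<Phi> t q \<in> D \<and>
           ((\<lambda>s. \<Phi> s q) has_derivative (\<lambda>h. h *\<^sub>C X (\<Phi> t q))) (at t)))"

text \<open>The flow being only local, a graph of a solution is mapped to a graph of a solution after
  shrinking it around any given one of its points, and for small times.  The image is in general
  a graph over another domain \<open>W\<close>.\<close>

definition infinitesimal_symmetry ::
  "'m::finite \<Rightarrow> ('n::finite, 'm) jet set \<Rightarrow> ('n, 'm) rhs2 \<Rightarrow> ('n, 'm) rhs1 \<Rightarrow>
   ('n, 'm) base set \<Rightarrow> (('n, 'm) base \<Rightarrow> ('n, 'm) base) \<Rightarrow> bool"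
where
  "infinitesimal_symmetry o1 \<Omega> F G D X \<longleftrightarrow>
     holomorphic_map_on X D \<and>
     (\<forall>V u. is_solution o1 \<Omega> F G V u \<and> graph_on u V \<subseteq> D \<longrightarrow>
        (\<forall>x0\<in>V. \<exists>V' \<delta> \<Phi>. open V' \<and> x0 \<in> V' \<and> V' \<subseteq> V \<and> \<delta> > 0 \<and>
           is_local_flow X D \<delta> (graph_on u V') \<Phi> \<and>
           (\<forall>t\<in>ball 0 \<delta>. \<exists>W v. is_solution o1 \<Omega> F G W v \<and>
              \<Phi> t ` graph_on u V' = graph_on v W)))"

text \<open>The Lie algebra of the system at a base point \<open>q0\<close> is the space of germs at \<open>q0\<close> of the
  following vector fields; two of them define the same germ if they agree near \<open>q0\<close>.\<close>

definition Lie_at ::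
  "'m::finite \<Rightarrow> ('n::finite, 'm) jet set \<Rightarrow> ('n, 'm) rhs2 \<Rightarrow> ('n, 'm) rhs1 \<Rightarrow>
   ('n, 'm) base \<Rightarrow> (('n, 'm) base \<Rightarrow> ('n, 'm) base) set"
where
  "Lie_at o1 \<Omega> F G q0 =
     {X. \<exists>D. open D \<and> q0 \<in> D \<and> infinitesimal_symmetry o1 \<Omega> F G D X}"

definition independent_germs ::
  "'a::topological_space \<Rightarrow> nat \<Rightarrow> (nat \<Rightarrow> 'a \<Rightarrow> 'b::complex_normed_space) \<Rightarrow> bool"
where
  "independent_germs q0 N X \<longleftrightarrow>
     (\<forall>c :: nat \<Rightarrow> complex.
        (\<forall>\<^sub>F q in nhds q0. (\<Sum>i<N. c i *\<^sub>C X i q) = 0) \<longrightarrow> (\<forall>i<N. c i = 0))"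

text \<open>Complex dimension (possibly infinite) of the space of germs at \<open>q0\<close> of the elements
  of \<open>L\<close>.\<close>

definition germ_dim ::
  "'a::topological_space \<Rightarrow> ('a \<Rightarrow> 'b::complex_normed_space) set \<Rightarrow> enat"
where
  "germ_dim q0 L =
     Sup {enat N | N. \<exists>X. (\<forall>i<N. X i \<in> L) \<and> independent_germs q0 N X}"

end

theory Submission
  imports Defs "HOL-Complex_Analysis.Complex_Analysis"
begin

text \<open>
  Along a solution, a symmetry \<open>X\<close> satisfies the linearized system.  By the Frobenius theorem there is
  a solution through every jet, so \<open>X\<close> satisfies linear determining equations, whose coefficients are
  holomorphic functions of the jet.  If \<open>P\<close> is the leading homogeneous part of the Taylor expansion of
  \<open>X\<close> at the base point, then only the terms of top order survive a dilation of the base point, hence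
  \<open>P\<close> satisfies homogeneous equations with constant coefficients which depend on the gradient variable
  and tend to the flat determining equations as \<open>\<epsilon>\<close> tends to the origin.

  Conversely every homogeneous solution of the flat determining equations is a symmetry of the flat
  system: it induces a vector field on the space of the planes which are the solutions, and its flow
  moves these planes along the flow of the induced field.  So if the symmetry algebra of the flat
  system has finite dimension \<open>d\<close>, then at most \<open>d\<close> linear functionals, each depending on a single
  homogeneous part, separate the homogeneous flat solutions, and there are no nonzero flat solutions
  of large degree \<open>r\<close>.  By compactness the same functionals separate the homogeneous solutions of
  degree at most \<open>r\<close> of the equations for small \<open>\<epsilon>\<close>; in degrees above \<open>r\<close> there are none, since
  their derivatives of degree \<open>r\<close> would be solutions.  More than \<open>d\<close> symmetries have a nontrivial
  combination on which all these functionals vanish; its leading part is zero, hence its germ is.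
\<close>

section \<open>Holomorphic maps on complex Euclidean spaces\<close>

text \<open>Symmetries of the perturbed systems are germs without a common domain or bound, so they
  cannot be compared with the flat ones by a direct limit. Their leading parts can: a homogeneous
  map is determined by its values on the unit ball, where Cauchy estimates give compactness.
  Compactness treats one degree at a time and shrinks the parameter neighborhood each time; this is
  why all degrees above \<open>r\<close> have to be handled at once by differentiation. As
  \<open>r\<close> exceeds the degree of every functional, no functional needs to be imposed in
  degree \<open>r\<close>. Combinations of symmetries are not shown to be symmetries; linearity of
  the determining equations takes the place of that fact. The limit equations are first known for
  the gradients \<open>p\<close> with \<open>(x0, u0, p)\<close> in \<open>\<Omega>\<close>, an open
  set; analytic continuation in \<open>p\<close> gives all gradients, which the flow on the space of
  planes requires. Holomorphy means that the real differential is complex linear, so estimates in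
  several variables are obtained by restriction to complex lines.\<close>

class cspace = complex_normed_space + euclidean_space

instance complex :: cspace ..
instance vec :: (cspace, finite) cspace ..
instance prod :: (cspace, cspace) cspace ..

abbreviation holo :: "('a::complex_normed_space \<Rightarrow> 'b::complex_normed_space) \<Rightarrow> 'a set \<Rightarrow> bool"
  where "holo \<equiv> holomorphic_map_on"

definition clinear :: "('a::complex_normed_space \<Rightarrow> 'b::complex_normed_space) \<Rightarrow> bool"
  where "clinear f \<longleftrightarrow> bounded_linear f \<and> (\<forall>c v. f (c *\<^sub>C v) = c *\<^sub>C f v)"

abbreviation fderiv :: "('a::real_normed_vector \<Rightarrow> 'b::real_normed_vector) \<Rightarrow> 'a \<Rightarrow> 'a \<Rightarrow> 'b"
  where "fderiv f z \<equiv> frechet_derivative f (at z)"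

section \<open>Complex scalars and complex linear maps\<close>

lemma scaleC_zero [simp]: "c *\<^sub>C (0::'a::complex_normed_space) = 0"
  by (metis norm_eq_zero norm_scaleC mult_zero_right norm_zero)

lemma scaleC_zero_left [simp]: "0 *\<^sub>C (x::'a::complex_normed_space) = 0"
  using scaleC_of_real[of 0 x] by simp

lemma scaleC_one [simp]: "1 *\<^sub>C (x::'a::complex_normed_space) = x"
  using scaleC_of_real[of 1 x] by simp

lemma scaleC_minus_right [simp]: "c *\<^sub>C (- x) = - (c *\<^sub>C (x::'a::complex_normed_space))"
  by (metis add.right_inverse add_eq_0_iff scaleC_add_right scaleC_zero)

lemma scaleC_minus_left [simp]: "(- c) *\<^sub>C x = - (c *\<^sub>C (x::'a::complex_normed_space))"
  by (metis add.right_inverse add_eq_0_iff scaleC_add_left scaleC_zero_left)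

lemma scaleC_diff_right: "c *\<^sub>C (x - y) = c *\<^sub>C x - c *\<^sub>C (y::'a::complex_normed_space)"
  by (metis scaleC_add_right scaleC_minus_right uminus_add_conv_diff add.commute)

lemma scaleC_scaleR_left: "(r *\<^sub>R c) *\<^sub>C x = r *\<^sub>R (c *\<^sub>C (x::'a::complex_normed_space))"
  by (simp add: scaleR_conv_of_real flip: scaleC_scaleC scaleC_of_real)

lemma scaleC_scaleR_right: "c *\<^sub>C (r *\<^sub>R x) = r *\<^sub>R (c *\<^sub>C (x::'a::complex_normed_space))"
  by (simp add: scaleC_scaleC mult.commute flip: scaleC_of_real)

lemma bounded_bilinear_scaleC: "bounded_bilinear (scaleC :: complex \<Rightarrow> 'a \<Rightarrow> 'a::complex_normed_space)"
proof
  show "\<exists>K. \<forall>a b. norm (a *\<^sub>C (b::'a)) \<le> norm a * norm b * K"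
    by (rule exI[of _ 1]) (simp add: norm_scaleC)
qed (simp_all add: scaleC_add_left scaleC_add_right scaleC_scaleR_left scaleC_scaleR_right)

lemma scaleC_sum_right: "c *\<^sub>C (\<Sum>i\<in>I. f i) = (\<Sum>i\<in>I. c *\<^sub>C (f i::'a::complex_normed_space))"
  by (induction I rule: infinite_finite_induct) (auto simp: scaleC_add_right)

lemma scaleC_eq_0_iff [simp]: "c *\<^sub>C x = 0 \<longleftrightarrow> c = 0 \<or> (x::'a::complex_normed_space) = 0"
  by (metis mult_eq_0_iff norm_eq_zero norm_scaleC)

lemma scaleC_complex_eq [simp]: "(c::complex) *\<^sub>C (x::complex) = c * x"
  by (simp add: scaleC_complex_def)

lemma scaleC_Pair [simp]: "c *\<^sub>C (x, y) = (c *\<^sub>C x, c *\<^sub>C y)"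
  by (simp add: scaleC_prod_def)

lemma fst_scaleC [simp]: "fst (c *\<^sub>C x) = c *\<^sub>C fst x"
  by (simp add: scaleC_prod_def)

lemma snd_scaleC [simp]: "snd (c *\<^sub>C x) = c *\<^sub>C snd x"
  by (simp add: scaleC_prod_def)

lemma vec_scaleC_nth [simp]: "(c *\<^sub>C x) $ i = c *\<^sub>C (x $ i)"
  by (simp add: scaleC_vec_def)

lemma clinear_scaleC_D: "clinear f \<Longrightarrow> f (c *\<^sub>C v) = c *\<^sub>C f v"
  by (simp add: clinear_def)

lemma clinear_bounded_linear: "clinear f \<Longrightarrow> bounded_linear f"
  by (simp add: clinear_def)

lemma clinear_add: "clinear f \<Longrightarrow> f (v + w) = f v + f w"
  by (simp add: clinear_def linear_simps)

lemma clinear_diff: "clinear f \<Longrightarrow> f (v - w) = f v - f w"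
  by (simp add: clinear_def linear_simps)

lemma clinear_zero: "clinear f \<Longrightarrow> f 0 = 0"
  by (simp add: clinear_def linear_simps)

lemma clinear_scaleR: "clinear f \<Longrightarrow> f (c *\<^sub>R v) = c *\<^sub>R f v"
  by (simp add: clinear_def linear_simps)

lemma clinear_sum: "clinear f \<Longrightarrow> f (\<Sum>i\<in>I. g i) = (\<Sum>i\<in>I. f (g i))"
  by (induction I rule: infinite_finite_induct) (auto simp: clinear_zero clinear_add)

lemma clinear_compose: "clinear f \<Longrightarrow> clinear g \<Longrightarrow> clinear (\<lambda>v. f (g v))"
  unfolding clinear_def using bounded_linear_compose by auto

lemma clinear_id: "clinear (\<lambda>v. v)" and clinear_fst: "clinear fst" and clinear_snd: "clinear snd"
  and clinear_const0: "clinear (\<lambda>v. 0)"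
  and clinear_vec_nth: "clinear (\<lambda>v :: 'a::complex_normed_space ^ 'n::finite. v $ i)"
  unfolding clinear_def by (auto intro: bounded_linear_fst bounded_linear_snd bounded_linear_vec_nth bounded_linear_ident)

lemma clinear_plus: "clinear f \<Longrightarrow> clinear g \<Longrightarrow> clinear (\<lambda>v. f v + g v)"
  unfolding clinear_def using bounded_linear_add by (auto simp: scaleC_add_right)

lemma clinear_Pair: "clinear f \<Longrightarrow> clinear g \<Longrightarrow> clinear (\<lambda>v. (f v, g v))"
  unfolding clinear_def using bounded_linear_Pair by auto

lemma clinear_scaleC: "clinear f \<Longrightarrow> clinear (\<lambda>v. c *\<^sub>C f v)"
  unfolding clinear_def
  by (auto simp: scaleC_scaleC mult.commute
      intro: bounded_linear_compose[OF bounded_bilinear.bounded_linear_right[OF bounded_bilinear_scaleC]])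

lemma clinear_scaleC_left: "clinear f \<Longrightarrow> clinear (\<lambda>v. f v *\<^sub>C x)"
  unfolding clinear_def
  by (auto simp: scaleC_scaleC mult.commute
      intro: bounded_linear_compose[OF bounded_bilinear.bounded_linear_left[OF bounded_bilinear_scaleC]])

lemma clinear_mult_right: "clinear f \<Longrightarrow> clinear (\<lambda>v. f v * (x::complex))"
  using clinear_scaleC_left[of f x] by simp

lemma clinear_mult_left: "clinear f \<Longrightarrow> clinear (\<lambda>v. x * (f v::complex))"
  using clinear_scaleC[of f x] by simp

lemma clinear_sumI: "(\<And>i. i \<in> I \<Longrightarrow> clinear (f i)) \<Longrightarrow> clinear (\<lambda>v. \<Sum>i\<in>I. f i v)"
  by (induction I rule: infinite_finite_induct) (auto intro: clinear_const0 clinear_plus)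

lemma clinear_vec_lambda:
  fixes f :: "'n::finite \<Rightarrow> 'a::complex_normed_space \<Rightarrow> 'b::cspace"
  assumes "\<And>i. clinear (f i)"
  shows "clinear (\<lambda>v. \<chi> i. f i v)"
proof -
  have l: "bounded_linear (\<lambda>v. \<chi> i. f i v)"
  proof (rule bounded_linear_intro[where K = "\<Sum>i\<in>UNIV. onorm (f i)"])
    fix x
    have "norm (\<chi> i. f i x) \<le> (\<Sum>i\<in>UNIV. norm (f i x))"
      using norm_vec_def[of "\<chi> i. f i x"] L2_set_le_sum[of UNIV "\<lambda>i. norm (f i x)"] by simp
    also have "\<dots> \<le> (\<Sum>i\<in>UNIV. onorm (f i) * norm x)"
      using assms by (intro sum_mono onorm) (simp add: clinear_def)
    finally show "norm (\<chi> i. f i x) \<le> norm x * (\<Sum>i\<in>UNIV. onorm (f i))"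
      by (simp add: sum_distrib_left mult.commute)
  qed (simp_all add: vec_eq_iff clinear_add[OF assms] clinear_scaleR[OF assms])
  then show ?thesis unfolding clinear_def
    by (simp add: vec_eq_iff clinear_scaleC_D[OF assms])
qed

section \<open>Differentiation rules for holomorphic maps\<close>

lemma holoI: "(\<And>z. z \<in> S \<Longrightarrow> \<exists>D. (f has_derivative D) (at z) \<and> clinear D) \<Longrightarrow> holo f S"
  unfolding holomorphic_map_on_def clinear_def by blast

lemma holoI': "(\<And>z. z \<in> S \<Longrightarrow> (f has_derivative D z) (at z)) \<Longrightarrow> (\<And>z. z \<in> S \<Longrightarrow> clinear (D z)) \<Longrightarrow> holo f S"
  by (rule holoI) blast

lemma holo_has_derivative: "holo f S \<Longrightarrow> z \<in> S \<Longrightarrow> (f has_derivative fderiv f z) (at z)"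
  unfolding holomorphic_map_on_def by (metis frechet_derivative_at)

lemma holo_clinear: "holo f S \<Longrightarrow> z \<in> S \<Longrightarrow> clinear (fderiv f z)"
  unfolding holomorphic_map_on_def clinear_def
  by (metis frechet_derivative_at has_derivative_bounded_linear)

lemma fderiv_eqI: "(f has_derivative D) (at z) \<Longrightarrow> fderiv f z = D"
  by (metis frechet_derivative_at)

lemma holo_subset: "holo f S \<Longrightarrow> T \<subseteq> S \<Longrightarrow> holo f T"
  unfolding holomorphic_map_on_def by blast

lemma holo_continuous_on: "holo f S \<Longrightarrow> continuous_on S f"
  by (meson holo_has_derivative continuous_at_imp_continuous_on has_derivative_continuous)

lemma holo_isCont: "holo f S \<Longrightarrow> z \<in> S \<Longrightarrow> isCont f z"
  by (meson holo_has_derivative has_derivative_continuous)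

lemma has_derivative_clinear: "clinear f \<Longrightarrow> (f has_derivative f) (at z)"
  by (simp add: clinear_def bounded_linear_imp_has_derivative)

lemma holo_clinear_map: "clinear f \<Longrightarrow> holo f S"
  by (meson has_derivative_clinear holoI)

lemma fderiv_clinear: "clinear f \<Longrightarrow> fderiv f z = f"
  by (simp add: fderiv_eqI has_derivative_clinear)

lemma holo_const: "holo (\<lambda>_. c) S"
  by (rule holoI) (auto intro!: exI[of _ "\<lambda>_. 0"] clinear_const0)

lemma holo_ident: "holo (\<lambda>z. z) S"
  by (rule holo_clinear_map[OF clinear_id])

lemma holo_compose:
  assumes "holo g T" "holo f S" "f ` S \<subseteq> T"
  shows "holo (\<lambda>z. g (f z)) S"
proof (rule holoI')
  fix z assume z: "z \<in> S"
  show "((\<lambda>z. g (f z)) has_derivative (\<lambda>v. fderiv g (f z) (fderiv f z v))) (at z)"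
    using assms z by (intro has_derivative_compose[of f _ _ _ g] holo_has_derivative[of f S] holo_has_derivative[of g T]) auto
  show "clinear (\<lambda>v. fderiv g (f z) (fderiv f z v))"
    by (rule clinear_compose) (use assms z in \<open>auto intro: holo_clinear\<close>)
qed

lemma fderiv_compose:
  assumes "holo g T" "f z \<in> T" "(f has_derivative D) (at z)"
  shows "fderiv (\<lambda>z. g (f z)) z v = fderiv g (f z) (D v)"
  using has_derivative_compose[OF assms(3) holo_has_derivative[OF assms(1,2)]] fderiv_eqI by metis

lemma holo_clinear_compose: "clinear g \<Longrightarrow> holo f S \<Longrightarrow> holo (\<lambda>z. g (f z)) S"
  using holo_compose[of g UNIV f S] holo_clinear_map by blast

lemma fderiv_clinear_compose:
  assumes "clinear g" "holo f S" "z \<in> S"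
  shows "fderiv (\<lambda>z. g (f z)) z v = g (fderiv f z v)"
  using fderiv_compose[of g UNIV f z] holo_clinear_map[OF assms(1)] holo_has_derivative[OF assms(2,3)]
  by (simp add: fderiv_clinear[OF assms(1)])

lemma holo_add: "holo f S \<Longrightarrow> holo g S \<Longrightarrow> holo (\<lambda>z. f z + g z) S"
  by (rule holoI'[OF has_derivative_add[OF holo_has_derivative holo_has_derivative] clinear_plus[OF holo_clinear holo_clinear]])

lemma fderiv_add: "holo f S \<Longrightarrow> holo g S \<Longrightarrow> z \<in> S \<Longrightarrow> fderiv (\<lambda>z. f z + g z) z v = fderiv f z v + fderiv g z v"
  using fderiv_eqI[OF has_derivative_add[OF holo_has_derivative holo_has_derivative]] by metis

lemma holo_scaleC_left: "holo f S \<Longrightarrow> holo (\<lambda>z. c *\<^sub>C f z) S"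
  by (rule holo_clinear_compose[OF clinear_scaleC[OF clinear_id]])

lemma fderiv_scaleC_left: "holo f S \<Longrightarrow> z \<in> S \<Longrightarrow> fderiv (\<lambda>z. c *\<^sub>C f z) z v = c *\<^sub>C fderiv f z v"
  by (rule fderiv_clinear_compose[OF clinear_scaleC[OF clinear_id]])

lemma holo_diff: "holo f S \<Longrightarrow> holo g S \<Longrightarrow> holo (\<lambda>z. f z - g z) S"
  using holo_add[of f S "\<lambda>z. (-1) *\<^sub>C g z"] holo_scaleC_left[of g S "-1"] by simp

lemma fderiv_diff: "holo f S \<Longrightarrow> holo g S \<Longrightarrow> z \<in> S \<Longrightarrow> fderiv (\<lambda>z. f z - g z) z v = fderiv f z v - fderiv g z v"
  using fderiv_eqI[OF has_derivative_diff[OF holo_has_derivative holo_has_derivative]] by metis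

lemma holo_sum: "(\<And>i. i \<in> I \<Longrightarrow> holo (f i) S) \<Longrightarrow> holo (\<lambda>z. \<Sum>i\<in>I. f i z) S"
  by (induction I rule: infinite_finite_induct) (auto intro: holo_const holo_add)

lemma fderiv_sum:
  assumes "\<And>i. i \<in> I \<Longrightarrow> holo (f i) S" "z \<in> S"
  shows "fderiv (\<lambda>z. \<Sum>i\<in>I. f i z) z v = (\<Sum>i\<in>I. fderiv (f i) z v)"
proof -
  have "((\<lambda>z. \<Sum>i\<in>I. f i z) has_derivative (\<lambda>v. \<Sum>i\<in>I. fderiv (f i) z v)) (at z)"
    using assms by (intro has_derivative_sum holo_has_derivative) auto
  then show ?thesis by (simp add: fderiv_eqI)
qed

lemma holo_Pair: "holo f S \<Longrightarrow> holo g S \<Longrightarrow> holo (\<lambda>z. (f z, g z)) S"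
  by (rule holoI'[OF has_derivative_Pair[OF holo_has_derivative holo_has_derivative] clinear_Pair[OF holo_clinear holo_clinear]])

lemma fderiv_Pair: "holo f S \<Longrightarrow> holo g S \<Longrightarrow> z \<in> S \<Longrightarrow> fderiv (\<lambda>z. (f z, g z)) z v = (fderiv f z v, fderiv g z v)"
  using fderiv_eqI[OF has_derivative_Pair[OF holo_has_derivative holo_has_derivative]] by metis

lemma holo_fst: "holo f S \<Longrightarrow> holo (\<lambda>z. fst (f z)) S"
  and holo_snd: "holo f S \<Longrightarrow> holo (\<lambda>z. snd (f z)) S"
  and holo_vec_nth: "holo h S \<Longrightarrow> holo (\<lambda>z. h z $ i) S"
  by (auto intro: holo_clinear_compose clinear_fst clinear_snd clinear_vec_nth)

lemma fderiv_fst: "holo f S \<Longrightarrow> z \<in> S \<Longrightarrow> fderiv (\<lambda>z. fst (f z)) z v = fst (fderiv f z v)"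
  and fderiv_snd: "holo f S \<Longrightarrow> z \<in> S \<Longrightarrow> fderiv (\<lambda>z. snd (f z)) z v = snd (fderiv f z v)"
  and fderiv_vec_nth: "holo h S \<Longrightarrow> z \<in> S \<Longrightarrow> fderiv (\<lambda>z. h z $ i) z w = fderiv h z w $ i"
  by (auto intro: fderiv_clinear_compose clinear_fst clinear_snd clinear_vec_nth)

lemma holo_scaleC:
  assumes "holo f S" "holo g S"
  shows "holo (\<lambda>z. f z *\<^sub>C g z) S"
    and "z \<in> S \<Longrightarrow> fderiv (\<lambda>z. f z *\<^sub>C g z) z v = fderiv f z v *\<^sub>C g z + f z *\<^sub>C fderiv g z v"
proof -
  have *: "((\<lambda>z. f z *\<^sub>C g z) has_derivative (\<lambda>v. f z *\<^sub>C fderiv g z v + fderiv f z v *\<^sub>C g z)) (at z)"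
    if "z \<in> S" for z
    using bounded_bilinear.FDERIV[OF bounded_bilinear_scaleC holo_has_derivative[OF assms(1) that] holo_has_derivative[OF assms(2) that]] .
  show "holo (\<lambda>z. f z *\<^sub>C g z) S"
    by (rule holoI'[OF *]) (use assms in \<open>auto intro!: clinear_plus clinear_scaleC clinear_scaleC_left holo_clinear\<close>)
  show "z \<in> S \<Longrightarrow> fderiv (\<lambda>z. f z *\<^sub>C g z) z v = fderiv f z v *\<^sub>C g z + f z *\<^sub>C fderiv g z v"
    using fderiv_eqI[OF *] by simp
qed

lemma holo_mult: "holo f S \<Longrightarrow> holo g S \<Longrightarrow> holo (\<lambda>z. f z * (g z::complex)) S"
  using holo_scaleC(1)[of f S g] by simp

lemma fderiv_mult: "holo f S \<Longrightarrow> holo g S \<Longrightarrow> z \<in> S \<Longrightarrow>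
    fderiv (\<lambda>z. f z * (g z::complex)) z v = fderiv f z v * g z + f z * fderiv g z v"
  using holo_scaleC(2)[of f S g] by simp

lemma holo_prod: "(\<And>i. i \<in> I \<Longrightarrow> holo (f i) S) \<Longrightarrow> holo (\<lambda>z. \<Prod>i\<in>I. f i z :: complex) S"
  by (induction I rule: infinite_finite_induct) (auto intro: holo_const holo_mult)

lemma holo_vec_lambda:
  fixes f :: "'n::finite \<Rightarrow> 'a::complex_normed_space \<Rightarrow> 'b::cspace"
  assumes "\<And>i. holo (f i) S"
  shows "holo (\<lambda>z. \<chi> i. f i z) S"
proof (rule holoI')
  fix z assume z: "z \<in> S"
  have "((\<lambda>z. \<chi> i. f i z) has_derivative (\<lambda>v. \<chi> i. fderiv (f i) z v)) (at z)"
    unfolding has_derivative_componentwise_within[of "\<lambda>z. \<chi> i. f i z"]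
    using holo_has_derivative[OF assms z]
    by (auto simp: Basis_vec_def inner_axis intro: has_derivative_inner_left)
  then show "((\<lambda>z. \<chi> i. f i z) has_derivative (\<lambda>v. \<chi> i. fderiv (f i) z v)) (at z)" .
  show "clinear (\<lambda>v. \<chi> i. fderiv (f i) z v)" by (rule clinear_vec_lambda[OF holo_clinear[OF assms z]])
qed

lemma fderiv_vec_lambda:
  fixes f :: "'n::finite \<Rightarrow> 'a::complex_normed_space \<Rightarrow> 'b::cspace"
  assumes "\<And>i. holo (f i) S" "z \<in> S"
  shows "fderiv (\<lambda>z. \<chi> i. f i z) z v = (\<chi> i. fderiv (f i) z v)"
proof -
  have "fderiv (\<lambda>z. \<chi> i. f i z) z v $ j = fderiv (f j) z v" for j
    using fderiv_vec_nth[OF holo_vec_lambda[of f S, OF assms(1)] assms(2), where i = j] by simp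
  then show ?thesis by (simp add: vec_eq_iff)
qed

text \<open>A complex linear map of the complex numbers is multiplication by its value at 1; this
  links \<open>holo\<close> to the one-variable notions \<open>holomorphic_on\<close> and
  \<open>deriv\<close>.\<close>

lemma holo_holomorphic_on: "holo f S \<Longrightarrow> f holomorphic_on S"
  and fderiv_deriv: "holo f S \<Longrightarrow> z \<in> S \<Longrightarrow> fderiv f z h = h * deriv f z"
proof -
  have *: "(f has_field_derivative fderiv f z 1) (at z)" if "holo f S" "z \<in> S" for z
  proof -
    have "fderiv f z h = fderiv f z 1 * h" for h
      using clinear_scaleC_D[OF holo_clinear[OF that], of h 1] by (metis mult.commute mult.right_neutral scaleC_complex_eq)
    then have "fderiv f z = (\<lambda>h. fderiv f z 1 * h)" ..
    then show ?thesis using holo_has_derivative[OF that] by (simp add: has_field_derivative_def)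
  qed
  show "holo f S \<Longrightarrow> f holomorphic_on S"
    using * by (meson field_differentiable_at_within field_differentiable_def holomorphic_on_def)
  show "fderiv f z h = h * deriv f z" if "holo f S" "z \<in> S"
    using DERIV_imp_deriv[OF *[OF that]] clinear_scaleC_D[OF holo_clinear[OF that], of h 1]
    by (metis mult.right_neutral scaleC_complex_eq)
qed

lemma holomorphic_on_holo:
  assumes "f holomorphic_on S" "open S" shows "holo f S"
proof (rule holoI)
  fix z assume "z \<in> S"
  then have "(f has_field_derivative deriv f z) (at z)"
    using assms holomorphic_derivI by blast
  then show "\<exists>D. (f has_derivative D) (at z) \<and> clinear D"
    unfolding has_field_derivative_def by (intro exI conjI) (assumption, rule clinear_mult_left[OF clinear_id])
qed

text \<open>The complex linear functional whose real part is the coordinate along \<open>b\<close>.\<close>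

definition cfun :: "'a::cspace \<Rightarrow> 'a \<Rightarrow> complex"
  where "cfun b v = Complex (v \<bullet> b) (- ((\<i> *\<^sub>C v) \<bullet> b))"

lemma clinear_cfun: "clinear (cfun b)"
proof -
  have 1: "(c *\<^sub>C v) \<bullet> b = Re c * (v \<bullet> b) + Im c * ((\<i> *\<^sub>C v) \<bullet> b)" for c v
  proof -
    have "(complex_of_real (Re c) + complex_of_real (Im c) * \<i>) *\<^sub>C v = Re c *\<^sub>R v + Im c *\<^sub>R (\<i> *\<^sub>C v)"
      by (simp only: scaleC_add_left scaleC_of_real flip: scaleC_scaleC)
    moreover have "complex_of_real (Re c) + complex_of_real (Im c) * \<i> = c"
      by (simp add: complex_eq_iff)
    ultimately have "c *\<^sub>C v = Re c *\<^sub>R v + Im c *\<^sub>R (\<i> *\<^sub>C v)" by simp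
    then show ?thesis by (metis inner_add_left inner_scaleR_left)
  qed
  have 2: "(\<i> *\<^sub>C c *\<^sub>C v) \<bullet> b = Re c * ((\<i> *\<^sub>C v) \<bullet> b) - Im c * (v \<bullet> b)" for c v
    using 1[of "\<i> * c" v] by (simp add: scaleC_scaleC)
  have "cfun b (c *\<^sub>C v) = c *\<^sub>C cfun b v" for c v
    unfolding cfun_def using 1[of c v] 2[of c v] by (simp add: complex_eq_iff)
  moreover have "linear (cfun b)"
    by (rule linearI) (simp_all add: cfun_def complex_eq_iff scaleC_add_right inner_add_left scaleC_scaleR_right)
  ultimately show ?thesis unfolding clinear_def by (simp add: linear_conv_bounded_linear)
qed

lemma norm_cfun: "b \<in> Basis \<Longrightarrow> cmod (cfun b v) \<le> 2 * norm v"
proof -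
  assume "b \<in> Basis"
  then have "\<bar>v \<bullet> b\<bar> \<le> norm v" "\<bar>(\<i> *\<^sub>C v) \<bullet> b\<bar> \<le> norm v"
    using Basis_le_norm[of b v] Basis_le_norm[of b "\<i> *\<^sub>C v"] by (simp_all add: norm_scaleC)
  then show ?thesis unfolding cfun_def using cmod_le[of "Complex (v \<bullet> b) (- ((\<i> *\<^sub>C v) \<bullet> b))"] by simp
qed

lemma norm_le_cfun: "norm v \<le> (\<Sum>b\<in>Basis. cmod (cfun b v))"
proof -
  have "norm v \<le> (\<Sum>b\<in>Basis. \<bar>v \<bullet> b\<bar>)" by (rule norm_le_l1)
  also have "\<dots> \<le> (\<Sum>b\<in>Basis. cmod (cfun b v))"
    by (rule sum_mono) (metis abs_Re_le_cmod complex.sel(1) cfun_def)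
  finally show ?thesis .
qed

lemma cfun_zeroI: "(\<And>b. b \<in> Basis \<Longrightarrow> cfun b v = 0) \<Longrightarrow> v = 0"
  using norm_le_cfun[of v] by simp

section \<open>Estimates along complex lines\<close>

lemma holo_line: "holo (\<lambda>t::complex. z + t *\<^sub>C v) S"
  by (intro holo_add holo_const holo_clinear_map clinear_scaleC_left clinear_id)

lemma line_has_derivative: "((\<lambda>t::complex. z + t *\<^sub>C v) has_derivative (\<lambda>h. h *\<^sub>C v)) (at t)"
  using has_derivative_add[OF has_derivative_const has_derivative_clinear[OF clinear_scaleC_left[OF clinear_id]]]
  by simp

text \<open>Restriction to the complex line through \<open>z\<close> in direction \<open>v\<close>
  reduces this to the one-variable Cauchy inequality for the coordinates \<open>cfun b\<close>. The
  factor 2 comes from \<open>norm_cfun\<close>, the dimension from summing over the real basis in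
  \<open>norm_le_cfun\<close>.\<close>

lemma cauchy_bound:
  fixes f :: "'a::complex_normed_space \<Rightarrow> 'b::cspace" and M r :: real
  assumes "0 < r" "holo f (cball z r)" "\<And>w. w \<in> cball z r \<Longrightarrow> norm (f w) \<le> M"
  shows "norm (fderiv f z v) \<le> 2 * real DIM('b) * M / r * norm v"
proof (cases "v = 0")
  case True
  then show ?thesis using assms by (simp add: clinear_zero[OF holo_clinear])
next
  case False
  \<comment> \<open>The radius of the disc of parameters \<open>t\<close> for which the line stays
    in \<open>cball z r\<close>.\<close>
  define \<rho> where "\<rho> = r / norm v"
  have \<rho>: "\<rho> > 0" using False assms(1) by (simp add: \<rho>_def)
  have sub: "z + t *\<^sub>C v \<in> cball z r" if "t \<in> cball 0 \<rho>" for t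
    using that False by (simp add: dist_norm norm_scaleC \<rho>_def field_simps)
  have b: "cmod (cfun b (fderiv f z v)) \<le> 2 * M / \<rho>" if "b \<in> Basis" for b
  proof -
    let ?g = "\<lambda>t. cfun b (f (z + t *\<^sub>C v))"
    have h: "holo ?g (cball 0 \<rho>)"
      by (intro holo_clinear_compose[OF clinear_cfun] holo_compose[OF assms(2)] holo_line) (use sub in blast)
    have "norm ((deriv ^^ 1) ?g 0) \<le> fact 1 * (2 * M) / \<rho> ^ 1"
    proof (rule Cauchy_inequality[OF _ _ \<rho>])
      show "?g holomorphic_on ball 0 \<rho>" using holo_holomorphic_on[OF h] holomorphic_on_subset ball_subset_cball by blast
      show "continuous_on (cball 0 \<rho>) ?g" using holo_continuous_on[OF h] .
      fix t :: complex assume "norm (0 - t) = \<rho>"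
      then have "norm (f (z + t *\<^sub>C v)) \<le> M" using sub assms(3) by simp
      then show "norm (?g t) \<le> 2 * M" using norm_cfun[OF that, of "f (z + t *\<^sub>C v)"] by linarith
    qed
    moreover have "fderiv ?g 0 1 = cfun b (fderiv f z v)"
      using assms(1)
      by (subst fderiv_clinear_compose[OF clinear_cfun, where S = "cball 0 \<rho>"])
         (use \<rho> sub in \<open>auto intro!: holo_compose[OF assms(2)] holo_line
           simp: fderiv_compose[OF assms(2) _ line_has_derivative]\<close>)
    moreover have "fderiv ?g 0 1 = deriv ?g 0" using fderiv_deriv[OF h, of 0 1] \<rho> by simp
    ultimately show ?thesis by simp
  qed
  have "norm (fderiv f z v) \<le> (\<Sum>b\<in>(Basis::'b set). cmod (cfun b (fderiv f z v)))" by (rule norm_le_cfun)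
  also have "\<dots> \<le> (\<Sum>b\<in>(Basis::'b set). 2 * M / \<rho>)" using b by (rule sum_mono)
  also have "\<dots> = 2 * real DIM('b) * M / r * norm v" by (simp add: \<rho>_def)
  finally show ?thesis .
qed

lemma holo_lipschitz:
  assumes "convex S" "holo f S" "\<And>z v. z \<in> S \<Longrightarrow> norm (fderiv f z v) \<le> B * norm v" "0 \<le> B" "x \<in> S" "y \<in> S"
  shows "norm (f x - f y) \<le> B * norm (x - y)"
proof (rule differentiable_bound[OF assms(1)])
  fix x assume x: "x \<in> S"
  show "(f has_derivative fderiv f x) (at x within S)"
    by (rule has_derivative_at_withinI[OF holo_has_derivative[OF assms(2) x]])
  show "onorm (fderiv f x) \<le> B"
    by (rule onorm_bound[OF assms(4) assms(3)[OF x]])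
qed (use assms in auto)

lemma fderiv_shift:
  assumes "holo f S" "z + h \<in> S"
  shows "fderiv (\<lambda>z. f (z + h)) z v = fderiv f (z + h) v"
proof -
  have "((\<lambda>z. z + h) has_derivative (\<lambda>v. v)) (at z)"
    using has_derivative_add[OF has_derivative_ident has_derivative_const, of h "at z"] by simp
  from fderiv_compose[OF assms(1) _ this] assms(2) show ?thesis by simp
qed

lemma holo_shift: "holo f S \<Longrightarrow> (\<And>z. z \<in> T \<Longrightarrow> z + h \<in> S) \<Longrightarrow> holo (\<lambda>z. f (z + h)) T"
  by (rule holo_compose[of f S]) (auto intro: holo_add holo_ident holo_const)

text \<open>Each Cauchy estimate costs one radius: \<open>f\<close> is bounded at distance
  \<open>3 * r\<close>, its differential at distance \<open>2 * r\<close>, and the Lipschitz bound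
  for the differential holds at distance \<open>r\<close>. The last one is the Cauchy estimate for
  \<open>\<lambda>s. f (s + h) - f s\<close>, so no second differential has to be formed.\<close>

lemma loc_bounds:
  fixes f :: "'a::complex_normed_space \<Rightarrow> 'b::cspace"
  assumes "open S" "z \<in> S" "holo f S"
  obtains r K where "r > 0" "K > 0" "cball z r \<subseteq> S"
    "\<And>w. w \<in> cball z r \<Longrightarrow> norm (f w) \<le> K"
    "\<And>w v. w \<in> cball z r \<Longrightarrow> norm (fderiv f w v) \<le> K * norm v"
    "\<And>w w'. w \<in> cball z r \<Longrightarrow> w' \<in> cball z r \<Longrightarrow> norm (f w - f w') \<le> K * norm (w - w')"
    "\<And>w w' v. w \<in> cball z r \<Longrightarrow> w' \<in> cball z r \<Longrightarrow>
       norm (fderiv f w v - fderiv f w' v) \<le> K * norm (w - w') * norm v"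
proof -
  have "isCont f z" using holo_isCont[OF assms(3,2)] .
  then have "(f \<longlongrightarrow> f z) (nhds z)"
    unfolding isCont_def tendsto_at_iff_tendsto_nhds .
  then have "\<forall>\<^sub>F w in nhds z. dist (f w) (f z) < 1"
    by (rule tendstoD) simp
  moreover have "\<forall>\<^sub>F w in nhds z. w \<in> S" using assms(1,2) by (simp add: eventually_nhds_in_open)
  ultimately have "\<forall>\<^sub>F w in nhds z. w \<in> S \<and> dist (f w) (f z) < 1" by eventually_elim simp
  then obtain e where e: "e > 0" "\<And>w. dist w z < e \<Longrightarrow> w \<in> S \<and> dist (f w) (f z) < 1"
    unfolding eventually_nhds_metric by blast
  \<comment> \<open>Three nested radii \<open>r\<close>, \<open>2 * r\<close> and
    \<open>3 * r\<close> have to fit strictly below \<open>e\<close>.\<close>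
  define r where "r = e / 4"
  define M where "M = norm (f z) + 1"
  have r: "r > 0" and M: "M > 0" using e(1) by (auto simp: r_def M_def add_nonneg_pos)
  have in3: "w \<in> S \<and> norm (f w) \<le> M" if "dist z w \<le> 3 * r" for w
  proof -
    have "dist w z < e" using that e(1) unfolding r_def dist_commute[of w z] by linarith
    then have "w \<in> S" "norm (f w - f z) < 1" using e(2) by (auto simp: dist_norm)
    then show ?thesis unfolding M_def using norm_triangle_sub[of "f w" "f z"] by linarith
  qed
  define C where "C = 2 * real DIM('b)"
  have C: "C > 0" by (simp add: C_def)
  have d2: "norm (fderiv f w v) \<le> C * M / r * norm v" if "dist z w \<le> 2 * r" for w v
  proof -
    have *: "dist z s \<le> 3 * r" if "s \<in> cball w r" for s
      using that \<open>dist z w \<le> 2 * r\<close> dist_triangle[of z s w] by simp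
    show ?thesis unfolding C_def
      by (rule cauchy_bound[OF r]) (use in3 * in \<open>auto intro!: holo_subset[OF assms(3)]\<close>)
  qed
  have lip: "norm (f w - f w') \<le> C * M / r * norm (w - w')" if "dist z w \<le> 2 * r" "dist z w' \<le> 2 * r" for w w'
    by (rule holo_lipschitz[of "cball z (2 * r)"])
       (use in3 r C M d2 that in \<open>auto intro!: holo_subset[OF assms(3)]\<close>)
  have dl: "norm (fderiv f w v - fderiv f w' v) \<le> C * (C * M / r * norm (w - w')) / r * norm v"
    if "w \<in> cball z r" "w' \<in> cball z r" for w w' v
  proof -
    define h where "h = w - w'"
    have *: "dist z s \<le> 2 * r" "dist z (s + h) \<le> 2 * r" if "s \<in> cball w' r" for s
    proof -
      show "dist z s \<le> 2 * r" using that \<open>w' \<in> cball z r\<close> dist_triangle[of z s w'] by simp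
      have "dist w (s + h) = dist w' s" by (simp add: h_def dist_norm algebra_simps)
      then show "dist z (s + h) \<le> 2 * r" using that \<open>w \<in> cball z r\<close> dist_triangle[of z "s + h" w] by simp
    qed
    have hS: "holo f S" "holo f (cball w' r)" "holo (\<lambda>s. f (s + h)) (cball w' r)"
      using assms(3) * in3 r
      by (auto intro!: holo_subset[OF assms(3)] holo_shift[OF assms(3)])
        (smt (verit) mem_cball)+
    have "norm (fderiv (\<lambda>s. f (s + h) - f s) w' v) \<le> 2 * real DIM('b) * (C * M / r * norm h) / r * norm v"
      by (rule cauchy_bound[OF r holo_diff[OF hS(3,2)]])
         (use lip * in \<open>fastforce\<close>)
    moreover have "fderiv (\<lambda>s. f (s + h) - f s) w' v = fderiv f w v - fderiv f w' v"
      using fderiv_diff[OF hS(3,2), of w' v] fderiv_shift[OF assms(3), of w' h v] r that in3[of w] by (simp add: h_def)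
    ultimately show ?thesis by (simp add: C_def h_def)
  qed
  define K where "K = M + C * M / r + C * (C * M / r) / r"
  have pos: "C * M / r > 0" "C * (C * M / r) / r > 0" using r M C by auto
  show ?thesis
  proof (rule that[of r K])
    show "r > 0" by fact
    show "K > 0" using M pos by (simp add: K_def)
    show "cball z r \<subseteq> S" using in3 r by (auto simp: subset_iff)
    show "norm (f w) \<le> K" if "w \<in> cball z r" for w
      using in3[of w] that r pos by (simp add: K_def)
    have le: "C * M / r \<le> K" "C * (C * M / r) / r \<le> K" using M pos by (auto simp: K_def)
    show "norm (fderiv f w v) \<le> K * norm v" if "w \<in> cball z r" for w v
      using d2[of w v] that r mult_right_mono[OF le(1), of "norm v"] by simp
    show "norm (f w - f w') \<le> K * norm (w - w')" if "w \<in> cball z r" "w' \<in> cball z r" for w w'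
      using lip[of w w'] that r mult_right_mono[OF le(1), of "norm (w - w')"] by simp
    show "norm (fderiv f w v - fderiv f w' v) \<le> K * norm (w - w') * norm v" if "w \<in> cball z r" "w' \<in> cball z r" for w w' v
      using dl[OF that, of v] mult_right_mono[OF le(2), of "norm (w - w') * norm v"] by (simp add: mult_ac)
  qed
qed

text \<open>Holomorphy is required only from some index on, because the difference quotients and
  dilations to be used as \<open>f n\<close> are defined near a given point only for large
  \<open>n\<close>.\<close>

definition loc_lim ::
  "(nat \<Rightarrow> 'a::complex_normed_space \<Rightarrow> 'b::complex_normed_space) \<Rightarrow> ('a \<Rightarrow> 'b) \<Rightarrow> 'a set \<Rightarrow> bool"
  where "loc_lim f g S \<longleftrightarrow> (\<forall>z\<in>S. \<exists>r>0. (\<forall>\<^sub>F n in sequentially. holo (f n) (ball z r)) \<and>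
           uniform_limit (ball z r) f g sequentially)"

text \<open>The theorem of Weierstrass. Cauchy estimates for \<open>f n - f m\<close> make the
  differentials uniformly Cauchy on a smaller ball, term-by-term differentiation identifies their
  limit as the differential of \<open>g\<close>, and complex linearity survives the limit.\<close>

lemma loc_lim_main:
  fixes f :: "nat \<Rightarrow> 'a::complex_normed_space \<Rightarrow> 'b::cspace"
  assumes "loc_lim f g S" "z \<in> S"
  obtains r where "r > 0" "holo g (ball z r)" "\<forall>\<^sub>F n in sequentially. holo (f n) (ball z r)"
    "\<And>e. e > 0 \<Longrightarrow> \<forall>\<^sub>F n in sequentially. \<forall>w\<in>ball z r. \<forall>v. norm (fderiv (f n) w v - fderiv g w v) \<le> e * norm v"
proof -
  obtain R where R: "R > 0" "\<forall>\<^sub>F n in sequentially. holo (f n) (ball z R)" "uniform_limit (ball z R) f g sequentially"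
    using assms unfolding loc_lim_def by blast
  \<comment> \<open>A closed ball of radius \<open>r\<close> about any point of
    \<open>ball z r\<close> then stays inside \<open>ball z R\<close>.\<close>
  define r where "r = R / 3"
  have r: "r > 0" using R by (simp add: r_def)
  obtain N where N: "\<And>n. n \<ge> N \<Longrightarrow> holo (f n) (ball z R)"
    using R(2) unfolding eventually_sequentially by blast
  define C where "C = 2 * real DIM('b) / r"
  have C: "C > 0" using r by (simp add: C_def)
  have sub: "cball w r \<subseteq> ball z R" if "w \<in> ball z r" for w
  proof
    fix s assume "s \<in> cball w r"
    then show "s \<in> ball z R" using that dist_triangle[of z s w] r by (simp add: r_def)
  qed
  have cauchy: "\<exists>M\<ge>N. \<forall>n\<ge>M. \<forall>m\<ge>M. \<forall>w\<in>ball z r. \<forall>v. norm (fderiv (f n) w v - fderiv (f m) w v) \<le> e * norm v" if e: "e > 0" for e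
  proof -
    define d where "d = e / (2 * C)"
    have d: "d > 0" using C e by (simp add: d_def)
    obtain M0 where M0: "\<And>n x. n \<ge> M0 \<Longrightarrow> x \<in> ball z R \<Longrightarrow> dist (f n x) (g x) < d"
      using R(3) d unfolding uniform_limit_iff eventually_sequentially by blast
    show ?thesis
    proof (intro exI[of _ "max M0 N"] conjI allI impI ballI)
      fix n m w v assume nm: "max M0 N \<le> n" "max M0 N \<le> m" and w: "w \<in> ball z r"
      have h: "holo (f n) (cball w r)" "holo (f m) (cball w r)"
        using N nm sub[OF w] holo_subset by (metis max.bounded_iff)+
      have "norm (fderiv (\<lambda>x. f n x - f m x) w v) \<le> 2 * real DIM('b) * (2 * d) / r * norm v"
      proof (rule cauchy_bound[OF r holo_diff[OF h]])
        fix s assume "s \<in> cball w r"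
        then have "s \<in> ball z R" using sub[OF w] by blast
        then have "dist (f n s) (g s) < d" "dist (f m s) (g s) < d" using M0 nm by auto
        then show "norm (f n s - f m s) \<le> 2 * d" using dist_triangle2[of "f n s" "f m s" "g s"] by (simp add: dist_norm)
      qed
      also have "2 * real DIM('b) * (2 * d) / r = e" using C r by (simp add: d_def C_def)
      finally show "norm (fderiv (f n) w v - fderiv (f m) w v) \<le> e * norm v"
        using fderiv_diff[OF h] r by simp
    qed simp
  qed
  define L where "L w v = lim (\<lambda>n. fderiv (f n) w v)" for w v
  have L: "(\<lambda>n. fderiv (f n) w v) \<longlonglongrightarrow> L w v" if w: "w \<in> ball z r" for w v
  proof -
    have "Cauchy (\<lambda>n. fderiv (f n) w v)"
    proof (rule CauchyI)
      fix e :: real assume e: "e > 0"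
      define e' where "e' = e / (2 * (norm v + 1))"
      have e': "e' > 0" "e' * norm v < e"
      proof -
        have p: "norm v + 1 > 0" by (simp add: add_nonneg_pos)
        show "e' > 0" using e p by (simp add: e'_def)
        have "e' * norm v \<le> e' * (norm v + 1)" using \<open>e' > 0\<close> by simp
        moreover have "e' * (norm v + 1) = e / 2" 
        proof -
          have "e / (2 * q) * q = e / 2" if "q > 0" for q :: real using that by (simp add: field_simps)
          then show ?thesis unfolding e'_def using p by blast
        qed
        ultimately show "e' * norm v < e" using e by linarith
      qed
      then obtain M where "\<forall>n\<ge>M. \<forall>m\<ge>M. \<forall>w\<in>ball z r. \<forall>v. norm (fderiv (f n) w v - fderiv (f m) w v) \<le> e' * norm v"
        using cauchy by blast
      then have "norm (fderiv (f m) w v - fderiv (f n) w v) < e" if "m \<ge> M" "n \<ge> M" for m n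
        using w e'(2) that le_less_trans by blast
      then show "\<exists>M. \<forall>m\<ge>M. \<forall>n\<ge>M. norm (fderiv (f m) w v - fderiv (f n) w v) < e" by blast
    qed
    then show ?thesis unfolding L_def by (simp add: Cauchy_convergent_iff convergent_LIMSEQ_iff)
  qed
  have unif: "\<exists>M\<ge>N. \<forall>n\<ge>M. \<forall>w\<in>ball z r. \<forall>v. norm (fderiv (f n) w v - L w v) \<le> e * norm v" if e: "e > 0" for e
  proof -
    obtain M where M: "M \<ge> N" "\<And>n m w v. n\<ge>M \<Longrightarrow> m\<ge>M \<Longrightarrow> w\<in>ball z r \<Longrightarrow> norm (fderiv (f n) w v - fderiv (f m) w v) \<le> e * norm v"
      using cauchy[OF e] by blast
    have "norm (fderiv (f n) w v - L w v) \<le> e * norm v" if "n \<ge> M" "w \<in> ball z r" for n w v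
      by (rule LIMSEQ_le_const2[OF tendsto_norm[OF tendsto_diff[OF tendsto_const L[OF that(2)]]]])
         (use M(2) that in blast)
    then show ?thesis using M(1) by blast
  qed
  have zr: "z \<in> ball z r" using r by simp
  have pw: "(\<lambda>n. f n x) \<longlonglongrightarrow> g x" if "x \<in> ball z R" for x
    by (rule tendsto_uniform_limitI[OF R(3) that])
  have "\<exists>g'. \<forall>x\<in>ball z r. (\<lambda>n. f (n + N) x) \<longlonglongrightarrow> g' x \<and> (g' has_derivative L x) (at x within ball z r)"
  proof (rule has_derivative_sequence[OF convex_ball _ _ zr, where f = "\<lambda>n. f (n + N)" and f' = "\<lambda>n. fderiv (f (n + N))"])
    fix n x assume "x \<in> ball z r"
    then have xR: "x \<in> ball z R" using r by (simp add: r_def)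
    show "(f (n + N) has_derivative fderiv (f (n + N)) x) (at x within ball z r)"
      by (rule has_derivative_at_withinI[OF holo_has_derivative[OF N]]) (use xR in auto)
  next
    fix e :: real assume "e > 0"
    then obtain M where "\<forall>n\<ge>M. \<forall>w\<in>ball z r. \<forall>v. norm (fderiv (f n) w v - L w v) \<le> e * norm v" using unif by blast
    then show "\<forall>\<^sub>F n in sequentially. \<forall>x\<in>ball z r. \<forall>h. norm (fderiv (f (n + N)) x h - L x h) \<le> e * norm h"
      unfolding eventually_sequentially by (intro exI[of _ M]) auto
  next
    show "(\<lambda>n. f (n + N) z) \<longlonglongrightarrow> g z" using pw[of z] R(1) LIMSEQ_ignore_initial_segment by auto
  qed
  then obtain g' where g': "\<And>x. x\<in>ball z r \<Longrightarrow> (\<lambda>n. f (n + N) x) \<longlonglongrightarrow> g' x"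
     "\<And>x. x\<in>ball z r \<Longrightarrow> (g' has_derivative L x) (at x within ball z r)" by blast
  have gg: "g' x = g x" if "x \<in> ball z r" for x
  proof -
    have "x \<in> ball z R" using that r by (simp add: r_def)
    from LIMSEQ_unique[OF g'(1)[OF that] LIMSEQ_ignore_initial_segment[OF pw[OF this], of N]] show ?thesis .
  qed
  have der: "(g has_derivative L x) (at x)" if "x \<in> ball z r" for x
  proof -
    have "(g' has_derivative L x) (at x)" using g'(2)[OF that] unfolding at_within_open[OF that open_ball] .
    then show ?thesis by (rule has_derivative_transform_within_open[OF _ open_ball that]) (use gg in auto)
  qed
  have Lc: "clinear (L x)" if x: "x \<in> ball z r" for x
  proof -
    have "L x (c *\<^sub>C v) = c *\<^sub>C L x v" for c v
    proof (rule LIMSEQ_unique[OF L[OF x]])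
      have xR: "x \<in> ball z R" using x r by (simp add: r_def)
      have "\<forall>\<^sub>F n in sequentially. c *\<^sub>C fderiv (f n) x v = fderiv (f n) x (c *\<^sub>C v)"
        using R(2) by eventually_elim (use clinear_scaleC_D[OF holo_clinear] xR in metis)
      then show "(\<lambda>n. fderiv (f n) x (c *\<^sub>C v)) \<longlonglongrightarrow> c *\<^sub>C L x v"
        by (rule Lim_transform_eventually[rotated])
           (rule bounded_bilinear.tendsto[OF bounded_bilinear_scaleC tendsto_const L[OF x]])
    qed
    then show ?thesis unfolding clinear_def using der[OF x] has_derivative_bounded_linear by blast
  qed
  show ?thesis
  proof (rule that[OF r])
    show "holo g (ball z r)" by (rule holoI) (use der Lc in blast)
    show "\<forall>\<^sub>F n in sequentially. holo (f n) (ball z r)"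
      using R(2) by eventually_elim (use r in \<open>auto simp: r_def intro: holo_subset\<close>)
    fix e :: real assume "e > 0"
    then obtain M where "\<forall>n\<ge>M. \<forall>w\<in>ball z r. \<forall>v. norm (fderiv (f n) w v - L w v) \<le> e * norm v" using unif by blast
    then show "\<forall>\<^sub>F n in sequentially. \<forall>w\<in>ball z r. \<forall>v. norm (fderiv (f n) w v - fderiv g w v) \<le> e * norm v"
      unfolding eventually_sequentially using fderiv_eqI[OF der] by (intro exI[of _ M]) auto
  qed
qed

lemma loc_lim_holo:
  fixes f :: "nat \<Rightarrow> 'a::complex_normed_space \<Rightarrow> 'b::cspace"
  assumes "loc_lim f g S" shows "holo g S"
proof (rule holoI)
  fix z assume "z \<in> S"
  then obtain r where "r > 0" "holo g (ball z r)" using loc_lim_main[OF assms] by blast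
  then show "\<exists>D. (g has_derivative D) (at z) \<and> clinear D"
    by (meson centre_in_ball holo_clinear holo_has_derivative)
qed

text \<open>The estimate of \<open>loc_lim_main\<close> is uniform relative to the norm of the
  direction, so the directions may vary along a convergent, hence bounded, sequence.\<close>

lemma loc_lim_fderiv_tendsto:
  fixes f :: "nat \<Rightarrow> 'a::complex_normed_space \<Rightarrow> 'b::cspace"
  assumes "loc_lim f g S" "z \<in> S" "v \<longlonglongrightarrow> w"
  shows "(\<lambda>n. fderiv (f n) z (v n)) \<longlonglongrightarrow> fderiv g z w"
proof -
  obtain r where r: "r > 0" "holo g (ball z r)" "\<forall>\<^sub>F n in sequentially. holo (f n) (ball z r)"
    "\<And>e. e > 0 \<Longrightarrow> \<forall>\<^sub>F n in sequentially. \<forall>w\<in>ball z r. \<forall>v. norm (fderiv (f n) w v - fderiv g w v) \<le> e * norm v"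
    by (rule loc_lim_main[OF assms(1,2)]) (rule that)
  have bl: "bounded_linear (fderiv g z)" using holo_clinear[OF r(2), of z] r(1) by (simp add: clinear_def)
  obtain B where B: "B > 0" "\<And>n. norm (v n) \<le> B"
    using convergent_imp_Bseq[OF convergentI[OF assms(3)]] unfolding Bseq_def by blast
  have "(\<lambda>n. fderiv (f n) z (v n) - fderiv g z (v n)) \<longlonglongrightarrow> 0"
  proof (rule tendstoI)
    fix e :: real assume e: "e > 0"
    then have "e / (2 * B) > 0" using B by simp
    from r(4)[OF this] show "\<forall>\<^sub>F n in sequentially. dist (fderiv (f n) z (v n) - fderiv g z (v n)) 0 < e"
    proof eventually_elim
      case (elim n)
      then have "norm (fderiv (f n) z (v n) - fderiv g z (v n)) \<le> e / (2 * B) * norm (v n)" using r(1) by simp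
      also have "\<dots> \<le> e / (2 * B) * B" using B e by (intro mult_left_mono) auto
      also have "\<dots> < e" using B e by simp
      finally show ?case by simp
    qed
  qed
  from tendsto_add[OF this bounded_linear.tendsto[OF bl assms(3)]] show ?thesis by simp
qed

text \<open>The mean value inequality for \<open>f\<close> minus its linear part at
  \<open>x\<close>.\<close>

lemma holo_fderiv_remainder:
  assumes "convex S" "holo f S" "x \<in> S" "y \<in> S" "0 \<le> B"
    "\<And>w v. w \<in> S \<Longrightarrow> norm (fderiv f w v - fderiv f x v) \<le> B * norm v"
  shows "norm (f y - f x - fderiv f x (y - x)) \<le> B * norm (y - x)"
proof -
  have cl: "clinear (fderiv f x)" using holo_clinear assms by blast
  have h: "holo (\<lambda>w. f w - fderiv f x w) S" by (intro holo_diff assms holo_clinear_map cl)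
  have "norm ((f y - fderiv f x y) - (f x - fderiv f x x)) \<le> B * norm (y - x)"
  proof (rule holo_lipschitz[OF assms(1) h _ assms(5) assms(4,3)])
    fix z v assume z: "z \<in> S"
    show "norm (fderiv (\<lambda>w. f w - fderiv f x w) z v) \<le> B * norm v"
      using assms(6)[OF z, of v] fderiv_diff[OF assms(2) holo_clinear_map[OF cl] z, of v]
      by (simp add: fderiv_clinear[OF cl])
  qed
  then show ?thesis by (simp add: clinear_diff[OF cl] algebra_simps)
qed

text \<open>This is what makes the differential of a holomorphic map holomorphic again, without an
  integral formula in several variables.\<close>

lemma loc_lim_fderiv:
  fixes f :: "'a::complex_normed_space \<Rightarrow> 'b::cspace"
  assumes "open S" "holo f S"
  shows "loc_lim (\<lambda>n (z, v). real (Suc n) *\<^sub>R (f (z + v /\<^sub>R real (Suc n)) - f z)) (\<lambda>(z, v). fderiv f z v) (S \<times> UNIV)"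
  unfolding loc_lim_def
proof safe
  fix z0 and v0 :: 'a assume "z0 \<in> S"
  obtain r K where r: "r > 0" "K > 0" "cball z0 r \<subseteq> S"
    "\<And>w w' v. w \<in> cball z0 r \<Longrightarrow> w' \<in> cball z0 r \<Longrightarrow> norm (fderiv f w v - fderiv f w' v) \<le> K * norm (w - w') * norm v"
    by (rule loc_bounds[OF assms(1) \<open>z0 \<in> S\<close> assms(2)]) (rule that)
  \<comment> \<open>Base points then move by less than \<open>r / 3\<close> and directions stay
    shorter than \<open>V\<close>. The choice of \<open>N\<close> below keeps the increments under
    \<open>r / 3\<close> as well, so both points of the difference quotient lie in
    \<open>cball z0 r\<close>.\<close>
  define \<rho> where "\<rho> = min 1 (r / 3)"
  define V where "V = norm v0 + 1"
  have V: "V > 0" by (simp add: V_def add_nonneg_pos)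
  have \<rho>: "\<rho> > 0" using r by (simp add: \<rho>_def)
  have bd: "dist z0 z < r / 3 \<and> norm v < V" if "(z, v) \<in> ball (z0, v0) \<rho>" for z v
  proof -
    have "dist z0 z < \<rho>" "dist v0 v < \<rho>"
      using that dist_fst_le[of "(z0,v0)" "(z,v)"] dist_snd_le[of "(z0,v0)" "(z,v)"] by auto
    then show ?thesis using norm_triangle_sub[of v v0] by (auto simp: \<rho>_def V_def dist_norm norm_minus_commute)
  qed
  obtain N where N: "V / real (Suc N) < r / 3"
  proof -
    obtain N where "V / (r / 3) < real N" using reals_Archimedean2 by blast
    then have "V / (r/3) < real (Suc N)" by linarith
    then show ?thesis using that r(1) by (simp add: field_simps)
  qed
  have small: "norm (v /\<^sub>R real (Suc n)) \<le> V / real (Suc n)" "norm (v /\<^sub>R real (Suc n)) < r / 3" if "norm v < V" "n \<ge> N" for v :: 'a and n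
  proof -
    have "norm v / real (Suc n) \<le> V / real (Suc n)" using that by (intro divide_right_mono) auto
    moreover have "V / real (Suc n) \<le> V / real (Suc N)" using that V by (intro divide_left_mono) auto
    moreover have "norm (v /\<^sub>R real (Suc n)) = norm v / real (Suc n)"
      by (simp del: of_nat_Suc add: divide_inverse mult.commute)
    ultimately show "norm (v /\<^sub>R real (Suc n)) \<le> V / real (Suc n)" "norm (v /\<^sub>R real (Suc n)) < r / 3" using N by linarith+
  qed
  have inb: "z + v /\<^sub>R real (Suc n) \<in> cball z0 r" "z \<in> cball z0 r" if "(z, v) \<in> ball (z0, v0) \<rho>" "n \<ge> N" for z v n
  proof -
    have "dist z0 z < r / 3" "norm v < V" using bd[OF that(1)] by auto
    moreover have "dist z0 (z + v /\<^sub>R real (Suc n)) \<le> dist z0 z + norm (v /\<^sub>R real (Suc n))"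
      using norm_triangle_ineq4[of "z0 - z" "v /\<^sub>R real (Suc n)"] by (simp add: dist_norm algebra_simps)
    moreover have "norm (v /\<^sub>R real (Suc n)) < r / 3" using small(2)[OF \<open>norm v < V\<close> that(2)] .
    ultimately show "z + v /\<^sub>R real (Suc n) \<in> cball z0 r" "z \<in> cball z0 r" using r(1) by auto
  qed
  show "\<exists>r>0. (\<forall>\<^sub>F n in sequentially. holo (\<lambda>(z, v). real (Suc n) *\<^sub>R (f (z + v /\<^sub>R real (Suc n)) - f z)) (ball (z0, v0) r)) \<and>
        uniform_limit (ball (z0, v0) r) (\<lambda>n (z, v). real (Suc n) *\<^sub>R (f (z + v /\<^sub>R real (Suc n)) - f z)) (\<lambda>(z, v). fderiv f z v) sequentially"
  proof (intro exI[of _ \<rho>] conjI \<rho>)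
    have cl: "clinear (\<lambda>x::'a\<times>'a. fst x + c *\<^sub>R snd x)" for c
      by (subst scaleC_of_real[symmetric]) (intro clinear_plus clinear_scaleC clinear_fst clinear_snd)
    have "holo (\<lambda>(z, v). real (Suc n) *\<^sub>R (f (z + v /\<^sub>R real (Suc n)) - f z)) (ball (z0, v0) \<rho>)" if "n \<ge> N" for n
      unfolding case_prod_beta
      apply (subst scaleC_of_real[symmetric])
      apply (intro holo_scaleC_left holo_diff holo_compose[OF assms(2)] holo_clinear_map clinear_fst cl)
      using inb[OF _ that] r(3) by (force simp del: of_nat_Suc)+
    then show "\<forall>\<^sub>F n in sequentially. holo (\<lambda>(z, v). real (Suc n) *\<^sub>R (f (z + v /\<^sub>R real (Suc n)) - f z)) (ball (z0, v0) \<rho>)"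
      unfolding eventually_sequentially by blast
    show "uniform_limit (ball (z0, v0) \<rho>) (\<lambda>n (z, v). real (Suc n) *\<^sub>R (f (z + v /\<^sub>R real (Suc n)) - f z)) (\<lambda>(z, v). fderiv f z v) sequentially"
    proof (rule uniform_limitI)
      fix e :: real assume e: "e > 0"
      have "(\<lambda>n. K * V * V / real (Suc n)) \<longlonglongrightarrow> 0"
        using tendsto_mult[OF tendsto_const[of "K * V * V"] LIMSEQ_inverse_real_of_nat] by (simp add: divide_inverse)
      then have "\<forall>\<^sub>F n in sequentially. K * V * V / real (Suc n) < e" using e by (rule order_tendstoD)
      with eventually_ge_at_top[of N]
      show "\<forall>\<^sub>F n in sequentially. \<forall>x\<in>ball (z0, v0) \<rho>. dist (case x of (z, v) \<Rightarrow> real (Suc n) *\<^sub>R (f (z + v /\<^sub>R real (Suc n)) - f z)) (case x of (z, v) \<Rightarrow> fderiv f z v) < e"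
      proof eventually_elim
        case (elim n)
        show ?case
        proof safe
          fix z v assume zv: "(z, v) \<in> ball (z0, v0) \<rho>"
          define h where "h = v /\<^sub>R real (Suc n)"
          have v: "v = real (Suc n) *\<^sub>R h" by (simp add: h_def del: of_nat_Suc)
          have nv: "norm v < V" using bd[OF zv] by simp
          have hV: "norm h \<le> V / real (Suc n)" using small(1)[OF nv elim(1)] by (simp add: h_def)
          have zin: "z \<in> cball z0 r" "z + h \<in> cball z0 r" using inb[OF zv elim(1)] by (auto simp: h_def)
          have seg: "closed_segment z (z + h) \<subseteq> cball z0 r" using zin by (simp add: closed_segment_subset)
          have "norm (f (z + h) - f z - fderiv f z (z + h - z)) \<le> (K * norm h) * norm (z + h - z)"
          proof (rule holo_fderiv_remainder[OF convex_closed_segment[of z "z + h"]])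
            show "holo f (closed_segment z (z + h))" using assms(2) seg r(3) holo_subset by blast
            fix w v assume w: "w \<in> closed_segment z (z + h)"
            have "norm (fderiv f w v - fderiv f z v) \<le> K * norm (w - z) * norm v" using r(4) w seg zin by blast
            also have "\<dots> \<le> K * norm h * norm v"
              using segment_bound(1)[OF w] r(2) by (intro mult_right_mono mult_left_mono) auto
            finally show "norm (fderiv f w v - fderiv f z v) \<le> K * norm h * norm v" .
          qed (use r(2) in auto)
          then have "norm (f (z + h) - f z - fderiv f z h) \<le> K * norm h * norm h" by simp
          also have "\<dots> \<le> K * (V / real (Suc n)) * (V / real (Suc n))"
            using hV r(2) V by (intro mult_mono mult_left_mono) auto
          finally have "real (Suc n) * norm (f (z + h) - f z - fderiv f z h) \<le> real (Suc n) * (K * (V / real (Suc n)) * (V / real (Suc n)))"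
            by (rule mult_left_mono) simp
          also have "\<dots> = K * V * V / real (Suc n)" by (simp add: field_simps del: of_nat_Suc)
          also have "\<dots> < e" by (rule elim(2))
          finally have 1: "real (Suc n) * norm (f (z + h) - f z - fderiv f z h) < e" .
          have zS: "z \<in> S" using zin r(3) by blast
          have "fderiv f z v = real (Suc n) *\<^sub>R fderiv f z h"
            unfolding v by (rule clinear_scaleR[OF holo_clinear[OF assms(2) zS]])
          then have "real (Suc n) *\<^sub>R (f (z + h) - f z) - fderiv f z v = real (Suc n) *\<^sub>R (f (z + h) - f z - fderiv f z h)"
            by (simp add: scaleR_diff_right)
          then have "dist (real (Suc n) *\<^sub>R (f (z + h) - f z)) (fderiv f z v) = real (Suc n) * norm (f (z + h) - f z - fderiv f z h)"
            by (simp add: dist_norm del: of_nat_Suc)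
          then show "dist (real (Suc n) *\<^sub>R (f (z + v /\<^sub>R real (Suc n)) - f z)) (fderiv f z v) < e"
            using 1 by (simp add: h_def)
        qed
      qed
    qed
  qed
qed

section \<open>The differential as a holomorphic map of point and direction\<close>

lemma holo_fderiv_joint:
  fixes f :: "'a::complex_normed_space \<Rightarrow> 'b::cspace"
  assumes "open S" "holo f S"
  shows "holo (\<lambda>(z, v). fderiv f z v) (S \<times> UNIV)"
  by (rule loc_lim_holo[OF loc_lim_fderiv[OF assms]])

lemma holo_fderiv:
  fixes f :: "'a::complex_normed_space \<Rightarrow> 'b::cspace"
  assumes "open S" "holo f S" "holo g T" "holo h T" "g ` T \<subseteq> S"
  shows "holo (\<lambda>x. fderiv f (g x) (h x)) T"
  using holo_compose[OF holo_fderiv_joint[OF assms(1,2)] holo_Pair[OF assms(3,4)]] assms(5) by auto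

lemma holo_fderiv_const:
  fixes f :: "'a::complex_normed_space \<Rightarrow> 'b::cspace"
  assumes "open S" "holo f S"
  shows "holo (\<lambda>x. fderiv f x v) S"
  by (rule holo_fderiv[OF assms]) (auto intro: holo_ident holo_const)

lemma holo_slice1:
  assumes "holo f (S \<times> B)" "q \<in> B"
  shows "holo (\<lambda>t. f (t, q)) S" and "t \<in> S \<Longrightarrow> fderiv (\<lambda>t. f (t, q)) t h = fderiv f (t, q) (h, 0)"
proof -
  show "holo (\<lambda>t. f (t, q)) S"
    by (rule holo_compose[OF assms(1)]) (use assms(2) in \<open>auto intro!: holo_Pair holo_ident holo_const\<close>)
  have "((\<lambda>t. (t, q)) has_derivative (\<lambda>h. (h, 0))) (at t)"
    by (intro has_derivative_Pair has_derivative_ident has_derivative_const)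
  from fderiv_compose[OF assms(1) _ this, of h] assms(2)
  show "t \<in> S \<Longrightarrow> fderiv (\<lambda>t. f (t, q)) t h = fderiv f (t, q) (h, 0)" by simp
qed

lemma holo_slice2:
  assumes "holo f (S \<times> B)" "t \<in> S"
  shows "holo (\<lambda>q. f (t, q)) B" and "q \<in> B \<Longrightarrow> fderiv (\<lambda>q. f (t, q)) q h = fderiv f (t, q) (0, h)"
proof -
  show "holo (\<lambda>q. f (t, q)) B"
    by (rule holo_compose[OF assms(1)]) (use assms(2) in \<open>auto intro!: holo_Pair holo_ident holo_const\<close>)
  have "((\<lambda>q. (t, q)) has_derivative (\<lambda>h. (0, h))) (at q)"
    by (intro has_derivative_Pair has_derivative_ident has_derivative_const)
  from fderiv_compose[OF assms(1) _ this, of h] assms(2)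
  show "q \<in> B \<Longrightarrow> fderiv (\<lambda>q. f (t, q)) q h = fderiv f (t, q) (0, h)" by simp
qed

text \<open>The differential splits into two partial ones, and a map that is linear in its second
  argument is its own partial differential there.\<close>

lemma fderiv_lin_joint:
  fixes J :: "'a::complex_normed_space \<times> 'c::complex_normed_space \<Rightarrow> 'b::cspace"
  assumes J: "holo J (S \<times> UNIV)" and lin: "\<And>z. z \<in> S \<Longrightarrow> clinear (\<lambda>v. J (z, v))"
    and g: "holo g T" and h: "holo h T" and gT: "g ` T \<subseteq> S" and x: "x \<in> T"
  shows "fderiv (\<lambda>x. J (g x, h x)) x u = fderiv (\<lambda>z. J (z, h x)) (g x) (fderiv g x u) + J (g x, fderiv h x u)"
proof -
  have gS: "g x \<in> S" using gT x by blast
  have clJ: "clinear (fderiv J (g x, h x))" by (rule holo_clinear[OF J]) (use gS in auto)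
  have "((\<lambda>x. (g x, h x)) has_derivative (\<lambda>u. (fderiv g x u, fderiv h x u))) (at x)"
    by (intro has_derivative_Pair holo_has_derivative[OF g x] holo_has_derivative[OF h x])
  from fderiv_compose[OF J _ this, of u] gS
  have "fderiv (\<lambda>x. J (g x, h x)) x u = fderiv J (g x, h x) (fderiv g x u, fderiv h x u)" by simp
  also have "\<dots> = fderiv J (g x, h x) (fderiv g x u, 0) + fderiv J (g x, h x) (0, fderiv h x u)"
    using clinear_add[OF clJ, of "(fderiv g x u, 0)" "(0, fderiv h x u)"] by simp
  also have "fderiv J (g x, h x) (fderiv g x u, 0) = fderiv (\<lambda>z. J (z, h x)) (g x) (fderiv g x u)"
    using holo_slice1(2)[OF J _ gS] by simp
  also have "fderiv J (g x, h x) (0, fderiv h x u) = J (g x, fderiv h x u)"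
    using holo_slice2(2)[OF J gS, of "h x"] by (simp add: fderiv_clinear[OF lin[OF gS]])
  finally show ?thesis .
qed

lemma fderiv_fderiv_joint:
  fixes f :: "'a::complex_normed_space \<Rightarrow> 'b::cspace"
  assumes "open S" "holo f S" "holo g T" "holo h T" "g ` T \<subseteq> S" "x \<in> T"
  shows "fderiv (\<lambda>x. fderiv f (g x) (h x)) x u = fderiv (\<lambda>z. fderiv f z (h x)) (g x) (fderiv g x u) + fderiv f (g x) (fderiv h x u)"
  using fderiv_lin_joint[OF holo_fderiv_joint[OF assms(1,2)] _ assms(3-6), of u] holo_clinear[OF assms(2)] by simp

text \<open>The difference quotients of \<open>f\<close> in direction \<open>v\<close>,
  differentiated in direction \<open>w\<close>, have two limits: the differential of their limit
  and, since they are also difference quotients of \<open>\<lambda>z. fderiv f z w\<close>, the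
  differential of that map in direction \<open>v\<close>.\<close>

lemma fderiv_fderiv_sym:
  fixes f :: "'a::complex_normed_space \<Rightarrow> 'b::cspace"
  assumes "open S" "holo f S" "z \<in> S"
  shows "fderiv (\<lambda>z. fderiv f z v) z w = fderiv (\<lambda>z. fderiv f z w) z v"
proof -
  let ?F = "\<lambda>n (z, v). real (Suc n) *\<^sub>R (f (z + v /\<^sub>R real (Suc n)) - f z)"
  let ?g = "\<lambda>z. fderiv f z w"
  have L: "loc_lim ?F (\<lambda>(z, v). fderiv f z v) (S \<times> UNIV)" by (rule loc_lim_fderiv[OF assms(1,2)])
  have gh: "holo ?g S" by (rule holo_fderiv_const[OF assms(1,2)])
  have lim1: "(\<lambda>n. fderiv (?F n) (z, v) (w, 0)) \<longlonglongrightarrow> fderiv (\<lambda>(z, v). fderiv f z v) (z, v) (w, 0)"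
    by (rule loc_lim_fderiv_tendsto[OF L _ tendsto_const]) (use assms in auto)
  have e1: "fderiv (\<lambda>(z, v). fderiv f z v) (z, v) (w, 0) = fderiv (\<lambda>z. fderiv f z v) z w"
  proof -
    have "((\<lambda>z. (z, v)) has_derivative (\<lambda>w. (w, 0))) (at z)"
      by (intro has_derivative_Pair has_derivative_ident has_derivative_const)
    from fderiv_compose[OF holo_fderiv_joint[OF assms(1,2)] _ this, of w] assms(3) show ?thesis by simp
  qed
  have sm: "(\<lambda>n. v /\<^sub>R real (Suc n)) \<longlonglongrightarrow> 0"
    using tendsto_scaleR[OF LIMSEQ_inverse_real_of_nat tendsto_const[of v]] by simp
  have inS: "\<forall>\<^sub>F n in sequentially. z + v /\<^sub>R real (Suc n) \<in> S"
    using topological_tendstoD[OF tendsto_add[OF tendsto_const[of z] sm] assms(1)] assms(3) by simp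
  have e2: "\<forall>\<^sub>F n in sequentially. real (Suc n) *\<^sub>R (?g (z + v /\<^sub>R real (Suc n)) - ?g z) = fderiv (?F n) (z, v) (w, 0)"
    using inS
  proof eventually_elim
    case (elim n)
    let ?h = "v /\<^sub>R real (Suc n)"
    have "((\<lambda>(z, v). real (Suc n) *\<^sub>R (f (z + v /\<^sub>R real (Suc n)) - f z)) has_derivative
        (\<lambda>(a, b). real (Suc n) *\<^sub>R (fderiv f (z + ?h) (a + b /\<^sub>R real (Suc n)) - fderiv f z a))) (at (z, v))"
      unfolding case_prod_beta
      by (rule has_derivative_eq_rhs)
        (auto intro!: derivative_eq_intros has_derivative_compose[OF _ holo_has_derivative[OF assms(2)]] simp: elim assms(3) simp del: of_nat_Suc)
    from fderiv_eqI[OF this] show ?case by (simp del: of_nat_Suc)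
  qed
  have lim2: "(\<lambda>n. real (Suc n) *\<^sub>R (?g (z + v /\<^sub>R real (Suc n)) - ?g z)) \<longlonglongrightarrow> fderiv (\<lambda>z. fderiv f z v) z w"
    by (rule Lim_transform_eventually[OF _ eventually_mono[OF e2 sym]]) (use lim1 e1 in \<open>simp del: of_nat_Suc\<close>)
  have L2: "loc_lim (\<lambda>n (z, v). real (Suc n) *\<^sub>R (?g (z + v /\<^sub>R real (Suc n)) - ?g z)) (\<lambda>(z, v). fderiv ?g z v) (S \<times> UNIV)"
    by (rule loc_lim_fderiv[OF assms(1) gh])
  have "(\<lambda>n. real (Suc n) *\<^sub>R (?g (z + v /\<^sub>R real (Suc n)) - ?g z)) \<longlonglongrightarrow> fderiv ?g z v"
  proof -
    obtain r where "r > 0" "uniform_limit (ball (z, v) r) (\<lambda>n (z, v). real (Suc n) *\<^sub>R (?g (z + v /\<^sub>R real (Suc n)) - ?g z)) (\<lambda>(z, v). fderiv ?g z v) sequentially"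
      using L2 assms(3) unfolding loc_lim_def by blast
    from tendsto_uniform_limitI[OF this(2), of "(z, v)"] this(1) show ?thesis by simp
  qed
  with lim2 show ?thesis using LIMSEQ_unique by blast
qed

lemma holo_zero_continuation:
  fixes e :: "complex \<Rightarrow> 'a::cspace"
  assumes "holo e B" "open B" "connected B" "t0 \<in> B" "\<forall>\<^sub>F t in nhds t0. e t = 0" "t \<in> B"
  shows "e t = 0"
proof (rule cfun_zeroI)
  fix b :: 'a
  obtain S where S: "open S" "t0 \<in> S" "\<And>t. t \<in> S \<Longrightarrow> e t = 0"
    using assms(5) unfolding eventually_nhds by blast
  show "cfun b (e t) = 0"
  proof (rule analytic_continuation_open[of "S \<inter> B" B "\<lambda>t. cfun b (e t)" "\<lambda>_. 0"])
    show "(\<lambda>t. cfun b (e t)) holomorphic_on B"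
      by (rule holo_holomorphic_on[OF holo_clinear_compose[OF clinear_cfun assms(1)]])
  qed (use assms S in \<open>auto simp: clinear_zero[OF clinear_cfun]\<close>)
qed

text \<open>Gronwall's inequality for complex time: the derivative bound is only needed near one point,
  the rest follows by analytic continuation.\<close>

lemma holo_gronwall_zero:
  fixes e :: "complex \<Rightarrow> 'a::cspace"
  assumes "holo e B" "open B" "connected B" "t0 \<in> B" "e t0 = 0"
    "\<forall>\<^sub>F t in nhds t0. norm (fderiv e t 1) \<le> K * norm (e t)" "t \<in> B"
  shows "e t = 0"
proof (rule holo_zero_continuation[OF assms(1-4) _ assms(7)])
  have "\<forall>\<^sub>F t in nhds t0. t \<in> B \<and> norm (fderiv e t 1) \<le> K * norm (e t)"
    using assms(6) eventually_nhds_in_open[OF assms(2,4)] by eventually_elim simp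
  then obtain d where d: "d > 0" "\<And>t. dist t t0 < d \<Longrightarrow> t \<in> B \<and> norm (fderiv e t 1) \<le> K * norm (e t)"
    unfolding eventually_nhds_metric by blast
  \<comment> \<open>With this radius \<open>\<bar>K\<bar> * \<rho>\<close> is at most 1/2; the added
    1 keeps the denominator positive when \<open>K = 0\<close>.\<close>
  define \<rho> where "\<rho> = min (d / 2) (1 / (2 * (\<bar>K\<bar> + 1)))"
  have \<rho>: "\<rho> > 0" using d by (simp add: \<rho>_def)
  have K\<rho>: "\<bar>K\<bar> * \<rho> \<le> 1 / 2"
  proof -
    have "\<bar>K\<bar> * \<rho> \<le> (\<bar>K\<bar> + 1) * \<rho>" using \<rho> by simp
    also have "\<dots> \<le> (\<bar>K\<bar> + 1) * (1 / (2 * (\<bar>K\<bar> + 1)))" by (rule mult_left_mono) (auto simp: \<rho>_def)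
    also have "\<dots> = 1 / 2" by (simp add: field_simps)
    finally show ?thesis .
  qed
  have in': "t \<in> B \<and> norm (fderiv e t 1) \<le> \<bar>K\<bar> * norm (e t)" if "t \<in> cball t0 \<rho>" for t
  proof -
    have "dist t t0 < d" using that d(1) by (simp add: \<rho>_def dist_commute)
    then have "t \<in> B \<and> norm (fderiv e t 1) \<le> K * norm (e t)" by (rule d(2))
    moreover have "K * norm (e t) \<le> \<bar>K\<bar> * norm (e t)" by (rule mult_right_mono) auto
    ultimately show ?thesis by linarith
  qed
  have hol: "holo e (cball t0 \<rho>)" using holo_subset[OF assms(1)] in' by blast
  have "continuous_on (cball t0 \<rho>) (\<lambda>t. norm (e t))"
    by (intro continuous_on_norm holo_continuous_on hol)
  \<comment> \<open>At a maximum point \<open>s\<close> of the norm the mean value bound gives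
    \<open>norm (e s) \<le> 1 / 2 * norm (e s)\<close>, so \<open>e\<close> vanishes on the whole
    disc.\<close>
  then obtain s where s: "s \<in> cball t0 \<rho>" "\<And>t. t \<in> cball t0 \<rho> \<Longrightarrow> norm (e t) \<le> norm (e s)"
    using continuous_attains_sup[of "cball t0 \<rho>" "\<lambda>t. norm (e t)"] \<rho> by auto
  have "norm (e s - e t0) \<le> (\<bar>K\<bar> * norm (e s)) * norm (s - t0)"
  proof (rule holo_lipschitz[OF convex_cball hol])
    fix t h assume t: "t \<in> cball t0 \<rho>"
    have "fderiv e t h = h *\<^sub>C fderiv e t 1"
      using clinear_scaleC_D[OF holo_clinear[OF hol t], of h 1] by simp
    then have "norm (fderiv e t h) = norm h * norm (fderiv e t 1)" by (simp add: norm_scaleC)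
    also have "\<dots> \<le> norm h * (\<bar>K\<bar> * norm (e s))"
    proof (rule mult_left_mono)
      have "norm (fderiv e t 1) \<le> \<bar>K\<bar> * norm (e t)" using in'[OF t] by simp
      also have "\<dots> \<le> \<bar>K\<bar> * norm (e s)" using s(2)[OF t] by (intro mult_left_mono) auto
      finally show "norm (fderiv e t 1) \<le> \<bar>K\<bar> * norm (e s)" .
    qed simp
    finally show "norm (fderiv e t h) \<le> \<bar>K\<bar> * norm (e s) * norm h" by (simp add: mult_ac)
  qed (use s \<rho> in auto)
  also have "\<dots> \<le> (\<bar>K\<bar> * norm (e s)) * \<rho>"
    using s(1) by (intro mult_left_mono) (auto simp: dist_norm norm_minus_commute)
  also have "\<dots> = (\<bar>K\<bar> * \<rho>) * norm (e s)" by simp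
  also have "\<dots> \<le> 1 / 2 * norm (e s)" by (rule mult_right_mono[OF K\<rho>]) simp
  finally have "norm (e s) \<le> 0" using assms(5) by simp
  then have "e t = 0" if "t \<in> cball t0 \<rho>" for t using s(2)[OF that] by simp
  then show "\<forall>\<^sub>F t in nhds t0. e t = 0"
    unfolding eventually_nhds_metric using \<rho> by (intro exI[of _ \<rho>]) (auto simp: dist_commute)
qed

lemma holo_cong:
  assumes "holo f S" "open S" "\<And>z. z \<in> S \<Longrightarrow> f z = g z"
  shows "holo g S" and "z \<in> S \<Longrightarrow> fderiv g z = fderiv f z"
proof -
  have *: "(g has_derivative fderiv f z) (at z)" if "z \<in> S" for z
    by (rule has_derivative_transform_within_open[OF holo_has_derivative[OF assms(1) that] assms(2) that])
       (use assms(3) in auto)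
  show "holo g S" by (rule holoI'[OF * holo_clinear[OF assms(1)]])
  show "z \<in> S \<Longrightarrow> fderiv g z = fderiv f z" by (rule fderiv_eqI[OF *])
qed

lemma holo_tendsto_nhds: "holo f S \<Longrightarrow> z \<in> S \<Longrightarrow> (f \<longlongrightarrow> f z) (nhds z)"
  using holo_isCont[of f S z] unfolding isCont_def tendsto_at_iff_tendsto_nhds[of f z] by blast

section \<open>Flows and the Frobenius theorem\<close>

text \<open>The primitive vanishing at time 0 is \<open>t\<close> times the integral of
  \<open>g\<close> at \<open>(s * t, q)\<close> over the real \<open>s\<close> in the unit interval.
  Since the interval of integration is fixed, the Leibniz rule applies to \<open>t\<close> and
  \<open>q\<close> together and gives joint holomorphy.\<close>

lemma holo_primitive:
  fixes g :: "complex \<times> 'a::cspace \<Rightarrow> 'b::cspace"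
  assumes g: "holo g (ball 0 \<delta> \<times> B)" and B: "open B"
  obtains G where "holo G (ball 0 \<delta> \<times> B)" "\<And>q. q \<in> B \<Longrightarrow> G (0, q) = 0"
    "\<And>t q. t \<in> ball 0 \<delta> \<Longrightarrow> q \<in> B \<Longrightarrow> fderiv G (t, q) (1, 0) = g (t, q)"
proof -
  let ?P = "ball (0::complex) \<delta> \<times> B"
  have oP: "open ?P" by (intro open_Times open_ball B)
  define f where "f x s = g (s *\<^sub>R fst x, snd x)" for x :: "complex \<times> 'a" and s :: real
  define D where "D x s v = fderiv g (s *\<^sub>R fst x, snd x) (s *\<^sub>R fst v, snd v)" for x :: "complex \<times> 'a" and s :: real and v :: "complex \<times> 'a"
  define I where "I x = integral (cbox 0 1) (f x)" for x
  have inP: "(s *\<^sub>R fst x, snd x) \<in> ?P" if "x \<in> ?P" "s \<in> cbox 0 1" for x :: "complex \<times> 'a" and s :: real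
  proof -
    have "\<bar>s\<bar> * norm (fst x) \<le> 1 * norm (fst x)" using that(2) by (intro mult_right_mono) auto
    then show ?thesis using that(1) by auto
  qed
  have lin: "clinear (\<lambda>v::complex \<times> 'a. (s *\<^sub>R fst v, snd v))" for s :: real
    using clinear_Pair[OF clinear_scaleC[OF clinear_fst] clinear_snd, of "complex_of_real s"] unfolding scaleC_of_real .
  have Dcl: "clinear (D x s)" if "x \<in> ?P" "s \<in> cbox 0 1" for x s
    unfolding D_def by (rule clinear_compose[OF holo_clinear[OF g inP[OF that]] lin])
  have fD: "((\<lambda>x. f x s) has_derivative D x s) (at x)" if "x \<in> ?P" "s \<in> cbox 0 1" for x s
    unfolding f_def D_def
    by (rule has_derivative_compose[OF has_derivative_clinear[OF lin] holo_has_derivative[OF g inP[OF that]]])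
  have cont_f: "continuous_on (cbox 0 1) (f x)" if "x \<in> ?P" for x
    unfolding f_def
    by (rule continuous_on_compose2[OF holo_continuous_on[OF g]]) (use inP[OF that] in \<open>auto intro!: continuous_intros\<close>)
  have cont_D: "continuous_on (?P \<times> cbox 0 1) (\<lambda>(x, s). D x s v)" for v
  proof -
    have "continuous_on (?P \<times> cbox 0 1) (\<lambda>y. (\<lambda>(z, v). fderiv g z v) ((snd y *\<^sub>R fst (fst y), snd (fst y)), (snd y *\<^sub>R fst v, snd v)))"
      by (rule continuous_on_compose2[OF holo_continuous_on[OF holo_fderiv_joint[OF oP g]]])
         (use inP in \<open>auto intro!: continuous_intros\<close>)
    then show ?thesis by (simp add: D_def case_prod_unfold)
  qed
  have I: "\<exists>D'. (I has_derivative D') (at x0) \<and> clinear D' \<and> (\<forall>v. D' v = integral (cbox 0 1) (\<lambda>s. D x0 s v))" if x0: "x0 \<in> ?P" for x0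
  proof -
    obtain e where e: "e > 0" "ball x0 e \<subseteq> ?P" using oP x0 open_contains_ball by blast
    have x0e: "x0 \<in> ball x0 e" using e by simp
    \<comment> \<open>The Leibniz rule needs the differential as a continuous family of bounded
      linear maps; its continuity is checked on one direction at a time.\<close>
    define fx where "fx x s = Blinfun (D x s)" for x s
    have fx: "blinfun_apply (fx x s) = D x s" if "x \<in> ?P" "s \<in> cbox 0 1" for x s
      unfolding fx_def using Dcl[OF that] by (simp add: clinear_def bounded_linear_Blinfun_apply)
    have cfx: "continuous_on (ball x0 e \<times> cbox 0 1) (\<lambda>(x, s). fx x s)"
    proof (rule continuous_on_blinfun_componentwise)
      fix i :: "complex \<times> 'a"
      have "continuous_on (ball x0 e \<times> cbox 0 1) (\<lambda>(x, s). D x s i)"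
        by (rule continuous_on_subset[OF cont_D]) (use e in auto)
      then show "continuous_on (ball x0 e \<times> cbox 0 1) (\<lambda>x. blinfun_apply (case x of (x, s) \<Rightarrow> fx x s) i)"
        by (rule continuous_on_eq) (use e fx in auto)
    qed
    have "((\<lambda>x. integral (cbox 0 1) (f x)) has_derivative integral (cbox 0 1) (fx x0)) (at x0 within ball x0 e)"
    proof (rule leibniz_rule[OF _ _ cfx x0e convex_ball])
      fix x s assume "x \<in> ball x0 e" "s \<in> cbox (0::real) 1"
      then show "((\<lambda>x. f x s) has_derivative blinfun_apply (fx x s)) (at x within ball x0 e)"
        using e fx fD by (metis has_derivative_at_withinI subsetD)
    next
      fix x assume "x \<in> ball x0 e"
      then show "f x integrable_on cbox 0 1" using e cont_f by (intro integrable_continuous) auto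
    qed
    then have 1: "(I has_derivative integral (cbox 0 1) (fx x0)) (at x0)"
      unfolding at_within_open[OF x0e open_ball] by (simp add: I_def[abs_def])
    have int: "fx x0 integrable_on cbox 0 1"
    proof (rule integrable_continuous)
      show "continuous_on (cbox 0 1) (fx x0)"
        using continuous_on_compose2[OF cfx continuous_on_Pair[OF continuous_on_const[of _ x0] continuous_on_id]] x0e
        by (simp add: image_subset_iff)
    qed
    have 2: "blinfun_apply (integral (cbox 0 1) (fx x0)) v = integral (cbox 0 1) (\<lambda>s. D x0 s v)" for v
      unfolding blinfun_apply_integral[OF int]
      by (rule Henstock_Kurzweil_Integration.integral_cong) (use fx x0 in auto)
    have intD: "(\<lambda>s. D x0 s v) integrable_on cbox 0 1" for v
    proof (rule integrable_continuous)
      show "continuous_on (cbox 0 1) (\<lambda>s. D x0 s v)"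
        using continuous_on_compose2[OF cont_D[of v] continuous_on_Pair[OF continuous_on_const[of _ x0] continuous_on_id]] x0
        by (simp add: image_subset_iff)
    qed
    have "integral (cbox 0 1) (\<lambda>s. D x0 s (c *\<^sub>C v)) = c *\<^sub>C integral (cbox 0 1) (\<lambda>s. D x0 s v)" for c v
    proof -
      have "integral (cbox 0 1) (\<lambda>s. D x0 s (c *\<^sub>C v)) = integral (cbox 0 1) ((\<lambda>w. c *\<^sub>C w) \<circ> (\<lambda>s. D x0 s v))"
        by (rule Henstock_Kurzweil_Integration.integral_cong) (use clinear_scaleC_D[OF Dcl[OF x0]] in simp)
      also have "\<dots> = c *\<^sub>C integral (cbox 0 1) (\<lambda>s. D x0 s v)"
        by (rule integral_linear[OF intD clinear_bounded_linear[OF clinear_scaleC[OF clinear_id]]])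
      finally show ?thesis .
    qed
    then have "clinear (blinfun_apply (integral (cbox 0 1) (fx x0)))"
      unfolding clinear_def by (intro conjI allI blinfun.bounded_linear_right) (simp only: 2)
    with 1 2 show ?thesis by blast
  qed
  have Ih: "holo I ?P" by (rule holoI) (use I in blast)
  have Idd: "fderiv I x v = integral (cbox 0 1) (\<lambda>s. D x s v)" if "x \<in> ?P" for x v
    using I[OF that] fderiv_eqI by metis
  define G where "G x = fst x *\<^sub>C I x" for x
  show ?thesis
  proof (rule that[of G])
    show Gh: "holo G ?P" unfolding G_def by (intro holo_scaleC(1) holo_clinear_map clinear_fst Ih)
    show "G (0, q) = 0" for q by (simp add: G_def)
    fix t :: complex and q assume tq: "t \<in> ball 0 \<delta>" "q \<in> B"
    then have x: "(t, q) \<in> ?P" by simp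
    have "fderiv G (t, q) (1, 0) = I (t, q) + t *\<^sub>C integral (cbox 0 1) (\<lambda>s. D (t, q) s (1, 0))"
      unfolding G_def using holo_scaleC(2)[OF holo_clinear_map[OF clinear_fst] Ih x, of "(1, 0)"]
      by (simp add: fderiv_clinear[OF clinear_fst] Idd[OF x])
    also have "\<dots> = integral (cbox 0 1) (\<lambda>s. f (t, q) s + t *\<^sub>C D (t, q) s (1, 0))"
    proof -
      have i1: "f (t, q) integrable_on cbox 0 1" by (rule integrable_continuous[OF cont_f[OF x]])
      have i2: "(\<lambda>s. D (t, q) s (1, 0)) integrable_on cbox 0 1"
      proof (rule integrable_continuous)
        show "continuous_on (cbox 0 1) (\<lambda>s. D (t, q) s (1, 0))"
          using continuous_on_compose2[OF cont_D[of "(1, 0)"] continuous_on_Pair[OF continuous_on_const[of _ "(t, q)"] continuous_on_id]] x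
          by (simp add: image_subset_iff)
      qed
      have bl: "bounded_linear (\<lambda>w::'b. t *\<^sub>C w)" by (rule clinear_bounded_linear[OF clinear_scaleC[OF clinear_id]])
      have "t *\<^sub>C integral (cbox 0 1) (\<lambda>s. D (t, q) s (1, 0)) = integral (cbox 0 1) (\<lambda>s. t *\<^sub>C D (t, q) s (1, 0))"
        using integral_linear[OF i2 bl] by (simp add: o_def)
      moreover have "(\<lambda>s. t *\<^sub>C D (t, q) s (1, 0)) integrable_on cbox 0 1"
        using integrable_linear[OF i2 bl] by (simp add: o_def)
      ultimately show ?thesis unfolding I_def using integral_add[OF i1, of "\<lambda>s. t *\<^sub>C D (t, q) s (1, 0)"] by simp
    qed
    also have "\<dots> = g (t, q)"
    proof -
      \<comment> \<open>The integrand is the derivative in \<open>s\<close> of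
        \<open>s *\<^sub>R f (t, q) s\<close>.\<close>
      have "((\<lambda>s. f (t, q) s + t *\<^sub>C D (t, q) s (1, 0)) has_integral (1 *\<^sub>R f (t, q) 1 - 0 *\<^sub>R f (t, q) 0)) {0..1}"
      proof (rule fundamental_theorem_of_calculus)
        fix s :: real assume s: "s \<in> {0..1}"
        then have s': "s \<in> cbox 0 1" by simp
        have sP: "(s *\<^sub>R t, q) \<in> ?P" using inP[OF x s'] by simp
        have cl: "clinear (fderiv g (s *\<^sub>R t, q))" by (rule holo_clinear[OF g sP])
        have "((\<lambda>s::real. (s *\<^sub>R t, q)) has_derivative (\<lambda>h. (h *\<^sub>R t, 0))) (at s)"
          by (intro has_derivative_Pair has_derivative_const has_derivative_scaleR_left has_derivative_ident)
        from has_derivative_compose[OF this holo_has_derivative[OF g sP]]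
        have "((\<lambda>s. f (t, q) s) has_derivative (\<lambda>h. fderiv g (s *\<^sub>R t, q) (h *\<^sub>R t, 0))) (at s)" by (simp add: f_def)
        from has_derivative_scaleR[OF has_derivative_ident this]
        have "((\<lambda>s. s *\<^sub>R f (t, q) s) has_derivative (\<lambda>h. s *\<^sub>R fderiv g (s *\<^sub>R t, q) (h *\<^sub>R t, 0) + h *\<^sub>R f (t, q) s)) (at s)" .
        moreover have "s *\<^sub>R fderiv g (s *\<^sub>R t, q) (h *\<^sub>R t, 0) = h *\<^sub>R (t *\<^sub>C D (t, q) s (1, 0))" for h
        proof -
          have c: "fderiv g (s *\<^sub>R t, q) (c, 0) = c *\<^sub>C fderiv g (s *\<^sub>R t, q) (1, 0)" for c
            using clinear_scaleC_D[OF cl, of c "(1, 0)"] by simp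
          have "fderiv g (s *\<^sub>R t, q) (h *\<^sub>R t, 0) = (of_real h * t) *\<^sub>C fderiv g (s *\<^sub>R t, q) (1, 0)"
            unfolding c[of "h *\<^sub>R t"] by (simp add: scaleR_conv_of_real)
          moreover have "D (t, q) s (1, 0) = of_real s *\<^sub>C fderiv g (s *\<^sub>R t, q) (1, 0)"
            using c[of "s *\<^sub>R 1"] by (simp add: D_def scaleR_conv_of_real)
          ultimately show ?thesis
            by (simp add: scaleC_scaleC mult_ac flip: scaleC_of_real)
        qed
        ultimately have "((\<lambda>s. s *\<^sub>R f (t, q) s) has_derivative (\<lambda>h. h *\<^sub>R (f (t, q) s + t *\<^sub>C D (t, q) s (1, 0)))) (at s)"
          by (simp add: scaleR_add_right add.commute)
        then show "((\<lambda>s. s *\<^sub>R f (t, q) s) has_vector_derivative (f (t, q) s + t *\<^sub>C D (t, q) s (1, 0))) (at s within {0..1})"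
          unfolding has_vector_derivative_def by (rule has_derivative_at_withinI)
      qed simp
      then show ?thesis by (simp add: integral_unique f_def)
    qed
    finally show "fderiv G (t, q) (1, 0) = g (t, q)" .
  qed
qed

lemma holo_time_bound:
  fixes \<psi> :: "complex \<times> 'a::cspace \<Rightarrow> 'b::cspace"
  assumes "holo \<psi> (ball 0 \<delta> \<times> B)" "q \<in> B" "t \<in> ball 0 \<delta>" "0 \<le> M"
    "\<And>s. s \<in> ball 0 \<delta> \<Longrightarrow> norm (fderiv \<psi> (s, q) (1, 0)) \<le> M"
  shows "norm (\<psi> (t, q) - \<psi> (0, q)) \<le> M * norm t"
proof -
  have h: "holo (\<lambda>s. \<psi> (s, q)) (ball 0 \<delta>)" by (rule holo_slice1(1)[OF assms(1,2)])
  have "0 < \<delta>" using assms(3) by (metis ball_eq_empty empty_iff linorder_not_less)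
  have "norm (\<psi> (t, q) - \<psi> (0, q)) \<le> M * norm (t - 0)"
  proof (rule holo_lipschitz[OF convex_ball h _ assms(4,3)])
    fix s v :: complex assume s: "s \<in> ball 0 \<delta>"
    have "fderiv (\<lambda>s. \<psi> (s, q)) s v = v *\<^sub>C fderiv (\<lambda>s. \<psi> (s, q)) s 1"
      using clinear_scaleC_D[OF holo_clinear[OF h s], of v 1] by simp
    then have "norm (fderiv (\<lambda>s. \<psi> (s, q)) s v) = norm v * norm (fderiv \<psi> (s, q) (1, 0))"
      using holo_slice1(2)[OF assms(1,2) s, of 1] by (simp add: norm_scaleC)
    also have "\<dots> \<le> norm v * M" by (rule mult_left_mono[OF assms(5)[OF s]]) simp
    finally show "norm (fderiv (\<lambda>s. \<psi> (s, q)) s v) \<le> M * norm v" by (simp add: mult.commute)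
  qed (use \<open>0 < \<delta>\<close> in simp)
  then show ?thesis by simp
qed

text \<open>Picard iteration, where each iterate is \<open>q\<close> plus the primitive in time of
  \<open>Z\<close> along the previous one. The iterates are holomorphic in time and initial point
  together, and this survives the uniform limit.\<close>

lemma flow_exists:
  fixes Z :: "'a::cspace \<Rightarrow> 'a"
  assumes U: "open U" "a \<in> U" and Z: "holo Z U"
  obtains \<delta> r \<Phi> where "0 < \<delta>" "0 < r" "ball a r \<subseteq> U" "holo \<Phi> (ball (0::complex) \<delta> \<times> ball a r)"
    "\<And>q. q \<in> ball a r \<Longrightarrow> \<Phi> (0, q) = q"
    "\<And>t q. t \<in> ball 0 \<delta> \<Longrightarrow> q \<in> ball a r \<Longrightarrow> \<Phi> (t, q) \<in> U \<and> fderiv \<Phi> (t, q) (1, 0) = Z (\<Phi> (t, q))"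
proof -
  obtain R K where R: "R > 0" "K > 0" "cball a R \<subseteq> U" "\<And>w. w \<in> cball a R \<Longrightarrow> norm (Z w) \<le> K"
    "\<And>w w'. w \<in> cball a R \<Longrightarrow> w' \<in> cball a R \<Longrightarrow> norm (Z w - Z w') \<le> K * norm (w - w')"
    by (rule loc_bounds[OF U Z]) (rule that)
  define r where "r = R / 2"
  \<comment> \<open>The first bound keeps iterates that start within \<open>R / 2\<close> of
    \<open>a\<close> inside \<open>cball a R\<close>; the second makes consecutive differences
    shrink by the factor 1/2.\<close>
  define \<delta> where "\<delta> = min (R / (2 * K)) (1 / (2 * K))"
  have r: "r > 0" and d: "\<delta> > 0" using R by (auto simp: r_def \<delta>_def)
  have dK: "K * norm t \<le> R / 2" "K * norm t \<le> 1 / 2" if "t \<in> ball 0 \<delta>" for t :: complex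
  proof -
    have "norm t \<le> R / (2 * K)" "norm t \<le> 1 / (2 * K)" using that by (auto simp: \<delta>_def)
    then show "K * norm t \<le> R / 2" "K * norm t \<le> 1 / 2" using R(2) by (auto simp: field_simps)
  qed
  let ?P = "ball (0::complex) \<delta> \<times> ball a r"
  define Inv where "Inv \<phi> \<longleftrightarrow> holo \<phi> ?P \<and> (\<forall>x\<in>?P. \<phi> x \<in> cball a R) \<and> (\<forall>q\<in>ball a r. \<phi> (0, q) = q)" for \<phi> :: "complex \<times> 'a \<Rightarrow> 'a"
  define Nxt where "Nxt \<phi> \<psi> \<longleftrightarrow> (\<forall>x\<in>?P. fderiv \<psi> x (1, 0) = Z (\<phi> x))" for \<phi> \<psi> :: "complex \<times> 'a \<Rightarrow> 'a"
  \<comment> \<open>The next iterate is only known to exist, so the sequence is obtained by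
    dependent choice under the invariant \<open>Inv\<close>.\<close>
  have "\<exists>\<phi>. \<forall>n. Inv (\<phi> n) \<and> Nxt (\<phi> n) (\<phi> (Suc n))"
  proof (rule dependent_nat_choice)
    show "\<exists>\<phi>. Inv \<phi>"
      unfolding Inv_def using R(1) by (intro exI[of _ snd]) (auto simp: r_def intro!: holo_clinear_map clinear_snd)
    fix \<phi> and n :: nat assume I: "Inv \<phi>"
    have Z\<phi>: "holo (\<lambda>x. Z (\<phi> x)) ?P"
      by (rule holo_compose[OF Z]) (use I R(3) in \<open>auto simp: Inv_def\<close>)
    obtain G where G: "holo G ?P" "\<And>q. q \<in> ball a r \<Longrightarrow> G (0, q) = 0"
      "\<And>t q. t \<in> ball 0 \<delta> \<Longrightarrow> q \<in> ball a r \<Longrightarrow> fderiv G (t, q) (1, 0) = Z (\<phi> (t, q))"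
      by (rule holo_primitive[OF Z\<phi> open_ball]) (rule that)
    define \<psi> where "\<psi> x = snd x + G x" for x
    have h: "holo \<psi> ?P" unfolding \<psi>_def by (intro holo_add holo_clinear_map clinear_snd G(1))
    have N: "fderiv \<psi> x (1, 0) = Z (\<phi> x)" if "x \<in> ?P" for x
      unfolding \<psi>_def using that G(3)[of "fst x" "snd x"]
      by (subst fderiv_add[OF holo_clinear_map[OF clinear_snd] G(1) that]) (auto simp: fderiv_clinear[OF clinear_snd])
    have z: "\<psi> (0, q) = q" if "q \<in> ball a r" for q using G(2)[OF that] by (simp add: \<psi>_def)
    have "\<psi> (t, q) \<in> cball a R" if tq: "t \<in> ball 0 \<delta>" "q \<in> ball a r" for t q
    proof -
      have "norm (\<psi> (t, q) - \<psi> (0, q)) \<le> K * norm t"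
        by (rule holo_time_bound[OF h tq(2,1)]) (use R(2,4) I tq N in \<open>auto simp: Inv_def\<close>)
      also have "\<dots> \<le> R / 2" by (rule dK[OF tq(1)])
      finally have "dist (\<psi> (t, q)) q \<le> R / 2" using z[OF tq(2)] by (simp add: dist_norm)
      moreover have "dist a q < R / 2" using tq(2) by (simp add: r_def)
      ultimately show ?thesis using dist_triangle2[of a "\<psi> (t, q)" q] by (simp add: dist_commute)
    qed
    then show "\<exists>\<psi>. Inv \<psi> \<and> Nxt \<phi> \<psi>"
      using h N z by (intro exI[of _ \<psi>]) (auto simp: Inv_def Nxt_def)
  qed
  then obtain \<phi> where \<phi>: "\<And>n. Inv (\<phi> n)" "\<And>n x. x \<in> ?P \<Longrightarrow> fderiv (\<phi> (Suc n)) x (1, 0) = Z (\<phi> n x)"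
    unfolding Nxt_def by blast
  have h\<phi>: "holo (\<phi> n) ?P" and c\<phi>: "\<And>x. x \<in> ?P \<Longrightarrow> \<phi> n x \<in> cball a R" and z\<phi>: "\<And>q. q \<in> ball a r \<Longrightarrow> \<phi> n (0, q) = q" for n
    using \<phi>(1)[of n] by (auto simp: Inv_def)
  have diff: "norm (\<phi> (Suc n) x - \<phi> n x) \<le> 2 * R * (1 / 2) ^ n" if "x \<in> ?P" for n x
    using that
  proof (induction n arbitrary: x)
    case 0
    have "dist a (\<phi> (Suc 0) x) \<le> R" "dist a (\<phi> 0 x) \<le> R" using c\<phi>[OF 0] by auto
    then show ?case using dist_triangle3[of "\<phi> (Suc 0) x" "\<phi> 0 x" a] by (simp add: dist_norm)
  next
    case (Suc n)
    obtain t q where x: "x = (t, q)" "t \<in> ball 0 \<delta>" "q \<in> ball a r" using Suc.prems by auto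
    let ?c = "2 * R * (1 / 2) ^ n"
    have hd: "holo (\<lambda>x. \<phi> (Suc (Suc n)) x - \<phi> (Suc n) x) ?P" by (intro holo_diff h\<phi>)
    have "norm ((\<phi> (Suc (Suc n)) (t, q) - \<phi> (Suc n) (t, q)) - (\<phi> (Suc (Suc n)) (0, q) - \<phi> (Suc n) (0, q))) \<le> (K * ?c) * norm t"
    proof (rule holo_time_bound[OF hd x(3,2)])
      show "0 \<le> K * ?c" using R by simp
      fix s :: complex assume s: "s \<in> ball 0 \<delta>"
      then have P: "(s, q) \<in> ?P" using x(3) by simp
      have "fderiv (\<lambda>x. \<phi> (Suc (Suc n)) x - \<phi> (Suc n) x) (s, q) (1, 0) = Z (\<phi> (Suc n) (s, q)) - Z (\<phi> n (s, q))"
        using fderiv_diff[OF h\<phi> h\<phi> P] \<phi>(2)[OF P] by simp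
      also have "norm \<dots> \<le> K * norm (\<phi> (Suc n) (s, q) - \<phi> n (s, q))"
        by (rule R(5)) (use c\<phi>[OF P] in auto)
      also have "\<dots> \<le> K * ?c" using Suc.IH[OF P] R(2) by (intro mult_left_mono) auto
      finally show "norm (fderiv (\<lambda>x. \<phi> (Suc (Suc n)) x - \<phi> (Suc n) x) (s, q) (1, 0)) \<le> K * ?c" .
    qed
    also have "(K * ?c) * norm t = (K * norm t) * ?c" by simp
    also have "\<dots> \<le> 1 / 2 * ?c" using dK(2)[OF x(2)] R(1) by (intro mult_right_mono) auto
    finally show ?case using z\<phi>[OF x(3)] by (simp add: x(1))
  qed
  define \<Phi> where "\<Phi> x = \<phi> 0 x + (\<Sum>n. \<phi> (Suc n) x - \<phi> n x)" for x
  have "uniform_limit ?P (\<lambda>n x. \<Sum>i<n. \<phi> (Suc i) x - \<phi> i x) (\<lambda>x. \<Sum>i. \<phi> (Suc i) x - \<phi> i x) sequentially"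
  proof (rule Weierstrass_m_test[OF diff])
    show "summable (\<lambda>n. 2 * R * (1 / 2) ^ n)" by (intro summable_mult summable_geometric) auto
  qed
  then have "uniform_limit ?P (\<lambda>n x. \<phi> 0 x + (\<Sum>i<n. \<phi> (Suc i) x - \<phi> i x)) \<Phi> sequentially"
    unfolding \<Phi>_def by (intro uniform_limit_add uniform_limit_const)
  moreover have "\<phi> 0 x + (\<Sum>i<n. \<phi> (Suc i) x - \<phi> i x) = \<phi> n x" for n x
    using sum_lessThan_telescope[of "\<lambda>i. \<phi> i x" n] by simp
  ultimately have ul: "uniform_limit ?P \<phi> \<Phi> sequentially" by simp
  have L: "loc_lim \<phi> \<Phi> ?P"
    unfolding loc_lim_def
  proof
    fix x assume "x \<in> ?P"
    then obtain e where "e > 0" "ball x e \<subseteq> ?P"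
      using open_Times[OF open_ball[of "0::complex" \<delta>] open_ball[of a r]] open_contains_ball by blast
    then show "\<exists>e>0. (\<forall>\<^sub>F n in sequentially. holo (\<phi> n) (ball x e)) \<and> uniform_limit (ball x e) \<phi> \<Phi> sequentially"
      using holo_subset[OF h\<phi>] uniform_limit_on_subset[OF ul]
      by (intro exI[of _ e] conjI always_eventually allI) auto
  qed
  have pw: "(\<lambda>n. \<phi> n x) \<longlonglongrightarrow> \<Phi> x" if "x \<in> ?P" for x
    by (rule tendsto_uniform_limitI[OF ul that])
  have cb: "\<Phi> x \<in> cball a R" if "x \<in> ?P" for x
    by (rule Lim_in_closed_set[OF closed_cball _ _ pw[OF that]]) (use c\<phi>[OF that] in auto)
  show ?thesis
  proof (rule that[OF d r])
    show "ball a r \<subseteq> U" using R(1,3) by (auto simp: r_def subset_iff)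
    show "holo \<Phi> ?P" by (rule loc_lim_holo[OF L])
    show "\<Phi> (0, q) = q" if "q \<in> ball a r" for q
      using z\<phi>[OF that] by (simp add: \<Phi>_def)
    fix t :: complex and q assume "t \<in> ball 0 \<delta>" "q \<in> ball a r"
    then have x: "(t, q) \<in> ?P" by simp
    have "(\<lambda>n. fderiv (\<phi> (Suc n)) (t, q) (1, 0)) \<longlonglongrightarrow> fderiv \<Phi> (t, q) (1, 0)"
      by (rule LIMSEQ_Suc[OF loc_lim_fderiv_tendsto[OF L x tendsto_const]])
    then have 1: "(\<lambda>n. Z (\<phi> n (t, q))) \<longlonglongrightarrow> fderiv \<Phi> (t, q) (1, 0)" by (simp add: \<phi>(2)[OF x])
    have "isCont Z (\<Phi> (t, q))" by (rule holo_isCont[OF Z]) (use cb[OF x] R(3) in blast)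
    then have "(\<lambda>n. Z (\<phi> n (t, q))) \<longlonglongrightarrow> Z (\<Phi> (t, q))" by (rule isCont_tendsto_compose[OF _ pw[OF x]])
    with 1 show "\<Phi> (t, q) \<in> U \<and> fderiv \<Phi> (t, q) (1, 0) = Z (\<Phi> (t, q))"
      using LIMSEQ_unique cb[OF x] R(3) by blast
  qed
qed

text \<open>Near \<open>t0\<close> a Lipschitz bound for \<open>Z\<close> gives Gronwall's
  inequality for the difference of the curves. No Lipschitz bound along the whole curves is
  required, since \<open>holo_gronwall_zero\<close> continues the zero analytically.\<close>

lemma flow_unique:
  fixes c1 c2 :: "complex \<Rightarrow> 'a::cspace"
  assumes "open U" "holo Z U" "open B" "connected B" "holo c1 B" "holo c2 B"
    "\<And>t. t \<in> B \<Longrightarrow> c1 t \<in> U \<and> fderiv c1 t 1 = Z (c1 t)"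
    "\<And>t. t \<in> B \<Longrightarrow> c2 t \<in> U \<and> fderiv c2 t 1 = Z (c2 t)"
    "t0 \<in> B" "c1 t0 = c2 t0" "t \<in> B"
  shows "c1 t = c2 t"
proof -
  have U0: "c1 t0 \<in> U" using assms by blast
  obtain r K where r: "r > 0" "K > 0" "cball (c1 t0) r \<subseteq> U"
    "\<And>w w'. w \<in> cball (c1 t0) r \<Longrightarrow> w' \<in> cball (c1 t0) r \<Longrightarrow> norm (Z w - Z w') \<le> K * norm (w - w')"
    by (rule loc_bounds[OF assms(1) U0 assms(2)]) (rule that)
  have near: "\<forall>\<^sub>F t in nhds t0. c t \<in> ball (c1 t0) r" if "holo c B" "c t0 = c1 t0" for c
  proof -
    have "(c \<longlongrightarrow> c t0) (nhds t0)"
      by (rule holo_tendsto_nhds[OF that(1) assms(9)])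
    from topological_tendstoD[OF this open_ball] show ?thesis using r(1) that(2) by simp
  qed
  have "c1 t - c2 t = 0"
  proof (rule holo_gronwall_zero[OF holo_diff[OF assms(5,6)] assms(3,4,9) _ _ assms(11)])
    show "\<forall>\<^sub>F t in nhds t0. norm (fderiv (\<lambda>t. c1 t - c2 t) t 1) \<le> K * norm (c1 t - c2 t)"
      using near[OF assms(5) refl] near[OF assms(6) assms(10)[symmetric]] eventually_nhds_in_open[OF assms(3,9)]
    proof eventually_elim
      case (elim t)
      have "norm (Z (c1 t) - Z (c2 t)) \<le> K * norm (c1 t - c2 t)"
        by (rule r(4)) (use elim in auto)
      then show ?case using assms(7,8)[OF elim(3)] fderiv_diff[OF assms(5,6) elim(3)] by simp
    qed
  qed (use assms in simp)
  then show ?thesis by simp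
qed

text \<open>The equation is integrated along the rays from \<open>x1\<close>. The direction
  \<open>\<xi>\<close> of a ray is carried as a constant component of the flow, so holomorphic
  dependence on \<open>\<xi>\<close> comes with the flow; the point \<open>x\<close> is then reached
  at a fixed time with a direction proportional to \<open>x - x1\<close>. Integrability enters for
  the derivatives across the rays.\<close>

lemma frobenius_local_solution:
  fixes H :: "'x::cspace \<times> 'y::cspace \<Rightarrow> 'x \<Rightarrow> 'y"
  assumes \<Omega>: "open \<Omega>" "(x1, y1) \<in> \<Omega>"
    and H: "holo (\<lambda>(z, v). H z v) (\<Omega> \<times> UNIV)" and lin: "\<And>z. z \<in> \<Omega> \<Longrightarrow> clinear (H z)"
    and int: "\<And>z v w. z \<in> \<Omega> \<Longrightarrow> fderiv (\<lambda>z. H z w) z (v, H z v) = fderiv (\<lambda>z. H z v) z (w, H z w)"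
  obtains r Y where "0 < r" "holo Y (ball x1 r)" "Y x1 = y1"
    "\<And>x. x \<in> ball x1 r \<Longrightarrow> (x, Y x) \<in> \<Omega> \<and> (\<forall>v. fderiv Y x v = H (x, Y x) v)"
proof -
  define J where "J = (\<lambda>(z, v). H z v)"
  have J: "holo J (\<Omega> \<times> UNIV)" and J': "\<And>z v. J (z, v) = H z v" using H by (simp_all add: J_def)
  have linJ: "clinear (\<lambda>v. J (z, v))" if "z \<in> \<Omega>" for z using lin[OF that] by (simp add: J')
  \<comment> \<open>The state is \<open>((x, y), \<xi>)\<close>: \<open>x\<close> moves with
    velocity \<open>\<xi>\<close>, \<open>y\<close> with velocity \<open>H (x, y) \<xi>\<close>, and
    \<open>\<xi>\<close> rests.\<close>
  define Z where "Z s = ((snd s, J s), 0 :: 'x)" for s :: "('x \<times> 'y) \<times> 'x"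
  have hZ: "holo Z (\<Omega> \<times> UNIV)" unfolding Z_def
    by (intro holo_Pair holo_clinear_map clinear_snd J holo_const)
  define a where "a = ((x1, y1), 0 :: 'x)"
  obtain \<delta> r \<Phi> where \<Phi>: "0 < \<delta>" "0 < r" "ball a r \<subseteq> \<Omega> \<times> UNIV" "holo \<Phi> (ball (0::complex) \<delta> \<times> ball a r)"
    "\<And>q. q \<in> ball a r \<Longrightarrow> \<Phi> (0, q) = q"
    "\<And>t q. t \<in> ball 0 \<delta> \<Longrightarrow> q \<in> ball a r \<Longrightarrow> \<Phi> (t, q) \<in> \<Omega> \<times> UNIV \<and> fderiv \<Phi> (t, q) (1, 0) = Z (\<Phi> (t, q))"
    by (rule flow_exists[OF _ _ hZ, of a]) (use \<Omega> in \<open>auto intro: open_Times simp: a_def\<close>)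
  let ?T = "ball (0::complex) \<delta>" let ?X = "ball (0::'x) r"
  define q where "q \<xi> = ((x1, y1), \<xi>)" for \<xi> :: 'x
  have q: "q \<xi> \<in> ball a r" if "\<xi> \<in> ?X" for \<xi> using that by (simp add: q_def a_def dist_Pair_Pair)
  define C where "C p = \<Phi> (fst p, q (snd p))" for p :: "complex \<times> 'x"
  have hC: "holo C (?T \<times> ?X)" unfolding C_def q_def
    by (rule holo_compose[OF \<Phi>(4) holo_Pair[OF holo_clinear_map[OF clinear_fst]
            holo_Pair[OF holo_const holo_clinear_map[OF clinear_snd]]]])
       (use q in \<open>auto simp: q_def\<close>)
  have C0: "C (0, \<xi>) = ((x1, y1), \<xi>)" if "\<xi> \<in> ?X" for \<xi>
    using \<Phi>(5)[OF q[OF that]] by (simp add: C_def q_def)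
  have C\<Omega>: "fst (C (t, \<xi>)) \<in> \<Omega>" and Ct: "fderiv C (t, \<xi>) (1, 0) = Z (C (t, \<xi>))" if "t \<in> ?T" "\<xi> \<in> ?X" for t \<xi>
  proof -
    show "fst (C (t, \<xi>)) \<in> \<Omega>" using \<Phi>(6)[OF that(1) q[OF that(2)]] by (auto simp: C_def)
    have "fderiv C (t, \<xi>) (1, 0) = fderiv (\<lambda>t. C (t, \<xi>)) t 1" using holo_slice1(2)[OF hC that(2,1)] by simp
    also have "\<dots> = fderiv \<Phi> (t, q \<xi>) (1, 0)"
      using holo_slice1(2)[OF \<Phi>(4) q[OF that(2)] that(1)] by (simp add: C_def)
    finally show "fderiv C (t, \<xi>) (1, 0) = Z (C (t, \<xi>))" using \<Phi>(6)[OF that(1) q[OF that(2)]] by (simp add: C_def)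
  qed
  have Csnd: "snd (C (t, \<xi>)) = \<xi>" if "t \<in> ?T" "\<xi> \<in> ?X" for t \<xi>
  proof -
    have h: "holo (\<lambda>p. snd (C p)) (?T \<times> ?X)" by (intro holo_snd hC)
    have "norm (snd (C (t, \<xi>)) - snd (C (0, \<xi>))) \<le> 0 * norm t"
      by (rule holo_time_bound[OF h that(2,1)]) (use Ct that in \<open>auto simp: fderiv_snd[OF hC] Z_def\<close>)
    then show ?thesis using C0[OF that(2)] by simp
  qed
  have Cx: "fst (fst (C (t, \<xi>))) = x1 + t *\<^sub>C \<xi>" if "t \<in> ?T" "\<xi> \<in> ?X" for t \<xi>
  proof -
    have hf: "holo (\<lambda>p. fst (fst (C p))) (?T \<times> ?X)" by (intro holo_fst hC)
    have hs: "holo (\<lambda>p. fst p *\<^sub>C snd p) (?T \<times> ?X)" by (intro holo_scaleC(1) holo_clinear_map clinear_fst clinear_snd)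
    have h: "holo (\<lambda>p. fst (fst (C p)) - fst p *\<^sub>C snd p) (?T \<times> ?X)" by (intro holo_diff hf hs)
    have z: "norm (fderiv (\<lambda>p. fst (fst (C p)) - fst p *\<^sub>C snd p) (s, \<xi>) (1, 0)) \<le> 0" if s: "s \<in> ?T" for s
    proof -
      have P: "(s, \<xi>) \<in> ?T \<times> ?X" using s \<open>\<xi> \<in> ?X\<close> by simp
      have "fderiv (\<lambda>p. fst (fst (C p))) (s, \<xi>) (1, 0) = \<xi>"
        using fderiv_fst[OF holo_fst[OF hC] P] fderiv_fst[OF hC P] Ct[OF s \<open>\<xi> \<in> ?X\<close>] Csnd[OF s \<open>\<xi> \<in> ?X\<close>] by (simp add: Z_def)
      moreover have "fderiv (\<lambda>p. fst p *\<^sub>C snd p) (s, \<xi>) (1, 0) = \<xi>"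
        using holo_scaleC(2)[OF holo_clinear_map[OF clinear_fst] holo_clinear_map[OF clinear_snd] P, of "(1, 0)"]
        by (simp add: fderiv_clinear clinear_fst clinear_snd)
      ultimately show ?thesis using fderiv_diff[OF hf hs P] by simp
    qed
    from holo_time_bound[OF h that(2,1) order_refl z]
    show ?thesis using C0[OF that(2)] by (simp add: algebra_simps)
  qed
  define y where "y p = snd (fst (C p))" for p
  have hy: "holo y (?T \<times> ?X)" unfolding y_def by (intro holo_fst holo_snd hC)
  define zz where "zz p = (x1 + fst p *\<^sub>C snd p, y p)" for p
  have zzC: "zz p = fst (C p)" if "p \<in> ?T \<times> ?X" for p
    using Cx[of "fst p" "snd p"] that by (auto simp: zz_def y_def prod_eq_iff)
  have zz\<Omega>: "zz p \<in> \<Omega>" if "p \<in> ?T \<times> ?X" for p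
    using zzC[OF that] C\<Omega>[of "fst p" "snd p"] that by auto
  have hzz: "holo zz (?T \<times> ?X)" unfolding zz_def
    by (intro holo_Pair hy holo_add holo_const holo_scaleC(1) holo_clinear_map clinear_fst clinear_snd)
  have oP: "open (?T \<times> ?X)" by (intro open_Times open_ball)
  have dzz: "fderiv zz p u = (fst u *\<^sub>C snd p + fst p *\<^sub>C snd u, fderiv y p u)" if p: "p \<in> ?T \<times> ?X" for p u
  proof -
    have hs: "holo (\<lambda>p. fst p *\<^sub>C snd p) (?T \<times> ?X)" by (intro holo_scaleC(1) holo_clinear_map clinear_fst clinear_snd)
    have "fderiv (\<lambda>p. x1 + fst p *\<^sub>C snd p) p u = fst u *\<^sub>C snd p + fst p *\<^sub>C snd u"
      using fderiv_add[OF holo_const[of x1] hs p, of u] holo_scaleC(2)[OF holo_clinear_map[OF clinear_fst] holo_clinear_map[OF clinear_snd] p, of u]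
      by (simp add: fderiv_clinear clinear_fst clinear_snd)
    then show ?thesis unfolding zz_def using fderiv_Pair[OF holo_add[OF holo_const[of x1] hs] hy p, of u] by simp
  qed
  have yt: "fderiv y p (1, 0) = J (zz p, snd p)" if p: "p \<in> ?T \<times> ?X" for p
  proof -
    have "fderiv y p (1, 0) = snd (fst (fderiv C p (1, 0)))"
      unfolding y_def using fderiv_snd[OF holo_fst[OF hC] p] fderiv_fst[OF hC p] by simp
    also have "\<dots> = J (C p)" using Ct[of "fst p" "snd p"] p by (auto simp: Z_def)
    also have "C p = (zz p, snd p)" using zzC[OF p] Csnd[of "fst p" "snd p"] p by (auto simp: prod_eq_iff)
    finally show ?thesis .
  qed
  text \<open>The deviation \<open>e\<close> solves a homogeneous linear equation along each ray because of
    integrability.\<close>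
  have key: "fderiv y (t, \<xi>) (0, v) = t *\<^sub>C J (zz (t, \<xi>), v)" if "t \<in> ?T" and \<xi>: "\<xi> \<in> ?X" for t \<xi> v
  proof -
    define e where "e t = fderiv y (t, \<xi>) (0, v) - t *\<^sub>C J (zz (t, \<xi>), v)" for t
    have h1: "holo (\<lambda>p. fderiv y p (0, v)) (?T \<times> ?X)" by (rule holo_fderiv_const[OF oP hy])
    have hzt: "holo (\<lambda>t. zz (t, \<xi>)) ?T" by (rule holo_slice1(1)[OF hzz \<xi>])
    have h2: "holo (\<lambda>t. J (zz (t, \<xi>), v)) ?T"
      by (rule holo_compose[OF J]) (use zz\<Omega> \<xi> in \<open>auto intro!: holo_Pair hzt holo_const\<close>)
    have h3: "holo (\<lambda>t::complex. t *\<^sub>C J (zz (t, \<xi>), v)) ?T" by (intro holo_scaleC(1) holo_ident h2)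
    have he: "holo e ?T" unfolding e_def by (intro holo_diff h3 holo_slice1(1)[OF h1 \<xi>])
    have hJ\<xi>: "holo (\<lambda>z. J (z, w)) \<Omega>" for w by (rule holo_slice1(1)[OF J]) simp
    have de: "fderiv e t 1 = fderiv (\<lambda>z. J (z, \<xi>)) (zz (t, \<xi>)) (0, e t)" if t: "t \<in> ?T" for t
    proof -
      have P: "(t, \<xi>) \<in> ?T \<times> ?X" using t \<xi> by simp
      let ?z = "zz (t, \<xi>)"
      have z\<Omega>: "?z \<in> \<Omega>" by (rule zz\<Omega>[OF P])
      have cl: "clinear (fderiv (\<lambda>z. J (z, w)) ?z)" for w by (rule holo_clinear[OF hJ\<xi> z\<Omega>])
      have "fderiv (\<lambda>t. fderiv y (t, \<xi>) (0, v)) t 1 = fderiv (\<lambda>p. fderiv y p (0, v)) (t, \<xi>) (1, 0)"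
        by (rule holo_slice1(2)[OF h1 \<xi> t])
      also have "\<dots> = fderiv (\<lambda>p. fderiv y p (1, 0)) (t, \<xi>) (0, v)" by (rule fderiv_fderiv_sym[OF oP hy P])
      also have "\<dots> = fderiv (\<lambda>p. J (zz p, snd p)) (t, \<xi>) (0, v)"
        using holo_cong(2)[OF holo_fderiv_const[OF oP hy] oP yt P] by simp
      also have "\<dots> = fderiv (\<lambda>z. J (z, \<xi>)) ?z (fderiv zz (t, \<xi>) (0, v)) + J (?z, v)"
        using fderiv_lin_joint[OF J linJ hzz holo_clinear_map[OF clinear_snd] _ P, of "(0, v)"] zz\<Omega>
        by (simp add: fderiv_clinear[OF clinear_snd] image_subset_iff)
      \<comment> \<open>The variation across the rays splits into a multiple of
        \<open>(v, H z v)\<close>, on which integrability exchanges \<open>v\<close> and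
        \<open>\<xi>\<close>, and a purely vertical part, the deviation \<open>e t\<close>.\<close>
      also have "fderiv zz (t, \<xi>) (0, v) = t *\<^sub>C (v, J (?z, v)) + (0, e t)"
        using dzz[OF P] by (simp add: e_def)
      also have "fderiv (\<lambda>z. J (z, \<xi>)) ?z (t *\<^sub>C (v, J (?z, v)) + (0, e t))
          = t *\<^sub>C fderiv (\<lambda>z. J (z, v)) ?z (\<xi>, J (?z, \<xi>)) + fderiv (\<lambda>z. J (z, \<xi>)) ?z (0, e t)"
        using int[OF z\<Omega>, of \<xi> v] by (simp only: J' clinear_add[OF cl] clinear_scaleC_D[OF cl] flip: J')
      finally have 1: "fderiv (\<lambda>t. fderiv y (t, \<xi>) (0, v)) t 1 = t *\<^sub>C fderiv (\<lambda>z. J (z, v)) ?z (\<xi>, J (?z, \<xi>)) + fderiv (\<lambda>z. J (z, \<xi>)) ?z (0, e t) + J (?z, v)" .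
      have "fderiv (\<lambda>t. J (zz (t, \<xi>), v)) t 1 = fderiv (\<lambda>z. J (z, v)) ?z (fderiv (\<lambda>t. zz (t, \<xi>)) t 1)"
        by (rule fderiv_compose[OF hJ\<xi> z\<Omega> holo_has_derivative[OF hzt t]])
      also have "fderiv (\<lambda>t. zz (t, \<xi>)) t 1 = (\<xi>, J (?z, \<xi>))"
        using holo_slice1(2)[OF hzz \<xi> t, of 1] dzz[OF P] yt[OF P] by simp
      finally have "fderiv (\<lambda>t::complex. t *\<^sub>C J (zz (t, \<xi>), v)) t 1 = J (?z, v) + t *\<^sub>C fderiv (\<lambda>z. J (z, v)) ?z (\<xi>, J (?z, \<xi>))"
        using holo_scaleC(2)[OF holo_ident h2 t, of 1] by (simp add: fderiv_clinear[OF clinear_id])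
      with 1 show ?thesis
        unfolding e_def using fderiv_diff[OF holo_slice1(1)[OF h1 \<xi>] h3 t, of 1] by simp
    qed
    have z0: "zz (0, \<xi>) = (x1, y1)" using C0[OF \<xi>] by (simp add: zz_def y_def)
    obtain \<rho> K where \<rho>: "\<rho> > 0" "K > 0" "cball (x1, y1) \<rho> \<subseteq> \<Omega>"
      "\<And>w v. w \<in> cball (x1, y1) \<rho> \<Longrightarrow> norm (fderiv (\<lambda>z. J (z, \<xi>)) w v) \<le> K * norm v"
      by (rule loc_bounds[OF \<Omega> hJ\<xi>[of \<xi>]]) (rule that)
    have T0: "0 \<in> ?T" using \<Phi>(1) by simp
    have "e t = 0"
    proof (rule holo_gronwall_zero[OF he open_ball connected_ball T0 _ _ \<open>t \<in> ?T\<close>])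
      have "y (0, \<xi>') = y1" if "\<xi>' \<in> ?X" for \<xi>' using C0[OF that] by (simp add: y_def)
      then have "fderiv (\<lambda>\<xi>. y (0, \<xi>)) \<xi> v = fderiv (\<lambda>_. y1) \<xi> v"
        using holo_cong(2)[OF holo_const[of y1] open_ball _ \<xi>, of "\<lambda>\<xi>. y (0, \<xi>)"] by simp
      then have "fderiv y (0, \<xi>) (0, v) = 0" using holo_slice2(2)[OF hy T0 \<xi>, of v] by simp
      then show "e 0 = 0" by (simp add: e_def)
      have "((\<lambda>t. zz (t, \<xi>)) \<longlongrightarrow> zz (0, \<xi>)) (nhds 0)"
        by (rule holo_tendsto_nhds[OF hzt T0])
      then have "\<forall>\<^sub>F t in nhds 0. zz (t, \<xi>) \<in> ball (x1, y1) \<rho>"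
        unfolding z0 by (rule topological_tendstoD) (use \<rho>(1) in auto)
      with eventually_nhds_in_open[OF open_ball T0]
      show "\<forall>\<^sub>F t in nhds 0. norm (fderiv e t 1) \<le> K * norm (e t)"
      proof eventually_elim
        case (elim t)
        then show ?case using de[OF elim(1)] \<rho>(4)[of "zz (t, \<xi>)" "(0, e t)"] by (simp add: norm_Pair)
      qed
    qed
    then show ?thesis by (simp add: e_def)
  qed
  \<comment> \<open>Any nonzero time in the disc would serve: dividing \<open>x - x1\<close> by
    \<open>\<tau>\<close> makes the ray arrive at \<open>x\<close> at time
    \<open>\<tau>\<close>.\<close>
  define \<tau> where "\<tau> = complex_of_real (\<delta> / 2)"
  have \<tau>: "\<tau> \<in> ?T" "\<tau> \<noteq> 0" "norm \<tau> = \<delta> / 2" using \<Phi>(1) by (auto simp: \<tau>_def norm_divide)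
  define \<sigma> where "\<sigma> x = (1 / \<tau>) *\<^sub>C (x - x1)" for x
  have h\<sigma>: "holo \<sigma> S" for S unfolding \<sigma>_def by (intro holo_scaleC_left holo_diff holo_ident holo_const)
  have d\<sigma>: "fderiv \<sigma> x v = (1 / \<tau>) *\<^sub>C v" for x v
    unfolding \<sigma>_def using fderiv_scaleC_left[OF holo_diff[OF holo_ident holo_const], of x UNIV "1 / \<tau>" x1 v]
      fderiv_diff[OF holo_ident holo_const, of x UNIV x1 v] by (simp add: fderiv_clinear[OF clinear_id])
  have \<sigma>X: "\<sigma> x \<in> ?X" if "x \<in> ball x1 (r * \<delta> / 2)" for x
  proof -
    have "norm (x - x1) / (\<delta> / 2) < r" using that \<Phi>(1) by (simp add: dist_norm norm_minus_commute field_simps)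
    then show ?thesis by (simp add: \<sigma>_def norm_scaleC norm_divide \<tau>(3) mult.commute)
  qed
  define Y where "Y x = y (\<tau>, \<sigma> x)" for x
  show ?thesis
  proof (rule that[of "r * \<delta> / 2" Y])
    show "0 < r * \<delta> / 2" using \<Phi> by simp
    have hy\<tau>: "holo (\<lambda>\<xi>. y (\<tau>, \<xi>)) ?X" by (rule holo_slice2(1)[OF hy \<tau>(1)])
    show hY: "holo Y (ball x1 (r * \<delta> / 2))"
      unfolding Y_def by (rule holo_compose[OF hy\<tau> h\<sigma>]) (use \<sigma>X in blast)
    have "norm (y (\<tau>, 0) - y (0, 0)) \<le> 0 * norm \<tau>"
    proof (rule holo_time_bound[OF hy])
      show "norm (fderiv y (s, 0) (1, 0)) \<le> 0" if "s \<in> ?T" for s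
      proof -
        have "(s, 0) \<in> ?T \<times> ?X" using that \<Phi>(2) by simp
        then show ?thesis using yt[of "(s, 0)"] clinear_zero[OF linJ[OF zz\<Omega>, of "(s, 0)"]] by simp
      qed
    qed (use \<tau> \<Phi> in auto)
    then show "Y x1 = y1" using C0[of 0] \<Phi>(2) by (simp add: Y_def \<sigma>_def y_def)
    fix x assume x: "x \<in> ball x1 (r * \<delta> / 2)"
    have P: "(\<tau>, \<sigma> x) \<in> ?T \<times> ?X" using \<tau> \<sigma>X[OF x] by simp
    have z: "zz (\<tau>, \<sigma> x) = (x, Y x)" using \<tau>(2) by (simp add: zz_def Y_def \<sigma>_def scaleC_scaleC)
    have "fderiv Y x v = H (x, Y x) v" for v
    proof -
      have "fderiv Y x v = fderiv (\<lambda>\<xi>. y (\<tau>, \<xi>)) (\<sigma> x) (fderiv \<sigma> x v)"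
        unfolding Y_def by (rule fderiv_compose[OF hy\<tau> \<sigma>X[OF x] holo_has_derivative[OF h\<sigma>[of UNIV]]]) simp
      also have "\<dots> = fderiv y (\<tau>, \<sigma> x) (0, (1 / \<tau>) *\<^sub>C v)"
        using holo_slice2(2)[OF hy \<tau>(1) \<sigma>X[OF x]] by (simp add: d\<sigma>)
      also have "\<dots> = \<tau> *\<^sub>C H (x, Y x) ((1 / \<tau>) *\<^sub>C v)" using key[OF \<tau>(1) \<sigma>X[OF x]] z by (simp add: J')
      also have "\<dots> = H (x, Y x) v"
        using clinear_scaleC_D[OF lin[OF zz\<Omega>[OF P]], of "1 / \<tau>" v] \<tau>(2) z by (simp add: scaleC_scaleC)
      finally show ?thesis .
    qed
    then show "(x, Y x) \<in> \<Omega> \<and> (\<forall>v. fderiv Y x v = H (x, Y x) v)" using zz\<Omega>[OF P] z by simp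
  qed
qed

section \<open>Determining equations of infinitesimal symmetries\<close>

text \<open>The row \<open>o1\<close> is filled with the gradient variable, so that the relation
  between \<open>w\<close> and \<open>p\<close> becomes one of the first-order equations.\<close>

definition rhs_ext :: "'m \<Rightarrow> ('n::finite, 'm::finite) rhs1 \<Rightarrow> ('n, 'm) rhs1"
  where "rhs_ext o1 G k j z = (if k = o1 then snd (snd z) $ j else G k j z)"

text \<open>The system in Pfaffian form \<open>d(u, p) = pfaff z dx\<close>.\<close>

definition pfaff :: "'m \<Rightarrow> ('n, 'm) rhs2 \<Rightarrow> ('n::finite, 'm::finite) rhs1 \<Rightarrow> ('n, 'm) jet \<Rightarrow>
    complex ^ 'n \<Rightarrow> (complex ^ 'm) \<times> (complex ^ 'n)"
  where "pfaff o1 F G z v = ((\<chi> k. \<Sum>j\<in>UNIV. rhs_ext o1 G k j z * v $ j), (\<chi> i. \<Sum>j\<in>UNIV. F i j z * v $ j))"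

text \<open>The properties of one member of the deformation, at a fixed parameter, from which its
  determining equations are derived.\<close>

definition good_system :: "'m \<Rightarrow> ('n, 'm) jet set \<Rightarrow> ('n, 'm) rhs2 \<Rightarrow> ('n::finite, 'm::finite) rhs1 \<Rightarrow> bool"
  where "good_system o1 \<Omega> F G \<longleftrightarrow> open \<Omega> \<and> (\<forall>i j. holo (F i j) \<Omega>) \<and>
    (\<forall>k j. k \<noteq> o1 \<longrightarrow> holo (G k j) \<Omega>) \<and> involutive o1 \<Omega> F G"

lemma good_system_open: "good_system o1 \<Omega> F G \<Longrightarrow> open \<Omega>"
  by (simp add: good_system_def)

lemma vec_axis_sum: "(v :: complex ^ 'n::finite) = (\<Sum>j\<in>UNIV. v $ j *\<^sub>C axis j 1)"
  by (simp add: vec_eq_iff axis_def if_distrib cong: if_cong)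

lemma clinear_axis_sum:
  assumes "clinear (f :: complex ^ 'n::finite \<Rightarrow> _)"
  shows "f v = (\<Sum>j\<in>UNIV. v $ j *\<^sub>C f (axis j 1))"
  by (subst vec_axis_sum[of v]) (simp add: clinear_sum[OF assms] clinear_scaleC_D[OF assms])

lemma holo_rhs_ext: "good_system o1 \<Omega> F G \<Longrightarrow> holo (rhs_ext o1 G k j) \<Omega>"
proof (cases "k = o1")
  case True
  then have "rhs_ext o1 G k j = (\<lambda>z. snd (snd z) $ j)" by (auto simp: rhs_ext_def)
  then show ?thesis by (simp add: holo_vec_nth holo_snd holo_clinear_map clinear_snd)
next
  case False
  then have "rhs_ext o1 G k j = G k j" by (auto simp: rhs_ext_def)
  then show "good_system o1 \<Omega> F G \<Longrightarrow> ?thesis" using False by (simp add: good_system_def)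
qed

lemma clinear_pfaff: "clinear (pfaff o1 F G z)"
  unfolding pfaff_def
  by (intro clinear_Pair clinear_vec_lambda clinear_sumI clinear_mult_left clinear_vec_nth)

lemma holo_pfaff: "good_system o1 \<Omega> F G \<Longrightarrow> holo (\<lambda>(z, v). pfaff o1 F G z v) (\<Omega> \<times> UNIV)"
proof -
  assume g: "good_system o1 \<Omega> F G"
  have f: "holo (\<lambda>p. f (fst p)) (\<Omega> \<times> UNIV)" if "holo f \<Omega>" for f :: "('b, 'a) jet \<Rightarrow> complex"
    by (rule holo_compose[OF that holo_clinear_map[OF clinear_fst]]) auto
  have F: "holo (F i j) \<Omega>" for i j using g by (simp add: good_system_def)
  show ?thesis
    unfolding pfaff_def case_prod_unfold
    by (intro holo_Pair holo_vec_lambda holo_sum holo_mult f holo_rhs_ext[OF g] F holo_vec_nth holo_clinear_map clinear_snd)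
qed

lemma holo_Hs': "good_system o1 \<Omega> F G \<Longrightarrow> holo (\<lambda>z. pfaff o1 F G z v) \<Omega>"
  using holo_slice1(1)[OF holo_pfaff, of o1 \<Omega> F G v] by simp

text \<open>The vectors \<open>(w, H z w)\<close>, with \<open>H\<close> the Pfaffian right side,
  lie in the distribution. On a fixed vector each form depends on the point only through
  \<open>H\<close>, so its exterior derivative on two such vectors is a difference of the two mixed
  differentials of \<open>H\<close>.\<close>

lemma pfaff_integrable:
  assumes g: "good_system o1 \<Omega> F G" and z: "z \<in> \<Omega>"
  shows "fderiv (\<lambda>z. pfaff o1 F G z w) z (v, pfaff o1 F G z v) = fderiv (\<lambda>z. pfaff o1 F G z v) z (w, pfaff o1 F G z w)"
proof -
  let ?H = "pfaff o1 F G"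
  let ?\<Theta> = "range (form_omega F) \<union> range (form_phi o1 G)"
  have om: "form_omega F i y (w, \<eta>) = snd \<eta> $ i - snd (?H y w) $ i" for i y w \<eta>
    by (simp add: form_omega_def pfaff_def case_prod_unfold)
  have ph: "form_phi o1 G k y (w, \<eta>) = fst \<eta> $ k - fst (?H y w) $ k" for k y w \<eta>
    by (cases y; cases \<eta>) (simp add: form_phi_def pfaff_def rhs_ext_def cong: if_cong)
  have dist: "(w, ?H z w) \<in> distribution_at ?\<Theta> z" for w
    by (auto simp: distribution_at_def om ph)
  have fr: "ext_deriv \<theta> z (v, ?H z v) (w, ?H z w) = 0" if "\<theta> \<in> ?\<Theta>" for \<theta>
    using g z that dist unfolding good_system_def involutive_def frobenius_condition_def by blast
  have h: "holo (\<lambda>z. ?H z w) \<Omega>" for w by (rule holo_Hs'[OF g])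
  have dp: "fderiv (\<lambda>y. snd \<eta> $ i - snd (?H y w) $ i) z \<xi> = - (snd (fderiv (\<lambda>z. ?H z w) z \<xi>) $ i)" for w \<eta> i \<xi>
    using fderiv_diff[OF holo_const holo_vec_nth[OF holo_snd[OF h]] z, of "snd \<eta> $ i" w i \<xi>]
      fderiv_vec_nth[OF holo_snd[OF h] z, of w i \<xi>] fderiv_snd[OF h z, of w \<xi>]
    by (simp add: fderiv_eqI[OF has_derivative_const])
  have du: "fderiv (\<lambda>y. fst \<eta> $ k - fst (?H y w) $ k) z \<xi> = - (fst (fderiv (\<lambda>z. ?H z w) z \<xi>) $ k)" for w \<eta> k \<xi>
    using fderiv_diff[OF holo_const holo_vec_nth[OF holo_fst[OF h]] z, of "fst \<eta> $ k" w k \<xi>]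
      fderiv_vec_nth[OF holo_fst[OF h] z, of w k \<xi>] fderiv_fst[OF h z, of w \<xi>]
    by (simp add: fderiv_eqI[OF has_derivative_const])
  have "snd (fderiv (\<lambda>z. ?H z w) z (v, ?H z v)) $ i = snd (fderiv (\<lambda>z. ?H z v) z (w, ?H z w)) $ i" for i
    using fr[of "form_omega F i"] by (simp add: ext_deriv_def om dp)
  moreover have "fst (fderiv (\<lambda>z. ?H z w) z (v, ?H z v)) $ k = fst (fderiv (\<lambda>z. ?H z v) z (w, ?H z w)) $ k" for k
    using fr[of "form_phi o1 G k"] by (simp add: ext_deriv_def ph du)
  ultimately show ?thesis by (simp add: prod_eq_iff vec_eq_iff)
qed

lemma partial_deriv_fderiv:
  assumes "open V" "holo f V" "x \<in> V"
  shows "partial_deriv j f x = fderiv f x (axis j 1)"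
proof -
  have ax: "axis j t = t *\<^sub>C (axis j 1 :: complex ^ 'a)" for t :: complex
    by (simp add: vec_eq_iff axis_def)
  have "((\<lambda>t::complex. x + t *\<^sub>C axis j 1) has_derivative (\<lambda>h. h *\<^sub>C axis j 1)) (at 0)"
    by (rule line_has_derivative)
  from has_derivative_compose[OF this, of f "fderiv f x"] holo_has_derivative[OF assms(2,3)]
  have "((\<lambda>t. f (x + t *\<^sub>C axis j 1)) has_derivative (\<lambda>h. fderiv f x (h *\<^sub>C axis j 1))) (at 0)" by simp
  then have "((\<lambda>t. f (x + t *\<^sub>C axis j 1)) has_derivative (*) (fderiv f x (axis j 1))) (at 0)"
    by (simp add: clinear_scaleC_D[OF holo_clinear[OF assms(2,3)]] mult.commute[of _ "fderiv f x (axis j 1)"])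
  then have "((\<lambda>t. f (x + axis j t)) has_field_derivative fderiv f x (axis j 1)) (at 0)"
    unfolding has_field_derivative_def by (simp only: ax[symmetric])
  then show ?thesis unfolding partial_deriv_def by (rule DERIV_imp_deriv)
qed

lemma holo_partial_deriv:
  assumes "open V" "holo f V"
  shows "holo (partial_deriv j f) V"
  by (rule holo_cong(1)[OF holo_fderiv_const[OF assms] assms(1)]) (simp add: partial_deriv_fderiv[OF assms])

lemma fderiv_partial_sum:
  assumes "open V" "holo f V" "x \<in> V"
  shows "fderiv f x v = (\<Sum>j\<in>UNIV. partial_deriv j f x * v $ j)"
  by (subst clinear_axis_sum[OF holo_clinear[OF assms(2,3)]]) (simp add: partial_deriv_fderiv[OF assms] mult.commute)

text \<open>Turns the coordinate description of a solution into total differentials: its 1-jet is an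
  integral manifold of the Pfaffian system.\<close>

lemma solution_jet:
  assumes "is_solution o1 \<Omega> F G V u"
  shows "holo (jet1 o1 u) V" and "x \<in> V \<Longrightarrow> fderiv (jet1 o1 u) x v = (v, pfaff o1 F G (jet1 o1 u x) v)"
    and "x \<in> V \<Longrightarrow> fderiv u x v = fst (pfaff o1 F G (jet1 o1 u x) v)"
proof -
  have V: "open V" and hu: "holo u V" using assms by (auto simp: is_solution_def)
  have hk: "holo (\<lambda>y. u y $ k) V" for k by (rule holo_vec_nth[OF hu])
  have hp: "holo (partial_deriv j (\<lambda>y. u y $ o1)) V" for j by (rule holo_partial_deriv[OF V hk])
  have hP: "holo (\<lambda>x. \<chi> j. partial_deriv j (\<lambda>y. u y $ o1) x) V" by (rule holo_vec_lambda[OF hp])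
  have J: "jet1 o1 u = (\<lambda>x. (x, u x, \<chi> j. partial_deriv j (\<lambda>y. u y $ o1) x))" by (auto simp: jet1_def)
  show "holo (jet1 o1 u) V" unfolding J by (intro holo_Pair holo_ident hu hP)
  assume x: "x \<in> V"
  have du: "fderiv u x v $ k = fst (pfaff o1 F G (jet1 o1 u x) v) $ k" for k v
  proof -
    have pk: "partial_deriv j (\<lambda>y. u y $ k) x = rhs_ext o1 G k j (jet1 o1 u x)" for j
      using assms x by (auto simp: is_solution_def rhs_ext_def jet1_def)
    have "fderiv u x v $ k = fderiv (\<lambda>y. u y $ k) x v" using fderiv_vec_nth[OF hu x] by simp
    also have "\<dots> = (\<Sum>j\<in>UNIV. partial_deriv j (\<lambda>y. u y $ k) x * v $ j)" by (rule fderiv_partial_sum[OF V hk x])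
    finally show ?thesis by (simp add: pfaff_def pk)
  qed
  then show du': "fderiv u x v = fst (pfaff o1 F G (jet1 o1 u x) v)" for v by (simp add: vec_eq_iff)
  have dp: "fderiv (\<lambda>x. \<chi> j. partial_deriv j (\<lambda>y. u y $ o1) x) x v = snd (pfaff o1 F G (jet1 o1 u x) v)"
  proof -
    have "fderiv (\<lambda>x. \<chi> j. partial_deriv j (\<lambda>y. u y $ o1) x) x v = (\<chi> i. fderiv (partial_deriv i (\<lambda>y. u y $ o1)) x v)"
      by (rule fderiv_vec_lambda[OF hp x])
    moreover have "fderiv (partial_deriv i (\<lambda>y. u y $ o1)) x v = (\<Sum>j\<in>UNIV. F i j (jet1 o1 u x) * v $ j)" for i
      using fderiv_partial_sum[OF V hp x, of i v] assms x by (simp add: is_solution_def)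
    ultimately show ?thesis by (simp add: pfaff_def)
  qed
  show "fderiv (jet1 o1 u) x v = (v, pfaff o1 F G (jet1 o1 u x) v)"
    unfolding J using fderiv_Pair[OF holo_ident holo_Pair[OF hu hP] x, of v] fderiv_Pair[OF hu hP x, of v] du' dp
    by (simp add: fderiv_clinear[OF clinear_id] J prod_eq_iff)
qed

text \<open>The row \<open>o1\<close> of the Pfaffian system forces the second half of the Frobenius
  solution to be the gradient of \<open>w\<close>, so the differential of that half consists of the
  second derivatives of \<open>w\<close>.\<close>

lemma solution_exists:
  assumes g: "good_system o1 \<Omega> F G" and z: "(x1, u1, p1) \<in> \<Omega>"
  obtains r u where "0 < r" "is_solution o1 \<Omega> F G (ball x1 r) u" "jet1 o1 u x1 = (x1, u1, p1)"
proof -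
  let ?H = "pfaff o1 F G"
  obtain r Y where rY: "0 < r" "holo Y (ball x1 r)" "Y x1 = (u1, p1)"
    "\<And>x. x \<in> ball x1 r \<Longrightarrow> (x, Y x) \<in> \<Omega> \<and> (\<forall>v. fderiv Y x v = ?H (x, Y x) v)"
    by (rule frobenius_local_solution[OF good_system_open[OF g] z holo_pfaff[OF g] clinear_pfaff pfaff_integrable[OF g]])
      (assumption, rule that)
  define u where "u x = fst (Y x)" for x
  have hu: "holo u (ball x1 r)" unfolding u_def by (rule holo_fst[OF rY(2)])
  have pu: "partial_deriv j (\<lambda>y. u y $ k) x = rhs_ext o1 G k j (x, Y x)" if "x \<in> ball x1 r" for x j k
  proof -
    have "partial_deriv j (\<lambda>y. u y $ k) x = fderiv (\<lambda>y. u y $ k) x (axis j 1)"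
      by (rule partial_deriv_fderiv[OF open_ball holo_vec_nth[OF hu] that])
    also have "\<dots> = fst (fderiv Y x (axis j 1)) $ k"
      unfolding u_def using fderiv_vec_nth[OF holo_fst[OF rY(2)] that] fderiv_fst[OF rY(2) that] by simp
    also have "\<dots> = rhs_ext o1 G k j (x, Y x)"
      using rY(4)[OF that] by (simp add: pfaff_def axis_def if_distrib cong: if_cong)
    finally show ?thesis .
  qed
  have jet: "jet1 o1 u x = (x, Y x)" if "x \<in> ball x1 r" for x
    using pu[OF that, of _ o1] by (simp add: jet1_def u_def rhs_ext_def prod_eq_iff vec_eq_iff)
  have pp: "partial_deriv j (partial_deriv i (\<lambda>y. u y $ o1)) x = F i j (x, Y x)" if x: "x \<in> ball x1 r" for x i j
  proof -
    have hp: "holo (partial_deriv i (\<lambda>y. u y $ o1)) (ball x1 r)" by (rule holo_partial_deriv[OF open_ball holo_vec_nth[OF hu]])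
    have eq: "partial_deriv i (\<lambda>y. u y $ o1) x = snd (Y x) $ i" if "x \<in> ball x1 r" for x
      using pu[OF that, of i o1] by (simp add: rhs_ext_def)
    have "partial_deriv j (partial_deriv i (\<lambda>y. u y $ o1)) x = fderiv (partial_deriv i (\<lambda>y. u y $ o1)) x (axis j 1)"
      by (rule partial_deriv_fderiv[OF open_ball hp x])
    also have "\<dots> = fderiv (\<lambda>x. snd (Y x) $ i) x (axis j 1)"
      using holo_cong(2)[OF hp open_ball eq x] by simp
    also have "\<dots> = snd (fderiv Y x (axis j 1)) $ i"
      using fderiv_vec_nth[OF holo_snd[OF rY(2)] x] fderiv_snd[OF rY(2) x] by simp
    also have "\<dots> = F i j (x, Y x)"
      using rY(4)[OF x] by (simp add: pfaff_def axis_def if_distrib cong: if_cong)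
    finally show ?thesis .
  qed
  show ?thesis
  proof (rule that[OF rY(1)])
    show "is_solution o1 \<Omega> F G (ball x1 r) u"
      unfolding is_solution_def using hu rY(4) jet pu pp by (auto simp: rhs_ext_def)
    show "jet1 o1 u x1 = (x1, u1, p1)" using jet[of x1] rY(1,3) by simp
  qed
qed

lemma solution_subset:
  assumes "is_solution o1 \<Omega> F G V u" "open V'" "V' \<subseteq> V"
  shows "is_solution o1 \<Omega> F G V' u"
  using assms holo_subset unfolding is_solution_def by blast

section \<open>The action of a symmetry on solutions\<close>

lemma holo_det:
  fixes M :: "'a::complex_normed_space \<Rightarrow> complex ^ 'n ^ 'n::finite"
  assumes "\<And>i j. holo (\<lambda>x. M x $ i $ j) S"
  shows "holo (\<lambda>x. det (M x)) S"
  unfolding det_def by (intro holo_sum holo_mult holo_const holo_prod assms)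

lemma holo_divide:
  assumes "holo f S" "holo g S" "\<And>x. x \<in> S \<Longrightarrow> g x \<noteq> (0::complex)"
  shows "holo (\<lambda>x. f x / g x) S"
proof -
  have "holo (inverse :: complex \<Rightarrow> complex) (- {0})"
    by (rule holomorphic_on_holo) (auto intro!: holomorphic_intros)
  then have "holo (\<lambda>x. inverse (g x)) S" by (rule holo_compose[OF _ assms(2)]) (use assms(3) in auto)
  then show ?thesis unfolding divide_inverse by (rule holo_mult[OF assms(1)])
qed

text \<open>For small times the symmetry moves a solution to solutions. Their jets satisfy the
  Pfaffian system, and differentiating this identity in time at 0 gives the linearized equation;
  \<open>\<pi>\<close> is the time derivative of the moved gradient.\<close>

lemma symmetry_along_solution:
  fixes o1 :: "'m::finite" and F :: "('n::finite, 'm) rhs2"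
  assumes g: "good_system o1 \<Omega> F G" and sym: "infinitesimal_symmetry o1 \<Omega> F G D X" and D: "open D"
    and z: "(x1, u1, p1) \<in> \<Omega>" and q1: "(x1, u1) \<in> D"
  obtains r u \<pi> where "0 < r" "is_solution o1 \<Omega> F G (ball x1 r) u" "jet1 o1 u x1 = (x1, u1, p1)"
    "\<And>x. x \<in> ball x1 r \<Longrightarrow> (x, u x) \<in> D" "holo \<pi> (ball x1 r)"
    "\<And>x w. x \<in> ball x1 r \<Longrightarrow> fderiv (\<lambda>x. (snd (X (x, u x)), \<pi> x)) x w =
       fderiv (\<lambda>z. pfaff o1 F G z w) (jet1 o1 u x) (fst (X (x, u x)), snd (X (x, u x)), \<pi> x)
       + pfaff o1 F G (jet1 o1 u x) (fderiv (\<lambda>x. fst (X (x, u x))) x w)"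
proof -
  let ?H = "pfaff o1 F G"
  have hX: "holo X D" using sym by (simp add: infinitesimal_symmetry_def)
  obtain r0 u where u: "0 < r0" "is_solution o1 \<Omega> F G (ball x1 r0) u" "jet1 o1 u x1 = (x1, u1, p1)"
    by (rule solution_exists[OF g z])
  define q where "q x = (x, u x)" for x
  have hu: "holo u (ball x1 r0)" using u(2) by (simp add: is_solution_def)
  have hq: "holo q (ball x1 r0)" unfolding q_def by (intro holo_Pair holo_ident hu)
  have x1: "x1 \<in> ball x1 r0" using u(1) by simp
  have qx1: "q x1 = (x1, u1)" using u(3) by (simp add: q_def jet1_def)
  have q_near: "\<exists>e>0. e \<le> r0 \<and> (\<forall>x\<in>ball x1 e. q x \<in> S)" if "open S" "(x1, u1) \<in> S" for S
  proof -
    have "\<forall>\<^sub>F x in nhds x1. q x \<in> S"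
      by (rule topological_tendstoD[OF holo_tendsto_nhds[OF hq x1]]) (use that qx1 in auto)
    then obtain e where "e > 0" "\<And>x. dist x x1 < e \<Longrightarrow> q x \<in> S" unfolding eventually_nhds_metric by blast
    then show ?thesis using u(1) by (intro exI[of _ "min e r0"]) (auto simp: dist_commute)
  qed
  obtain r1 where r1: "r1 > 0" "r1 \<le> r0" "\<And>x. x \<in> ball x1 r1 \<Longrightarrow> q x \<in> D" using q_near[OF D q1] by blast
  have sol1: "is_solution o1 \<Omega> F G (ball x1 r1) u"
    by (rule solution_subset[OF u(2)]) (use r1 in auto)
  have x11: "x1 \<in> ball x1 r1" using r1 by simp
  have graph: "graph_on u (ball x1 r1) \<subseteq> D" using r1(3) by (auto simp: graph_on_def q_def)
  obtain V' \<delta>' \<Phi>' where V': "open V'" "x1 \<in> V'" "V' \<subseteq> ball x1 r1" "\<delta>' > 0"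
    "is_local_flow X D \<delta>' (graph_on u V') \<Phi>'"
    "\<And>t. t \<in> ball 0 \<delta>' \<Longrightarrow> \<exists>W v. is_solution o1 \<Omega> F G W v \<and> \<Phi>' t ` graph_on u V' = graph_on v W"
    using sym sol1 graph x11 unfolding infinitesimal_symmetry_def by metis
  \<comment> \<open>The flow \<open>\<Phi>'\<close> supplied by the symmetry is known to be
    holomorphic in time for each point separately. This second flow is jointly holomorphic, and
    uniqueness identifies the two on the graph.\<close>
  obtain \<delta> r \<Phi> where \<Phi>: "0 < \<delta>" "0 < r" "ball (x1, u1) r \<subseteq> D" "holo \<Phi> (ball (0::complex) \<delta> \<times> ball (x1, u1) r)"
    "\<And>q. q \<in> ball (x1, u1) r \<Longrightarrow> \<Phi> (0, q) = q"
    "\<And>t q. t \<in> ball 0 \<delta> \<Longrightarrow> q \<in> ball (x1, u1) r \<Longrightarrow> \<Phi> (t, q) \<in> D \<and> fderiv \<Phi> (t, q) (1, 0) = X (\<Phi> (t, q))"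
    by (rule flow_exists[OF D q1 hX]) (rule that)
  obtain r2 where r2: "r2 > 0" "r2 \<le> r0" "\<And>x. x \<in> ball x1 r2 \<Longrightarrow> q x \<in> ball (x1, u1) r"
    using q_near[of "ball (x1, u1) r"] \<Phi>(2) by auto
  obtain r3 where r3: "r3 > 0" "ball x1 r3 \<subseteq> V'" using V'(1,2) open_contains_ball by blast
  define \<rho> where "\<rho> = min r1 (min r2 r3)"
  have \<rho>: "\<rho> > 0" using r1 r2 r3 by (simp add: \<rho>_def)
  define \<delta>0 where "\<delta>0 = min \<delta> \<delta>'"
  have \<delta>0: "\<delta>0 > 0" using \<Phi>(1) V'(4) by (simp add: \<delta>0_def)
  let ?B = "ball x1 \<rho>" let ?T = "ball (0::complex) \<delta>0"
  have B: "q x \<in> D" "q x \<in> ball (x1, u1) r" "x \<in> V'" "x \<in> ball x1 r0" if "x \<in> ?B" for x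
  proof -
    have "x \<in> ball x1 r1" "x \<in> ball x1 r2" "x \<in> ball x1 r3" using that by (auto simp: \<rho>_def)
    then show "q x \<in> D" "q x \<in> ball (x1, u1) r" "x \<in> V'" "x \<in> ball x1 r0" using r1 r2 r3 by auto
  qed
  define C where "C p = \<Phi> (fst p, q (snd p))" for p
  have hqB: "holo q ?B" by (rule holo_subset[OF hq]) (use B in auto)
  have hC: "holo C (?T \<times> ?B)" unfolding C_def
    by (rule holo_compose[OF \<Phi>(4) holo_Pair[OF holo_clinear_map[OF clinear_fst] holo_compose[OF hqB holo_clinear_map[OF clinear_snd]]]])
       (use B in \<open>auto simp: \<delta>0_def\<close>)
  have C0: "C (0, x) = q x" if "x \<in> ?B" for x using \<Phi>(5)[OF B(2)[OF that]] by (simp add: C_def)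
  have Ct: "fderiv C (t, x) (1, 0) = X (C (t, x))" "C (t, x) \<in> D" if "t \<in> ?T" "x \<in> ?B" for t x
  proof -
    have t\<delta>: "t \<in> ball 0 \<delta>" using that by (simp add: \<delta>0_def)
    have "fderiv C (t, x) (1, 0) = fderiv (\<lambda>t. C (t, x)) t 1" using holo_slice1(2)[OF hC that(2,1)] by simp
    also have "\<dots> = fderiv \<Phi> (t, q x) (1, 0)"
      using holo_slice1(2)[OF \<Phi>(4) B(2)[OF that(2)] t\<delta>] by (simp add: C_def)
    finally show "fderiv C (t, x) (1, 0) = X (C (t, x))" "C (t, x) \<in> D"
      using \<Phi>(6)[OF t\<delta> B(2)[OF that(2)]] by (simp_all add: C_def)
  qed
  have \<Phi>': "\<Phi>' t (q x) = C (t, x)" if "t \<in> ?T" "x \<in> ?B" for t x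
  proof -
    have qx: "q x \<in> graph_on u V'" using B(3)[OF that(2)] by (auto simp: graph_on_def q_def)
    have d: "((\<lambda>s. \<Phi>' s (q x)) has_derivative (\<lambda>h. h *\<^sub>C X (\<Phi>' t (q x)))) (at t)" "\<Phi>' t (q x) \<in> D" if "t \<in> ?T" for t
      using V'(5) qx that unfolding is_local_flow_def by (auto simp: \<delta>0_def)
    have h: "holo (\<lambda>s. \<Phi>' s (q x)) ?T"
      by (rule holoI'[OF d(1)]) (auto intro: clinear_scaleC_left clinear_id)
    have h0: "\<Phi>' 0 (q x) = C (0, x)" using V'(5) qx C0[OF that(2)] unfolding is_local_flow_def by auto
    show ?thesis
      by (rule flow_unique[OF D hX open_ball connected_ball h holo_slice1(1)[OF hC that(2)] _ _ _ h0 that(1)])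
        (use d fderiv_eqI[OF d(1)] Ct[OF _ that(2)] holo_slice1(2)[OF hC that(2)] \<delta>0 in auto)
  qed
  define y where "y p = fst (C p)" for p
  define U where "U p = snd (C p)" for p
  have hy: "holo y (?T \<times> ?B)" and hU: "holo U (?T \<times> ?B)" unfolding y_def U_def by (intro holo_fst holo_snd hC)+
  have oP: "open (?T \<times> ?B)" by (intro open_Times open_ball)
  have T0: "0 \<in> ?T" using \<delta>0 by simp
  have xB: "x1 \<in> ?B" using \<rho> by simp
  \<comment> \<open>Row \<open>j\<close> is the derivative of the moved base point in direction
    \<open>j\<close>. With this transposed Jacobian the chain rule says that \<open>Mt\<close> times
    the new gradient is the space gradient of the moved \<open>w\<close>.\<close>
  define Mt where "Mt p = (\<chi> j l. fderiv y p (0, axis j 1) $ l)" for p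
  have hM: "holo (\<lambda>p. Mt p $ i $ j) (?T \<times> ?B)" for i j
    unfolding Mt_def using holo_vec_nth[OF holo_fderiv_const[OF oP hy]] by simp
  have y0: "y (0, x) = x" "U (0, x) = u x" if "x \<in> ?B" for x using C0[OF that] by (auto simp: y_def U_def q_def)
  have dy0: "fderiv y (0, x) (0, w) = w" if "x \<in> ?B" for x w
    using holo_slice2(2)[OF hy T0 that, of w] holo_cong(2)[OF holo_ident open_ball _ that, of "\<lambda>x. y (0, x)"] y0(1)
    by (simp add: fderiv_clinear[OF clinear_id])
  \<comment> \<open>At time 0 base points have not moved, so the Jacobian is the identity; it stays
    invertible on a product neighborhood.\<close>
  have "Mt (0, x1) = mat 1" using dy0[OF xB] by (simp add: Mt_def vec_eq_iff mat_def axis_def)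
  then have "((\<lambda>p. det (Mt p)) \<longlongrightarrow> 1) (nhds (0, x1))"
    using holo_tendsto_nhds[OF holo_det[OF hM], of "(0, x1)"] T0 xB by simp
  then have "\<forall>\<^sub>F p in nhds (0, x1). det (Mt p) \<in> - {0}"
    by (rule topological_tendstoD) auto
  then obtain S where S: "open S" "(0, x1) \<in> S" "\<And>p. p \<in> S \<Longrightarrow> det (Mt p) \<noteq> 0"
    unfolding eventually_nhds by auto
  obtain A1 A2 where A: "open A1" "open A2" "(0, x1) \<in> A1 \<times> A2" "A1 \<times> A2 \<subseteq> S"
    by (rule open_prod_elim[OF S(1,2)])
  obtain \<delta>1 where d1: "\<delta>1 > 0" "ball 0 \<delta>1 \<subseteq> A1" using A(1,3) open_contains_ball by blast
  obtain \<rho>1 where r1': "\<rho>1 > 0" "ball x1 \<rho>1 \<subseteq> A2" using A(2,3) open_contains_ball by blast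
  define T1 where "T1 = ball (0::complex) (min \<delta>0 \<delta>1)"
  define R1 where "R1 = min \<rho> \<rho>1"
  let ?B1 = "ball x1 R1"
  have sub: "T1 \<times> ?B1 \<subseteq> ?T \<times> ?B" by (auto simp: T1_def R1_def)
  have det0: "det (Mt p) \<noteq> 0" if "p \<in> T1 \<times> ?B1" for p
    by (rule S(3)) (use that A(4) d1(2) r1'(2) in \<open>auto simp: T1_def R1_def subset_iff\<close>)
  have T10: "0 \<in> T1" and oT1: "open T1" using \<delta>0 d1 by (auto simp: T1_def)
  have R1: "R1 > 0" using \<rho> r1' by (simp add: R1_def)
  have oP1: "open (T1 \<times> ?B1)" by (intro open_Times oT1 open_ball)
  have hy1: "holo y (T1 \<times> ?B1)" and hU1: "holo U (T1 \<times> ?B1)"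
    and hM1: "holo (\<lambda>p. Mt p $ i $ j) (T1 \<times> ?B1)" for i j
    using holo_subset[OF _ sub] hy hU hM by auto
  text \<open>By Cramer's rule the gradient of the moved solution is holomorphic in time and space, although
    nothing is assumed about the dependence of the moved solution on time.\<close>
  define P where "P p = (\<chi> k. det (\<chi> i j. if j = k then fderiv U p (0, axis i 1) $ o1 else Mt p $ i $ j) / det (Mt p))" for p
  have hP: "holo P (T1 \<times> ?B1)" unfolding P_def
  proof (intro holo_vec_lambda holo_divide holo_det hM1 det0)
    fix i j k
    show "holo (\<lambda>p. (\<chi> i j. if j = k then fderiv U p (0, axis i 1) $ o1 else Mt p $ i $ j) $ i $ j) (T1 \<times> ?B1)"
      using hM1[of i j] holo_vec_nth[OF holo_fderiv_const[OF oP1 hU1]] by (cases "j = k") auto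
  qed
  have jet: "jet1 o1 v (y (t, x)) = (y (t, x), U (t, x), P (t, x))"
    if t: "t \<in> T1" and v: "is_solution o1 \<Omega> F G W v" "\<And>x. x \<in> ?B1 \<Longrightarrow> y (t, x) \<in> W \<and> U (t, x) = v (y (t, x))" and x: "x \<in> ?B1" for t v W x
  proof -
    have px: "(t, x) \<in> T1 \<times> ?B1" using t x by simp
    have yW: "y (t, x) \<in> W" using v(2)[OF x] by simp
    have hv: "holo v W" using v(1) by (simp add: is_solution_def)
    let ?J = "jet1 o1 v (y (t, x))"
    have "fderiv U (t, x) (0, w) = fst (?H ?J (fderiv y (t, x) (0, w)))" for w
    proof -
      have "fderiv U (t, x) (0, w) = fderiv (\<lambda>x. U (t, x)) x w" using holo_slice2(2)[OF hU1 t x] by simp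
      also have "\<dots> = fderiv (\<lambda>x. v (y (t, x))) x w"
        using holo_cong(2)[OF holo_slice2(1)[OF hU1 t] open_ball _ x, of "\<lambda>x. v (y (t, x))"] v(2) by simp
      also have "\<dots> = fderiv v (y (t, x)) (fderiv y (t, x) (0, w))"
        using fderiv_compose[OF hv yW holo_has_derivative[OF holo_slice2(1)[OF hy1 t] x]] holo_slice2(2)[OF hy1 t x] by simp
      also have "\<dots> = fst (?H ?J (fderiv y (t, x) (0, w)))" by (rule solution_jet(3)[OF v(1) yW])
      finally show ?thesis .
    qed
    then have "Mt (t, x) *v snd (snd ?J) = (\<chi> i. fderiv U (t, x) (0, axis i 1) $ o1)"
      by (simp add: vec_eq_iff matrix_vector_mult_def Mt_def pfaff_def rhs_ext_def mult.commute)
    then have "snd (snd ?J) = (\<chi> k. det (\<chi> i j. if j = k then (\<chi> i. fderiv U (t, x) (0, axis i 1) $ o1) $ i else Mt (t, x) $ i $ j) / det (Mt (t, x)))"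
      using cramer[OF det0[OF px]] by blast
    also have "\<dots> = P (t, x)" unfolding P_def by (simp only: vec_lambda_beta)
    finally show ?thesis using v(2)[OF x] by (simp add: jet1_def)
  qed
  \<comment> \<open>The domain \<open>W\<close> and the solution \<open>v\<close> vary with
    \<open>t\<close> without any control, so from here on they are used only through their values at
    the moved points.\<close>
  have moved: "\<exists>W v. is_solution o1 \<Omega> F G W v \<and> (\<forall>x\<in>?B1. y (t, x) \<in> W \<and> U (t, x) = v (y (t, x)))" if "t \<in> T1" for t
  proof -
    have t: "t \<in> ?T" "t \<in> ball 0 \<delta>'" using that by (auto simp: T1_def \<delta>0_def)
    obtain W v where Wv: "is_solution o1 \<Omega> F G W v" "\<Phi>' t ` graph_on u V' = graph_on v W" using V'(6)[OF t(2)] by blast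
    have "y (t, x) \<in> W \<and> U (t, x) = v (y (t, x))" if "x \<in> ?B1" for x
    proof -
      have xB: "x \<in> ?B" using that by (simp add: R1_def)
      then have "q x \<in> graph_on u V'" using B(3) by (auto simp: graph_on_def q_def)
      then have "C (t, x) \<in> graph_on v W" using Wv(2) \<Phi>'[OF t(1) xB] by (metis imageI)
      then show ?thesis by (auto simp: graph_on_def y_def U_def)
    qed
    then show ?thesis using Wv(1) by blast
  qed
  define N where "N p = (U p, P p)" for p
  define Wj where "Wj p = (y p, N p)" for p
  have hN: "holo N (T1 \<times> ?B1)" unfolding N_def by (intro holo_Pair hU1 hP)
  have hW: "holo Wj (T1 \<times> ?B1)" unfolding Wj_def by (intro holo_Pair hy1 hN)
  have W0: "Wj (0, x) = jet1 o1 u x" if "x \<in> ?B1" for x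
  proof -
    have *: "x \<in> ?B" if "x \<in> ?B1" for x using that by (simp add: R1_def)
    have "jet1 o1 u (y (0, x)) = (y (0, x), U (0, x), P (0, x))"
      by (rule jet[OF T10 u(2) _ that]) (use y0[OF *] B(4)[OF *] in auto)
    then show ?thesis using y0[OF *[OF that]] by (simp add: Wj_def N_def)
  qed
  have WD: "Wj p \<in> \<Omega>" "fderiv N p (0, w) = ?H (Wj p) (fderiv y p (0, w))" if p: "p \<in> T1 \<times> ?B1" for p w
  proof -
    obtain t x where tx: "p = (t, x)" "t \<in> T1" "x \<in> ?B1" using p by auto
    obtain W v where v: "is_solution o1 \<Omega> F G W v" "\<And>x. x \<in> ?B1 \<Longrightarrow> y (t, x) \<in> W \<and> U (t, x) = v (y (t, x))"
      using moved[OF tx(2)] by blast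
    have J: "jet1 o1 v (y (t, x)) = Wj (t, x)" if "x \<in> ?B1" for x
      using jet[OF tx(2) v that] by (simp add: Wj_def N_def)
    have yW: "y (t, x) \<in> W" using v(2)[OF tx(3)] by simp
    show "Wj p \<in> \<Omega>" using v(1) yW J[OF tx(3)] unfolding is_solution_def tx(1) by metis
    have "fderiv Wj (t, x) (0, w) = fderiv (\<lambda>x. Wj (t, x)) x w" using holo_slice2(2)[OF hW tx(2,3)] by simp
    also have "\<dots> = fderiv (\<lambda>x. jet1 o1 v (y (t, x))) x w"
      using holo_cong(2)[OF holo_slice2(1)[OF hW tx(2)] open_ball J[symmetric] tx(3)] by simp
    also have "\<dots> = fderiv (jet1 o1 v) (y (t, x)) (fderiv y (t, x) (0, w))"
      using fderiv_compose[OF solution_jet(1)[OF v(1)] yW holo_has_derivative[OF holo_slice2(1)[OF hy1 tx(2)] tx(3)]]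
        holo_slice2(2)[OF hy1 tx(2,3)] by simp
    also have "\<dots> = (fderiv y (t, x) (0, w), ?H (Wj (t, x)) (fderiv y (t, x) (0, w)))"
      using solution_jet(2)[OF v(1) yW] J[OF tx(3)] by simp
    finally have "snd (fderiv Wj (t, x) (0, w)) = ?H (Wj (t, x)) (fderiv y (t, x) (0, w))" by simp
    moreover have "fderiv Wj (t, x) (0, w) = (fderiv y (t, x) (0, w), fderiv N (t, x) (0, w))"
      unfolding Wj_def using fderiv_Pair[OF hy1 hN, of "(t, x)"] p tx(1) by simp
    ultimately show "fderiv N p (0, w) = ?H (Wj p) (fderiv y p (0, w))" by (simp add: tx(1))
  qed
  define \<pi> where "\<pi> x = fderiv P (0, x) (1, 0)" for x
  have Ut: "fderiv U (0, x) (1, 0) = snd (X (q x))" and yt: "fderiv y (0, x) (1, 0) = fst (X (q x))" if "x \<in> ?B1" for x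
  proof -
    have xB: "x \<in> ?B" using that by (simp add: R1_def)
    have p: "(0, x) \<in> ?T \<times> ?B" using T0 xB by simp
    show "fderiv U (0, x) (1, 0) = snd (X (q x))" "fderiv y (0, x) (1, 0) = fst (X (q x))"
      unfolding U_def y_def using fderiv_snd[OF hC p] fderiv_fst[OF hC p] Ct(1)[OF T0 xB] C0[OF xB] by auto
  qed
  show ?thesis
  proof (rule that[of R1 u \<pi>])
    show "0 < R1" by (rule R1)
    show "is_solution o1 \<Omega> F G (ball x1 R1) u"
      by (rule solution_subset[OF u(2)]) (use B(4) in \<open>auto simp: R1_def\<close>)
    show "jet1 o1 u x1 = (x1, u1, p1)" by (rule u(3))
    show "(x, u x) \<in> D" if "x \<in> ball x1 R1" for x using B(1)[of x] that by (simp add: R1_def q_def)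
    show "holo \<pi> ?B1" unfolding \<pi>_def by (rule holo_slice2(1)[OF holo_fderiv_const[OF oP1 hP] T10])
    fix x w assume x: "x \<in> ?B1"
    have p: "(0, x) \<in> T1 \<times> ?B1" using T10 x by simp
    have Nt: "fderiv N (0, x) (1, 0) = (snd (X (x, u x)), \<pi> x)" if "x \<in> ?B1" for x
      unfolding N_def using fderiv_Pair[OF hU1 hP, of "(0, x)"] T10 that Ut[OF that] by (simp add: \<pi>_def q_def)
    have Wt: "fderiv Wj (0, x) (1, 0) = (fst (X (x, u x)), snd (X (x, u x)), \<pi> x)"
      unfolding Wj_def using fderiv_Pair[OF hy1 hN p] Nt[OF x] yt[OF x] by (simp add: q_def)
    \<comment> \<open>The mixed derivative of \<open>N\<close> is computed twice: by exchanging time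
      and space, and from the Pfaffian equation of the moved jets.\<close>
    have "fderiv (\<lambda>p. fderiv N p (0, w)) (0, x) (1, 0) = fderiv (\<lambda>p. fderiv N p (1, 0)) (0, x) (0, w)"
      by (rule fderiv_fderiv_sym[OF oP1 hN p])
    also have "\<dots> = fderiv (\<lambda>x. fderiv N (0, x) (1, 0)) x w"
      using holo_slice2(2)[OF holo_fderiv_const[OF oP1 hN] T10 x] by simp
    also have "\<dots> = fderiv (\<lambda>x. (snd (X (x, u x)), \<pi> x)) x w"
      using holo_cong(2)[OF holo_slice2(1)[OF holo_fderiv_const[OF oP1 hN] T10] open_ball Nt x] by simp
    finally have 1: "fderiv (\<lambda>p. fderiv N p (0, w)) (0, x) (1, 0) = fderiv (\<lambda>x. (snd (X (x, u x)), \<pi> x)) x w" .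
    have hdy: "holo (\<lambda>p. fderiv y p (0, w)) (T1 \<times> ?B1)" by (rule holo_fderiv_const[OF oP1 hy1])
    have "fderiv (\<lambda>p. fderiv N p (0, w)) (0, x) (1, 0) = fderiv (\<lambda>p. ?H (Wj p) (fderiv y p (0, w))) (0, x) (1, 0)"
      using holo_cong(2)[OF holo_fderiv_const[OF oP1 hN] oP1 WD(2) p] by simp
    also have "\<dots> = fderiv (\<lambda>z. ?H z (fderiv y (0, x) (0, w))) (Wj (0, x)) (fderiv Wj (0, x) (1, 0))
        + ?H (Wj (0, x)) (fderiv (\<lambda>p. fderiv y p (0, w)) (0, x) (1, 0))"
      using fderiv_lin_joint[OF holo_pfaff[OF g] _ hW hdy _ p, of "(1, 0)"] WD(1) by (simp add: clinear_pfaff image_subset_iff)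
    also have "fderiv y (0, x) (0, w) = w" by (rule dy0) (use x in \<open>simp add: R1_def\<close>)
    also have "fderiv (\<lambda>p. fderiv y p (0, w)) (0, x) (1, 0) = fderiv (\<lambda>x. fst (X (x, u x))) x w"
    proof -
      have "fderiv (\<lambda>p. fderiv y p (0, w)) (0, x) (1, 0) = fderiv (\<lambda>p. fderiv y p (1, 0)) (0, x) (0, w)"
        by (rule fderiv_fderiv_sym[OF oP1 hy1 p])
      also have "\<dots> = fderiv (\<lambda>x. fderiv y (0, x) (1, 0)) x w"
        using holo_slice2(2)[OF holo_fderiv_const[OF oP1 hy1] T10 x] by simp
      also have "\<dots> = fderiv (\<lambda>x. fst (X (x, u x))) x w"
        using holo_cong(2)[OF holo_slice2(1)[OF holo_fderiv_const[OF oP1 hy1] T10] open_ball yt x] by (simp add: q_def)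
      finally show ?thesis .
    qed
    finally show "fderiv (\<lambda>x. (snd (X (x, u x)), \<pi> x)) x w =
       fderiv (\<lambda>z. ?H z w) (jet1 o1 u x) (fst (X (x, u x)), snd (X (x, u x)), \<pi> x)
       + ?H (jet1 o1 u x) (fderiv (\<lambda>x. fst (X (x, u x))) x w)"
      using 1 by (simp add: Wt W0[OF x])
  qed
qed

text \<open>The 1-form \<open>dw - p dx\<close> of the Pfaffian system, read as a form on the base
  with \<open>p\<close> as a parameter.\<close>

definition contact :: "'m \<Rightarrow> complex ^ 'n \<Rightarrow> ('n::finite, 'm::finite) base \<Rightarrow> complex"
  where "contact o1 p V = snd V $ o1 - (\<Sum>j\<in>UNIV. p $ j * fst V $ j)"

lemma clinear_contact: "clinear (contact o1 p)"
proof -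
  have "clinear (\<lambda>V. snd V $ o1 + (- 1) *\<^sub>C (\<Sum>j\<in>UNIV. p $ j * fst V $ j))"
    by (intro clinear_plus clinear_scaleC clinear_sumI clinear_mult_left clinear_compose[OF clinear_vec_nth] clinear_snd clinear_fst)
  then show ?thesis by (simp add: contact_def[abs_def])
qed

lemma holo_contact:
  assumes p: "holo p S" and V: "holo V S"
  shows "holo (\<lambda>x. contact o1 (p x) (V x)) S"
    and "x \<in> S \<Longrightarrow> fderiv (\<lambda>x. contact o1 (p x) (V x)) x w = contact o1 (p x) (fderiv V x w) - (\<Sum>j\<in>UNIV. fderiv p x w $ j * fst (V x) $ j)"
proof -
  have h1: "holo (\<lambda>x. snd (V x) $ o1) S" by (intro holo_vec_nth holo_snd V)
  have h2: "holo (\<lambda>x. p x $ j * fst (V x) $ j) S" for j by (intro holo_mult holo_vec_nth holo_fst V p)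
  have h3: "holo (\<lambda>x. \<Sum>j\<in>UNIV. p x $ j * fst (V x) $ j) S" by (intro holo_sum h2)
  show "holo (\<lambda>x. contact o1 (p x) (V x)) S" unfolding contact_def by (intro holo_diff h1 h3)
  assume x: "x \<in> S"
  have "fderiv (\<lambda>x. p x $ j * fst (V x) $ j) x w = fderiv p x w $ j * fst (V x) $ j + p x $ j * fst (fderiv V x w) $ j" for j
    using fderiv_mult[OF holo_vec_nth[OF p] holo_vec_nth[OF holo_fst[OF V]] x, of j j w]
      fderiv_vec_nth[OF p x] fderiv_vec_nth[OF holo_fst[OF V] x] fderiv_fst[OF V x] by simp
  moreover have ds: "fderiv (\<lambda>x. \<Sum>j\<in>UNIV. p x $ j * fst (V x) $ j) x w = (\<Sum>j\<in>UNIV. fderiv (\<lambda>x. p x $ j * fst (V x) $ j) x w)"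
    by (rule fderiv_sum[OF h2 x])
  ultimately show "fderiv (\<lambda>x. contact o1 (p x) (V x)) x w = contact o1 (p x) (fderiv V x w) - (\<Sum>j\<in>UNIV. fderiv p x w $ j * fst (V x) $ j)"
    unfolding contact_def using fderiv_diff[OF h1 h3 x] ds fderiv_vec_nth[OF holo_snd[OF V] x] fderiv_snd[OF V x]
    by (simp add: sum.distrib)
qed

text \<open>The \<open>o1\<close> component of the linearized system expresses \<open>\<pi>\<close>
  by the differential of \<open>X\<close>; this is the prolongation formula. Inserting it in the
  other components eliminates \<open>\<pi>\<close> and leaves one equation of first and one of
  second order in \<open>X\<close>. Since a solution passes through every jet, both hold at each jet
  over the base point.\<close>

lemma determining_equations:
  fixes o1 :: "'m::finite" and F :: "('n::finite, 'm) rhs2"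
  assumes g: "good_system o1 \<Omega> F G" and sym: "infinitesimal_symmetry o1 \<Omega> F G D X" and D: "open D"
    and z: "(x1, u1, p1) \<in> \<Omega>" and q1: "(x1, u1) \<in> D"
  defines "H \<equiv> pfaff o1 F G" and "z1 \<equiv> (x1, u1, p1)" and "q1 \<equiv> (x1, u1)"
  defines "T \<equiv> \<lambda>w. (w, fst (H z1 w))"
  defines "\<pi>1 \<equiv> \<chi> j. contact o1 p1 (fderiv X q1 (T (axis j 1)))"
  defines "Y \<equiv> (fst (X q1), snd (X q1), \<pi>1)"
  shows "snd (fderiv X q1 (T w)) = fst (fderiv (\<lambda>z. H z w) z1 Y) + fst (H z1 (fst (fderiv X q1 (T w))))"
    and "contact o1 p1 (fderiv (\<lambda>q. fderiv X q (T (axis i 1))) q1 (T w)) =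
      (\<Sum>j\<in>UNIV. snd (H z1 w) $ j * fst (fderiv X q1 (T (axis i 1))) $ j)
      - contact o1 p1 (fderiv X q1 (0, fst (fderiv (\<lambda>z. H z (axis i 1)) z1 (w, H z1 w))))
      + snd (fderiv (\<lambda>z. H z w) z1 Y) $ i + snd (H z1 (fst (fderiv X q1 (T w)))) $ i"
proof -
  obtain r u \<pi> where r: "0 < r" and sol: "is_solution o1 \<Omega> F G (ball x1 r) u" and jx1: "jet1 o1 u x1 = (x1, u1, p1)"
    and uD: "\<And>x. x \<in> ball x1 r \<Longrightarrow> (x, u x) \<in> D" and h\<pi>: "holo \<pi> (ball x1 r)"
    and eq: "\<And>x w. x \<in> ball x1 r \<Longrightarrow> fderiv (\<lambda>x. (snd (X (x, u x)), \<pi> x)) x w =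
       fderiv (\<lambda>z. pfaff o1 F G z w) (jet1 o1 u x) (fst (X (x, u x)), snd (X (x, u x)), \<pi> x)
       + pfaff o1 F G (jet1 o1 u x) (fderiv (\<lambda>x. fst (X (x, u x))) x w)"
    by (rule symmetry_along_solution[OF g sym D z q1[unfolded q1_def]]) (rule that)
  let ?B = "ball x1 r"
  define J where "J = jet1 o1 u"
  define q where "q x = (x, u x)" for x
  define p where "p x = snd (snd (J x))" for x
  have hX: "holo X D" using sym by (simp add: infinitesimal_symmetry_def)
  have hu: "holo u ?B" using sol by (simp add: is_solution_def)
  have hq: "holo q ?B" unfolding q_def by (intro holo_Pair holo_ident hu)
  have qD: "q ` ?B \<subseteq> D" using uD by (auto simp: q_def)
  have hJ: "holo J ?B" unfolding J_def by (rule solution_jet(1)[OF sol])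
  have dJ: "fderiv J x w = (w, H (J x) w)" if "x \<in> ?B" for x w
    unfolding J_def H_def by (rule solution_jet(2)[OF sol that])
  have J\<Omega>: "J x \<in> \<Omega>" if "x \<in> ?B" for x using sol that by (auto simp: is_solution_def J_def)
  have hp: "holo p ?B" unfolding p_def by (intro holo_snd hJ)
  have dp: "fderiv p x w = snd (H (J x) w)" if "x \<in> ?B" for x w
    unfolding p_def using fderiv_snd[OF holo_snd[OF hJ] that] fderiv_snd[OF hJ that] dJ[OF that] by simp
  have du: "fderiv u x w = fst (H (J x) w)" if "x \<in> ?B" for x w
    using solution_jet(3)[OF sol that] by (simp add: H_def J_def)
  define TT where "TT x w = (w, fst (H (J x) w))" for x w
  have dq: "fderiv q x w = TT x w" if "x \<in> ?B" for x w
    unfolding q_def TT_def using fderiv_Pair[OF holo_ident hu that] du[OF that] by (simp add: fderiv_clinear[OF clinear_id])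
  have hXq: "holo (\<lambda>x. X (q x)) ?B" by (rule holo_compose[OF hX hq qD])
  have dXq: "fderiv (\<lambda>x. X (q x)) x w = fderiv X (q x) (TT x w)" if "x \<in> ?B" for x w
  proof -
    have "q x \<in> D" using qD that by blast
    from fderiv_compose[OF hX this holo_has_derivative[OF hq that]] show ?thesis by (simp add: dq[OF that])
  qed
  have E: "(snd (fderiv X (q x) (TT x w)), fderiv \<pi> x w) = fderiv (\<lambda>z. H z w) (J x) (fst (X (q x)), snd (X (q x)), \<pi> x) + H (J x) (fst (fderiv X (q x) (TT x w)))"
    if x: "x \<in> ?B" for x w
    using eq[OF x, of w] fderiv_Pair[OF holo_snd[OF hXq] h\<pi> x, of w] fderiv_snd[OF hXq x] fderiv_fst[OF hXq x] dXq[OF x]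
    by (simp add: q_def H_def J_def)
  have hH: "holo (\<lambda>z. H z w) \<Omega>" for w unfolding H_def by (rule holo_Hs'[OF g])
  have Ho1: "fst (H z w) $ o1 = (\<Sum>j\<in>UNIV. snd (snd z) $ j * w $ j)" for z w
    by (simp add: H_def pfaff_def rhs_ext_def)
  have dHo1: "fst (fderiv (\<lambda>z. H z w) z \<xi>) $ o1 = (\<Sum>j\<in>UNIV. snd (snd \<xi>) $ j * w $ j)" if "z \<in> \<Omega>" for z w \<xi>
  proof -
    have "fst (fderiv (\<lambda>z. H z w) z \<xi>) $ o1 = fderiv (\<lambda>z. fst (H z w) $ o1) z \<xi>"
      using fderiv_vec_nth[OF holo_fst[OF hH] that] fderiv_fst[OF hH that] by simp
    also have "\<dots> = fderiv (\<lambda>z. \<Sum>j\<in>UNIV. snd (snd z) $ j * w $ j) z \<xi>" by (simp add: Ho1)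
    also have "\<dots> = (\<Sum>j\<in>UNIV. snd (snd \<xi>) $ j * w $ j)"
    proof -
      have "clinear (\<lambda>z::('n,'m) jet. \<Sum>j\<in>UNIV. snd (snd z) $ j * w $ j)"
        by (intro clinear_sumI clinear_mult_right clinear_compose[OF clinear_vec_nth] clinear_compose[OF clinear_snd] clinear_snd)
      from fderiv_clinear[OF this] show ?thesis by simp
    qed
    finally show ?thesis .
  qed
  \<comment> \<open>For the direction \<open>axis j 1\<close> the differential of the row
    \<open>o1\<close> of \<open>H\<close> returns exactly the \<open>j\<close>-th component of
    \<open>\<pi>\<close>.\<close>
  have \<pi>: "\<pi> x $ j = contact o1 (p x) (fderiv X (q x) (TT x (axis j 1)))" if x: "x \<in> ?B" for x j
  proof -
    have "snd (fderiv X (q x) (TT x (axis j 1))) $ o1 = (\<Sum>l\<in>UNIV. \<pi> x $ l * axis j 1 $ l) + (\<Sum>l\<in>UNIV. p x $ l * fst (fderiv X (q x) (TT x (axis j 1))) $ l)"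
      using arg_cong[OF E[OF x, of "axis j 1"], of "\<lambda>v. fst v $ o1"] dHo1[OF J\<Omega>[OF x]] Ho1 by (simp add: p_def)
    then show ?thesis by (simp add: contact_def axis_def if_distrib cong: if_cong)
  qed
  have x1: "x1 \<in> ?B" using r by simp
  have at1: "J x1 = z1" "q x1 = q1" "p x1 = p1" "TT x1 = T" "\<pi> x1 = \<pi>1"
  proof -
    show 1: "J x1 = z1" using jx1 by (simp add: J_def z1_def)
    show 2: "q x1 = q1" using jx1 by (simp add: q_def q1_def jet1_def)
    show 3: "p x1 = p1" using 1 by (simp add: p_def z1_def)
    show 4: "TT x1 = T" by (simp add: TT_def T_def fun_eq_iff 1)
    show "\<pi> x1 = \<pi>1" using \<pi>[OF x1] by (simp add: \<pi>1_def vec_eq_iff 2 3 4)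
  qed
  have E1: "(snd (fderiv X q1 (T w)), fderiv \<pi> x1 w) = fderiv (\<lambda>z. H z w) z1 Y + H z1 (fst (fderiv X q1 (T w)))" for w
    using E[OF x1, of w] by (simp add: at1 Y_def)
  from arg_cong[OF E1, of fst]
  show "snd (fderiv X q1 (T w)) = fst (fderiv (\<lambda>z. H z w) z1 Y) + fst (H z1 (fst (fderiv X q1 (T w))))" by simp
  have hTT: "holo (\<lambda>x. TT x (axis i 1)) ?B" unfolding TT_def
    by (intro holo_Pair holo_const holo_fst holo_compose[OF hH hJ]) (use J\<Omega> in auto)
  have dTT: "fderiv (\<lambda>x. TT x (axis i 1)) x1 w = (0, fst (fderiv (\<lambda>z. H z (axis i 1)) z1 (w, H z1 w)))"
  proof -
    have c: "holo (\<lambda>x. H (J x) (axis i 1)) ?B" by (rule holo_compose[OF hH hJ]) (use J\<Omega> in auto)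
    have "fderiv (\<lambda>x. H (J x) (axis i 1)) x1 w = fderiv (\<lambda>z. H z (axis i 1)) z1 (w, H z1 w)"
      using fderiv_compose[OF hH J\<Omega>[OF x1] holo_has_derivative[OF hJ x1], of "axis i 1" w] dJ[OF x1] by (simp add: at1)
    then show ?thesis unfolding TT_def
      using fderiv_Pair[OF holo_const holo_fst[OF c] x1, of "axis i (1::complex) :: complex ^ 'n"] fderiv_fst[OF c x1]
      by (simp add: fderiv_eqI[OF has_derivative_const])
  qed
  have hV: "holo (\<lambda>x. fderiv X (q x) (TT x (axis i 1))) ?B" by (rule holo_fderiv[OF D hX hq hTT qD])
  have "fderiv \<pi> x1 w $ i = fderiv (\<lambda>x. \<pi> x $ i) x1 w" using fderiv_vec_nth[OF h\<pi> x1] by simp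
  also have "\<dots> = fderiv (\<lambda>x. contact o1 (p x) (fderiv X (q x) (TT x (axis i 1)))) x1 w"
    using holo_cong(2)[OF holo_vec_nth[OF h\<pi>] open_ball \<pi> x1] by simp
  also have "\<dots> = contact o1 p1 (fderiv (\<lambda>x. fderiv X (q x) (TT x (axis i 1))) x1 w) - (\<Sum>j\<in>UNIV. snd (H z1 w) $ j * fst (fderiv X q1 (T (axis i 1))) $ j)"
    using holo_contact(2)[OF hp hV x1] dp[OF x1] by (simp add: at1)
  \<comment> \<open>Along the solution both the base point and the tangent direction vary: the first
    contributes the second differential of \<open>X\<close>, the second a term of first
    order.\<close>
  also have "fderiv (\<lambda>x. fderiv X (q x) (TT x (axis i 1))) x1 w = fderiv (\<lambda>q. fderiv X q (T (axis i 1))) q1 (T w) + fderiv X q1 (0, fst (fderiv (\<lambda>z. H z (axis i 1)) z1 (w, H z1 w)))"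
    using fderiv_fderiv_joint[OF D hX hq hTT qD x1, of w] dq[OF x1] dTT by (simp add: at1)
  finally show "contact o1 p1 (fderiv (\<lambda>q. fderiv X q (T (axis i 1))) q1 (T w)) =
      (\<Sum>j\<in>UNIV. snd (H z1 w) $ j * fst (fderiv X q1 (T (axis i 1))) $ j)
      - contact o1 p1 (fderiv X q1 (0, fst (fderiv (\<lambda>z. H z (axis i 1)) z1 (w, H z1 w))))
      + snd (fderiv (\<lambda>z. H z w) z1 Y) $ i + snd (H z1 (fst (fderiv X q1 (T w)))) $ i"
    using arg_cong[OF E1[of w], of "\<lambda>v. snd v $ i"] by (simp add: clinear_add[OF clinear_contact] algebra_simps)
qed

section \<open>Leading homogeneous parts\<close>

text \<open>\<open>iter_deriv f k (z, v)\<close> is the \<open>k\<close>-th derivative of \<open>t \<mapsto> f (z + t v)\<close> at \<open>0\<close>.\<close>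

primrec iter_deriv :: "('a::complex_normed_space \<Rightarrow> 'b::complex_normed_space) \<Rightarrow> nat \<Rightarrow> 'a \<times> 'a \<Rightarrow> 'b"
where
  "iter_deriv f 0 = (\<lambda>p. f (fst p))"
| "iter_deriv f (Suc k) = (\<lambda>p. fderiv (iter_deriv f k) p (snd p, 0))"

definition taylor_part :: "('a::complex_normed_space \<Rightarrow> 'b::complex_normed_space) \<Rightarrow> nat \<Rightarrow> 'a \<Rightarrow> 'a \<Rightarrow> 'b"
  where "taylor_part f k z v = (1 / fact k) *\<^sub>C iter_deriv f k (z, v)"

text \<open>An entire map with this scaling law is a homogeneous polynomial of degree
  \<open>k\<close>. The law is used instead of monomials because it passes directly to limits and
  derivatives.\<close>

definition homog :: "nat \<Rightarrow> ('a::complex_normed_space \<Rightarrow> 'b::complex_normed_space) \<Rightarrow> bool"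
  where "homog k P \<longleftrightarrow> holo P UNIV \<and> (\<forall>c q. P (c *\<^sub>C q) = c ^ k *\<^sub>C P q)"

lemma holo_iter_deriv:
  fixes f :: "'a::complex_normed_space \<Rightarrow> 'b::cspace"
  assumes "open S" "holo f S"
  shows "holo (iter_deriv f k) (S \<times> UNIV)"
proof (induction k)
  case 0
  show ?case by (simp, rule holo_compose[OF assms(2) holo_clinear_map[OF clinear_fst]]) auto
next
  case (Suc k)
  show ?case
    by (simp, rule holo_fderiv[OF open_Times[OF assms(1) open_UNIV] Suc holo_ident holo_clinear_map[OF clinear_Pair[OF clinear_snd clinear_const0]]]) auto
qed

lemma iter_deriv_scale:
  fixes f :: "'a::complex_normed_space \<Rightarrow> 'b::cspace"
  assumes "open S" "holo f S" "z \<in> S"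
  shows "iter_deriv f k (z, c *\<^sub>C v) = c ^ k *\<^sub>C iter_deriv f k (z, v)"
  using assms(3)
proof (induction k arbitrary: z)
  case (Suc k)
  note h = holo_iter_deriv[OF assms(1,2), of k]
  have s: "holo (\<lambda>z. iter_deriv f k (z, w)) S" "fderiv (\<lambda>z. iter_deriv f k (z, w)) z x = fderiv (iter_deriv f k) (z, w) (x, 0)" for w x
    using holo_slice1[OF h] Suc.prems by auto
  have "iter_deriv f (Suc k) (z, c *\<^sub>C v) = fderiv (\<lambda>z. iter_deriv f k (z, c *\<^sub>C v)) z (c *\<^sub>C v)" by (simp add: s)
  also have "\<dots> = fderiv (\<lambda>z. c ^ k *\<^sub>C iter_deriv f k (z, v)) z (c *\<^sub>C v)"
    using holo_cong(2)[OF s(1) assms(1) Suc.IH Suc.prems] by simp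
  also have "\<dots> = c ^ k *\<^sub>C c *\<^sub>C fderiv (\<lambda>z. iter_deriv f k (z, v)) z v"
    using fderiv_scaleC_left[OF s(1) Suc.prems] clinear_scaleC_D[OF holo_clinear[OF s(1) Suc.prems]] by simp
  finally show ?case by (simp add: s scaleC_scaleC mult.commute)
qed simp

lemma homog_taylor_part:
  fixes f :: "'a::complex_normed_space \<Rightarrow> 'b::cspace"
  assumes "open S" "holo f S" "z \<in> S"
  shows "homog k (taylor_part f k z)"
  unfolding homog_def taylor_part_def
  using iter_deriv_scale[OF assms] holo_slice2(1)[OF holo_iter_deriv[OF assms(1,2)] assms(3)]
  by (auto intro!: holo_scaleC_left simp: scaleC_scaleC mult.commute)

lemma iter_deriv_sum:
  fixes f :: "nat \<Rightarrow> 'a::complex_normed_space \<Rightarrow> 'b::cspace"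
  assumes "open S" "\<And>i. i < N \<Longrightarrow> holo (f i) S" "z \<in> S"
  shows "iter_deriv (\<lambda>z. \<Sum>i<N. c i *\<^sub>C f i z) k (z, v) = (\<Sum>i<N. c i *\<^sub>C iter_deriv (f i) k (z, v))"
  using assms(3)
proof (induction k arbitrary: z v)
  case (Suc k)
  let ?f = "\<lambda>z. \<Sum>i<N. c i *\<^sub>C f i z"
  have hf: "holo ?f S" by (intro holo_sum holo_scaleC_left assms) auto
  have s: "holo (\<lambda>z. iter_deriv (f i) k (z, w)) S" "fderiv (\<lambda>z. iter_deriv (f i) k (z, w)) z x = fderiv (iter_deriv (f i) k) (z, w) (x, 0)" if "i < N" for i w x
    using holo_slice1[OF holo_iter_deriv[OF assms(1) assms(2)[OF that]]] Suc.prems by auto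
  have sf: "holo (\<lambda>z. iter_deriv ?f k (z, w)) S" "fderiv (\<lambda>z. iter_deriv ?f k (z, w)) z x = fderiv (iter_deriv ?f k) (z, w) (x, 0)" for w x
    using holo_slice1[OF holo_iter_deriv[OF assms(1) hf]] Suc.prems by auto
  have "iter_deriv ?f (Suc k) (z, v) = fderiv (\<lambda>z. iter_deriv ?f k (z, v)) z v" by (simp add: sf)
  also have "\<dots> = fderiv (\<lambda>z. \<Sum>i<N. c i *\<^sub>C iter_deriv (f i) k (z, v)) z v"
    using holo_cong(2)[OF sf(1) assms(1) Suc.IH Suc.prems] by simp
  also have "\<dots> = (\<Sum>i<N. fderiv (\<lambda>z. c i *\<^sub>C iter_deriv (f i) k (z, v)) z v)"
    by (rule fderiv_sum[OF _ Suc.prems]) (auto intro!: holo_scaleC_left s)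
  also have "\<dots> = (\<Sum>i<N. c i *\<^sub>C iter_deriv (f i) (Suc k) (z, v))"
    by (rule sum.cong) (auto simp: fderiv_scaleC_left[OF s(1) Suc.prems] s)
  finally show ?case .
qed simp

lemma taylor_part_sum:
  fixes f :: "nat \<Rightarrow> 'a::complex_normed_space \<Rightarrow> 'b::cspace"
  assumes "open S" "\<And>i. i < N \<Longrightarrow> holo (f i) S" "z \<in> S"
  shows "taylor_part (\<lambda>z. \<Sum>i<N. c i *\<^sub>C f i z) k z v = (\<Sum>i<N. c i *\<^sub>C taylor_part (f i) k z v)"
  using iter_deriv_sum[OF assms, where c = c and k = k and v = v]
  by (simp add: taylor_part_def scaleC_sum_right scaleC_scaleC mult.commute)

text \<open>Links \<open>iter_deriv\<close> to the one-variable Taylor coefficients along a complex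
  line, one coordinate at a time.\<close>

lemma iter_deriv_higher_deriv:
  fixes f :: "'a::complex_normed_space \<Rightarrow> 'b::cspace"
  assumes "open S" "holo f S" "z + t *\<^sub>C v \<in> S"
  shows "(deriv ^^ k) (\<lambda>t. cfun b (f (z + t *\<^sub>C v))) t = cfun b (iter_deriv f k (z + t *\<^sub>C v, v))"
  using assms(3)
proof (induction k arbitrary: t)
  case (Suc k)
  let ?S = "(\<lambda>t::complex. z + t *\<^sub>C v) -` S"
  have oS: "open ?S"
    by (rule open_vimage[OF assms(1)]) (rule holo_continuous_on[OF holo_line])
  have hL: "holo (\<lambda>t. iter_deriv f k (z + t *\<^sub>C v, v)) ?S"
    by (rule holo_compose[OF holo_iter_deriv[OF assms(1,2)] holo_Pair[OF holo_line holo_const]]) auto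
  have hk: "holo (\<lambda>t. cfun b (iter_deriv f k (z + t *\<^sub>C v, v))) ?S" by (rule holo_clinear_compose[OF clinear_cfun hL])
  have t: "t \<in> ?S" using Suc.prems by simp
  have "(deriv ^^ Suc k) (\<lambda>t. cfun b (f (z + t *\<^sub>C v))) t = deriv (\<lambda>t. cfun b (iter_deriv f k (z + t *\<^sub>C v, v))) t"
  proof -
    have "\<forall>\<^sub>F t in nhds t. (deriv ^^ k) (\<lambda>t. cfun b (f (z + t *\<^sub>C v))) t = cfun b (iter_deriv f k (z + t *\<^sub>C v, v))"
      using eventually_nhds_in_open[OF oS t] by eventually_elim (use Suc.IH in simp)
    from deriv_cong_ev[OF this refl] show ?thesis by simp
  qed
  also have "\<dots> = fderiv (\<lambda>t. cfun b (iter_deriv f k (z + t *\<^sub>C v, v))) t 1" using fderiv_deriv[OF hk t, of 1] by simp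
  also have "\<dots> = cfun b (fderiv (\<lambda>t. iter_deriv f k (z + t *\<^sub>C v, v)) t 1)" by (rule fderiv_clinear_compose[OF clinear_cfun hL t])
  also have "fderiv (\<lambda>t. iter_deriv f k (z + t *\<^sub>C v, v)) t 1 = fderiv (iter_deriv f k) (z + t *\<^sub>C v, v) (v, 0)"
  proof -
    have "((\<lambda>t. (z + t *\<^sub>C v, v)) has_derivative (\<lambda>h. (h *\<^sub>C v, 0))) (at t)"
      by (intro has_derivative_Pair line_has_derivative has_derivative_const)
    from fderiv_compose[where g = "iter_deriv f k", OF holo_iter_deriv[OF assms(1,2)] _ this, of 1] Suc.prems show ?thesis by simp
  qed
  finally show ?case by simp
qed simp

text \<open>Cauchy's inequality bounds the coefficients by \<open>M / \<rho> ^ j\<close>, so the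
  tail after degree \<open>k\<close> is dominated by a geometric series of ratio
  \<open>cmod t / \<rho>\<close>; with ratio at most 1/2 its sum costs the factor 2.\<close>

lemma scalar_taylor_remainder:
  assumes h: "h holomorphic_on cball 0 \<rho>" and \<rho>: "0 < \<rho>" and M: "\<And>t. t \<in> cball 0 \<rho> \<Longrightarrow> cmod (h t) \<le> M"
    and z: "\<And>j. j < k \<Longrightarrow> (deriv ^^ j) h 0 = 0" and t: "cmod t \<le> \<rho> / 2"
  shows "cmod (h t - (deriv ^^ k) h 0 / fact k * t ^ k) \<le> 2 * M * (cmod t / \<rho>) ^ Suc k"
proof -
  define c where "c j = (deriv ^^ j) h 0 / fact j" for j
  define x where "x = cmod t / \<rho>"
  have x: "0 \<le> x" "x \<le> 1 / 2" using t \<rho> by (auto simp: x_def field_simps)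
  have M0: "0 \<le> M" using M[of 0] \<rho> norm_ge_zero order_trans by (metis centre_in_cball less_imp_le)
  have hb: "h holomorphic_on ball 0 \<rho>" using h holomorphic_on_subset ball_subset_cball by blast
  have cb: "cmod (c j) \<le> M / \<rho> ^ j" for j
  proof -
    have "cmod ((deriv ^^ j) h 0) \<le> fact j * M / \<rho> ^ j"
      by (rule Cauchy_inequality[OF hb holomorphic_on_imp_continuous_on[OF h] \<rho>]) (use M in auto)
    then show ?thesis by (simp add: c_def norm_divide field_simps)
  qed
  have "t \<in> ball 0 \<rho>" using t \<rho> by simp
  from holomorphic_power_series[OF hb this]
  have S: "(\<lambda>j. c j * t ^ j) sums h t" by (simp add: c_def)
  have "(\<Sum>j<Suc k. c j * t ^ j) = c k * t ^ k"
    using z by (simp add: c_def)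
  with sums_split_initial_segment[OF S, of "Suc k"]
  have S': "(\<lambda>j. c (j + Suc k) * t ^ (j + Suc k)) sums (h t - c k * t ^ k)" by simp
  have tb: "cmod (c j * t ^ j) \<le> M * x ^ j" for j
  proof -
    have "cmod (c j * t ^ j) \<le> M / \<rho> ^ j * cmod t ^ j"
      using mult_right_mono[OF cb[of j], of "cmod t ^ j"] by (simp add: norm_mult norm_power)
    then show ?thesis by (simp add: x_def power_divide)
  qed
  have G: "(\<lambda>j. M * x ^ (j + Suc k)) sums (M * x ^ Suc k * (1 / (1 - x)))"
    using sums_mult[OF geometric_sums[of x], of "M * x ^ Suc k"] x by (simp add: power_add mult_ac)
  have "cmod (h t - c k * t ^ k) \<le> M * x ^ Suc k * (1 / (1 - x))"
    unfolding sums_unique[OF G] sums_unique[OF S']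
    by (rule norm_suminf_le[OF tb sums_summable[OF G]])
  also have "\<dots> \<le> M * x ^ Suc k * 2"
    by (rule mult_left_mono) (use x M0 in \<open>auto simp: field_simps\<close>)
  finally show ?thesis by (simp add: c_def x_def mult_ac)
qed

text \<open>The scalar estimate on the line in direction \<open>v\<close>, for each
  \<open>cfun b\<close>. The constant collects a factor 2 from \<open>norm_cfun\<close>, a factor 2
  from the geometric tail and the number of basis vectors.\<close>

lemma taylor_part_remainder:
  fixes f :: "'a::complex_normed_space \<Rightarrow> 'b::cspace"
  assumes S: "open S" "holo f S" "cball z \<rho> \<subseteq> S" and \<rho>: "0 < \<rho>" and M: "\<And>w. w \<in> cball z \<rho> \<Longrightarrow> norm (f w) \<le> M"
    and z: "\<And>j v. j < k \<Longrightarrow> taylor_part f j z v = 0" and t: "0 \<le> t" "t * norm v \<le> \<rho> / 2"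
  shows "norm (f (z + t *\<^sub>R v) - t ^ k *\<^sub>R taylor_part f k z v) \<le> 4 * real DIM('b) * M * (t * norm v / \<rho>) ^ Suc k"
proof (cases "v = 0 \<or> t = 0")
  \<comment> \<open>For \<open>v = 0\<close> the disc radius \<open>\<rho> / norm v\<close> is
    meaningless; in these degenerate cases the remainder is exactly 0.\<close>
  case True
  have zS: "z \<in> S" using S(3) \<rho> by auto
  have k0: "k = 0 \<or> f z = 0" using z[of 0 v] by (auto simp: taylor_part_def)
  have "taylor_part f k z (0 *\<^sub>C v) = 0 ^ k *\<^sub>C taylor_part f k z v" using homog_taylor_part[OF S(1,2) zS, of k] unfolding homog_def by blast
  moreover have "taylor_part f 0 z v = f z" for v by (simp add: taylor_part_def)
  ultimately have "f (z + t *\<^sub>R v) - t ^ k *\<^sub>R taylor_part f k z v = 0"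
    using True k0 by (cases "k = 0") (auto simp: power_0_left)
  moreover have "0 \<le> M" using M[of z] \<rho> norm_ge_zero order_trans by (metis centre_in_cball less_imp_le)
  ultimately show ?thesis using t \<rho> by simp
next
  case False
  then have nv: "norm v > 0" by simp
  have zS: "z \<in> S" using S(3) \<rho> by auto
  define r where "r = \<rho> / norm v"
  have r: "r > 0" using \<rho> nv by (simp add: r_def)
  have inb: "z + s *\<^sub>C v \<in> cball z \<rho>" if "s \<in> cball 0 r" for s
    using that nv by (simp add: dist_norm norm_scaleC r_def field_simps)
  have "cmod (cfun b (f (z + t *\<^sub>R v) - t ^ k *\<^sub>R taylor_part f k z v)) \<le> 4 * M * (t * norm v / \<rho>) ^ Suc k" if b: "b \<in> Basis" for b
  proof -
    let ?h = "\<lambda>s. cfun b (f (z + s *\<^sub>C v))"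
    have hh: "holo ?h (cball 0 r)"
      by (rule holo_clinear_compose[OF clinear_cfun holo_compose[OF S(2) holo_line]]) (use inb S(3) in blast)
    have d: "(deriv ^^ j) ?h 0 = fact j * cfun b (taylor_part f j z v)" for j
      using iter_deriv_higher_deriv[OF S(1,2), of z 0 v j b] zS by (simp add: taylor_part_def clinear_scaleC_D[OF clinear_cfun])
    have "cmod (?h (of_real t) - (deriv ^^ k) ?h 0 / fact k * of_real t ^ k) \<le> 2 * (2 * M) * (cmod (of_real t) / r) ^ Suc k"
    proof (rule scalar_taylor_remainder[OF holo_holomorphic_on[OF hh] r])
      show "cmod (?h s) \<le> 2 * M" if "s \<in> cball 0 r" for s
        using norm_cfun[OF b, of "f (z + s *\<^sub>C v)"] M[OF inb[OF that]] by linarith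
      show "(deriv ^^ j) ?h 0 = 0" if "j < k" for j using d[of j] z[OF that] by (simp add: clinear_zero[OF clinear_cfun])
      show "cmod (of_real t) \<le> r / 2" using t nv by (simp add: r_def field_simps)
    qed
    moreover have e1: "?h (of_real t) - (deriv ^^ k) ?h 0 / fact k * of_real t ^ k = cfun b (f (z + t *\<^sub>R v) - t ^ k *\<^sub>R taylor_part f k z v)"
      using d[of k] by (simp add: scaleC_of_real clinear_diff[OF clinear_cfun] clinear_scaleR[OF clinear_cfun] scaleR_conv_of_real mult.commute)
    moreover have e2: "cmod (of_real t) / r = t * norm v / \<rho>" using t(1) by (simp add: r_def)
    ultimately show ?thesis unfolding e1 e2 by simp
  qed
  then have "(\<Sum>b\<in>(Basis::'b set). cmod (cfun b (f (z + t *\<^sub>R v) - t ^ k *\<^sub>R taylor_part f k z v))) \<le> (\<Sum>b\<in>(Basis::'b set). 4 * M * (t * norm v / \<rho>) ^ Suc k)"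
    by (rule sum_mono)
  from order_trans[OF norm_le_cfun this] show ?thesis by (simp add: mult_ac)
qed

text \<open>The remainder estimate holds in every degree with the same constant, and its ratio is
  below 1 near \<open>z\<close>.\<close>

lemma taylor_part_all_zero:
  fixes f :: "'a::complex_normed_space \<Rightarrow> 'b::cspace"
  assumes S: "open S" "holo f S" "z \<in> S" and z: "\<And>j v. taylor_part f j z v = 0"
  shows "\<forall>\<^sub>F w in nhds z. f w = 0"
proof -
  obtain \<rho> M where \<rho>: "\<rho> > 0" "M > 0" "cball z \<rho> \<subseteq> S" "\<And>w. w \<in> cball z \<rho> \<Longrightarrow> norm (f w) \<le> M"
    by (rule loc_bounds[OF S(1,3,2)]) (rule that)
  have "f w = 0" if w: "dist w z < \<rho> / 2" for w
  proof -
    define v where "v = w - z"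
    have v: "norm v \<le> \<rho> / 2" using w by (simp add: v_def dist_norm)
    have x: "0 \<le> norm v / \<rho>" "norm v / \<rho> < 1" using v \<rho>(1) by (auto simp: field_simps)
    have "norm (f (z + 1 *\<^sub>R v) - 1 ^ k *\<^sub>R taylor_part f k z v) \<le> 4 * real DIM('b) * M * (1 * norm v / \<rho>) ^ Suc k" for k
      by (rule taylor_part_remainder[OF S(1,2) \<rho>(3,1,4) z]) (use v in auto)
    then have "norm (f w) \<le> 4 * real DIM('b) * M * (norm v / \<rho>) ^ Suc k" for k by (simp add: z v_def)
    moreover have "(\<lambda>k. 4 * real DIM('b) * M * (norm v / \<rho>) ^ Suc k) \<longlonglongrightarrow> 4 * real DIM('b) * M * 0"
      by (intro tendsto_mult tendsto_const LIMSEQ_Suc LIMSEQ_power_zero) (use x in auto)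
    ultimately have "norm (f w) \<le> 4 * real DIM('b) * M * 0"
      by (intro LIMSEQ_le_const[of _ _ "norm (f w)"]) auto
    then show ?thesis by simp
  qed
  then show ?thesis unfolding eventually_nhds_metric using \<rho>(1) by (intro exI[of _ "\<rho> / 2"]) auto
qed

text \<open>The dilation by \<open>1 / Suc n\<close> divides the part of degree \<open>j\<close> by
  the \<open>j\<close>-th power of \<open>Suc n\<close>. After multiplication by the
  \<open>k\<close>-th power the part of degree \<open>k\<close> is unchanged and the remainder is of
  size \<open>C / Suc n\<close>.\<close>

lemma leading_loc_lim:
  fixes f :: "'a::complex_normed_space \<Rightarrow> 'b::cspace"
  assumes S: "open S" "holo f S" "z \<in> S" and z: "\<And>j v. j < k \<Longrightarrow> taylor_part f j z v = 0"
  shows "loc_lim (\<lambda>n v. (real (Suc n)) ^ k *\<^sub>R f (z + v /\<^sub>R real (Suc n))) (taylor_part f k z) UNIV"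
  unfolding loc_lim_def
proof
  fix v0 :: 'a
  obtain \<rho> M where \<rho>: "\<rho> > 0" "M > 0" "cball z \<rho> \<subseteq> S" "\<And>w. w \<in> cball z \<rho> \<Longrightarrow> norm (f w) \<le> M"
    by (rule loc_bounds[OF S(1,3,2)]) (rule that)
  define V where "V = norm v0 + 1"
  have V: "V > 0" by (simp add: V_def add_nonneg_pos)
  have vV: "norm v \<le> V" if "v \<in> ball v0 1" for v
    using that norm_triangle_sub[of v v0] by (simp add: V_def dist_norm norm_minus_commute)
  have lim0: "(\<lambda>n. c / real (Suc n)) \<longlonglongrightarrow> 0" for c
    using tendsto_mult[OF tendsto_const[of c] LIMSEQ_inverse_real_of_nat] by (simp add: divide_inverse)
  have ev: "\<forall>\<^sub>F n in sequentially. V / real (Suc n) < \<rho> / 2"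
    using order_tendstoD(2)[OF lim0, of "\<rho> / 2"] \<rho>(1) by simp
  have small: "norm (v /\<^sub>R real (Suc n)) \<le> V / real (Suc n)" if "v \<in> ball v0 1" for v n
    using divide_right_mono[OF vV[OF that], of "real (Suc n)"] by (simp add: divide_inverse mult.commute del: of_nat_Suc)
  show "\<exists>r>0. (\<forall>\<^sub>F n in sequentially. holo (\<lambda>v. real (Suc n) ^ k *\<^sub>R f (z + v /\<^sub>R real (Suc n))) (ball v0 r)) \<and>
      uniform_limit (ball v0 r) (\<lambda>n v. real (Suc n) ^ k *\<^sub>R f (z + v /\<^sub>R real (Suc n))) (taylor_part f k z) sequentially"
  proof (intro exI[of _ 1] conjI)
    show "\<forall>\<^sub>F n in sequentially. holo (\<lambda>v. real (Suc n) ^ k *\<^sub>R f (z + v /\<^sub>R real (Suc n))) (ball v0 1)"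
      using ev
    proof eventually_elim
      case (elim n)
      have "holo (\<lambda>v::'a. complex_of_real (inverse (real (Suc n))) *\<^sub>C v) T" for T
        by (intro holo_scaleC_left holo_ident)
      then have a: "holo (\<lambda>v::'a. z + v /\<^sub>R real (Suc n)) T" for T
        unfolding scaleC_of_real by (intro holo_add holo_const)
      have "holo (\<lambda>v. complex_of_real (real (Suc n) ^ k) *\<^sub>C f (z + v /\<^sub>R real (Suc n))) (ball v0 1)"
      proof (intro holo_scaleC_left holo_compose[OF S(2) a], clarify)
        fix v assume "v \<in> ball v0 1"
        then have "norm (v /\<^sub>R real (Suc n)) < \<rho> / 2" using small elim by (meson le_less_trans)
        then have "norm (v /\<^sub>R real (Suc n)) \<le> \<rho>" using \<rho>(1) by linarith
        then have "z + v /\<^sub>R real (Suc n) \<in> cball z \<rho>" by (simp add: dist_norm del: of_nat_Suc)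
        then show "z + v /\<^sub>R real (Suc n) \<in> S" using \<rho>(3) by blast
      qed
      then show ?case unfolding scaleC_of_real .
    qed
    show "uniform_limit (ball v0 1) (\<lambda>n v. real (Suc n) ^ k *\<^sub>R f (z + v /\<^sub>R real (Suc n))) (taylor_part f k z) sequentially"
    proof (rule uniform_limitI)
      fix e :: real assume e: "e > 0"
      define C where "C = 4 * real DIM('b) * M * (V / \<rho>) ^ Suc k"
      have "\<forall>\<^sub>F n in sequentially. C / real (Suc n) < e" by (rule order_tendstoD(2)[OF lim0 e])
      with ev show "\<forall>\<^sub>F n in sequentially. \<forall>v\<in>ball v0 1. dist (real (Suc n) ^ k *\<^sub>R f (z + v /\<^sub>R real (Suc n))) (taylor_part f k z v) < e"
      proof eventually_elim
        case (elim n)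
        show ?case
        proof
          fix v assume v: "v \<in> ball v0 1"
          define t where "t = inverse (real (Suc n))"
          have t: "0 < t" "real (Suc n) * t = 1" by (auto simp: t_def simp del: of_nat_Suc)
          have tV: "t * norm v \<le> t * V" using vV[OF v] t(1) by simp
          have tV2: "t * V < \<rho> / 2" using elim(1) unfolding t_def divide_inverse[of V] by (simp only: mult.commute)
          have "norm (f (z + t *\<^sub>R v) - t ^ k *\<^sub>R taylor_part f k z v) \<le> 4 * real DIM('b) * M * (t * norm v / \<rho>) ^ Suc k"
            by (rule taylor_part_remainder[OF S(1,2) \<rho>(3,1,4) z]) (use t tV tV2 in linarith)+
          also have "\<dots> \<le> 4 * real DIM('b) * M * (t * V / \<rho>) ^ Suc k"
            using \<rho> t tV by (intro mult_left_mono power_mono divide_right_mono) auto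
          also have "\<dots> = C * t ^ Suc k" by (simp add: C_def power_mult_distrib power_divide)
          finally have "real (Suc n) ^ k * norm (f (z + t *\<^sub>R v) - t ^ k *\<^sub>R taylor_part f k z v) \<le> real (Suc n) ^ k * (C * t ^ Suc k)"
            by (rule mult_left_mono) simp
          also have "\<dots> = C * (real (Suc n) * t) ^ k * t" by (simp only: power_mult_distrib power_Suc mult_ac)
          also have "\<dots> = C / real (Suc n)" unfolding t(2) by (simp add: t_def divide_inverse)
          also have "\<dots> < e" by (rule elim(2))
          finally have 1: "real (Suc n) ^ k * norm (f (z + t *\<^sub>R v) - t ^ k *\<^sub>R taylor_part f k z v) < e" .
          have "real (Suc n) ^ k *\<^sub>R f (z + t *\<^sub>R v) - taylor_part f k z v = real (Suc n) ^ k *\<^sub>R (f (z + t *\<^sub>R v) - t ^ k *\<^sub>R taylor_part f k z v)"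
            using t(2) by (simp add: scaleR_diff_right del: of_nat_Suc flip: power_mult_distrib)
          then show "dist (real (Suc n) ^ k *\<^sub>R f (z + v /\<^sub>R real (Suc n))) (taylor_part f k z v) < e"
            using 1 by (simp add: dist_norm t_def del: of_nat_Suc)
        qed
      qed
    qed
  qed simp
qed

text \<open>Makes the limit theorem applicable a second time, to second differentials.\<close>

lemma loc_lim_fderiv_const:
  fixes f :: "nat \<Rightarrow> 'a::complex_normed_space \<Rightarrow> 'b::cspace"
  assumes "loc_lim f g S"
  shows "loc_lim (\<lambda>n z. fderiv (f n) z v) (\<lambda>z. fderiv g z v) S"
  unfolding loc_lim_def
proof
  fix z assume z: "z \<in> S"
  obtain r where r: "r > 0" "holo g (ball z r)" "\<forall>\<^sub>F n in sequentially. holo (f n) (ball z r)"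
    "\<And>e. e > 0 \<Longrightarrow> \<forall>\<^sub>F n in sequentially. \<forall>w\<in>ball z r. \<forall>v. norm (fderiv (f n) w v - fderiv g w v) \<le> e * norm v"
    by (rule loc_lim_main[OF assms z]) (rule that)
  show "\<exists>r>0. (\<forall>\<^sub>F n in sequentially. holo (\<lambda>z. fderiv (f n) z v) (ball z r)) \<and>
      uniform_limit (ball z r) (\<lambda>n z. fderiv (f n) z v) (\<lambda>z. fderiv g z v) sequentially"
  proof (intro exI[of _ r] conjI r(1))
    show "\<forall>\<^sub>F n in sequentially. holo (\<lambda>z. fderiv (f n) z v) (ball z r)"
      using r(3) by eventually_elim (rule holo_fderiv_const[OF open_ball])
    show "uniform_limit (ball z r) (\<lambda>n z. fderiv (f n) z v) (\<lambda>z. fderiv g z v) sequentially"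
    proof (rule uniform_limitI)
      fix e :: real assume e: "e > 0"
      have p: "norm v + 1 > 0" by (simp add: add_nonneg_pos)
      have "e / (norm v + 1) > 0" using e p by simp
      from r(4)[OF this]
      show "\<forall>\<^sub>F n in sequentially. \<forall>w\<in>ball z r. dist (fderiv (f n) w v) (fderiv g w v) < e"
      proof eventually_elim
        case (elim n)
        have "e / (norm v + 1) * norm v < e"
          using p e by (simp add: divide_simps)
        then show ?case using elim unfolding dist_norm by (blast intro: le_less_trans)
      qed
    qed
  qed
qed

text \<open>The direction \<open>a n\<close> of the inner differential varies with \<open>n\<close>.
  Expanding it in the real basis leaves finitely many fixed directions, to which
  \<open>loc_lim_fderiv_const\<close> applies.\<close>

lemma loc_lim_fderiv2_tendsto:
  fixes f :: "nat \<Rightarrow> 'a::cspace \<Rightarrow> 'b::cspace"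
  assumes L: "loc_lim f g S" and z: "z \<in> S" and a: "a \<longlonglongrightarrow> a0" and b: "b \<longlonglongrightarrow> b0"
  shows "(\<lambda>n. fderiv (\<lambda>z. fderiv (f n) z (a n)) z (b n)) \<longlonglongrightarrow> fderiv (\<lambda>z. fderiv g z a0) z b0"
proof -
  have expand: "fderiv (\<lambda>z. fderiv f z a) z b = (\<Sum>i\<in>Basis. (a \<bullet> i) *\<^sub>R fderiv (\<lambda>z. fderiv f z i) z b)"
    if h: "holo f (ball z r)" "r > 0" for f :: "'a \<Rightarrow> 'b" and r a b
  proof -
    have zr: "z \<in> ball z r" using h(2) by simp
    have hd: "holo (\<lambda>z. fderiv f z i) (ball z r)" for i by (rule holo_fderiv_const[OF open_ball h(1)])
    have hs: "holo (\<lambda>z. complex_of_real (a \<bullet> i) *\<^sub>C fderiv f z i) (ball z r)" for i by (rule holo_scaleC_left[OF hd])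
    have e: "fderiv f z' a = (\<Sum>i\<in>Basis. complex_of_real (a \<bullet> i) *\<^sub>C fderiv f z' i)" if "z' \<in> ball z r" for z'
    proof -
      have c: "clinear (fderiv f z')" by (rule holo_clinear[OF h(1) that])
      have "fderiv f z' a = fderiv f z' (\<Sum>i\<in>Basis. (a \<bullet> i) *\<^sub>R i)" by (simp add: euclidean_representation)
      then show ?thesis by (simp add: clinear_sum[OF c] clinear_scaleR[OF c] scaleC_of_real)
    qed
    have "fderiv (\<lambda>z. fderiv f z a) z b = fderiv (\<lambda>z. \<Sum>i\<in>Basis. complex_of_real (a \<bullet> i) *\<^sub>C fderiv f z i) z b"
      using holo_cong(2)[OF hd open_ball e zr] by simp
    also have "\<dots> = (\<Sum>i\<in>Basis. fderiv (\<lambda>z. complex_of_real (a \<bullet> i) *\<^sub>C fderiv f z i) z b)"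
      by (rule fderiv_sum[OF hs zr])
    also have "\<dots> = (\<Sum>i\<in>Basis. (a \<bullet> i) *\<^sub>R fderiv (\<lambda>z. fderiv f z i) z b)"
    proof (rule sum.cong[OF refl])
      fix i
      show "fderiv (\<lambda>z. complex_of_real (a \<bullet> i) *\<^sub>C fderiv f z i) z b = (a \<bullet> i) *\<^sub>R fderiv (\<lambda>z. fderiv f z i) z b"
        unfolding fderiv_scaleC_left[OF hd zr] by (rule scaleC_of_real)
    qed
    finally show ?thesis .
  qed
  obtain r where r: "r > 0" "holo g (ball z r)" "\<forall>\<^sub>F n in sequentially. holo (f n) (ball z r)"
    by (rule loc_lim_main[OF L z]) (rule that)
  have "(\<lambda>n. \<Sum>i\<in>Basis. (a n \<bullet> i) *\<^sub>R fderiv (\<lambda>z. fderiv (f n) z i) z (b n)) \<longlonglongrightarrow> (\<Sum>i\<in>Basis. (a0 \<bullet> i) *\<^sub>R fderiv (\<lambda>z. fderiv g z i) z b0)"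
    by (intro tendsto_sum tendsto_scaleR tendsto_inner a tendsto_const loc_lim_fderiv_tendsto[OF loc_lim_fderiv_const[OF L] z b])
  then have "(\<lambda>n. \<Sum>i\<in>Basis. (a n \<bullet> i) *\<^sub>R fderiv (\<lambda>z. fderiv (f n) z i) z (b n)) \<longlonglongrightarrow> fderiv (\<lambda>z. fderiv g z a0) z b0"
    unfolding expand[OF r(2,1), of a0 b0, symmetric] .
  moreover have "\<forall>\<^sub>F n in sequentially. (\<Sum>i\<in>Basis. (a n \<bullet> i) *\<^sub>R fderiv (\<lambda>z. fderiv (f n) z i) z (b n)) = fderiv (\<lambda>z. fderiv (f n) z (a n)) z (b n)"
    using r(3) by eventually_elim (rule expand[OF _ r(1), symmetric])
  ultimately show ?thesis by (rule Lim_transform_eventually)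
qed

text \<open>The determining equations with coefficients frozen at one base point and only the terms of
  top order kept.  \<open>L w\<close> stands for \<open>\<Sum>\<^sub>j G\<^sup>k\<^sub>j w\<^sub>j\<close> and \<open>K w\<close> for its derivative in the gradient variable.\<close>

definition varpi :: "'m \<Rightarrow> complex ^ 'n \<Rightarrow> (complex ^ 'n \<Rightarrow> complex ^ 'm) \<Rightarrow>
    (('n::finite, 'm::finite) base \<Rightarrow> ('n, 'm) base) \<Rightarrow> ('n, 'm) base \<Rightarrow> complex ^ 'n"
  where "varpi o1 p L P q = (\<chi> j. contact o1 p (fderiv P q (axis j 1, L (axis j 1))))"

definition frozen :: "'m \<Rightarrow> complex ^ 'n \<Rightarrow> (complex ^ 'n \<Rightarrow> complex ^ 'm) \<Rightarrow>
    (complex ^ 'n \<Rightarrow> complex ^ 'n \<Rightarrow> complex ^ 'm) \<Rightarrow> (('n::finite, 'm::finite) base \<Rightarrow> ('n, 'm) base) \<Rightarrow> bool"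
  where "frozen o1 p L K P \<longleftrightarrow>
    (\<forall>q w. snd (fderiv P q (w, L w)) = K w (varpi o1 p L P q) + L (fst (fderiv P q (w, L w)))) \<and>
    (\<forall>q i w. contact o1 p (fderiv (\<lambda>q. fderiv P q (axis i 1, L (axis i 1))) q (w, L w)) = 0)"

lemma tendsto_clinear: "clinear f \<Longrightarrow> (a \<longlongrightarrow> l) net \<Longrightarrow> ((\<lambda>n. f (a n)) \<longlongrightarrow> f l) net"
  by (rule bounded_linear.tendsto[OF clinear_bounded_linear])

text \<open>One limit argument serves two purposes: the dilations at a fixed parameter, where the
  coefficients still depend on the point \<open>q\<close>, and the passage of the parameter to the
  origin.\<close>

lemma frozen_limit:
  fixes Pn :: "nat \<Rightarrow> ('n::finite, 'm::finite) base \<Rightarrow> ('n, 'm) base"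
  assumes P: "loc_lim Pn P UNIV"
    and T: "\<And>q w. (\<lambda>n. Tn n q w) \<longlonglongrightarrow> (w, L w)"
    and K: "\<And>q w \<pi> \<pi>0. \<pi> \<longlonglongrightarrow> \<pi>0 \<Longrightarrow> (\<lambda>n. Kn n q w (\<pi> n)) \<longlonglongrightarrow> K w \<pi>0"
    and L: "\<And>q a a0. a \<longlonglongrightarrow> a0 \<Longrightarrow> (\<lambda>n. Lq n q (a n)) \<longlonglongrightarrow> L a0"
    and e1: "\<And>q w. \<forall>\<^sub>F n in sequentially. snd (fderiv (Pn n) q (Tn n q w)) =
        Kn n q w (\<chi> j. contact o1 p (fderiv (Pn n) q (Tn n q (axis j 1)))) + Lq n q (fst (fderiv (Pn n) q (Tn n q w)))"
    and e2: "\<And>q i w. (\<lambda>n. contact o1 p (fderiv (\<lambda>q'. fderiv (Pn n) q' (Tn n q (axis i 1))) q (Tn n q w))) \<longlonglongrightarrow> 0"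
  shows "frozen o1 p L K P"
  unfolding frozen_def
proof (intro conjI allI)
  fix q w
  have d: "(\<lambda>n. fderiv (Pn n) q (Tn n q w)) \<longlonglongrightarrow> fderiv P q (w, L w)" for w
    by (rule loc_lim_fderiv_tendsto[OF P UNIV_I T])
  have "(\<lambda>n. \<chi> j. contact o1 p (fderiv (Pn n) q (Tn n q (axis j 1)))) \<longlonglongrightarrow> varpi o1 p L P q"
    unfolding varpi_def by (intro tendsto_vec_lambda tendsto_clinear[OF clinear_contact] d)
  then have r: "(\<lambda>n. Kn n q w (\<chi> j. contact o1 p (fderiv (Pn n) q (Tn n q (axis j 1)))) + Lq n q (fst (fderiv (Pn n) q (Tn n q w))))
      \<longlonglongrightarrow> K w (varpi o1 p L P q) + L (fst (fderiv P q (w, L w)))"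
    by (intro tendsto_add K L tendsto_fst d)
  have l: "(\<lambda>n. snd (fderiv (Pn n) q (Tn n q w))) \<longlonglongrightarrow> snd (fderiv P q (w, L w))" by (intro tendsto_snd d)
  show "snd (fderiv P q (w, L w)) = K w (varpi o1 p L P q) + L (fst (fderiv P q (w, L w)))"
    by (rule LIMSEQ_unique[OF Lim_transform_eventually[OF l e1] r])
next
  fix q i w
  have "(\<lambda>n. contact o1 p (fderiv (\<lambda>q'. fderiv (Pn n) q' (Tn n q (axis i 1))) q (Tn n q w)))
      \<longlonglongrightarrow> contact o1 p (fderiv (\<lambda>q. fderiv P q (axis i 1, L (axis i 1))) q (w, L w))"
    by (intro tendsto_clinear[OF clinear_contact] loc_lim_fderiv2_tendsto[OF P UNIV_I] T)
  from LIMSEQ_unique[OF this e2]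
  show "contact o1 p (fderiv (\<lambda>q. fderiv P q (axis i 1, L (axis i 1))) q (w, L w)) = 0" .
qed

text \<open>The right sides of the two determining equations at the jet \<open>z\<close>, as functions of the value \<open>a\<close>
  and the differential \<open>D\<close> of the vector field at the base point.  They are of lower order than the
  left sides, up to the terms kept in \<open>frozen\<close>.\<close>

definition jet_dir :: "'m \<Rightarrow> ('n, 'm) rhs2 \<Rightarrow> ('n::finite, 'm::finite) rhs1 \<Rightarrow> ('n, 'm) jet \<Rightarrow> complex ^ 'n \<Rightarrow> ('n, 'm) base"
  where "jet_dir o1 F G z w = (w, fst (pfaff o1 F G z w))"

definition prolong :: "'m \<Rightarrow> ('n, 'm) rhs2 \<Rightarrow> ('n::finite, 'm::finite) rhs1 \<Rightarrow> ('n, 'm) jet \<Rightarrow>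
    ('n, 'm) base \<Rightarrow> (('n, 'm) base \<Rightarrow> ('n, 'm) base) \<Rightarrow> ('n, 'm) jet"
  where "prolong o1 F G z a D = (fst a, snd a, \<chi> j. contact o1 (snd (snd z)) (D (jet_dir o1 F G z (axis j 1))))"

definition det1 :: "'m \<Rightarrow> ('n, 'm) rhs2 \<Rightarrow> ('n::finite, 'm::finite) rhs1 \<Rightarrow> ('n, 'm) jet \<Rightarrow>
    complex ^ 'n \<Rightarrow> ('n, 'm) base \<Rightarrow> (('n, 'm) base \<Rightarrow> ('n, 'm) base) \<Rightarrow> complex ^ 'm"
  where "det1 o1 F G z w a D = fst (fderiv (\<lambda>z. pfaff o1 F G z w) z (prolong o1 F G z a D)) + fst (pfaff o1 F G z (fst (D (jet_dir o1 F G z w))))"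

definition det2 :: "'m \<Rightarrow> ('n, 'm) rhs2 \<Rightarrow> ('n::finite, 'm::finite) rhs1 \<Rightarrow> ('n, 'm) jet \<Rightarrow> 'n \<Rightarrow>
    complex ^ 'n \<Rightarrow> ('n, 'm) base \<Rightarrow> (('n, 'm) base \<Rightarrow> ('n, 'm) base) \<Rightarrow> complex"
  where "det2 o1 F G z i w a D =
      (\<Sum>j\<in>UNIV. snd (pfaff o1 F G z w) $ j * fst (D (jet_dir o1 F G z (axis i 1))) $ j)
      - contact o1 (snd (snd z)) (D (0, fst (fderiv (\<lambda>z. pfaff o1 F G z (axis i 1)) z (w, pfaff o1 F G z w))))
      + snd (fderiv (\<lambda>z. pfaff o1 F G z w) z (prolong o1 F G z a D)) $ i + snd (pfaff o1 F G z (fst (D (jet_dir o1 F G z w)))) $ i"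

definition determining :: "'m \<Rightarrow> ('n, 'm) jet set \<Rightarrow> ('n, 'm) rhs2 \<Rightarrow> ('n::finite, 'm::finite) rhs1 \<Rightarrow>
    ('n, 'm) base set \<Rightarrow> (('n, 'm) base \<Rightarrow> ('n, 'm) base) \<Rightarrow> bool"
  where "determining o1 \<Omega> F G D X \<longleftrightarrow> holo X D \<and>
    (\<forall>q p w i. (fst q, snd q, p) \<in> \<Omega> \<longrightarrow> q \<in> D \<longrightarrow> (let z = (fst q, snd q, p) in
      snd (fderiv X q (jet_dir o1 F G z w)) = det1 o1 F G z w (X q) (fderiv X q) \<and>
      contact o1 p (fderiv (\<lambda>q. fderiv X q (jet_dir o1 F G z (axis i 1))) q (jet_dir o1 F G z w)) = det2 o1 F G z i w (X q) (fderiv X q)))"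

lemma symmetry_determining:
  assumes g: "good_system o1 \<Omega> F G" and sym: "infinitesimal_symmetry o1 \<Omega> F G D X" and D: "open D"
  shows "determining o1 \<Omega> F G D X"
  unfolding determining_def Let_def
proof (intro conjI allI impI)
  show "holo X D" using sym by (simp add: infinitesimal_symmetry_def)
  fix q p w i assume "(fst q, snd q, p) \<in> \<Omega>" "q \<in> D"
  then have *: "(fst q, snd q, p) \<in> \<Omega>" "(fst q, snd q) \<in> D" by auto
  show "snd (fderiv X q (jet_dir o1 F G (fst q, snd q, p) w)) = det1 o1 F G (fst q, snd q, p) w (X q) (fderiv X q)"
    using determining_equations(1)[OF g sym D *, of w] by (simp add: det1_def prolong_def jet_dir_def)
  show "contact o1 p (fderiv (\<lambda>q'. fderiv X q' (jet_dir o1 F G (fst q, snd q, p) (axis i 1))) q (jet_dir o1 F G (fst q, snd q, p) w))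
      = det2 o1 F G (fst q, snd q, p) i w (X q) (fderiv X q)"
    using determining_equations(2)[OF g sym D *, of i w] by (simp add: det2_def prolong_def jet_dir_def)
qed

section \<open>Linearity of the determining equations\<close>

lemma prolong_lin:
  shows "prolong o1 F G z (\<Sum>i<N. c i *\<^sub>C a i) (\<lambda>v. \<Sum>i<N. c i *\<^sub>C D i v) = (\<Sum>i<(N::nat). c i *\<^sub>C prolong o1 F G z (a i) (D i))"
  by (induction N)
    (simp_all add: prolong_def prod_eq_iff vec_eq_iff clinear_add[OF clinear_contact] clinear_scaleC_D[OF clinear_contact] clinear_zero[OF clinear_contact])

lemma det_lin:
  assumes g: "good_system o1 \<Omega> F G" and z: "z \<in> \<Omega>"
  shows "det1 o1 F G z w (\<Sum>i<(N::nat). c i *\<^sub>C a i) (\<lambda>v. \<Sum>i<N. c i *\<^sub>C D i v) = (\<Sum>i<N. c i *\<^sub>C det1 o1 F G z w (a i) (D i))"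
    and "det2 o1 F G z i0 w (\<Sum>i<(N::nat). c i *\<^sub>C a i) (\<lambda>v. \<Sum>i<N. c i *\<^sub>C D i v) = (\<Sum>i<N. c i *\<^sub>C det2 o1 F G z i0 w (a i) (D i))"
proof -
  have cd: "clinear (fderiv (\<lambda>z. pfaff o1 F G z w) z)" by (rule holo_clinear[OF holo_Hs'[OF g] z])
  note cl = clinear_sum[OF cd] clinear_scaleC_D[OF cd] clinear_sum[OF clinear_pfaff] clinear_scaleC_D[OF clinear_pfaff] clinear_sum[OF clinear_contact] clinear_scaleC_D[OF clinear_contact]
    clinear_sum[OF clinear_fst] clinear_sum[OF clinear_snd]
  show "det1 o1 F G z w (\<Sum>i<(N::nat). c i *\<^sub>C a i) (\<lambda>v. \<Sum>i<N. c i *\<^sub>C D i v) = (\<Sum>i<N. c i *\<^sub>C det1 o1 F G z w (a i) (D i))"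
    unfolding det1_def prolong_lin by (simp add: cl scaleC_add_right sum.distrib)
  have "(\<Sum>j\<in>UNIV. snd (pfaff o1 F G z w) $ j * (\<Sum>i<N. c i * fst (D i V) $ j)) = (\<Sum>i<N. c i * (\<Sum>j\<in>UNIV. snd (pfaff o1 F G z w) $ j * fst (D i V) $ j))" for V
    unfolding sum_distrib_left by (subst sum.swap) (simp add: mult_ac)
  then show "det2 o1 F G z i0 w (\<Sum>i<(N::nat). c i *\<^sub>C a i) (\<lambda>v. \<Sum>i<N. c i *\<^sub>C D i v) = (\<Sum>i<N. c i *\<^sub>C det2 o1 F G z i0 w (a i) (D i))"
    unfolding det2_def prolong_lin
    by (simp add: cl sum.distrib sum_subtractf distrib_left right_diff_distrib)
qed

text \<open>Stands in for the vector space structure of the symmetries: from a combination of them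
  nothing but the linear determining equations is used later.\<close>

lemma determining_sum:
  fixes X :: "nat \<Rightarrow> ('n::finite, 'm::finite) base \<Rightarrow> ('n, 'm) base"
  assumes g: "good_system o1 \<Omega> F G" and D: "open D" and X: "\<And>i. i < N \<Longrightarrow> determining o1 \<Omega> F G D (X i)"
  shows "determining o1 \<Omega> F G D (\<lambda>q. \<Sum>i<N. c i *\<^sub>C X i q)"
  unfolding determining_def Let_def
proof (intro conjI allI impI)
  have hX: "holo (X i) D" if "i < N" for i using X[OF that] by (simp add: determining_def)
  let ?X = "\<lambda>q. \<Sum>i<N. c i *\<^sub>C X i q"
  show "holo ?X D" by (intro holo_sum holo_scaleC_left hX) auto
  have d: "fderiv ?X q v = (\<Sum>i<N. c i *\<^sub>C fderiv (X i) q v)" if "q \<in> D" for q v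
  proof -
    have "fderiv ?X q v = (\<Sum>i<N. fderiv (\<lambda>q. c i *\<^sub>C X i q) q v)"
      by (rule fderiv_sum[OF _ that]) (auto intro!: holo_scaleC_left hX)
    also have "\<dots> = (\<Sum>i<N. c i *\<^sub>C fderiv (X i) q v)" by (rule sum.cong) (auto simp: fderiv_scaleC_left[OF hX that])
    finally show ?thesis .
  qed
  fix q p w i0 assume z: "(fst q, snd q, p) \<in> \<Omega>" and q: "q \<in> D"
  let ?z = "(fst q, snd q, p)"
  let ?T = "jet_dir o1 F G ?z"
  have dq: "fderiv ?X q = (\<lambda>v. \<Sum>i<N. c i *\<^sub>C fderiv (X i) q v)" by (rule ext) (rule d[OF q])
  have eqs: "snd (fderiv (X i) q (?T w)) = det1 o1 F G ?z w (X i q) (fderiv (X i) q)"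
    "contact o1 p (fderiv (\<lambda>q. fderiv (X i) q (?T (axis i0 1))) q (?T w)) = det2 o1 F G ?z i0 w (X i q) (fderiv (X i) q)" if "i < N" for i
    using X[OF that, unfolded determining_def Let_def] z q by blast+
  show "snd (fderiv ?X q (?T w)) = det1 o1 F G ?z w (?X q) (fderiv ?X q)"
    unfolding dq det_lin(1)[OF g z] using eqs(1) by (simp add: clinear_sum[OF clinear_snd])
  have hd: "holo (\<lambda>q. fderiv (X i) q v) D" if "i < N" for i v by (rule holo_fderiv_const[OF D hX[OF that]])
  have "fderiv (\<lambda>q. fderiv ?X q v) q u = (\<Sum>i<N. c i *\<^sub>C fderiv (\<lambda>q. fderiv (X i) q v) q u)" for v u
  proof -
    have hs: "holo (\<lambda>q. \<Sum>i<N. c i *\<^sub>C fderiv (X i) q v) D" by (intro holo_sum holo_scaleC_left hd) auto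
    have "fderiv (\<lambda>q. fderiv ?X q v) q u = fderiv (\<lambda>q. \<Sum>i<N. c i *\<^sub>C fderiv (X i) q v) q u"
      using holo_cong(2)[OF hs D d[symmetric] q] by simp
    also have "\<dots> = (\<Sum>i<N. fderiv (\<lambda>q. c i *\<^sub>C fderiv (X i) q v) q u)"
      by (rule fderiv_sum[OF _ q]) (auto intro!: holo_scaleC_left hd)
    also have "\<dots> = (\<Sum>i<N. c i *\<^sub>C fderiv (\<lambda>q. fderiv (X i) q v) q u)"
      by (rule sum.cong) (auto simp: fderiv_scaleC_left[OF hd q])
    finally show ?thesis .
  qed
  then show "contact o1 p (fderiv (\<lambda>q. fderiv ?X q (?T (axis i0 1))) q (?T w)) = det2 o1 F G ?z i0 w (?X q) (fderiv ?X q)"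
    unfolding dq det_lin(2)[OF g z] using eqs(2)
    by (simp add: clinear_sum[OF clinear_contact] clinear_scaleC_D[OF clinear_contact])
qed

text \<open>\<open>frozen_L\<close> and \<open>frozen_K\<close> are the coefficients
  \<open>L\<close> and \<open>K\<close> of \<open>frozen\<close> that belong to a system at the jet
  \<open>z\<close>.\<close>

definition frozen_L :: "'m \<Rightarrow> ('n, 'm) rhs2 \<Rightarrow> ('n::finite, 'm::finite) rhs1 \<Rightarrow> ('n, 'm) jet \<Rightarrow> complex ^ 'n \<Rightarrow> complex ^ 'm"
  where "frozen_L o1 F G z w = fst (pfaff o1 F G z w)"

definition frozen_K :: "'m \<Rightarrow> ('n, 'm) rhs2 \<Rightarrow> ('n::finite, 'm::finite) rhs1 \<Rightarrow> ('n, 'm) jet \<Rightarrow> complex ^ 'n \<Rightarrow> complex ^ 'n \<Rightarrow> complex ^ 'm"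
  where "frozen_K o1 F G z w \<pi> = fst (fderiv (\<lambda>z. pfaff o1 F G z w) z (0, 0, \<pi>))"

lemma det_scale:
  assumes g: "good_system o1 \<Omega> F G" and z: "z \<in> \<Omega>"
  shows "det1 o1 F G z w (c *\<^sub>C a) (\<lambda>v. c *\<^sub>C D v) = c *\<^sub>C det1 o1 F G z w a D"
    and "det2 o1 F G z i w (c *\<^sub>C a) (\<lambda>v. c *\<^sub>C D v) = c *\<^sub>C det2 o1 F G z i w a D"
  using det_lin[OF g z, where N = 1 and c = "\<lambda>_. c" and a = "\<lambda>_. a" and D = "\<lambda>_. D"] by simp_all

text \<open>Under the dilation of the base point by \<open>s\<close> each differentiation brings one
  factor \<open>s\<close>. In the first equation the value of \<open>X\<close> therefore becomes
  negligible against its differential; in the second the whole right side carries a factor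
  \<open>s\<close> against the second differential.\<close>

lemma leading_frozen:
  fixes o1 :: "'m::finite" and F :: "('n::finite, 'm) rhs2"
  assumes g: "good_system o1 \<Omega> F G" and D: "open D" and X: "determining o1 \<Omega> F G D X"
    and q0: "(x0, u0) \<in> D" and z0: "(x0, u0, p) \<in> \<Omega>"
    and z: "\<And>j v. j < k \<Longrightarrow> taylor_part X j (x0, u0) v = 0"
  shows "frozen o1 p (frozen_L o1 F G (x0, u0, p)) (frozen_K o1 F G (x0, u0, p)) (taylor_part X k (x0, u0))"
proof -
  let ?H = "pfaff o1 F G" and ?q0 = "(x0, u0)" and ?z0 = "(x0, u0, p)"
  have hX: "holo X D" using X by (simp add: determining_def)
  define s where "s n = inverse (real (Suc n))" for n
  have s0: "s \<longlonglongrightarrow> 0" unfolding s_def by (rule LIMSEQ_inverse_real_of_nat)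
  have spos: "s n > 0" for n by (simp add: s_def)
  define Pn where "Pn n v = (real (Suc n)) ^ k *\<^sub>R X (?q0 + v /\<^sub>R real (Suc n))" for n v
  define P where "P = taylor_part X k ?q0"
  have loc: "loc_lim Pn P UNIV" unfolding Pn_def P_def by (rule leading_loc_lim[OF D hX q0 z])
  define qn where "qn n q = ?q0 + s n *\<^sub>R q" for n and q :: "('n, 'm) base"
  \<comment> \<open>The gradient stays fixed while the base point tends to \<open>(x0, u0)\<close>,
    so all coefficients tend to their values at the one jet \<open>(x0, u0, p)\<close>.\<close>
  define zn where "zn n q = (fst (qn n q), snd (qn n q), p)" for n q
  have qn: "(\<lambda>n. qn n q) \<longlonglongrightarrow> ?q0" for q
  proof -
    have "(\<lambda>n. ?q0 + s n *\<^sub>R q) \<longlonglongrightarrow> ?q0 + 0 *\<^sub>R q" by (intro tendsto_add tendsto_const tendsto_scaleR s0)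
    then show ?thesis by (simp add: qn_def)
  qed
  have zn: "(\<lambda>n. zn n q) \<longlonglongrightarrow> ?z0" for q
    unfolding zn_def using tendsto_Pair[OF tendsto_fst[OF qn[of q]] tendsto_Pair[OF tendsto_snd[OF qn[of q]] tendsto_const[of p]]] by simp
  have ev: "\<forall>\<^sub>F n in sequentially. qn n q \<in> D \<and> zn n q \<in> \<Omega>" for q
    using topological_tendstoD[OF qn D q0] topological_tendstoD[OF zn good_system_open[OF g] z0]
    by eventually_elim simp
  have Hc: "(\<lambda>n. ?H (zn n q) (a n)) \<longlonglongrightarrow> ?H ?z0 a0" if "a \<longlonglongrightarrow> a0" for a a0 q
    using isCont_tendsto_compose[OF holo_isCont[OF holo_pfaff[OF g], of "(?z0, a0)"] tendsto_Pair[OF zn that]] z0 by simp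
  have dHc: "(\<lambda>n. fderiv (\<lambda>z. ?H z w) (zn n q) (a n)) \<longlonglongrightarrow> fderiv (\<lambda>z. ?H z w) ?z0 a0" if "a \<longlonglongrightarrow> a0" for a a0 q w
    using isCont_tendsto_compose[OF holo_isCont[OF holo_fderiv_joint[OF good_system_open[OF g] holo_Hs'[OF g, of w]], of "(?z0, a0)"] tendsto_Pair[OF zn that]] z0 by simp
  \<comment> \<open>The common factor: \<open>s n *\<^sub>R Pn n q\<close> and
    \<open>fderiv (Pn n) q\<close> are \<open>\<kappa> n\<close> times the value and the
    differential of \<open>X\<close> at \<open>qn n q\<close>. Hence the linearity of
    \<open>det1\<close> and \<open>det2\<close> in that pair applies.\<close>
  define \<kappa> where "\<kappa> n = real (Suc n) ^ k * s n" for n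
  have \<kappa>: "\<kappa> n \<noteq> 0" for n using spos[of n] by (simp add: \<kappa>_def)
  have Pq: "s n *\<^sub>R Pn n q = complex_of_real (\<kappa> n) *\<^sub>C X (qn n q)" for n q
    unfolding scaleC_of_real by (simp add: Pn_def \<kappa>_def qn_def s_def mult.commute del: of_nat_Suc)
  let ?U = "\<lambda>n. (\<lambda>q. qn n q) -` D"
  have sc: "complex_of_real (s n) *\<^sub>C v = s n *\<^sub>R v" for n and v :: "('n, 'm) base" by (rule scaleC_of_real)
  have hqn: "holo (qn n) S" for n S
    unfolding qn_def sc[symmetric] by (intro holo_add holo_const holo_scaleC_left holo_ident)
  have dqn: "fderiv (qn n) q v = complex_of_real (s n) *\<^sub>C v" for n q v
    unfolding qn_def sc[symmetric] using fderiv_add[OF holo_const[of ?q0] holo_scaleC_left[OF holo_ident] UNIV_I]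
      fderiv_scaleC_left[OF holo_ident UNIV_I] by (simp add: fderiv_clinear[OF clinear_id] fderiv_eqI[OF has_derivative_const])
  have oU: "open (?U n)" for n by (rule open_vimage[OF D]) (rule holo_continuous_on[OF hqn])
  have Pn': "Pn n = (\<lambda>v. complex_of_real (real (Suc n) ^ k) *\<^sub>C X (qn n v))" for n
    unfolding scaleC_of_real by (simp add: fun_eq_iff Pn_def qn_def s_def del: of_nat_Suc)
  have hXq: "holo (\<lambda>v. X (qn n v)) (?U n)" for n by (rule holo_compose[OF hX hqn]) auto
  have dP: "fderiv (Pn n) q v = complex_of_real (\<kappa> n) *\<^sub>C fderiv X (qn n q) v" if q: "qn n q \<in> D" for n q v
  proof -
    have qU: "q \<in> ?U n" using q by simp
    have "fderiv (Pn n) q v = complex_of_real (real (Suc n) ^ k) *\<^sub>C fderiv (\<lambda>v. X (qn n v)) q v"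
      unfolding Pn' by (rule fderiv_scaleC_left[OF hXq qU])
    also have "fderiv (\<lambda>v. X (qn n v)) q v = fderiv X (qn n q) (complex_of_real (s n) *\<^sub>C v)"
      using fderiv_compose[OF hX q holo_has_derivative[OF hqn[of n UNIV] UNIV_I]] by (simp only: dqn)
    also have "\<dots> = complex_of_real (s n) *\<^sub>C fderiv X (qn n q) v" by (rule clinear_scaleC_D[OF holo_clinear[OF hX q]])
    finally show ?thesis by (simp only: scaleC_scaleC \<kappa>_def of_real_mult)
  qed
  have d2P: "fderiv (\<lambda>q. fderiv (Pn n) q v) q w = complex_of_real (s n * \<kappa> n) *\<^sub>C fderiv (\<lambda>q. fderiv X q v) (qn n q) w" if q: "qn n q \<in> D" for n q v w
  proof -
    have qU: "q \<in> ?U n" using q by simp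
    have hd: "holo (\<lambda>q. fderiv X q v) D" by (rule holo_fderiv_const[OF D hX])
    have hdq: "holo (\<lambda>q. fderiv X (qn n q) v) (?U n)" by (rule holo_compose[OF hd hqn]) auto
    have "fderiv (\<lambda>q. fderiv (Pn n) q v) q w = fderiv (\<lambda>q. complex_of_real (\<kappa> n) *\<^sub>C fderiv X (qn n q) v) q w"
      using holo_cong(2)[OF holo_scaleC_left[OF hdq, of "complex_of_real (\<kappa> n)"] oU _ qU, of "\<lambda>q. fderiv (Pn n) q v"] dP by simp
    also have "\<dots> = complex_of_real (\<kappa> n) *\<^sub>C fderiv (\<lambda>q. fderiv X (qn n q) v) q w" by (rule fderiv_scaleC_left[OF hdq qU])
    also have "fderiv (\<lambda>q. fderiv X (qn n q) v) q w = fderiv (\<lambda>q. fderiv X q v) (qn n q) (complex_of_real (s n) *\<^sub>C w)"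
      using fderiv_compose[OF hd q holo_has_derivative[OF hqn[of n UNIV] UNIV_I]] by (simp only: dqn)
    also have "\<dots> = complex_of_real (s n) *\<^sub>C fderiv (\<lambda>q. fderiv X q v) (qn n q) w" by (rule clinear_scaleC_D[OF holo_clinear[OF hd q]])
    finally show ?thesis by (simp only: scaleC_scaleC of_real_mult mult.commute)
  qed
  define Tn where "Tn n q w = jet_dir o1 F G (zn n q) w" for n q w
  have T: "(\<lambda>n. Tn n q w) \<longlonglongrightarrow> (w, frozen_L o1 F G ?z0 w)" for q w
    unfolding Tn_def jet_dir_def frozen_L_def by (intro tendsto_Pair tendsto_const tendsto_fst Hc)
  have Pqlim: "(\<lambda>n. s n *\<^sub>R Pn n q) \<longlonglongrightarrow> 0" for q
  proof -
    obtain r where "r > 0" "uniform_limit (ball q r) Pn P sequentially" using loc unfolding loc_lim_def by blast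
    then have "(\<lambda>n. Pn n q) \<longlonglongrightarrow> P q" by (intro tendsto_uniform_limitI[where S = "ball q r"]) auto
    from tendsto_scaleR[OF s0 this] show ?thesis by simp
  qed
  have E: "snd (fderiv (Pn n) q (Tn n q w)) = det1 o1 F G (zn n q) w (s n *\<^sub>R Pn n q) (fderiv (Pn n) q)"
    "contact o1 p (fderiv (\<lambda>q'. fderiv (Pn n) q' (Tn n q (axis i 1))) q (Tn n q w)) = complex_of_real (s n) * det2 o1 F G (zn n q) i w (s n *\<^sub>R Pn n q) (fderiv (Pn n) q)"
    if "qn n q \<in> D" "zn n q \<in> \<Omega>" for n q i w
  proof -
    let ?c = "complex_of_real (\<kappa> n)"
    have Xe: "snd (fderiv X (qn n q) (Tn n q w)) = det1 o1 F G (zn n q) w (X (qn n q)) (fderiv X (qn n q))"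
      "contact o1 p (fderiv (\<lambda>q. fderiv X q (Tn n q' (axis i 1))) (qn n q) (Tn n q w)) = det2 o1 F G (zn n q) i w (X (qn n q)) (fderiv X (qn n q))" if "q' = q" for q'
      using X[unfolded determining_def Let_def] \<open>qn n q \<in> D\<close> \<open>zn n q \<in> \<Omega>\<close> unfolding Tn_def zn_def that by blast+
    have dPf: "fderiv (Pn n) q = (\<lambda>v. ?c *\<^sub>C fderiv X (qn n q) v)" by (rule ext) (rule dP[OF that(1)])
    show "snd (fderiv (Pn n) q (Tn n q w)) = det1 o1 F G (zn n q) w (s n *\<^sub>R Pn n q) (fderiv (Pn n) q)"
      unfolding Pq dPf det_scale(1)[OF g that(2)] using Xe(1)[OF refl] by simp
    show "contact o1 p (fderiv (\<lambda>q'. fderiv (Pn n) q' (Tn n q (axis i 1))) q (Tn n q w)) = complex_of_real (s n) * det2 o1 F G (zn n q) i w (s n *\<^sub>R Pn n q) (fderiv (Pn n) q)"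
      unfolding Pq d2P[OF that(1)] unfolding dPf det_scale(2)[OF g that(2)] using Xe(2)[OF refl]
      by (simp add: clinear_scaleC_D[OF clinear_contact])
  qed
  have dPl: "(\<lambda>n. fderiv (Pn n) q (v n)) \<longlonglongrightarrow> fderiv P q w" if "v \<longlonglongrightarrow> w" for q v w
    by (rule loc_lim_fderiv_tendsto[OF loc UNIV_I that])
  show ?thesis unfolding P_def[symmetric]
  proof (rule frozen_limit[OF loc T])
    show "(\<lambda>n. fst (fderiv (\<lambda>z. ?H z w) (zn n q) (fst (s n *\<^sub>R Pn n q), snd (s n *\<^sub>R Pn n q), \<pi> n))) \<longlonglongrightarrow> frozen_K o1 F G ?z0 w \<pi>0"
      if "\<pi> \<longlonglongrightarrow> \<pi>0" for q w \<pi> \<pi>0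
      unfolding frozen_K_def
      using tendsto_fst[OF dHc[OF tendsto_Pair[OF tendsto_fst[OF Pqlim[of q]] tendsto_Pair[OF tendsto_snd[OF Pqlim[of q]] that]], where q = q and w = w]]
      by (simp only: fst_zero snd_zero)
    show "(\<lambda>n. fst (?H (zn n q) (a n))) \<longlonglongrightarrow> frozen_L o1 F G ?z0 a0" if "a \<longlonglongrightarrow> a0" for q a a0
      unfolding frozen_L_def by (intro tendsto_fst Hc that)
    show "\<forall>\<^sub>F n in sequentially. snd (fderiv (Pn n) q (Tn n q w)) =
        fst (fderiv (\<lambda>z. ?H z w) (zn n q) (fst (s n *\<^sub>R Pn n q), snd (s n *\<^sub>R Pn n q), \<chi> j. contact o1 p (fderiv (Pn n) q (Tn n q (axis j 1)))))
        + fst (?H (zn n q) (fst (fderiv (Pn n) q (Tn n q w))))" for q w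
      using ev[of q] by eventually_elim (use E(1) in \<open>simp add: det1_def prolong_def Tn_def zn_def\<close>)
    show "(\<lambda>n. contact o1 p (fderiv (\<lambda>q'. fderiv (Pn n) q' (Tn n q (axis i 1))) q (Tn n q w))) \<longlonglongrightarrow> 0" for q i w
    proof -
      have "(\<lambda>n. complex_of_real (s n) * det2 o1 F G (zn n q) i w (s n *\<^sub>R Pn n q) (fderiv (Pn n) q)) \<longlonglongrightarrow>
         complex_of_real 0 * det2 o1 F G ?z0 i w 0 (fderiv P q)"
      proof (intro tendsto_mult tendsto_of_real s0)
        have pz: "snd (snd (zn n q)) = p" for n by (simp add: zn_def)
        have T': "(\<lambda>n. jet_dir o1 F G (zn n q) w) \<longlonglongrightarrow> jet_dir o1 F G ?z0 w" for w
          unfolding jet_dir_def by (intro tendsto_Pair tendsto_const tendsto_fst Hc)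
        have pr: "(\<lambda>n. prolong o1 F G (zn n q) (s n *\<^sub>R Pn n q) (fderiv (Pn n) q)) \<longlonglongrightarrow> prolong o1 F G ?z0 0 (fderiv P q)"
          unfolding prolong_def pz snd_conv
          by (intro tendsto_Pair tendsto_fst tendsto_snd Pqlim tendsto_vec_lambda tendsto_clinear[OF clinear_contact] dPl T')
        show "(\<lambda>n. det2 o1 F G (zn n q) i w (s n *\<^sub>R Pn n q) (fderiv (Pn n) q)) \<longlonglongrightarrow> det2 o1 F G ?z0 i w 0 (fderiv P q)"
          unfolding det2_def pz snd_conv
          by (intro tendsto_add tendsto_diff tendsto_sum tendsto_mult tendsto_vec_nth tendsto_fst tendsto_snd
              tendsto_clinear[OF clinear_contact] dPl T' Hc dHc tendsto_Pair tendsto_const zn pr)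
      qed
      then have "(\<lambda>n. complex_of_real (s n) * det2 o1 F G (zn n q) i w (s n *\<^sub>R Pn n q) (fderiv (Pn n) q)) \<longlonglongrightarrow> 0" by simp
      moreover have "\<forall>\<^sub>F n in sequentially. complex_of_real (s n) * det2 o1 F G (zn n q) i w (s n *\<^sub>R Pn n q) (fderiv (Pn n) q) =
          contact o1 p (fderiv (\<lambda>q'. fderiv (Pn n) q' (Tn n q (axis i 1))) q (Tn n q w))"
        using ev[of q] by eventually_elim (use E(2) in simp)
      ultimately show ?thesis by (rule Lim_transform_eventually)
    qed
  qed
qed

section \<open>Symmetries of the flat system\<close>

text \<open>Bilinear in \<open>p\<close> and \<open>w\<close>: the plane
  \<open>u = c + plane_map A p x\<close> has the gradient \<open>A k *v p\<close> in row
  \<open>k\<close>, in particular \<open>p\<close> in the row where \<open>A\<close> is the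
  identity.\<close>

definition plane_map :: "('m \<Rightarrow> complex ^ 'n ^ 'n) \<Rightarrow> complex ^ 'n::finite \<Rightarrow> complex ^ 'n \<Rightarrow> complex ^ 'm::finite"
  where "plane_map A p w = (\<chi> k. \<Sum>j\<in>UNIV. (A k *v p) $ j * w $ j)"

lemma clinear_plane_map: "clinear (plane_map A p)"
  unfolding plane_map_def by (intro clinear_vec_lambda clinear_sumI clinear_mult_left clinear_vec_nth)

lemma clinear_plane_map_left: "clinear (\<lambda>p. plane_map A p w)"
  unfolding plane_map_def matrix_vector_mult_def
  by (simp, intro clinear_vec_lambda clinear_sumI clinear_mult_right clinear_mult_left clinear_vec_nth)

lemma holo_plane_map:
  assumes "holo f S" "holo g S"
  shows "holo (\<lambda>x. plane_map A (f x) (g x)) S" and "x \<in> S \<Longrightarrow> fderiv (\<lambda>x. plane_map A (f x) (g x)) x v = plane_map A (fderiv f x v) (g x) + plane_map A (f x) (fderiv g x v)"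
proof -
  have J: "holo (\<lambda>p. plane_map A (fst p) (snd p)) (UNIV \<times> UNIV)"
    unfolding plane_map_def matrix_vector_mult_def
    by (simp, intro holo_vec_lambda holo_sum holo_mult holo_const holo_vec_nth holo_clinear_map clinear_fst clinear_snd)
  show "holo (\<lambda>x. plane_map A (f x) (g x)) S"
    using holo_compose[OF J holo_Pair[OF assms]] by simp
  show "x \<in> S \<Longrightarrow> fderiv (\<lambda>x. plane_map A (f x) (g x)) x v = plane_map A (fderiv f x v) (g x) + plane_map A (f x) (fderiv g x v)"
    using fderiv_lin_joint[OF J _ assms, of x v] by (simp add: clinear_plane_map fderiv_clinear[OF clinear_plane_map_left])
qed

lemma plane_map_axis: "plane_map A p (axis j 1) $ k = (A k *v p) $ j"
  by (simp add: plane_map_def axis_def if_distrib cong: if_cong)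

lemma pfaff_flat:
  assumes "A o1 = mat 1"
  shows "pfaff o1 flat_F (flat_G A) z w = (plane_map A (snd (snd z)) w, 0)"
proof -
  have "rhs_ext o1 (flat_G A) k j z = (A k *v snd (snd z)) $ j" for k j
    using assms by (cases z) (auto simp: rhs_ext_def flat_G_def)
  then show ?thesis by (simp add: pfaff_def flat_F_def plane_map_def vec_eq_iff)
qed

lemma holo_zero_derivative:
  fixes f :: "'a::complex_normed_space \<Rightarrow> 'b::cspace"
  assumes "convex S" "holo f S" "\<And>x w. x \<in> S \<Longrightarrow> fderiv f x w = 0" "x \<in> S" "y \<in> S"
  shows "f x = f y"
  using holo_lipschitz[OF assms(1,2), of 0 x y] assms(3-5) by simp

text \<open>The flat right sides are linear in the gradient, so their derivative in the gradient
  variable is the same bilinear map with \<open>\<pi>\<close> in place of \<open>p\<close>.\<close>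

definition frozen_flat :: "'m \<Rightarrow> ('m \<Rightarrow> complex ^ 'n ^ 'n) \<Rightarrow> (('n::finite, 'm::finite) base \<Rightarrow> ('n, 'm) base) \<Rightarrow> bool"
  where "frozen_flat o1 A X \<longleftrightarrow> (\<forall>p. frozen o1 p (plane_map A p) (\<lambda>w \<pi>. plane_map A \<pi> w) X)"

text \<open>\<open>const_field\<close> and \<open>slope_field\<close> are the components of the vector field induced on the space of
  the planes \<open>u = c + plane_map A p x\<close>, which are the solutions of the flat system.\<close>

definition const_field :: "('m \<Rightarrow> complex ^ 'n ^ 'n) \<Rightarrow> (('n::finite, 'm::finite) base \<Rightarrow> ('n, 'm) base) \<Rightarrow> (complex ^ 'm) \<times> (complex ^ 'n) \<Rightarrow> complex ^ 'm"
  where "const_field A X cp = snd (X (0, fst cp)) - plane_map A (snd cp) (fst (X (0, fst cp)))"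

definition slope_field :: "'m \<Rightarrow> ('m \<Rightarrow> complex ^ 'n ^ 'n) \<Rightarrow> (('n::finite, 'm::finite) base \<Rightarrow> ('n, 'm) base) \<Rightarrow> (complex ^ 'm) \<times> (complex ^ 'n) \<Rightarrow> complex ^ 'n"
  where "slope_field o1 A X cp = (\<chi> j. contact o1 (snd cp) (fderiv X (0, fst cp) (axis j 1, plane_map A (snd cp) (axis j 1))))"

lemma holo_const_field: "holo X UNIV \<Longrightarrow> holo (const_field A X) UNIV"
proof -
  assume X: "holo X UNIV"
  have h: "holo (\<lambda>cp. X (0, fst cp)) UNIV"
    by (rule holo_compose[OF X holo_Pair[OF holo_const holo_clinear_map[OF clinear_fst]]]) auto
  show ?thesis unfolding const_field_def
    by (rule holo_diff[OF holo_snd[OF h] holo_plane_map(1)[OF holo_clinear_map[OF clinear_snd] holo_fst[OF h]]])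
qed

lemma holo_slope_field: assumes X: "holo X UNIV" shows "holo (slope_field o1 A X) UNIV"
  unfolding slope_field_def
  by (intro holo_vec_lambda holo_contact(1) holo_fderiv[OF open_UNIV X] holo_Pair holo_const holo_plane_map(1) holo_clinear_map clinear_fst clinear_snd) auto

text \<open>Along a plane the second frozen equation makes \<open>varpi\<close> constant; the first
  then says that the left side has a constant differential in \<open>x\<close>. An affine map is
  determined by its value and slope at \<open>x = 0\<close>, which are the two induced
  components.\<close>

lemma plane_field:
  fixes X :: "('n::finite, 'm::finite) base \<Rightarrow> ('n, 'm) base"
  assumes X: "holo X UNIV" and fr: "frozen_flat o1 A X"
  shows "snd (X (x, c + plane_map A p x)) - plane_map A p (fst (X (x, c + plane_map A p x))) = const_field A X (c, p) + plane_map A (slope_field o1 A X (c, p)) x"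
proof -
  let ?q = "\<lambda>x. (x, c + plane_map A p x)"
  have hq: "holo ?q UNIV" by (intro holo_Pair holo_ident holo_add holo_const holo_clinear_map clinear_plane_map)
  have dq: "fderiv ?q x w = (w, plane_map A p w)" for x w
    using fderiv_Pair[OF holo_ident holo_add[OF holo_const[of c] holo_clinear_map[OF clinear_plane_map[of A p]]] UNIV_I]
      fderiv_add[OF holo_const[of c] holo_clinear_map[OF clinear_plane_map[of A p]] UNIV_I]
    by (simp add: fderiv_clinear[OF clinear_id] fderiv_clinear[OF clinear_plane_map] fderiv_eqI[OF has_derivative_const])
  have fr1: "snd (fderiv X q (w, plane_map A p w)) = plane_map A (varpi o1 p (plane_map A p) X q) w + plane_map A p (fst (fderiv X q (w, plane_map A p w)))"
    and fr2: "contact o1 p (fderiv (\<lambda>q. fderiv X q (axis i 1, plane_map A p (axis i 1))) q (w, plane_map A p w)) = 0" for q w i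
    using fr unfolding frozen_flat_def frozen_def by blast+
  have vp: "varpi o1 p (plane_map A p) X (?q x) = slope_field o1 A X (c, p)" for x
  proof -
    have "contact o1 p (fderiv X (?q x) (axis i 1, plane_map A p (axis i 1))) = contact o1 p (fderiv X (?q 0) (axis i 1, plane_map A p (axis i 1)))" for i
    proof (rule holo_zero_derivative[where f = "\<lambda>x. contact o1 p (fderiv X (?q x) (axis i 1, plane_map A p (axis i 1)))", OF convex_UNIV _ _ UNIV_I UNIV_I])
      have hd: "holo (\<lambda>q. fderiv X q (axis i 1, plane_map A p (axis i 1))) UNIV" by (rule holo_fderiv_const[OF open_UNIV X])
      have hdq: "holo (\<lambda>x. fderiv X (?q x) (axis i 1, plane_map A p (axis i 1))) UNIV" by (rule holo_compose[OF hd hq]) auto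
      show "holo (\<lambda>x. contact o1 p (fderiv X (?q x) (axis i 1, plane_map A p (axis i 1)))) UNIV"
        by (rule holo_clinear_compose[OF clinear_contact hdq])
      show "fderiv (\<lambda>x. contact o1 p (fderiv X (?q x) (axis i 1, plane_map A p (axis i 1)))) x w = 0" for x w
        using fderiv_clinear_compose[OF clinear_contact hdq UNIV_I] fderiv_compose[OF hd UNIV_I holo_has_derivative[OF hq UNIV_I]] fr2 dq by simp
    qed
    moreover have "plane_map A p 0 = 0" by (rule clinear_zero[OF clinear_plane_map])
    ultimately show ?thesis by (simp add: varpi_def slope_field_def)
  qed
  have hXq: "holo (\<lambda>x. X (?q x)) UNIV" by (rule holo_compose[OF X hq]) auto
  have dXq: "fderiv (\<lambda>x. X (?q x)) x w = fderiv X (?q x) (w, plane_map A p w)" for x w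
    using fderiv_compose[OF X UNIV_I holo_has_derivative[OF hq UNIV_I]] dq by simp
  let ?R = "\<lambda>x. snd (X (?q x)) - plane_map A p (fst (X (?q x))) - plane_map A (slope_field o1 A X (c, p)) x"
  have h1: "holo (\<lambda>x. snd (X (?q x))) UNIV" and h2: "holo (\<lambda>x. plane_map A p (fst (X (?q x)))) UNIV"
    by (intro holo_snd hXq holo_clinear_compose[OF clinear_plane_map] holo_fst)+
  have "?R x = ?R 0"
  proof (rule holo_zero_derivative[where f = ?R, OF convex_UNIV _ _ UNIV_I UNIV_I])
    show "holo ?R UNIV" by (intro holo_diff h1 h2 holo_clinear_map clinear_plane_map)
    show "fderiv ?R x w = 0" for x w
      using fderiv_diff[OF holo_diff[OF h1 h2] holo_clinear_map[OF clinear_plane_map[of A "slope_field o1 A X (c, p)"]] UNIV_I] fderiv_diff[OF h1 h2 UNIV_I] fderiv_snd[OF hXq UNIV_I]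
        fderiv_clinear_compose[OF clinear_plane_map[of A p] holo_fst[OF hXq] UNIV_I] fderiv_fst[OF hXq UNIV_I] dXq fr1[of "?q x" w] vp
      by (simp add: fderiv_clinear[OF clinear_plane_map])
  qed
  then show ?thesis by (simp add: const_field_def clinear_zero[OF clinear_plane_map] algebra_simps)
qed

lemma plane_is_solution:
  assumes A: "A o1 = mat 1" and W: "open W" and \<Omega>: "\<And>y. y \<in> W \<Longrightarrow> (y, c + plane_map A p y, p) \<in> \<Omega>"
  shows "is_solution o1 \<Omega> flat_F (flat_G A) W (\<lambda>y. c + plane_map A p y)"
proof -
  let ?v = "\<lambda>y. c + plane_map A p y"
  have hv: "holo ?v UNIV" by (intro holo_add holo_const holo_clinear_map clinear_plane_map)
  have pv: "partial_deriv j (\<lambda>y. ?v y $ k) = (\<lambda>y. (A k *v p) $ j)" for j k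
  proof
    fix y
    have "partial_deriv j (\<lambda>y. ?v y $ k) y = fderiv (\<lambda>y. ?v y $ k) y (axis j 1)"
      by (rule partial_deriv_fderiv[OF open_UNIV holo_vec_nth[OF hv] UNIV_I])
    also have "\<dots> = fderiv ?v y (axis j 1) $ k" by (rule fderiv_vec_nth[OF hv UNIV_I])
    also have "fderiv ?v y (axis j 1) = plane_map A p (axis j 1)"
      using fderiv_add[OF holo_const[of c] holo_clinear_map[OF clinear_plane_map] UNIV_I]
      by (simp add: fderiv_clinear[OF clinear_plane_map] fderiv_eqI[OF has_derivative_const])
    finally show "partial_deriv j (\<lambda>y. ?v y $ k) y = (A k *v p) $ j" by (simp add: plane_map_axis)
  qed
  have jet: "jet1 o1 ?v y = (y, ?v y, p)" for y
    unfolding jet1_def pv by (simp add: A vec_eq_iff)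
  show ?thesis
    unfolding is_solution_def jet using W \<Omega> holo_subset[OF hv] 
    unfolding pv by (auto simp: flat_F_def flat_G_def partial_deriv_def)
qed

text \<open>The gradient of a solution has differential 0, hence is constant on balls. The domain
  \<open>V\<close> may be disconnected, so one plane describes the solution only locally.\<close>

lemma flat_solution_plane:
  fixes u :: "complex ^ 'n::finite \<Rightarrow> complex ^ 'm::finite"
  assumes A: "A o1 = mat 1" and sol: "is_solution o1 \<Omega> flat_F (flat_G A) V u" and x1: "x1 \<in> V"
  obtains r c p where "0 < r" "ball x1 r \<subseteq> V" "(x1, u x1, p) \<in> \<Omega>" "\<And>x. x \<in> ball x1 r \<Longrightarrow> u x = c + plane_map A p x"
proof -
  have V: "open V" using sol by (simp add: is_solution_def)
  obtain r where r: "r > 0" "ball x1 r \<subseteq> V" using V x1 open_contains_ball by blast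
  have hu: "holo u (ball x1 r)" using sol holo_subset[OF _ r(2), of u] by (simp add: is_solution_def)
  let ?J = "jet1 o1 u"
  have hJ: "holo ?J (ball x1 r)" by (rule holo_subset[OF solution_jet(1)[OF sol] r(2)])
  define p where "p = snd (snd (?J x1))"
  have x1r: "x1 \<in> ball x1 r" using r by simp
  have pc: "snd (snd (?J x)) = p" if "x \<in> ball x1 r" for x
    unfolding p_def
  proof (rule holo_zero_derivative[where f = "\<lambda>x. snd (snd (?J x))", OF convex_ball _ _ that x1r])
    show "holo (\<lambda>x. snd (snd (?J x))) (ball x1 r)" by (intro holo_snd hJ)
    show "fderiv (\<lambda>x. snd (snd (?J x))) x w = 0" if "x \<in> ball x1 r" for x w
      using fderiv_snd[OF holo_snd[OF hJ] that] fderiv_snd[OF hJ that] solution_jet(2)[OF sol, of x] that r(2)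
      by (simp add: pfaff_flat[of A, OF A] subset_iff)
  qed
  have up: "u x - plane_map A p x = u x1 - plane_map A p x1" if "x \<in> ball x1 r" for x
  proof (rule holo_zero_derivative[where f = "\<lambda>x. u x - plane_map A p x", OF convex_ball _ _ that x1r])
    show "holo (\<lambda>x. u x - plane_map A p x) (ball x1 r)" by (intro holo_diff hu holo_clinear_map clinear_plane_map)
    show "fderiv (\<lambda>x. u x - plane_map A p x) x w = 0" if "x \<in> ball x1 r" for x w
      using fderiv_diff[OF hu holo_clinear_map[OF clinear_plane_map] that] solution_jet(3)[OF sol, of x] that r(2) pc[OF that]
      by (simp add: pfaff_flat[of A, OF A] subset_iff fderiv_clinear[OF clinear_plane_map])
  qed
  have "?J x1 \<in> \<Omega>" using sol x1 by (simp add: is_solution_def)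
  then have "(x1, u x1, p) \<in> \<Omega>" by (simp add: p_def jet1_def)
  moreover have "u x = (u x1 - plane_map A p x1) + plane_map A p x" if "x \<in> ball x1 r" for x
    using up[OF that] by (simp add: algebra_simps)
  ultimately show ?thesis using that[OF r] by blast
qed

text \<open>Points carried by the flow of \<open>X\<close> stay on the plane moved by the induced
  field, because their deviation from it starts at 0 and satisfies Gronwall's inequality. For a
  fixed time the projection of the moved points to \<open>x\<close> is continuous and injective, so
  invariance of domain makes the image the graph over an open set.\<close>

lemma flat_symmetry:
  fixes X :: "('n::finite, 'm::finite) base \<Rightarrow> ('n, 'm) base"
  assumes A: "A o1 = mat 1" and \<Omega>: "open \<Omega>" and X: "holo X UNIV" and fr: "frozen_flat o1 A X"
  shows "infinitesimal_symmetry o1 \<Omega> flat_F (flat_G A) UNIV X"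
  unfolding infinitesimal_symmetry_def
proof (intro conjI X allI impI ballI)
  fix V u x1 assume "is_solution o1 \<Omega> flat_F (flat_G A) V u \<and> graph_on u V \<subseteq> UNIV" and x1: "x1 \<in> V"
  then have sol: "is_solution o1 \<Omega> flat_F (flat_G A) V u" by simp
  obtain r c1 p1 where r: "0 < r" "ball x1 r \<subseteq> V" and z1: "(x1, u x1, p1) \<in> \<Omega>" and u: "\<And>x. x \<in> ball x1 r \<Longrightarrow> u x = c1 + plane_map A p1 x"
    by (rule flat_solution_plane[of A, OF A sol x1]) (rule that)
  define q where "q x = (x, c1 + plane_map A p1 x)" for x
  have hq: "holo q S" for S unfolding q_def by (intro holo_Pair holo_ident holo_add holo_const holo_clinear_map clinear_plane_map)
  have qx1: "q x1 = (x1, u x1)" using u[of x1] r(1) by (simp add: q_def)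
  obtain \<delta>1 r1 \<Phi> where \<Phi>: "0 < \<delta>1" "0 < r1" "ball (q x1) r1 \<subseteq> UNIV" "holo \<Phi> (ball (0::complex) \<delta>1 \<times> ball (q x1) r1)"
    "\<And>q'. q' \<in> ball (q x1) r1 \<Longrightarrow> \<Phi> (0, q') = q'"
    "\<And>t q'. t \<in> ball 0 \<delta>1 \<Longrightarrow> q' \<in> ball (q x1) r1 \<Longrightarrow> \<Phi> (t, q') \<in> UNIV \<and> fderiv \<Phi> (t, q') (1, 0) = X (\<Phi> (t, q'))"
    by (rule flow_exists[OF open_UNIV UNIV_I X]) (rule that)
  let ?Z = "\<lambda>cp. (const_field A X cp, slope_field o1 A X cp)"
  have hZ: "holo ?Z UNIV" by (intro holo_Pair holo_const_field holo_slope_field X)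
  obtain \<delta>2 r2 \<Psi> where \<Psi>: "0 < \<delta>2" "0 < r2" "ball (c1, p1) r2 \<subseteq> UNIV" "holo \<Psi> (ball (0::complex) \<delta>2 \<times> ball (c1, p1) r2)"
    "\<And>q. q \<in> ball (c1, p1) r2 \<Longrightarrow> \<Psi> (0, q) = q"
    "\<And>t q. t \<in> ball 0 \<delta>2 \<Longrightarrow> q \<in> ball (c1, p1) r2 \<Longrightarrow> \<Psi> (t, q) \<in> UNIV \<and> fderiv \<Psi> (t, q) (1, 0) = ?Z (\<Psi> (t, q))"
    by (rule flow_exists[OF open_UNIV UNIV_I hZ]) (rule that)
  define \<delta> where "\<delta> = min \<delta>1 \<delta>2"
  have \<delta>: "\<delta> > 0" using \<Phi>(1) \<Psi>(1) by (simp add: \<delta>_def)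
  let ?T = "ball (0::complex) \<delta>"
  have T0: "0 \<in> ?T" using \<delta> by simp
  have cp1: "(c1, p1) \<in> ball (c1, p1) r2" using \<Psi>(2) by simp
  define cc where "cc t = fst (\<Psi> (t, (c1, p1)))" for t
  define pp where "pp t = snd (\<Psi> (t, (c1, p1)))" for t
  have h\<Psi>: "holo (\<lambda>t. \<Psi> (t, (c1, p1))) ?T"
    by (rule holo_subset[OF holo_slice1(1)[OF \<Psi>(4) cp1]]) (auto simp: \<delta>_def)
  have d\<Psi>: "fderiv (\<lambda>t. \<Psi> (t, (c1, p1))) t 1 = ?Z (cc t, pp t)" if "t \<in> ?T" for t
    using holo_slice1(2)[OF \<Psi>(4) cp1, of t 1] \<Psi>(6)[OF _ cp1, of t] that by (simp add: \<delta>_def cc_def pp_def)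
  have hc: "holo cc ?T" and hp: "holo pp ?T" unfolding cc_def pp_def by (intro holo_fst holo_snd h\<Psi>)+
  have dc: "fderiv cc t 1 = const_field A X (cc t, pp t)" and dp: "fderiv pp t 1 = slope_field o1 A X (cc t, pp t)" if "t \<in> ?T" for t
    using fderiv_fst[OF h\<Psi> that, of 1] fderiv_snd[OF h\<Psi> that, of 1] d\<Psi>[OF that] unfolding cc_def pp_def by simp_all
  have c0: "cc 0 = c1" and p0: "pp 0 = p1" using \<Psi>(5)[OF cp1] by (simp_all add: cc_def pp_def)
  obtain r3 where r3: "r3 > 0" "r3 \<le> r" "\<And>x. x \<in> ball x1 r3 \<Longrightarrow> q x \<in> ball (q x1) r1"
  proof -
    have "\<forall>\<^sub>F x in nhds x1. q x \<in> ball (q x1) r1"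
      by (rule topological_tendstoD[OF holo_tendsto_nhds[OF hq UNIV_I]]) (use \<Phi>(2) in auto)
    then obtain e where "e > 0" "\<And>x. dist x x1 < e \<Longrightarrow> q x \<in> ball (q x1) r1" unfolding eventually_nhds_metric by blast
    then show ?thesis using r(1) by (intro that[of "min e r"]) (auto simp: dist_commute)
  qed
  let ?B = "ball x1 r3"
  define C where "C p = \<Phi> (fst p, q (snd p))" for p
  have hC: "holo C (?T \<times> ?B)" unfolding C_def
    by (rule holo_compose[OF \<Phi>(4) holo_Pair[OF holo_clinear_map[OF clinear_fst] holo_compose[OF hq[of UNIV] holo_clinear_map[OF clinear_snd]]]])
       (use r3 in \<open>auto simp: \<delta>_def\<close>)
  have hCt: "holo (\<lambda>t. C (t, x)) ?T" if "x \<in> ?B" for x by (rule holo_slice1(1)[OF hC that])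
  have C0: "C (0, x) = q x" if "x \<in> ?B" for x using \<Phi>(5)[OF r3(3)[OF that]] by (simp add: C_def)
  have Ct: "fderiv (\<lambda>t. C (t, x)) t 1 = X (C (t, x))" if "t \<in> ?T" "x \<in> ?B" for t x
  proof -
    have t: "t \<in> ball 0 \<delta>1" using that by (simp add: \<delta>_def)
    show ?thesis using holo_slice1(2)[OF \<Phi>(4) r3(3)[OF that(2)] t, of 1] \<Phi>(6)[OF t r3(3)[OF that(2)]] by (simp add: C_def)
  qed
  have on_plane: "snd (C (t, x)) = cc t + plane_map A (pp t) (fst (C (t, x)))" if t: "t \<in> ?T" and x: "x \<in> ?B" for t x
  proof -
    let ?x = "\<lambda>t. fst (C (t, x))" and ?u = "\<lambda>t. snd (C (t, x))"
    have hx: "holo ?x ?T" and hu: "holo ?u ?T" by (intro holo_fst holo_snd hCt x)+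
    have hB: "holo (\<lambda>t. plane_map A (pp t) (?x t)) ?T" by (rule holo_plane_map(1)[OF hp hx])
    define e where "e t = ?u t - cc t - plane_map A (pp t) (?x t)" for t
    have he: "holo e ?T" unfolding e_def by (intro holo_diff hu hc hB)
    \<comment> \<open>The rate at which the flow of \<open>X\<close> leaves the plane of slope
      \<open>fst s\<close> through the point \<open>snd s\<close>.\<close>
    define R where "R s = snd (X (snd s)) - plane_map A (fst s) (fst (X (snd s)))" for s
    have hR: "holo R UNIV"
    proof -
      have h: "holo (\<lambda>s. X (snd s)) UNIV" by (rule holo_compose[OF X holo_clinear_map[OF clinear_snd]]) auto
      show ?thesis unfolding R_def
        by (rule holo_diff[OF holo_snd[OF h] holo_plane_map(1)[OF holo_clinear_map[OF clinear_fst] holo_fst[OF h]]])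
    qed
    \<comment> \<open>The second argument is the vertical projection to the moving plane, where
      \<open>plane_field\<close> shows that \<open>R\<close> is the velocity of the plane itself.
      The two arguments differ by \<open>e t\<close> alone.\<close>
    have de: "fderiv e t 1 = R (pp t, (?x t, ?u t)) - R (pp t, (?x t, ?u t - e t))" if t: "t \<in> ?T" for t
    proof -
      have "fderiv e t 1 = fderiv ?u t 1 - fderiv cc t 1 - (plane_map A (fderiv pp t 1) (?x t) + plane_map A (pp t) (fderiv ?x t 1))"
        unfolding e_def using fderiv_diff[OF holo_diff[OF hu hc] hB t, of 1] fderiv_diff[OF hu hc t, of 1] holo_plane_map(2)[OF hp hx t, of A 1] by simp
      moreover have "fderiv ?u t 1 = snd (X (C (t, x)))" "fderiv ?x t 1 = fst (X (C (t, x)))"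
        using fderiv_snd[OF hCt[OF x] t] fderiv_fst[OF hCt[OF x] t] Ct[OF t x] by simp_all
      moreover have "R (pp t, (?x t, ?u t - e t)) = const_field A X (cc t, pp t) + plane_map A (slope_field o1 A X (cc t, pp t)) (?x t)"
        using plane_field[OF X fr, of "?x t" "cc t" "pp t"] by (simp add: R_def e_def)
      ultimately show ?thesis using dc[OF t] dp[OF t] by (simp add: R_def)
    qed
    have e0: "e 0 = 0" using C0[OF x] by (simp add: e_def c0 p0 q_def)
    obtain \<rho> K where K: "\<rho> > 0" "K > 0" "cball (p1, q x) \<rho> \<subseteq> UNIV"
      "\<And>w w'. w \<in> cball (p1, q x) \<rho> \<Longrightarrow> w' \<in> cball (p1, q x) \<rho> \<Longrightarrow> norm (R w - R w') \<le> K * norm (w - w')"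
      by (rule loc_bounds[OF open_UNIV UNIV_I hR]) (rule that)
    have near: "\<forall>\<^sub>F t in nhds 0. f t \<in> ball (p1, q x) \<rho>" if "holo f ?T" "f 0 = (p1, q x)" for f
      using topological_tendstoD[OF holo_tendsto_nhds[OF that(1) T0] open_ball, of "(p1, q x)" \<rho>] that(2) K(1) by simp
    have n1: "\<forall>\<^sub>F t in nhds 0. (pp t, (?x t, ?u t)) \<in> ball (p1, q x) \<rho>"
      by (rule near[OF holo_Pair[OF hp holo_Pair[OF hx hu]]]) (use C0[OF x] p0 in simp)
    have n2: "\<forall>\<^sub>F t in nhds 0. (pp t, (?x t, ?u t - e t)) \<in> ball (p1, q x) \<rho>"
      by (rule near[OF holo_Pair[OF hp holo_Pair[OF hx holo_diff[OF hu he]]]]) (use C0[OF x] p0 e0 in simp)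
    have "e t = 0"
    proof (rule holo_gronwall_zero[OF he open_ball connected_ball T0 e0 _ t])
      show "\<forall>\<^sub>F t in nhds 0. norm (fderiv e t 1) \<le> K * norm (e t)"
        using n1 n2 eventually_nhds_in_open[OF open_ball T0]
      proof eventually_elim
        case (elim t)
        have "norm (R (pp t, (?x t, ?u t)) - R (pp t, (?x t, ?u t - e t))) \<le> K * norm ((pp t, (?x t, ?u t)) - (pp t, (?x t, ?u t - e t)))"
          by (rule K(4)) (use elim in \<open>auto simp del: mem_ball dest: subsetD[OF ball_subset_cball]\<close>)
        also have "(pp t, (?x t, ?u t)) - (pp t, (?x t, ?u t - e t)) = (0, (0, e t))" by (simp add: prod_eq_iff)
        finally show ?case using de[OF elim(3)] by (simp add: norm_Pair)
      qed
    qed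
    then show ?thesis by (simp add: e_def algebra_simps)
  qed
  define Wj where "Wj s = (fst (C s), snd (C s), pp (fst s))" for s
  have hpf: "holo (\<lambda>s. pp (fst s)) (?T \<times> ?B)" by (rule holo_compose[OF hp holo_clinear_map[OF clinear_fst]]) auto
  have hW: "holo Wj (?T \<times> ?B)" unfolding Wj_def by (intro holo_Pair holo_fst holo_snd hC hpf)
  have xB: "x1 \<in> ?B" using r3 by simp
  \<comment> \<open>The moved jets must remain in \<open>\<Omega>\<close>; its openness tells how
    far time and neighborhood have to be shrunk.\<close>
  have "\<forall>\<^sub>F s in nhds (0, x1). Wj s \<in> \<Omega>"
    by (rule topological_tendstoD[OF holo_tendsto_nhds[OF hW]]) (use \<Omega> z1 T0 xB C0[OF xB] qx1 p0 in \<open>auto simp: Wj_def\<close>)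
  then obtain S where S: "open S" "(0, x1) \<in> S" "\<And>s. s \<in> S \<Longrightarrow> Wj s \<in> \<Omega>" unfolding eventually_nhds by auto
  obtain A1 A2 where A12: "open A1" "open A2" "(0, x1) \<in> A1 \<times> A2" "A1 \<times> A2 \<subseteq> S"
    by (rule open_prod_elim[OF S(1,2)])
  obtain \<delta>3 where d3: "\<delta>3 > 0" "ball 0 \<delta>3 \<subseteq> A1" using A12(1,3) open_contains_ball by blast
  obtain r4 where r4: "r4 > 0" "ball x1 r4 \<subseteq> A2" using A12(2,3) open_contains_ball by blast
  define \<epsilon> where "\<epsilon> = min \<delta> \<delta>3"
  define V' where "V' = ball x1 (min r3 r4)"
  have V'B: "V' \<subseteq> ?B" and TT: "ball 0 \<epsilon> \<subseteq> ?T" by (auto simp: V'_def \<epsilon>_def)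
  have gr: "graph_on u V' = q ` V'"
    unfolding graph_on_def by (rule image_cong) (use u V'B r3(2) in \<open>auto simp: q_def subset_iff\<close>)
  show "\<exists>V' \<delta> \<Phi>. open V' \<and> x1 \<in> V' \<and> V' \<subseteq> V \<and> \<delta> > 0 \<and> is_local_flow X UNIV \<delta> (graph_on u V') \<Phi> \<and>
           (\<forall>t\<in>ball 0 \<delta>. \<exists>W v. is_solution o1 \<Omega> flat_F (flat_G A) W v \<and> \<Phi> t ` graph_on u V' = graph_on v W)"
  proof (rule exI[of _ V'], rule exI[of _ \<epsilon>], rule exI[of _ "\<lambda>t q. \<Phi> (t, q)"], intro conjI ballI)
    show "open V'" "x1 \<in> V'" using r3 r4 by (auto simp: V'_def)
    show "V' \<subseteq> V" using V'B r(2) r3(2) by (auto simp: subset_iff)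
    show "\<epsilon> > 0" using \<delta> d3 by (simp add: \<epsilon>_def)
    show "is_local_flow X UNIV \<epsilon> (graph_on u V') (\<lambda>t q. \<Phi> (t, q))"
      unfolding is_local_flow_def gr
    proof (intro ballI conjI)
      fix q' assume "q' \<in> q ` V'"
      then obtain x where x: "q' = q x" "x \<in> ?B" using V'B by blast
      show "\<Phi> (0, q') = q'" using C0[OF x(2)] by (simp add: C_def x(1))
      fix t :: complex assume "t \<in> ball 0 \<epsilon>"
      then have t: "t \<in> ?T" using TT by blast
      show "\<Phi> (t, q') \<in> UNIV" by simp
      have "fderiv (\<lambda>s. C (s, x)) t h = h *\<^sub>C X (C (t, x))" for h
        using clinear_scaleC_D[OF holo_clinear[OF hCt[OF x(2)] t], of h 1] Ct[OF t x(2)] by simp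
      then have "fderiv (\<lambda>s. C (s, x)) t = (\<lambda>h. h *\<^sub>C X (C (t, x)))" by (rule ext)
      with holo_has_derivative[OF hCt[OF x(2)] t]
      show "((\<lambda>s. \<Phi> (s, q')) has_derivative (\<lambda>h. h *\<^sub>C X (\<Phi> (t, q')))) (at t)"
        by (simp add: C_def x(1))
    qed
    fix t :: complex assume t\<epsilon>: "t \<in> ball 0 \<epsilon>"
    then have t: "t \<in> ?T" using TT by blast
    let ?y = "\<lambda>x. fst (C (t, x))" and ?v = "\<lambda>y. cc t + plane_map A (pp t) y"
    have Cy: "C (t, x) = (?y x, ?v (?y x))" if "x \<in> V'" for x
      using on_plane[OF t, of x] V'B that by (auto simp: prod_eq_iff subset_iff)
    have "open (?y ` V')"
    proof (rule invariance_of_domain)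
      show "open V'" by (simp add: V'_def)
      have "holo ?y V'" by (rule holo_subset[OF holo_fst[OF holo_slice2(1)[OF hC t]] V'B])
      then show "continuous_on V' ?y" by (rule holo_continuous_on)
      show "inj_on ?y V'"
      proof (rule inj_onI)
        fix x x' assume xx: "x \<in> V'" "x' \<in> V'" "?y x = ?y x'"
        then have B: "x \<in> ?B" "x' \<in> ?B" using V'B by auto
        have eq: "C (t, x) = C (t, x')" using Cy[OF xx(1)] Cy[OF xx(2)] xx(3) by simp
        \<comment> \<open>Two orbits that meet at time \<open>t\<close> agree at time 0 by
          uniqueness of the flow.\<close>
        have "C (0, x) = C (0, x')"
          by (rule flow_unique[OF open_UNIV X open_ball connected_ball hCt[OF B(1)] hCt[OF B(2)] _ _ t eq T0])
             (use Ct B in auto)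
        then show "x = x'" using C0 B by (simp add: q_def)
      qed
    qed
    moreover have "(y, ?v y, pp t) \<in> \<Omega>" if yW: "y \<in> ?y ` V'" for y
    proof -
      obtain x where x: "x \<in> V'" "y = ?y x" using yW by blast
      have "(t, x) \<in> S" using A12(4) d3(2) r4(2) t\<epsilon> x(1) by (auto simp: \<epsilon>_def V'_def subset_iff)
      from S(3)[OF this] have "(?y x, snd (C (t, x)), pp t) \<in> \<Omega>" by (simp add: Wj_def)
      moreover have "snd (C (t, x)) = ?v (?y x)" using arg_cong[OF Cy[OF x(1)], of snd] by (simp only: snd_conv)
      ultimately show ?thesis unfolding x(2) by metis
    qed
    ultimately have "is_solution o1 \<Omega> flat_F (flat_G A) (?y ` V') ?v"
      by (intro plane_is_solution A)
    moreover have "(\<lambda>q. \<Phi> (t, q)) ` graph_on u V' = graph_on ?v (?y ` V')"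
    proof -
      have "(\<lambda>q. \<Phi> (t, q)) ` graph_on u V' = (\<lambda>x. C (t, x)) ` V'" by (simp add: gr image_image C_def)
      also have "\<dots> = (\<lambda>x. (?y x, ?v (?y x))) ` V'" by (rule image_cong[OF refl Cy])
      finally show ?thesis by (simp add: graph_on_def image_image)
    qed
    ultimately show "\<exists>W v. is_solution o1 \<Omega> flat_F (flat_G A) W v \<and> (\<lambda>q. \<Phi> (t, q)) ` graph_on u V' = graph_on v W"
      by blast
  qed
qed

section \<open>Small deformations\<close>

text \<open>Summability of a complex family is absolute, so at the point \<open>h0\<close> with all
  coordinates equal to \<open>\<rho>\<close> the norms of the terms have a finite sum
  \<open>M\<close>. If \<open>norm h = t * \<rho>\<close> with \<open>t \<le> 1\<close>, every
  nonconstant monomial at \<open>h\<close> is at most \<open>t\<close> times its value at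
  \<open>h0\<close>, which bounds \<open>f (a + h) - f a\<close> by \<open>t * M\<close>.\<close>

lemma real_analytic_on_isCont:
  fixes f :: "'a::euclidean_space \<Rightarrow> complex"
  assumes "real_analytic_on f S" "a \<in> S"
  shows "isCont f a"
proof -
  let ?A = "{\<alpha> :: 'a \<Rightarrow> nat. \<forall>b. b \<notin> Basis \<longrightarrow> \<alpha> b = 0}"
  let ?m = "\<lambda>h \<alpha>. (\<Prod>b\<in>Basis. (h \<bullet> b) ^ \<alpha> b) :: real"
  obtain r c where r: "r > 0" and S: "\<And>h. norm h < r \<Longrightarrow> ((\<lambda>\<alpha>. ?m h \<alpha> *\<^sub>R c \<alpha>) has_sum f (a + h)) ?A"
    using assms unfolding real_analytic_on_def by blast
  \<comment> \<open>The norm of \<open>h0\<close> is at most \<open>DIM('a) * \<rho>\<close>, so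
    this keeps \<open>h0\<close> inside the region of convergence.\<close>
  define \<rho> where "\<rho> = r / (2 * real DIM('a))"
  have \<rho>: "\<rho> > 0" using r by (simp add: \<rho>_def)
  define h0 where "h0 = (\<Sum>b\<in>Basis. \<rho> *\<^sub>R b :: 'a)"
  have "norm h0 \<le> (\<Sum>b\<in>(Basis :: 'a set). \<rho>)"
    unfolding h0_def using \<rho> by (intro order_trans[OF norm_sum] sum_mono) simp
  also have "\<dots> < r" using r by (simp add: \<rho>_def)
  finally have h0r: "norm h0 < r" .
  have h0b: "h0 \<bullet> b = \<rho>" if "b \<in> Basis" for b using that by (simp add: h0_def)
  define g where "g \<alpha> = (\<Prod>b\<in>(Basis :: 'a set). \<rho> ^ \<alpha> b) *\<^sub>R c \<alpha>" for \<alpha>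
  have mh0: "?m h0 \<alpha> = (\<Prod>b\<in>(Basis :: 'a set). \<rho> ^ \<alpha> b)" for \<alpha>
    by (rule prod.cong) (auto simp: h0b)
  have "g summable_on ?A"
    using S[OF h0r] unfolding mh0 g_def summable_on_def by blast
  then have "(\<lambda>\<alpha>. norm (g \<alpha>)) summable_on ?A" by (simp add: summable_on_iff_abs_summable_on_complex)
  then obtain M where M: "((\<lambda>\<alpha>. norm (g \<alpha>)) has_sum M) ?A" unfolding summable_on_def by blast
  have bound: "norm (f (a + h) - f a) \<le> norm h * (M / \<rho>)" if h: "norm h < r" "norm h \<le> \<rho>" for h
  proof -
    define t where "t = norm h / \<rho>"
    have t: "0 \<le> t" "t \<le> 1" "norm h = t * \<rho>" using h \<rho> by (auto simp: t_def)
    let ?d = "\<lambda>\<alpha>. ?m h \<alpha> *\<^sub>R c \<alpha> - ?m 0 \<alpha> *\<^sub>R c \<alpha>"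
    have "((\<lambda>\<alpha>. ?m h \<alpha> *\<^sub>R c \<alpha> + - (?m 0 \<alpha> *\<^sub>R c \<alpha>)) has_sum (f (a + h) + - f (a + 0))) ?A"
      by (intro has_sum_add S h(1) has_sum_uminusI) (use r in \<open>auto intro: S\<close>)
    then have D: "(?d has_sum (f (a + h) - f a)) ?A" by simp
    then have "(\<lambda>\<alpha>. norm (?d \<alpha>)) summable_on ?A"
      using summable_on_iff_abs_summable_on_complex[of ?d ?A] unfolding summable_on_def by blast
    then obtain n where n: "((\<lambda>\<alpha>. norm (?d \<alpha>)) has_sum n) ?A" unfolding summable_on_def by blast
    have "norm (f (a + h) - f a) \<le> n" by (rule norm_has_sum_bound[OF n D])
    also have "n \<le> t * M"
    proof (rule has_sum_mono[OF n has_sum_cmult_right[OF M]])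
      fix \<alpha> assume \<alpha>: "\<alpha> \<in> ?A"
      show "norm (?d \<alpha>) \<le> t * norm (g \<alpha>)"
      proof (cases "\<forall>b\<in>Basis. \<alpha> b = 0")
        case True
        then have "?m h \<alpha> = ?m 0 \<alpha>" by simp
        then show ?thesis using t by simp
      next
        case False
        then obtain b0 where b0: "b0 \<in> Basis" "\<alpha> b0 \<noteq> 0" by blast
        have z: "(\<Prod>b\<in>(Basis :: 'a set). (0::real) ^ \<alpha> b) = 0" by (rule prod_zero) (use b0 in auto)
        have "\<bar>?m h \<alpha>\<bar> = (\<Prod>b\<in>Basis. \<bar>h \<bullet> b\<bar> ^ \<alpha> b)" by (simp add: abs_prod power_abs)
        also have "\<dots> \<le> (\<Prod>b\<in>(Basis :: 'a set). (t * \<rho>) ^ \<alpha> b)"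
          by (rule prod_mono) (auto intro!: power_mono simp: Basis_le_norm t(3)[symmetric])
        also have "\<dots> = (\<Prod>b\<in>(Basis :: 'a set). t ^ \<alpha> b) * (\<Prod>b\<in>(Basis :: 'a set). \<rho> ^ \<alpha> b)"
          by (simp add: power_mult_distrib prod.distrib)
        also have "\<dots> \<le> t * (\<Prod>b\<in>(Basis :: 'a set). \<rho> ^ \<alpha> b)"
        proof (rule mult_right_mono)
          have "(\<Prod>b\<in>(Basis :: 'a set). t ^ \<alpha> b) = t ^ \<alpha> b0 * (\<Prod>b\<in>Basis - {b0}. t ^ \<alpha> b)"
            by (rule prod.remove) (use b0 in auto)
          also have "\<dots> \<le> t * 1"
          proof (rule mult_mono)
            show "t ^ \<alpha> b0 \<le> t" using b0(2) t by (cases "\<alpha> b0") (auto intro: mult_left_le power_le_one)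
            show "(\<Prod>b\<in>Basis - {b0}. t ^ \<alpha> b) \<le> 1" by (rule prod_le_1) (use t in \<open>auto intro: power_le_one\<close>)
            show "0 \<le> (\<Prod>b\<in>Basis - {b0}. t ^ \<alpha> b)" by (rule prod_nonneg) (use t in auto)
          qed (use t in auto)
          finally show "(\<Prod>b\<in>(Basis :: 'a set). t ^ \<alpha> b) \<le> t" by simp
        qed (use \<rho> in \<open>auto intro: prod_nonneg\<close>)
        finally have "\<bar>?m h \<alpha>\<bar> * norm (c \<alpha>) \<le> t * (\<Prod>b\<in>(Basis :: 'a set). \<rho> ^ \<alpha> b) * norm (c \<alpha>)"
          by (rule mult_right_mono) simp
        moreover have "\<bar>\<Prod>b\<in>(Basis :: 'a set). \<rho> ^ \<alpha> b\<bar> = (\<Prod>b\<in>(Basis :: 'a set). \<rho> ^ \<alpha> b)"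
          using \<rho> by (intro abs_of_nonneg prod_nonneg) auto
        ultimately show ?thesis by (simp add: z g_def mult.assoc)
      qed
    qed
    finally show ?thesis by (simp add: t_def)
  qed
  have "(\<lambda>h. f (a + h) - f a) \<midarrow>0\<rightarrow> 0"
  proof (rule Lim_null_comparison)
    have "\<forall>\<^sub>F h in at (0::'a). norm h < min r \<rho>"
      unfolding eventually_at by (rule exI[of _ "min r \<rho>"]) (use r \<rho> in \<open>auto simp: dist_norm\<close>)
    then show "\<forall>\<^sub>F h in at 0. norm (f (a + h) - f a) \<le> norm h * (M / \<rho>)"
      by eventually_elim (use bound in auto)
    show "(\<lambda>h. norm h * (M / \<rho>)) \<midarrow>0\<rightarrow> 0" using \<rho> by (auto intro!: tendsto_eq_intros)
  qed
  then show ?thesis unfolding isCont_iff by (rule LIM_zero_cancel)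
qed

text \<open>A jointly analytic family is jointly continuous, hence uniformly continuous on a product
  of closed balls. This turns convergence of the parameters into uniform convergence of the
  members.\<close>

lemma analytic_family_loc_lim:
  fixes f :: "'e::euclidean_space \<Rightarrow> 'z::cspace \<Rightarrow> complex"
  assumes E: "open E" "0 \<in> E" and \<Omega>: "open \<Omega>" and an: "real_analytic_on (\<lambda>(\<epsilon>, z). f \<epsilon> z) (E \<times> \<Omega>)"
    and h: "\<And>\<epsilon>. \<epsilon> \<in> E \<Longrightarrow> holo (f \<epsilon>) \<Omega>" and e: "\<epsilon>n \<longlonglongrightarrow> 0" "\<And>n. \<epsilon>n n \<in> E"
  shows "loc_lim (\<lambda>n. f (\<epsilon>n n)) (f 0) \<Omega>"
  unfolding loc_lim_def
proof
  fix z assume "z \<in> \<Omega>"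
  then obtain r where r: "r > 0" "cball z r \<subseteq> \<Omega>" using \<Omega> open_contains_cball by blast
  obtain \<eta> where \<eta>: "\<eta> > 0" "cball 0 \<eta> \<subseteq> E" using E open_contains_cball by blast
  let ?f = "\<lambda>(\<epsilon>, z). f \<epsilon> z"
  let ?K = "cball 0 \<eta> \<times> cball z r"
  have "continuous_on ?K ?f"
    by (rule continuous_at_imp_continuous_on) (use real_analytic_on_isCont[OF an] \<eta> r in blast)
  then have uc: "uniformly_continuous_on ?K ?f"
    by (rule compact_uniformly_continuous) (intro compact_Times compact_cball)
  show "\<exists>r>0. (\<forall>\<^sub>F n in sequentially. holo (f (\<epsilon>n n)) (ball z r)) \<and> uniform_limit (ball z r) (\<lambda>n. f (\<epsilon>n n)) (f 0) sequentially"
  proof (intro exI[of _ r] conjI r(1))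
    have "holo (f (\<epsilon>n n)) (ball z r)" for n
      by (rule holo_subset[OF h[OF e(2)]]) (use r(2) ball_subset_cball in blast)
    then show "\<forall>\<^sub>F n in sequentially. holo (f (\<epsilon>n n)) (ball z r)" by simp
    show "uniform_limit (ball z r) (\<lambda>n. f (\<epsilon>n n)) (f 0) sequentially"
    proof (rule uniform_limitI)
    fix e0 :: real assume "e0 > 0"
    then obtain d where d: "d > 0" "\<And>x x'. x \<in> ?K \<Longrightarrow> x' \<in> ?K \<Longrightarrow> dist x' x < d \<Longrightarrow> dist (?f x') (?f x) < e0"
      using uc unfolding uniformly_continuous_on_def by blast
    have "\<forall>\<^sub>F n in sequentially. dist (\<epsilon>n n) 0 < min d \<eta>" by (rule tendstoD[OF e(1)]) (use d \<eta> in auto)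
    then show "\<forall>\<^sub>F n in sequentially. \<forall>x\<in>ball z r. dist (f (\<epsilon>n n) x) (f 0 x) < e0"
    proof eventually_elim
      case (elim n)
      show ?case
      proof
        fix x assume "x \<in> ball z r"
        then show "dist (f (\<epsilon>n n) x) (f 0 x) < e0"
          using d(2)[of "(0, x)" "(\<epsilon>n n, x)"] elim \<eta>(1) by (simp add: dist_Pair_Pair)
      qed
    qed
    qed
  qed
qed

section \<open>Limits of the coefficients at the origin of the parameter space\<close>

lemma deformation_good_system:
  assumes "involutive_deformation o1 A E \<Omega> F G" "\<epsilon> \<in> E"
  shows "good_system o1 \<Omega> (F \<epsilon>) (G \<epsilon>)"
  using assms unfolding involutive_deformation_def good_system_def by simp

lemma clinear_matrix_nth: "clinear (\<lambda>p::complex ^ 'n::finite. (A *v p) $ j)"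
  unfolding matrix_vector_mult_def by (simp, intro clinear_sumI clinear_mult_left clinear_vec_nth)

text \<open>The row \<open>o1\<close> is the same for all parameters. In the other rows locally
  uniform convergence carries over to the differentials, and the limit \<open>flat_G\<close> is its
  own differential because it is linear.\<close>

lemma rhs_ext_limit:
  fixes A :: "'m::finite \<Rightarrow> complex ^ 'n ^ 'n::finite"
  assumes A: "A o1 = mat 1" and def: "involutive_deformation o1 A E \<Omega> F G"
    and e: "\<epsilon>n \<longlonglongrightarrow> 0" "\<And>n. \<epsilon>n n \<in> E" and z: "(x0, u0, p) \<in> \<Omega>"
  shows "(\<lambda>n. rhs_ext o1 (G (\<epsilon>n n)) k j (x0, u0, p)) \<longlonglongrightarrow> (A k *v p) $ j"
    and "\<pi> \<longlonglongrightarrow> \<pi>0 \<Longrightarrow> (\<lambda>n. fderiv (rhs_ext o1 (G (\<epsilon>n n)) k j) (x0, u0, p) (0, 0, \<pi> n)) \<longlonglongrightarrow> (A k *v \<pi>0) $ j"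
proof -
  let ?z = "(x0, u0, p)"
  have "(\<lambda>n. rhs_ext o1 (G (\<epsilon>n n)) k j ?z) \<longlonglongrightarrow> (A k *v p) $ j \<and>
     (\<pi> \<longlonglongrightarrow> \<pi>0 \<longrightarrow> (\<lambda>n. fderiv (rhs_ext o1 (G (\<epsilon>n n)) k j) ?z (0, 0, \<pi> n)) \<longlonglongrightarrow> (A k *v \<pi>0) $ j)" for \<pi> \<pi>0
  proof (cases "k = o1")
    case True
    have eq: "rhs_ext o1 g k j = (\<lambda>z. snd (snd z) $ j)" for g using True by (auto simp: rhs_ext_def)
    have "clinear (\<lambda>z::('n, 'm) jet. snd (snd z) $ j)"
      by (intro clinear_compose[OF clinear_vec_nth] clinear_compose[OF clinear_snd] clinear_snd)
    then show ?thesis unfolding eq using True by (auto simp: A fderiv_clinear intro: tendsto_vec_nth)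
  next
    case False
    have eq: "rhs_ext o1 g k j = g k j" for g using False by (auto simp: rhs_ext_def)
    have d: "open E" "0 \<in> E" "open \<Omega>" "real_analytic_on (\<lambda>(\<epsilon>, z). G \<epsilon> k j z) (E \<times> \<Omega>)"
      "\<And>\<epsilon>. \<epsilon> \<in> E \<Longrightarrow> holo (G \<epsilon> k j) \<Omega>" "\<And>z. z \<in> \<Omega> \<Longrightarrow> flat_G A k j z = G 0 k j z"
      using def False unfolding involutive_deformation_def by auto
    have L: "loc_lim (\<lambda>n. G (\<epsilon>n n) k j) (G 0 k j) \<Omega>"
      by (rule analytic_family_loc_lim[OF d(1-5) e])
    have fl: "flat_G A k j = (\<lambda>z. (A k *v snd (snd z)) $ j)" by (auto simp: flat_G_def)
    have cl: "clinear (flat_G A k j)"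
      unfolding fl by (rule clinear_compose[OF clinear_matrix_nth clinear_compose[OF clinear_snd clinear_snd]])
    have "fderiv (G 0 k j) ?z = fderiv (flat_G A k j) ?z"
      using holo_cong(2)[OF holo_clinear_map[OF cl] d(3,6) z] by simp
    then have dG: "fderiv (G 0 k j) ?z = flat_G A k j" by (simp add: fderiv_clinear[OF cl])
    obtain r where "r > 0" "uniform_limit (ball ?z r) (\<lambda>n. G (\<epsilon>n n) k j) (G 0 k j) sequentially"
      using L z unfolding loc_lim_def by blast
    then have "(\<lambda>n. G (\<epsilon>n n) k j ?z) \<longlonglongrightarrow> G 0 k j ?z"
      by (intro tendsto_uniform_limitI[where S = "ball ?z r"]) auto
    moreover have "(\<lambda>n. fderiv (G (\<epsilon>n n) k j) ?z (0, 0, \<pi> n)) \<longlonglongrightarrow> fderiv (G 0 k j) ?z (0, 0, \<pi>0)" if "\<pi> \<longlonglongrightarrow> \<pi>0"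
      by (rule loc_lim_fderiv_tendsto[OF L z]) (intro tendsto_Pair tendsto_const that)
    ultimately show ?thesis unfolding eq dG by (simp add: d(6)[OF z, symmetric] fl)
  qed
  then show "(\<lambda>n. rhs_ext o1 (G (\<epsilon>n n)) k j ?z) \<longlonglongrightarrow> (A k *v p) $ j"
    and "\<pi> \<longlonglongrightarrow> \<pi>0 \<Longrightarrow> (\<lambda>n. fderiv (rhs_ext o1 (G (\<epsilon>n n)) k j) ?z (0, 0, \<pi> n)) \<longlonglongrightarrow> (A k *v \<pi>0) $ j" by blast+
qed

lemma frozen_K_eq:
  assumes g: "good_system o1 \<Omega> F G" and z: "z \<in> \<Omega>"
  shows "frozen_K o1 F G z w \<pi> = (\<chi> k. \<Sum>j\<in>UNIV. fderiv (rhs_ext o1 G k j) z (0, 0, \<pi>) * w $ j)"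
proof -
  have hH: "holo (\<lambda>z. pfaff o1 F G z w) \<Omega>" by (rule holo_Hs'[OF g])
  have c: "holo (\<lambda>z. rhs_ext o1 G k j z * w $ j) \<Omega>" for k j by (intro holo_mult holo_rhs_ext[OF g] holo_const)
  have "frozen_K o1 F G z w \<pi> $ k = fderiv (\<lambda>z. fst (pfaff o1 F G z w) $ k) z (0, 0, \<pi>)" for k
    unfolding frozen_K_def using fderiv_vec_nth[OF holo_fst[OF hH] z] fderiv_fst[OF hH z] by simp
  also have "\<dots> k = fderiv (\<lambda>z. \<Sum>j\<in>UNIV. rhs_ext o1 G k j z * w $ j) z (0, 0, \<pi>)" for k by (simp add: pfaff_def)
  also have "\<dots> k = (\<Sum>j\<in>UNIV. fderiv (rhs_ext o1 G k j) z (0, 0, \<pi>) * w $ j)" for k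
  proof -
    have "fderiv (\<lambda>z. rhs_ext o1 G k j z * w $ j) z (0, 0, \<pi>) = fderiv (rhs_ext o1 G k j) z (0, 0, \<pi>) * w $ j" for j
      using fderiv_mult[OF holo_rhs_ext[OF g] holo_const z, of k j "w $ j" "(0, 0, \<pi>)"] by (simp add: fderiv_eqI[OF has_derivative_const])
    moreover have "fderiv (\<lambda>z. \<Sum>j\<in>UNIV. rhs_ext o1 G k j z * w $ j) z (0, 0, \<pi>) = (\<Sum>j\<in>UNIV. fderiv (\<lambda>z. rhs_ext o1 G k j z * w $ j) z (0, 0, \<pi>))"
      by (rule fderiv_sum[OF c z])
    ultimately show ?thesis by simp
  qed
  finally show ?thesis by (simp add: vec_eq_iff)
qed

lemma coefficient_limits:
  fixes A :: "'m::finite \<Rightarrow> complex ^ 'n ^ 'n::finite"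
  assumes A: "A o1 = mat 1" and def: "involutive_deformation o1 A E \<Omega> F G"
    and e: "\<epsilon>n \<longlonglongrightarrow> 0" "\<And>n. \<epsilon>n n \<in> E" and z: "(x0, u0, p) \<in> \<Omega>"
  shows "a \<longlonglongrightarrow> a0 \<Longrightarrow> (\<lambda>n. frozen_L o1 (F (\<epsilon>n n)) (G (\<epsilon>n n)) (x0, u0, p) (a n)) \<longlonglongrightarrow> plane_map A p a0"
    and "\<pi> \<longlonglongrightarrow> \<pi>0 \<Longrightarrow> (\<lambda>n. frozen_K o1 (F (\<epsilon>n n)) (G (\<epsilon>n n)) (x0, u0, p) w (\<pi> n)) \<longlonglongrightarrow> plane_map A \<pi>0 w"
  unfolding frozen_K_eq[OF deformation_good_system[OF def e(2)] z] unfolding frozen_L_def pfaff_def plane_map_def fst_conv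
  by (intro tendsto_vec_lambda tendsto_sum tendsto_mult tendsto_vec_nth tendsto_const rhs_ext_limit[OF A def e z]; assumption)+

lemma clinear_frozen_L: "clinear (frozen_L o1 F G z)"
  unfolding frozen_L_def by (rule clinear_compose[OF clinear_fst clinear_pfaff])

lemma clinear_frozen_K: "good_system o1 \<Omega> F G \<Longrightarrow> z \<in> \<Omega> \<Longrightarrow> clinear (frozen_K o1 F G z w)"
  unfolding frozen_K_def
  by (intro clinear_compose[OF clinear_fst] clinear_compose[OF holo_clinear[OF holo_Hs']] clinear_Pair clinear_const0 clinear_id)

text \<open>Gaussian elimination: an unknown with a nonzero coefficient in the last equation is
  solved for, which leaves one equation and one unknown less.\<close>

lemma underdetermined_system:
  fixes M :: "nat \<Rightarrow> 'i \<Rightarrow> complex"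
  assumes "finite I" "n < card I"
  shows "\<exists>c. (\<exists>i\<in>I. c i \<noteq> 0) \<and> (\<forall>j<n. (\<Sum>i\<in>I. c i * M j i) = 0)"
  using assms
proof (induction n arbitrary: I M)
  case 0
  then have "I \<noteq> {}" by auto
  then show ?case by (intro exI[of _ "\<lambda>_. 1"]) auto
next
  case (Suc n)
  show ?case
  proof (cases "\<forall>i\<in>I. M n i = 0")
    case True
    obtain c where "\<exists>i\<in>I. c i \<noteq> 0" "\<forall>j<n. (\<Sum>i\<in>I. c i * M j i) = 0"
      using Suc.IH[of I M] Suc.prems by auto
    then show ?thesis using True by (intro exI[of _ c]) (auto simp: less_Suc_eq)
  next
    case False
    then obtain i0 where i0: "i0 \<in> I" "M n i0 \<noteq> 0" by blast
    let ?I = "I - {i0}"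
    let ?M = "\<lambda>j i. M j i - M j i0 * M n i / M n i0"
    have "n < card ?I" using Suc.prems i0(1) by simp
    then obtain c where c: "\<exists>i\<in>?I. c i \<noteq> 0" "\<And>j. j < n \<Longrightarrow> (\<Sum>i\<in>?I. c i * ?M j i) = 0"
      using Suc.IH[of ?I ?M] Suc.prems(1) by auto
    define d where "d i = (if i = i0 then - (\<Sum>i\<in>?I. c i * M n i / M n i0) else c i)" for i
    have sum: "(\<Sum>i\<in>I. d i * M j i) = (\<Sum>i\<in>?I. c i * ?M j i)" for j
    proof -
      have "(\<Sum>i\<in>I. d i * M j i) = d i0 * M j i0 + (\<Sum>i\<in>?I. d i * M j i)"
        by (rule sum.remove[OF Suc.prems(1) i0(1)])
      also have "(\<Sum>i\<in>?I. d i * M j i) = (\<Sum>i\<in>?I. c i * M j i)" by (rule sum.cong) (auto simp: d_def)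
      also have "d i0 * M j i0 = - (\<Sum>i\<in>?I. c i * (M j i0 * M n i / M n i0))"
        by (simp add: d_def sum_distrib_left sum_distrib_right mult_ac)
      finally show ?thesis by (simp add: right_diff_distrib sum_subtractf)
    qed
    have "?M n i = 0" for i using i0(2) by simp
    then have "(\<Sum>i\<in>I. d i * M n i) = 0" unfolding sum by simp
    then show ?thesis using c sum by (intro exI[of _ d]) (auto simp: d_def less_Suc_eq)
  qed
qed

lemma homogD: "homog k P \<Longrightarrow> P (c *\<^sub>C q) = c ^ k *\<^sub>C P q" and homog_holo: "homog k P \<Longrightarrow> holo P UNIV"
  by (simp_all add: homog_def)

lemma varpi_eqI: "(\<And>j. contact o1 p (fderiv P q (axis j 1, L (axis j 1))) = v $ j) \<Longrightarrow> varpi o1 p L P q = v"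
  by (simp add: varpi_def vec_eq_iff)

lemma frozen_scale:
  assumes P: "holo P UNIV" and fr: "frozen o1 p L K P" and L: "clinear L" and K: "\<And>w. clinear (K w)"
  shows "frozen o1 p L K (\<lambda>q. c *\<^sub>C P q)"
proof -
  have d: "fderiv (\<lambda>q. c *\<^sub>C P q) q v = c *\<^sub>C fderiv P q v" for q v by (rule fderiv_scaleC_left[OF P UNIV_I])
  have d2: "fderiv (\<lambda>q. c *\<^sub>C fderiv P q v) q w = c *\<^sub>C fderiv (\<lambda>q. fderiv P q v) q w" for q v w
    by (rule fderiv_scaleC_left[OF holo_fderiv_const[OF open_UNIV P] UNIV_I])
  have vp: "varpi o1 p L (\<lambda>q. c *\<^sub>C P q) q = c *\<^sub>C varpi o1 p L P q" for q
    by (rule varpi_eqI) (simp add: varpi_def d clinear_scaleC_D[OF clinear_contact])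
  show ?thesis
    using fr unfolding frozen_def vp d d2
    by (simp add: clinear_scaleC_D[OF clinear_contact] clinear_scaleC_D[OF L] clinear_scaleC_D[OF K] scaleC_add_right)
qed

text \<open>The coefficients do not depend on the point \<open>q\<close>, so the equations can be
  differentiated in direction \<open>v\<close> and the order of the derivatives exchanged.\<close>

lemma frozen_fderiv:
  assumes P: "holo P UNIV" and fr: "frozen o1 p L K P" and L: "clinear L" and K: "\<And>w. clinear (K w)"
  shows "frozen o1 p L K (\<lambda>q. fderiv P q v)"
proof -
  have hd: "holo (\<lambda>q. fderiv P q w) UNIV" for w by (rule holo_fderiv_const[OF open_UNIV P])
  have sw: "fderiv (\<lambda>q. fderiv P q v) q w = fderiv (\<lambda>q. fderiv P q w) q v" for q w by (rule fderiv_fderiv_sym[OF open_UNIV P UNIV_I])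
  have sw2: "fderiv (\<lambda>q. fderiv (\<lambda>q. fderiv P q a) q v) q b = fderiv (\<lambda>q. fderiv (\<lambda>q. fderiv P q a) q b) q v" for q a b
    by (rule fderiv_fderiv_sym[OF open_UNIV hd UNIV_I])
  have vp: "varpi o1 p L (\<lambda>q. fderiv P q v) q = fderiv (varpi o1 p L P) q v" for q
  proof (rule varpi_eqI)
    fix j
    have hl: "holo (\<lambda>q. contact o1 p (fderiv P q (axis j 1, L (axis j 1)))) UNIV" for j
      by (rule holo_clinear_compose[OF clinear_contact hd])
    have "fderiv (varpi o1 p L P) q v = (\<chi> j. fderiv (\<lambda>q. contact o1 p (fderiv P q (axis j 1, L (axis j 1)))) q v)"
      unfolding varpi_def by (rule fderiv_vec_lambda[OF hl UNIV_I])
    then show "contact o1 p (fderiv (\<lambda>q. fderiv P q v) q (axis j 1, L (axis j 1))) = fderiv (varpi o1 p L P) q v $ j"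
      using fderiv_clinear_compose[OF clinear_contact hd UNIV_I] by (simp add: sw)
  qed
  have hvp: "holo (varpi o1 p L P) UNIV"
    unfolding varpi_def by (intro holo_vec_lambda holo_clinear_compose[OF clinear_contact hd])
  show ?thesis
    unfolding frozen_def
  proof (intro conjI allI)
    fix q w
    let ?T = "(w, L w)"
    have "snd (fderiv (\<lambda>q. fderiv P q v) q ?T) = fderiv (\<lambda>q. snd (fderiv P q ?T)) q v"
      unfolding sw using fderiv_snd[OF hd UNIV_I] by simp
    also have "(\<lambda>q. snd (fderiv P q ?T)) = (\<lambda>q. K w (varpi o1 p L P q) + L (fst (fderiv P q ?T)))"
      using fr unfolding frozen_def by blast
    also have "fderiv (\<lambda>q. K w (varpi o1 p L P q) + L (fst (fderiv P q ?T))) q v = K w (fderiv (varpi o1 p L P) q v) + L (fst (fderiv (\<lambda>q. fderiv P q ?T) q v))"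
      using fderiv_add[OF holo_clinear_compose[OF K hvp] holo_clinear_compose[OF L holo_fst[OF hd]] UNIV_I]
        fderiv_clinear_compose[OF K hvp UNIV_I] fderiv_clinear_compose[OF L holo_fst[OF hd] UNIV_I] fderiv_fst[OF hd UNIV_I] by simp
    finally show "snd (fderiv (\<lambda>q. fderiv P q v) q ?T) = K w (varpi o1 p L (\<lambda>q. fderiv P q v) q) + L (fst (fderiv (\<lambda>q. fderiv P q v) q ?T))"
      by (simp add: vp sw)
  next
    fix q i w
    let ?a = "(axis i 1, L (axis i 1))" and ?b = "(w, L w)"
    have hd2: "holo (\<lambda>q. fderiv (\<lambda>q. fderiv P q ?a) q ?b) UNIV" by (rule holo_fderiv_const[OF open_UNIV hd])
    have "contact o1 p (fderiv (\<lambda>q. fderiv (\<lambda>q. fderiv P q v) q ?a) q ?b) = contact o1 p (fderiv (\<lambda>q. fderiv (\<lambda>q. fderiv P q ?a) q ?b) q v)"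
      by (simp add: sw sw2)
    also have "\<dots> = fderiv (\<lambda>q. contact o1 p (fderiv (\<lambda>q. fderiv P q ?a) q ?b)) q v"
      using fderiv_clinear_compose[OF clinear_contact hd2 UNIV_I] by simp
    also have "(\<lambda>q. contact o1 p (fderiv (\<lambda>q. fderiv P q ?a) q ?b)) = (\<lambda>_. 0)"
      using fr unfolding frozen_def by blast
    finally show "contact o1 p (fderiv (\<lambda>q. fderiv (\<lambda>q. fderiv P q v) q ?a) q ?b) = 0"
      by (simp add: fderiv_eqI[OF has_derivative_const])
  qed
qed

lemma frozen_shift:
  assumes P: "holo P UNIV" and fr: "frozen o1 p L K P"
  shows "frozen o1 p L K (\<lambda>q. P (q + h))"
proof -
  have d: "fderiv (\<lambda>q. P (q + h)) q v = fderiv P (q + h) v" for q v by (rule fderiv_shift[OF P UNIV_I])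
  have d2: "fderiv (\<lambda>q. fderiv P (q + h) v) q w = fderiv (\<lambda>q. fderiv P q v) (q + h) w" for q v w
    by (rule fderiv_shift[OF holo_fderiv_const[OF open_UNIV P] UNIV_I])
  have vp: "varpi o1 p L (\<lambda>q. P (q + h)) q = varpi o1 p L P (q + h)" for q by (simp add: varpi_def d)
  show ?thesis using fr unfolding frozen_def vp d d2 by blast
qed

text \<open>Differentiating the scaling law produces an extra factor \<open>c\<close> that has to be
  cancelled; the case \<open>c = 0\<close> follows by continuity.\<close>

lemma homog_fderiv:
  fixes P :: "'a::complex_normed_space \<Rightarrow> 'b::cspace"
  assumes "homog (Suc k) P"
  shows "homog k (\<lambda>q. fderiv P q v)"
proof -
  note P = homog_holo[OF assms]
  have hd: "holo (\<lambda>q. fderiv P q v) UNIV" by (rule holo_fderiv_const[OF open_UNIV P])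
  have ne: "fderiv P (c *\<^sub>C q) v = c ^ k *\<^sub>C fderiv P q v" if c: "c \<noteq> 0" for c q
  proof -
    have "fderiv (\<lambda>q. P (c *\<^sub>C q)) q v = c *\<^sub>C fderiv P (c *\<^sub>C q) v"
      using fderiv_compose[OF P UNIV_I has_derivative_clinear[OF clinear_scaleC[OF clinear_id]], of c q v]
      by (simp add: clinear_scaleC_D[OF holo_clinear[OF P UNIV_I]])
    moreover have "fderiv (\<lambda>q. P (c *\<^sub>C q)) q v = c ^ Suc k *\<^sub>C fderiv P q v"
      unfolding homogD[OF assms] by (rule fderiv_scaleC_left[OF P UNIV_I])
    ultimately have "c *\<^sub>C (fderiv P (c *\<^sub>C q) v - c ^ k *\<^sub>C fderiv P q v) = 0"
      by (simp add: scaleC_diff_right scaleC_scaleC)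
    then show ?thesis using c by simp
  qed
  have "fderiv P (c *\<^sub>C q) v = c ^ k *\<^sub>C fderiv P q v" for c q
  proof (cases "c = 0")
    case True
    let ?s = "\<lambda>n. complex_of_real (inverse (real (Suc n)))"
    have "?s \<longlonglongrightarrow> complex_of_real 0" by (rule tendsto_of_real[OF LIMSEQ_inverse_real_of_nat])
    then have s: "?s \<longlonglongrightarrow> 0" by (simp only: of_real_0)
    have "(\<lambda>n. fderiv P (?s n *\<^sub>C q) v) \<longlonglongrightarrow> fderiv P (0 *\<^sub>C q) v"
      by (rule isCont_tendsto_compose[OF holo_isCont[OF hd UNIV_I] bounded_bilinear.tendsto[OF bounded_bilinear_scaleC s tendsto_const]])
    moreover have "(\<lambda>n. ?s n ^ k *\<^sub>C fderiv P q v) \<longlonglongrightarrow> 0 ^ k *\<^sub>C fderiv P q v"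
      by (intro bounded_bilinear.tendsto[OF bounded_bilinear_scaleC] tendsto_power s tendsto_const)
    moreover have "fderiv P (?s n *\<^sub>C q) v = ?s n ^ k *\<^sub>C fderiv P q v" for n
      by (rule ne) (simp only: of_real_eq_0_iff inverse_nonzero_iff_nonzero of_nat_eq_0_iff nat.simps not_False_eq_True)
    ultimately show ?thesis using LIMSEQ_unique True by simp
  qed (rule ne)
  then show ?thesis unfolding homog_def using hd by blast
qed

lemma homog_fderiv_nonzero:
  fixes P :: "'a::complex_normed_space \<Rightarrow> 'b::cspace"
  assumes "homog (Suc k) P" "P q \<noteq> 0"
  shows "\<exists>v q. fderiv P q v \<noteq> 0"
proof (rule ccontr)
  assume "\<not> ?thesis"
  then have "P q = P (0 *\<^sub>C q)"
    by (intro holo_zero_derivative[OF convex_UNIV homog_holo[OF assms(1)]]) auto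
  then show False using homogD[OF assms(1), of 0 q] assms(2) by simp
qed

text \<open>Differentiating a homogeneous solution lowers its degree without leaving the solution space.\<close>

lemma frozen_descend:
  fixes P :: "('n::finite, 'm::finite) base \<Rightarrow> ('n, 'm) base"
  assumes L: "\<And>p. p \<in> U \<Longrightarrow> clinear (L p)" and K: "\<And>p w. p \<in> U \<Longrightarrow> clinear (K p w)"
  shows "homog (r + j) P \<Longrightarrow> (\<And>p. p \<in> U \<Longrightarrow> frozen o1 p (L p) (K p) P) \<Longrightarrow> P q \<noteq> 0 \<Longrightarrow>
    \<exists>P' q'. homog r P' \<and> (\<forall>p\<in>U. frozen o1 p (L p) (K p) P') \<and> P' q' \<noteq> 0"
proof (induction j arbitrary: P q)
  case 0
  then have "homog r P" by simp
  with 0 show ?case by blast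
next
  case (Suc j)
  then have h: "homog (Suc (r + j)) P" by simp
  obtain v q' where v: "fderiv P q' v \<noteq> 0" using homog_fderiv_nonzero[OF h Suc.prems(3)] by blast
  show ?case
    by (rule Suc.IH[OF homog_fderiv[OF h] frozen_fderiv[OF homog_holo[OF h] Suc.prems(2) L K] v])
qed

text \<open>Both equations are holomorphic in \<open>p\<close>, so they spread from \<open>U\<close>
  along the complex line that joins \<open>p0\<close> to an arbitrary \<open>p\<close>. All slopes
  are wanted because the flow on the space of planes changes the slope.\<close>

lemma frozen_extend:
  fixes P :: "('n::finite, 'm::finite) base \<Rightarrow> ('n, 'm) base"
  assumes P: "holo P UNIV" and U: "open U" "p0 \<in> U"
    and fr: "\<And>p. p \<in> U \<Longrightarrow> frozen o1 p (plane_map A p) (\<lambda>w \<pi>. plane_map A \<pi> w) P"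
  shows "frozen_flat o1 A P"
proof -
  have ext: "f p = 0" if f: "holo f UNIV" and z: "\<And>p. p \<in> U \<Longrightarrow> f p = 0" for f :: "complex ^ 'n \<Rightarrow> 'b::cspace" and p
  proof -
    let ?l = "\<lambda>t::complex. p0 + t *\<^sub>C (p - p0)"
    have hl: "holo ?l UNIV" by (rule holo_line)
    have "f (?l 1) = 0"
    proof (rule holo_zero_continuation[of "\<lambda>t. f (?l t)" UNIV 0])
      show "holo (\<lambda>t. f (?l t)) UNIV" by (rule holo_compose[OF f hl]) simp
      have "\<forall>\<^sub>F t in nhds 0. ?l t \<in> U"
        by (rule topological_tendstoD[OF holo_tendsto_nhds[OF hl UNIV_I] U(1)]) (use U(2) in simp)
      then show "\<forall>\<^sub>F t in nhds 0. f (?l t) = 0" by eventually_elim (rule z)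
    qed auto
    then show ?thesis by simp
  qed
  have hT: "holo (\<lambda>p. (w, plane_map A p w)) UNIV" for w
    by (intro holo_Pair holo_const holo_clinear_map clinear_plane_map_left)
  have hP: "holo (\<lambda>p. fderiv P q (w, plane_map A p w)) UNIV" for q w
    by (rule holo_fderiv[OF open_UNIV P holo_const hT]) simp
  have hv: "holo (\<lambda>p. varpi o1 p (plane_map A p) P q) UNIV" for q
    unfolding varpi_def by (intro holo_vec_lambda holo_contact(1) holo_ident hP)
  let ?J = "\<lambda>(q, v). fderiv P q v"
  have J: "holo ?J (UNIV \<times> UNIV)" by (rule holo_fderiv_joint[OF open_UNIV P])
  \<comment> \<open>Both directions \<open>a\<close> and \<open>b\<close> will depend on
    \<open>p\<close>. Written as a value of the joint differential, the second derivative is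
    holomorphic in both of them.\<close>
  have d2: "fderiv (\<lambda>q. fderiv P q a) q b = fderiv ?J (q, a) (b, 0)" for q a b
    using holo_slice1(2)[OF J, of a q b] by simp
  show ?thesis
    unfolding frozen_flat_def frozen_def
  proof (intro allI conjI)
    fix p q w
    have h: "holo (\<lambda>p. snd (fderiv P q (w, plane_map A p w)) - (plane_map A (varpi o1 p (plane_map A p) P q) w + plane_map A p (fst (fderiv P q (w, plane_map A p w))))) UNIV"
      by (intro holo_diff holo_snd hP holo_add holo_plane_map(1) hv holo_const holo_ident holo_fst)
    have "snd (fderiv P q (w, plane_map A p w)) - (plane_map A (varpi o1 p (plane_map A p) P q) w + plane_map A p (fst (fderiv P q (w, plane_map A p w)))) = 0"
    proof (rule ext[OF h])
      fix p assume "p \<in> U"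
      from fr[OF this] have "snd (fderiv P q (w, plane_map A p w)) = plane_map A (varpi o1 p (plane_map A p) P q) w + plane_map A p (fst (fderiv P q (w, plane_map A p w)))"
        unfolding frozen_def by blast
      then show "snd (fderiv P q (w, plane_map A p w)) - (plane_map A (varpi o1 p (plane_map A p) P q) w + plane_map A p (fst (fderiv P q (w, plane_map A p w)))) = 0" by simp
    qed
    then show "snd (fderiv P q (w, plane_map A p w)) = plane_map A (varpi o1 p (plane_map A p) P q) w + plane_map A p (fst (fderiv P q (w, plane_map A p w)))" by simp
  next
    fix p q i w
    have hd: "holo (\<lambda>p. fderiv ?J (q, (axis i 1, plane_map A p (axis i 1))) ((w, plane_map A p w), 0)) UNIV"
      by (rule holo_fderiv[OF _ J holo_Pair[OF holo_const hT] holo_Pair[OF hT holo_const]]) auto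
    have h: "holo (\<lambda>p. contact o1 p (fderiv (\<lambda>q. fderiv P q (axis i 1, plane_map A p (axis i 1))) q (w, plane_map A p w))) UNIV"
      unfolding d2 by (rule holo_contact(1)[OF holo_ident hd])
    show "contact o1 p (fderiv (\<lambda>q. fderiv P q (axis i 1, plane_map A p (axis i 1))) q (w, plane_map A p w)) = 0"
      by (rule ext[OF h], drule fr) (unfold frozen_def, blast)
  qed
qed

lemma homog_scaleR: "homog k P \<Longrightarrow> P (r *\<^sub>R q) = r ^ k *\<^sub>R P q"
  using homogD[of k P "complex_of_real r" q] scaleC_of_real[of "r ^ k" "P q"] by (simp add: scaleC_of_real)

text \<open>Homogeneity extends the Arzela-Ascoli limit from the unit ball to the whole space.\<close>

lemma homog_compactness:
  fixes P :: "nat \<Rightarrow> 'a::cspace \<Rightarrow> 'b::cspace"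
  assumes P: "\<And>n. homog k (P n)" and nz: "\<And>n. \<exists>q. P n q \<noteq> 0"
  obtains c \<kappa> g where "strict_mono (\<kappa> :: nat \<Rightarrow> nat)" "homog k g" "loc_lim (\<lambda>n q. c (\<kappa> n) *\<^sub>C P (\<kappa> n) q) g UNIV" "\<exists>q. g q \<noteq> 0"
proof -
  have hP: "holo (P n) S" for n S using homog_holo[OF P] holo_subset by blast
  have "\<exists>s\<in>cball 0 1. (\<forall>q\<in>cball 0 1. norm (P n q) \<le> norm (P n s))" for n
    by (rule continuous_attains_sup[OF compact_cball _ continuous_on_norm[OF holo_continuous_on[OF hP]]]) simp
  then obtain s where s: "\<And>n. s n \<in> cball 0 1" "\<And>n q. q \<in> cball 0 1 \<Longrightarrow> norm (P n q) \<le> norm (P n (s n))" by metis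
  define M where "M n = norm (P n (s n))" for n
  have resc: "f q = R ^ k *\<^sub>R f (q /\<^sub>R R)" if "homog k f" "R > 0" for f :: "'a \<Rightarrow> 'b" and q R
    using homog_scaleR[OF that(1), of R "q /\<^sub>R R"] that(2) by simp
  have inb: "q /\<^sub>R R \<in> cball 0 1" if "norm q \<le> R" "R > 0" for q :: 'a and R
    using that by (simp add: field_simps)
  have M: "M n > 0" for n
  proof (rule ccontr)
    assume "\<not> M n > 0"
    then have z: "P n q = 0" if "q \<in> cball 0 1" for q using s(2)[OF that, of n] by (simp add: M_def)
    have "P n q = 0" for q
      using resc[OF P, of "norm q + 1" n q] z[OF inb[of q "norm q + 1"]] by (simp add: add_nonneg_pos)
    then show False using nz by blast
  qed
  define c where "c n = complex_of_real (inverse (M n))" for n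
  define Q where "Q n q = c n *\<^sub>C P n q" for n q
  have Q: "homog k (Q n)" for n
    unfolding homog_def Q_def using homogD[OF P] by (auto intro: holo_scaleC_left hP simp: scaleC_scaleC mult.commute)
  have hQ: "holo (Q n) S" for n S using homog_holo[OF Q] holo_subset by blast
  have nQ: "norm (Q n q) = norm (P n q) / M n" for n q
    using M[of n] by (simp add: Q_def c_def norm_scaleC divide_inverse mult.commute norm_inverse)
  have Q1: "norm (Q n q) \<le> 1" if "q \<in> cball 0 1" for n q
    using s(2)[OF that, of n] M[of n] by (simp add: nQ M_def)
  have Q2: "norm (Q n q) \<le> 2 ^ k" if "norm q \<le> 2" for n q
  proof -
    have "norm (Q n q) = 2 ^ k * norm (Q n (q /\<^sub>R 2))" unfolding resc[OF Q, of 2 n q, simplified] by simp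
    also have "\<dots> \<le> 2 ^ k * 1" using Q1[OF inb[of q 2]] that by (intro mult_left_mono) auto
    finally show ?thesis by simp
  qed
  \<comment> \<open>A unit ball about a point of the unit ball lies in the ball of radius 2, where
    homogeneity bounds \<open>Q n\<close> by \<open>2 ^ k\<close>; Cauchy's estimate then bounds all
    differentials uniformly, which gives equicontinuity.\<close>
  define B where "B = 2 * real DIM('b) * 2 ^ k"
  have B: "B > 0" by (simp add: B_def)
  have dQ: "norm (fderiv (Q n) q v) \<le> B * norm v" if "q \<in> cball 0 1" for n q v
  proof -
    have "norm (fderiv (Q n) q v) \<le> 2 * real DIM('b) * 2 ^ k / 1 * norm v"
    proof (rule cauchy_bound[OF _ hQ])
      fix w assume "w \<in> cball q 1"
      then have "norm w \<le> 2" using that norm_triangle_sub[of w q] by (simp add: dist_norm norm_minus_commute)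
      then show "norm (Q n w) \<le> 2 ^ k" by (rule Q2)
    qed simp
    then show ?thesis by (simp add: B_def)
  qed
  have lip: "norm (Q n x - Q n y) \<le> B * norm (x - y)" if "x \<in> cball 0 1" "y \<in> cball 0 1" for n x y
    by (rule holo_lipschitz[OF convex_cball hQ dQ less_imp_le[OF B] that])
  obtain g \<kappa> where g: "continuous_on (cball 0 1) g" "strict_mono (\<kappa> :: nat \<Rightarrow> nat)"
    "\<And>e. 0 < e \<Longrightarrow> \<exists>N. \<forall>n x. n \<ge> N \<and> x \<in> cball 0 1 \<longrightarrow> norm (Q (\<kappa> n) x - g x) < e"
  proof (rule Arzela_Ascoli[of "cball (0::'a) 1" Q 1])
    show "\<exists>d>0. \<forall>n y. y \<in> cball 0 1 \<and> norm (x - y) < d \<longrightarrow> norm (Q n x - Q n y) < e"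
      if "x \<in> cball 0 1" "0 < e" for x e
    proof (intro exI[of _ "e / B"] conjI allI impI)
      show "0 < e / B" using that B by simp
      fix n y assume y: "y \<in> cball 0 1 \<and> norm (x - y) < e / B"
      then have "B * norm (x - y) < e" using B by (simp add: field_simps)
      then show "norm (Q n x - Q n y) < e" using lip[OF that(1), of y n] y by linarith
    qed
  qed (use Q1 in auto)
  \<comment> \<open>Division by \<open>norm q + 1\<close> moves \<open>q\<close> into the unit ball
    and, unlike division by \<open>norm q\<close>, is also meaningful at the origin.\<close>
  define G where "G q = (norm q + 1) ^ k *\<^sub>R g (q /\<^sub>R (norm q + 1))" for q
  have np: "norm q + 1 > 0" for q :: 'a by (simp add: add_nonneg_pos)
  have gl: "(\<lambda>n. Q (\<kappa> n) x) \<longlonglongrightarrow> g x" if "x \<in> cball 0 1" for x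
  proof (rule LIMSEQ_I)
    fix e :: real assume "0 < e"
    then show "\<exists>N. \<forall>n\<ge>N. norm (Q (\<kappa> n) x - g x) < e" using g(3)[of e] that by blast
  qed
  have Gl: "(\<lambda>n. Q (\<kappa> n) q) \<longlonglongrightarrow> G q" for q
    unfolding G_def resc[OF Q np, of _ q q]
    by (intro tendsto_scaleR tendsto_const gl inb np) simp
  have GR: "G q = R ^ k *\<^sub>R g (q /\<^sub>R R)" if "norm q \<le> R" "R > 0" for q R
  proof (rule LIMSEQ_unique[OF Gl])
    show "(\<lambda>n. Q (\<kappa> n) q) \<longlonglongrightarrow> R ^ k *\<^sub>R g (q /\<^sub>R R)"
      unfolding resc[OF Q that(2), of _ q] by (intro tendsto_scaleR tendsto_const gl inb that)
  qed
  have L: "loc_lim (\<lambda>n. Q (\<kappa> n)) G UNIV"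
    unfolding loc_lim_def
  proof
    fix q0 :: 'a
    define R where "R = norm q0 + 1"
    have R: "R > 0" by (simp add: R_def np)
    show "\<exists>r>0. (\<forall>\<^sub>F n in sequentially. holo (Q (\<kappa> n)) (ball q0 r)) \<and> uniform_limit (ball q0 r) (\<lambda>n. Q (\<kappa> n)) G sequentially"
    proof (intro exI[of _ 1] conjI)
      show "\<forall>\<^sub>F n in sequentially. holo (Q (\<kappa> n)) (ball q0 1)" by (simp add: hQ)
      show "uniform_limit (ball q0 1) (\<lambda>n. Q (\<kappa> n)) G sequentially"
      proof (rule uniform_limitI)
        fix e :: real assume "e > 0"
        then have "e / R ^ k > 0" using R by simp
        then obtain N where N: "\<And>n x. n \<ge> N \<Longrightarrow> x \<in> cball 0 1 \<Longrightarrow> norm (Q (\<kappa> n) x - g x) < e / R ^ k" using g(3) by blast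
        have "dist (Q (\<kappa> n) q) (G q) < e" if n: "n \<ge> N" and q: "q \<in> ball q0 1" for n q
        proof -
          have qR: "norm q \<le> R" using q norm_triangle_sub[of q q0] by (simp add: R_def dist_norm norm_minus_commute)
          have "Q (\<kappa> n) q - G q = R ^ k *\<^sub>R (Q (\<kappa> n) (q /\<^sub>R R) - g (q /\<^sub>R R))"
            using resc[OF Q R, of "\<kappa> n" q] GR[OF qR R] by (simp add: scaleR_diff_right)
          then have "dist (Q (\<kappa> n) q) (G q) = R ^ k * norm (Q (\<kappa> n) (q /\<^sub>R R) - g (q /\<^sub>R R))" using R by (simp add: dist_norm)
          also have "\<dots> < R ^ k * (e / R ^ k)" using N[OF n inb[OF qR R]] R by (intro mult_strict_left_mono) auto
          finally show ?thesis using R by simp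
        qed
        then show "\<forall>\<^sub>F n in sequentially. \<forall>x\<in>ball q0 1. dist (Q (\<kappa> n) x) (G x) < e"
          unfolding eventually_sequentially by blast
      qed
    qed simp
  qed
  have "homog k G"
    unfolding homog_def
  proof (intro conjI allI)
    show "holo G UNIV" by (rule loc_lim_holo[OF L])
    fix c q
    have "(\<lambda>n. c ^ k *\<^sub>C Q (\<kappa> n) q) \<longlonglongrightarrow> c ^ k *\<^sub>C G q"
      by (intro bounded_bilinear.tendsto[OF bounded_bilinear_scaleC] tendsto_const Gl)
    then show "G (c *\<^sub>C q) = c ^ k *\<^sub>C G q"
      using LIMSEQ_unique[OF Gl[of "c *\<^sub>C q"]] by (simp add: homogD[OF Q])
  qed
  moreover have "\<exists>q. G q \<noteq> 0"
  proof -
    \<comment> \<open>The normalized map attains norm 1 at \<open>s (\<kappa> N)\<close>; uniform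
      closeness below 1 keeps the limit from vanishing there.\<close>
    obtain N where N: "\<And>n x. n \<ge> N \<Longrightarrow> x \<in> cball 0 1 \<Longrightarrow> norm (Q (\<kappa> n) x - g x) < 1" using g(3)[of 1] by auto
    let ?s = "s (\<kappa> N)"
    have "norm (Q (\<kappa> N) ?s) = 1" using M[of "\<kappa> N"] by (simp add: nQ M_def)
    then have "g ?s \<noteq> 0" using N[of N ?s] s(1) by auto
    then show ?thesis using GR[of ?s 1] s(1)[of "\<kappa> N"] by (intro exI[of _ ?s]) simp
  qed
  ultimately show ?thesis using that[OF g(2), of G c] L unfolding Q_def by blast
qed

section \<open>Comparison of the solution spaces and counting of dimensions\<close>

lemma loc_lim_pointwise:
  assumes "loc_lim f g S" "z \<in> S"
  shows "(\<lambda>n. f n z) \<longlonglongrightarrow> g z"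
proof -
  obtain r where "r > 0" "uniform_limit (ball z r) f g sequentially" using assms unfolding loc_lim_def by blast
  then show ?thesis by (intro tendsto_uniform_limitI[where S = "ball z r"]) auto
qed

text \<open>Otherwise there are parameters tending to the origin with nonzero solutions of degree
  \<open>k\<close> on which the functionals vanish. After normalization a subsequence converges to a
  nonzero solution of the flat equations with the same vanishing, against
  \<open>kill\<close>.\<close>

lemma frozen_compactness:
  fixes A :: "'m::finite \<Rightarrow> complex ^ 'n ^ 'n::finite" and E :: "'e::euclidean_space set"
  assumes A: "A o1 = mat 1" and def: "involutive_deformation o1 A E \<Omega> F G" and z0: "(x0, u0, p0) \<in> \<Omega>"
    and kill: "\<And>P. homog k P \<Longrightarrow> frozen_flat o1 A P \<Longrightarrow>
      (\<And>i. i < n \<Longrightarrow> kk i = k \<Longrightarrow> cfun (bb i) (P (qq i)) = 0) \<Longrightarrow> \<forall>q. P q = 0"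
  shows "\<forall>\<^sub>F \<epsilon> in nhds 0. \<forall>P. homog k P \<longrightarrow>
      (\<forall>p. (x0, u0, p) \<in> \<Omega> \<longrightarrow> frozen o1 p (frozen_L o1 (F \<epsilon>) (G \<epsilon>) (x0, u0, p)) (frozen_K o1 (F \<epsilon>) (G \<epsilon>) (x0, u0, p)) P) \<longrightarrow>
      (\<forall>i<n. kk i = k \<longrightarrow> cfun (bb i) (P (qq i)) = 0) \<longrightarrow> (\<forall>q. P q = 0)"
    (is "eventually ?Q (nhds 0)")
proof (rule ccontr)
  assume neg: "\<not> eventually ?Q (nhds 0)"
  have E: "open E" "0 \<in> E" and \<Omega>: "open \<Omega>" using def by (auto simp: involutive_deformation_def)
  have "\<exists>\<epsilon>. dist \<epsilon> 0 < inverse (real (Suc j)) \<and> \<epsilon> \<in> E \<and> \<not> ?Q \<epsilon>" for j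
  proof (rule ccontr)
    assume no: "\<not> ?thesis"
    have "\<forall>\<^sub>F \<epsilon> in nhds 0. dist \<epsilon> (0::'e) < inverse (real (Suc j))"
      unfolding eventually_nhds_metric by (rule exI[of _ "inverse (real (Suc j))"]) simp
    with eventually_nhds_in_open[OF E] have "eventually ?Q (nhds 0)"
      by eventually_elim (use no in blast)
    with neg show False ..
  qed
  then obtain \<epsilon>n where \<epsilon>n: "\<And>j. dist (\<epsilon>n j) 0 < inverse (real (Suc j))" "\<And>j. \<epsilon>n j \<in> E" "\<And>j. \<not> ?Q (\<epsilon>n j)" by metis
  have "\<exists>P. homog k P \<and> (\<forall>p. (x0, u0, p) \<in> \<Omega> \<longrightarrow> frozen o1 p (frozen_L o1 (F (\<epsilon>n j)) (G (\<epsilon>n j)) (x0, u0, p)) (frozen_K o1 (F (\<epsilon>n j)) (G (\<epsilon>n j)) (x0, u0, p)) P) \<and>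
      (\<forall>i<n. kk i = k \<longrightarrow> cfun (bb i) (P (qq i)) = 0) \<and> (\<exists>q. P q \<noteq> 0)" for j
    using \<epsilon>n(3)[of j] by blast
  then obtain P where P: "\<And>j. homog k (P j)"
    "\<And>j p. (x0, u0, p) \<in> \<Omega> \<Longrightarrow> frozen o1 p (frozen_L o1 (F (\<epsilon>n j)) (G (\<epsilon>n j)) (x0, u0, p)) (frozen_K o1 (F (\<epsilon>n j)) (G (\<epsilon>n j)) (x0, u0, p)) (P j)"
    "\<And>j i. i < n \<Longrightarrow> kk i = k \<Longrightarrow> cfun (bb i) (P j (qq i)) = 0" "\<And>j. \<exists>q. P j q \<noteq> 0"
    by metis
  obtain c \<kappa> g where g: "strict_mono (\<kappa> :: nat \<Rightarrow> nat)" "homog k g"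
    "loc_lim (\<lambda>n q. c (\<kappa> n) *\<^sub>C P (\<kappa> n) q) g UNIV" "\<exists>q. g q \<noteq> 0"
    by (rule homog_compactness[OF P(1,4)])
  have "\<epsilon>n \<longlonglongrightarrow> 0"
  proof (rule tendstoI)
    fix e :: real assume "e > 0"
    with LIMSEQ_inverse_real_of_nat have "\<forall>\<^sub>F j in sequentially. inverse (real (Suc j)) < e" by (rule order_tendstoD)
    then show "\<forall>\<^sub>F j in sequentially. dist (\<epsilon>n j) 0 < e" by eventually_elim (use \<epsilon>n(1) in \<open>meson less_trans\<close>)
  qed
  then have lim: "(\<lambda>j. \<epsilon>n (\<kappa> j)) \<longlonglongrightarrow> 0" using LIMSEQ_subseq_LIMSEQ[OF _ g(1)] by (simp add: o_def)
  note inE = \<epsilon>n(2)[of "\<kappa> _"]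
  have fr: "frozen o1 p (plane_map A p) (\<lambda>w \<pi>. plane_map A \<pi> w) g" if p: "(x0, u0, p) \<in> \<Omega>" for p
  proof -
    let ?z = "(x0, u0, p)"
    let ?L = "\<lambda>j. frozen_L o1 (F (\<epsilon>n (\<kappa> j))) (G (\<epsilon>n (\<kappa> j))) ?z" and ?K = "\<lambda>j. frozen_K o1 (F (\<epsilon>n (\<kappa> j))) (G (\<epsilon>n (\<kappa> j))) ?z"
    have f: "frozen o1 p (?L j) (?K j) (\<lambda>q. c (\<kappa> j) *\<^sub>C P (\<kappa> j) q)" for j
      by (rule frozen_scale[OF homog_holo[OF P(1)] P(2)[OF p] clinear_frozen_L clinear_frozen_K[OF deformation_good_system[OF def inE] p]])
    note lims = coefficient_limits[OF A def lim inE p]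
    show ?thesis
    proof (rule frozen_limit[OF g(3), where Tn = "\<lambda>j q w. (w, ?L j w)" and Kn = "\<lambda>j q. ?K j" and Lq = "\<lambda>j q. ?L j"])
      show "(\<lambda>j. (w, ?L j w)) \<longlonglongrightarrow> (w, plane_map A p w)" for w by (intro tendsto_Pair tendsto_const lims(1))
      show "(\<lambda>j. ?K j w (\<pi> j)) \<longlonglongrightarrow> plane_map A \<pi>0 w" if "\<pi> \<longlonglongrightarrow> \<pi>0" for w \<pi> \<pi>0 by (rule lims(2)[OF that])
      show "(\<lambda>j. ?L j (a j)) \<longlonglongrightarrow> plane_map A p a0" if "a \<longlonglongrightarrow> a0" for a a0 by (rule lims(1)[OF that])
      show "\<forall>\<^sub>F j in sequentially. snd (fderiv (\<lambda>q. c (\<kappa> j) *\<^sub>C P (\<kappa> j) q) q (w, ?L j w)) =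
          ?K j w (\<chi> l. contact o1 p (fderiv (\<lambda>q. c (\<kappa> j) *\<^sub>C P (\<kappa> j) q) q (axis l 1, ?L j (axis l 1)))) + ?L j (fst (fderiv (\<lambda>q. c (\<kappa> j) *\<^sub>C P (\<kappa> j) q) q (w, ?L j w)))" for q w
        using f unfolding frozen_def varpi_def by (intro always_eventually) blast
      have z: "contact o1 p (fderiv (\<lambda>q'. fderiv (\<lambda>q. c (\<kappa> j) *\<^sub>C P (\<kappa> j) q) q' (axis i 1, ?L j (axis i 1))) q (w, ?L j w)) = 0" for q i w j
        using f unfolding frozen_def by blast
      show "(\<lambda>j. contact o1 p (fderiv (\<lambda>q'. fderiv (\<lambda>q. c (\<kappa> j) *\<^sub>C P (\<kappa> j) q) q' (axis i 1, ?L j (axis i 1))) q (w, ?L j w))) \<longlonglongrightarrow> 0" for q i w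
        unfolding z by (rule tendsto_const)
    qed
  qed
  \<comment> \<open>The gradients of the jets over the base point form an open set containing
    \<open>p0\<close>; this is where the continuation in \<open>p\<close> starts.\<close>
  let ?U = "(\<lambda>p. (x0, u0, p)) -` \<Omega>"
  have "open ?U" by (rule open_vimage[OF \<Omega>]) (intro continuous_on_Pair continuous_on_const continuous_on_id)
  then have ff: "frozen_flat o1 A g"
    by (rule frozen_extend[OF homog_holo[OF g(2)], of _ p0]) (use z0 fr in auto)
  have "cfun (bb i) (g (qq i)) = 0" if "i < n" "kk i = k" for i
  proof (rule LIMSEQ_unique[OF tendsto_clinear[OF clinear_cfun loc_lim_pointwise[OF g(3) UNIV_I]]])
    show "(\<lambda>j. cfun (bb i) (c (\<kappa> j) *\<^sub>C P (\<kappa> j) (qq i))) \<longlonglongrightarrow> 0"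
      using P(3)[OF that] by (simp add: clinear_scaleC_D[OF clinear_cfun])
  qed
  with kill[OF g(2) ff] g(4) show False by blast
qed

text \<open>A triangular system of functionals and homogeneous solutions of the flat determining equations;
  the \<open>i\<close>-th functional is a coordinate of the degree \<open>kk i\<close> part at the point \<open>qq i\<close>.\<close>

definition triangular :: "'m \<Rightarrow> ('m \<Rightarrow> complex ^ 'n ^ 'n) \<Rightarrow> nat \<Rightarrow> (nat \<Rightarrow> nat) \<Rightarrow>
    (nat \<Rightarrow> ('n, 'm) base) \<Rightarrow> (nat \<Rightarrow> ('n, 'm) base) \<Rightarrow>
    (nat \<Rightarrow> ('n::finite, 'm::finite) base \<Rightarrow> ('n, 'm) base) \<Rightarrow> bool"
  where "triangular o1 A n kk qq bb PP \<longleftrightarrow> (\<forall>i<n. homog (kk i) (PP i) \<and> frozen_flat o1 A (PP i) \<and>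
     cfun (bb i) (PP i (qq i)) \<noteq> 0 \<and> (\<forall>j<i. kk j = kk i \<longrightarrow> cfun (bb j) (PP i (qq j)) = 0))"

text \<open>A polynomial that vanishes near 0 has only zero coefficients. This separates the
  homogeneous degrees of a sum restricted to a complex line.\<close>

lemma power_sum_zero:
  fixes a :: "nat \<Rightarrow> complex"
  assumes "\<forall>\<^sub>F s in nhds 0. (\<Sum>i<n. s ^ kk i * a i) = 0"
  shows "(\<Sum>i<n. if kk i = k then a i else 0) = 0"
proof -
  define p where "p = (\<Sum>i<n. monom (a i) (kk i))"
  have pe: "poly p s = (\<Sum>i<n. s ^ kk i * a i)" for s by (simp add: p_def poly_sum poly_monom mult.commute)
  obtain S where S: "open S" "0 \<in> S" "\<And>s. s \<in> S \<Longrightarrow> poly p s = 0"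
    using assms unfolding eventually_nhds pe by blast
  have "infinite S"
    using S(1,2) by (metis empty_iff finite_imp_not_open)
  then have "infinite {s. poly p s = 0}" using S(3) by (metis (mono_tags) finite_subset mem_Collect_eq subsetI)
  then have "p = 0" using poly_roots_finite by blast
  then have "coeff p k = 0" by simp
  then show ?thesis by (simp add: p_def coeff_sum coeff_monom)
qed

text \<open>The flat equations have constant coefficients, so the solutions can be translated to the
  base point, where they are symmetries. A combination that vanishes near it vanishes degree by
  degree along complex lines, and the triangular shape then forces its coefficients to be 0 one
  after the other.\<close>

lemma triangular_germ_dim:
  fixes A :: "'m::finite \<Rightarrow> complex ^ 'n ^ 'n::finite"
  assumes A: "A o1 = mat 1" and \<Omega>: "open \<Omega>" and tri: "triangular o1 A n kk qq bb PP"
  shows "enat n \<le> germ_dim q0 (Lie_at o1 \<Omega> flat_F (flat_G A) q0)"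
proof -
  define X where "X i q = PP i (q + (- q0))" for i q
  have t: "homog (kk i) (PP i)" "frozen_flat o1 A (PP i)" "cfun (bb i) (PP i (qq i)) \<noteq> 0"
    "\<And>j. j < i \<Longrightarrow> kk j = kk i \<Longrightarrow> cfun (bb j) (PP i (qq j)) = 0" if "i < n" for i
    using tri that unfolding triangular_def by blast+
  have "X i \<in> Lie_at o1 \<Omega> flat_F (flat_G A) q0" if i: "i < n" for i
  proof -
    have "holo (X i) UNIV" unfolding X_def by (rule holo_shift[OF homog_holo[OF t(1)[OF i]]]) simp
    moreover have "frozen_flat o1 A (X i)"
      using frozen_shift[OF homog_holo[OF t(1)[OF i]]] t(2)[OF i] unfolding frozen_flat_def X_def by blast
    ultimately have "infinitesimal_symmetry o1 \<Omega> flat_F (flat_G A) UNIV (X i)" by (rule flat_symmetry[of A, OF A \<Omega>])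
    then show ?thesis unfolding Lie_at_def by blast
  qed
  moreover have "independent_germs q0 n X"
    unfolding independent_germs_def
  proof (intro allI impI)
    fix c i assume z: "\<forall>\<^sub>F q in nhds q0. (\<Sum>i<n. c i *\<^sub>C X i q) = 0" and "i < n"
    have Z: "(\<Sum>i<n. if kk i = k then c i * cfun b (PP i q) else 0) = 0" for k b q
    proof (rule power_sum_zero)
      have hl: "holo (\<lambda>s::complex. q0 + s *\<^sub>C q) UNIV" by (rule holo_line)
      have "((\<lambda>s. q0 + s *\<^sub>C q) \<longlongrightarrow> q0) (nhds 0)"
        using holo_tendsto_nhds[OF hl UNIV_I, of 0] by simp
      from eventually_compose_filterlim[OF z this]
      show "\<forall>\<^sub>F s in nhds 0. (\<Sum>i<n. s ^ kk i * (c i * cfun b (PP i q))) = 0"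
      proof eventually_elim
        case (elim s)
        have "(\<Sum>i<n. s ^ kk i * (c i * cfun b (PP i q))) = cfun b (\<Sum>i<n. c i *\<^sub>C X i (q0 + s *\<^sub>C q))"
          unfolding clinear_sum[OF clinear_cfun] clinear_scaleC_D[OF clinear_cfun] X_def
          by (rule sum.cong) (auto simp: homogD[OF t(1)] clinear_scaleC_D[OF clinear_cfun])
        then show ?case using elim by (simp add: clinear_zero[OF clinear_cfun])
      qed
    qed
    show "c i = 0"
      using \<open>i < n\<close>
    proof (induction i rule: less_induct)
      case (less i)
      have "(\<Sum>l<n. if kk l = kk i then c l * cfun (bb i) (PP l (qq i)) else 0)
          = (\<Sum>l<n. if l = i then c i * cfun (bb i) (PP i (qq i)) else 0)"
      \<comment> \<open>Earlier terms have coefficient 0 by induction; later ones of the same degree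
        are annihilated by the \<open>i\<close>-th functional.\<close>
      proof (rule sum.cong[OF refl])
        fix l assume "l \<in> {..<n}"
        then show "(if kk l = kk i then c l * cfun (bb i) (PP l (qq i)) else 0) = (if l = i then c i * cfun (bb i) (PP i (qq i)) else 0)"
          using less.IH[of l] t(4)[of l i] less.prems by (cases l i rule: linorder_cases) auto
      qed
      then have "c i * cfun (bb i) (PP i (qq i)) = 0" using Z[of "kk i" "bb i" "qq i"] less.prems by simp
      then show ?case using t(3)[OF less.prems] by simp
    qed
  qed
  ultimately show ?thesis unfolding germ_dim_def by (intro Sup_upper) blast
qed

lemma determining_subset:
  "determining o1 \<Omega> F G D X \<Longrightarrow> D' \<subseteq> D \<Longrightarrow> determining o1 \<Omega> F G D' X"
  unfolding determining_def using holo_subset by blast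

theorem theorem6p5:
  fixes o1 :: "'m::finite"
    and A :: "'m \<Rightarrow> complex ^ 'n ^ 'n::finite"
    and E :: "'e::euclidean_space set"
    and \<Omega> :: "('n, 'm) jet set"
    and F :: "'e \<Rightarrow> ('n, 'm) rhs2"
    and G :: "'e \<Rightarrow> ('n, 'm) rhs1"
    and x0 :: "complex ^ 'n" and u0 :: "complex ^ 'm" and p0 :: "complex ^ 'n"
  assumes "nondegenerate_flat o1 A"
    and "involutive_deformation o1 A E \<Omega> F G"
    and "(x0, u0, p0) \<in> \<Omega>"
  shows "\<forall>\<^sub>F \<epsilon> in nhds 0.
           germ_dim (x0, u0) (Lie_at o1 \<Omega> (F \<epsilon>) (G \<epsilon>) (x0, u0))
             \<le> germ_dim (x0, u0) (Lie_at o1 \<Omega> flat_F (flat_G A) (x0, u0))"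
proof -
  let ?q0 = "(x0, u0)"
  let ?d = "germ_dim ?q0 (Lie_at o1 \<Omega> flat_F (flat_G A) ?q0)"
  note def = assms(2) and z0 = assms(3)
  have A: "A o1 = mat 1" using assms(1) by (simp add: nondegenerate_flat_def)
  have E: "open E" "0 \<in> E" and \<Omega>: "open \<Omega>" using def by (auto simp: involutive_deformation_def)
  show ?thesis
  proof (cases ?d)
    case infinity
    then show ?thesis by simp
  next
    case (enat d)
    \<comment> \<open>The possible lengths of triangular systems. They are at most \<open>d\<close>
      by \<open>triangular_germ_dim\<close>, so a longest system exists.\<close>
    define S where "S = {n. \<exists>kk qq bb PP. triangular o1 A n kk qq bb PP}"
    have bd: "n \<le> d" if "n \<in> S" for n
      using that triangular_germ_dim[of A, OF A \<Omega>, of _ _ _ _ _ ?q0] enat unfolding S_def by fastforce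
    have "finite S" using bd finite_nat_set_iff_bounded_le by blast
    have "0 \<in> S" by (auto simp: S_def triangular_def)
    define n where "n = Max S"
    have nS: "n \<in> S" unfolding n_def using \<open>finite S\<close> \<open>0 \<in> S\<close> by (intro Max_in) auto
    then obtain kk qq bb PP where tri: "triangular o1 A n kk qq bb PP" by (auto simp: S_def)
    have nmax: "Suc n \<notin> S" using Max_ge[OF \<open>finite S\<close>, of "Suc n"] by (auto simp: n_def)
    \<comment> \<open>A nonzero solution on which all functionals of its degree vanish would extend
      the longest system by one step.\<close>
    have kill: "\<forall>q. P q = 0" if P: "homog k P" "frozen_flat o1 A P" "\<And>i. i < n \<Longrightarrow> kk i = k \<Longrightarrow> cfun (bb i) (P (qq i)) = 0" for k P
    proof (rule ccontr)
      assume "\<not> ?thesis"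
      then obtain q where "P q \<noteq> 0" by blast
      then obtain b where b: "cfun b (P q) \<noteq> 0" using cfun_zeroI by blast
      have "triangular o1 A (Suc n) (kk(n := k)) (qq(n := q)) (bb(n := b)) (PP(n := P))"
        unfolding triangular_def
      proof (intro allI impI)
        fix i assume "i < Suc n"
        then consider "i < n" | "i = n" by linarith
        then show "homog ((kk(n := k)) i) ((PP(n := P)) i) \<and> frozen_flat o1 A ((PP(n := P)) i) \<and>
            cfun ((bb(n := b)) i) ((PP(n := P)) i ((qq(n := q)) i)) \<noteq> 0 \<and>
            (\<forall>j<i. (kk(n := k)) j = (kk(n := k)) i \<longrightarrow> cfun ((bb(n := b)) j) ((PP(n := P)) i ((qq(n := q)) j)) = 0)"
        proof cases
          case 1
          then show ?thesis using tri unfolding triangular_def by simp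
        next
          case 2
          then show ?thesis using P b by simp
        qed
      qed
      then show False using nmax unfolding S_def by blast
    qed
    \<comment> \<open>Strictly above every \<open>kk i\<close>: in degree \<open>r\<close> the
      vanishing condition is empty, so \<open>kill\<close> excludes every nonzero solution of this
      degree.\<close>
    define r where "r = Suc (\<Sum>i<n. kk i)"
    have kr: "kk i < r" if "i < n" for i
      using member_le_sum[of i "{..<n}" kk] that by (simp add: r_def)
    let ?fr = "\<lambda>\<epsilon> P. \<forall>p. (x0, u0, p) \<in> \<Omega> \<longrightarrow> frozen o1 p (frozen_L o1 (F \<epsilon>) (G \<epsilon>) (x0, u0, p)) (frozen_K o1 (F \<epsilon>) (G \<epsilon>) (x0, u0, p)) P"
    \<comment> \<open>Only finitely many degrees are involved, so their neighborhoods of the origin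
      have a common one.\<close>
    have "\<forall>\<^sub>F \<epsilon> in nhds 0. \<forall>k\<in>{..r}. \<forall>P. homog k P \<longrightarrow> ?fr \<epsilon> P \<longrightarrow>
        (\<forall>i<n. kk i = k \<longrightarrow> cfun (bb i) (P (qq i)) = 0) \<longrightarrow> (\<forall>q. P q = 0)"
      by (intro eventually_ball_finite finite_atMost ballI frozen_compactness[of A, OF A def z0] kill; assumption?)
    with eventually_nhds_in_open[OF E] show ?thesis
    proof eventually_elim
      case (elim \<epsilon>)
      let ?F = "F \<epsilon>" and ?G = "G \<epsilon>"
      have g: "good_system o1 \<Omega> ?F ?G" by (rule deformation_good_system[OF def elim(1)])
      have "N \<le> n" if X: "\<forall>i<N. X i \<in> Lie_at o1 \<Omega> ?F ?G ?q0" and ind: "independent_germs ?q0 N X" for N and X :: "nat \<Rightarrow> ('n, 'm) base \<Rightarrow> ('n, 'm) base"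
      proof (rule ccontr)
        assume "\<not> N \<le> n"
        have "\<forall>i\<in>{..<N}. \<exists>D. open D \<and> ?q0 \<in> D \<and> infinitesimal_symmetry o1 \<Omega> ?F ?G D (X i)"
          using X by (simp add: Lie_at_def)
        then obtain D where D: "\<And>i. i < N \<Longrightarrow> open (D i)" "\<And>i. i < N \<Longrightarrow> ?q0 \<in> D i"
          "\<And>i. i < N \<Longrightarrow> infinitesimal_symmetry o1 \<Omega> ?F ?G (D i) (X i)" by (metis lessThan_iff)
        define D0 where "D0 = (\<Inter>i<N. D i)"
        have oD: "open D0" unfolding D0_def by (rule open_INT) (use D in auto)
        have qD: "?q0 \<in> D0" using D by (simp add: D0_def)
        have dX: "determining o1 \<Omega> ?F ?G D0 (X i)" if "i < N" for i
          by (rule determining_subset[OF symmetry_determining[OF g D(3) D(1)]]) (use that in \<open>auto simp: D0_def\<close>)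
        have hX: "holo (X i) D0" if "i < N" for i using dX[OF that] by (simp add: determining_def)
        \<comment> \<open>These are \<open>n\<close> linear conditions on more than \<open>n\<close>
          coefficients. Each condition looks at a single Taylor part at the base point, so it does
          not presuppose which degree will be the leading one.\<close>
        obtain c where c: "\<exists>i\<in>{..<N}. c i \<noteq> 0"
          "\<And>j. j < n \<Longrightarrow> (\<Sum>i<N. c i * cfun (bb j) (taylor_part (X i) (kk j) ?q0 (qq j))) = 0"
          using underdetermined_system[of "{..<N}" n "\<lambda>j i. cfun (bb j) (taylor_part (X i) (kk j) ?q0 (qq j))"] \<open>\<not> N \<le> n\<close> by auto
        define Y where "Y q = (\<Sum>i<N. c i *\<^sub>C X i q)" for q
        have dY: "determining o1 \<Omega> ?F ?G D0 Y" unfolding Y_def by (rule determining_sum[OF g oD dX])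
        have hY: "holo Y D0" using dY by (simp add: determining_def)
        have tY: "taylor_part Y k ?q0 v = (\<Sum>i<N. c i *\<^sub>C taylor_part (X i) k ?q0 v)" for k v
          unfolding Y_def by (rule taylor_part_sum[OF oD hX qD])
        have "\<exists>k v. taylor_part Y k ?q0 v \<noteq> 0"
        proof (rule ccontr)
          assume "\<not> ?thesis"
          then have "\<forall>\<^sub>F q in nhds ?q0. Y q = 0" by (intro taylor_part_all_zero[OF oD hY qD]) auto
          then show False using ind c(1) unfolding independent_germs_def Y_def by blast
        qed
        then obtain k where k: "\<exists>v. taylor_part Y k ?q0 v \<noteq> 0" "\<And>j v. j < k \<Longrightarrow> taylor_part Y j ?q0 v = 0"
          using exists_least_iff[of "\<lambda>k. \<exists>v. taylor_part Y k ?q0 v \<noteq> 0"] by blast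
        let ?P = "taylor_part Y k ?q0"
        have P: "homog k ?P" by (rule homog_taylor_part[OF oD hY qD])
        have frP: "?fr \<epsilon> ?P" using leading_frozen[OF g oD dY qD _ k(2)] by blast
        show False
        proof (cases "k \<le> r")
          case True
          \<comment> \<open>Taylor parts depend linearly on the field, so the conditions on
            \<open>c\<close> are conditions on the leading part itself.\<close>
          have "cfun (bb i) (?P (qq i)) = 0" if "i < n" "kk i = k" for i
            using c(2)[OF that(1)] that(2) by (simp add: tY clinear_sum[OF clinear_cfun] clinear_scaleC_D[OF clinear_cfun])
          then show False using elim(2) True P frP k(1) by blast
        next
          case False
          then obtain j where j: "k = r + j" by (metis le_add_diff_inverse nat_le_linear)
          obtain v where v: "?P v \<noteq> 0" using k(1) by blast
          let ?U = "{p. (x0, u0, p) \<in> \<Omega>}"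
          \<comment> \<open>Differentiating \<open>j\<close> times leads to a nonzero solution of
            degree exactly \<open>r\<close>, where no functional is left to vanish; this settles all
            higher degrees for the same parameter.\<close>
          have "\<exists>P' q'. homog r P' \<and> (\<forall>p\<in>?U. frozen o1 p (frozen_L o1 ?F ?G (x0, u0, p)) (frozen_K o1 ?F ?G (x0, u0, p)) P') \<and> P' q' \<noteq> 0"
            by (rule frozen_descend[OF clinear_frozen_L _ P[unfolded j] _ v[unfolded j]]) (use clinear_frozen_K[OF g] frP j in auto)
          then obtain P' q' where P': "homog r P'" "?fr \<epsilon> P'" "P' q' \<noteq> 0" by blast
          have "\<forall>q. P' q = 0" using elim(2) P'(1,2) kr by (metis atMost_iff order_refl less_irrefl)
          with P'(3) show False by blast
        qed
      qed
      then have "germ_dim ?q0 (Lie_at o1 \<Omega> ?F ?G ?q0) \<le> enat n"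
        unfolding germ_dim_def by (intro Sup_least) auto
      also have "\<dots> \<le> ?d" by (rule triangular_germ_dim[of A, OF A \<Omega> tri])
      finally show ?case .
    qed
  qed
qed

end
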